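(* **Setting.** Let $\tau>0$, $r\ge0$, let $\tilde f:\mathbb{R}^n\times\mathbb{R}^m\to\mathbb{R}^n$ be a smooth vector field with $\tilde f(0,0)=0$ and let $h:\mathbb{R}^n\to\mathbb{R}^k$ be a smooth mapping with $h(0)=0$. Consider the system $$\dot x(t)=\tilde f(x(t),v(t-\tau)),\qquad x(t)\in\mathbb{R}^n,\ v(t)\in\mathbb{R}^m, \tag{S}$$ assumed forward complete, with sampled measurements $$y(\tau_i)=h(x(\tau_i-r)), \tag{M}$$ where $\{\tau_i\}_{i=0}^\infty$ is a partition of $\mathbb{R}_+$ (the sampling times). **Hypotheses.** Suppose there exist smooth functions $a_1:\mathbb{R}^n\to\mathbb{R}^l$, $a_2:\mathbb{R}^l\to\mathbb{R}^m$ with $a_1(0)=0$, $a_2(0)=0$ and a non-empty compact set $U\subset\mathbb{R}^m$ with $0\in U$ such that the vector field $f(x,u):=\tilde f(x,a_2(a_1(x))+u)$ satisfies all of the following. 1. There are a radially unbounded (not necessarily positive definite) function $V\in C^2(\mathbb{R}^n;\mathbb{R}_+)$, a positive definite function $W\in C^1(\mathbb{R}^n;\mathbb{R}_+)$ and a constant $R>0$ such that $\nabla V(x)f(x,u)\le -W(x)$ for all $(x,u)\in\mathbb{R}^n\times U$ with $V(x)\ge R$. 2. There are a positive definite function $P\in C^2(\mathbb{R}^n;\mathbb{R}_+)$, constants $\mu,K_1>0$ with $K_1|x|^2\le P(x)$ for all $x\in\mathbb{R}^n$ with $V(x)\le R$, and a globally Lipschitz mapping $\mathbf{k}:\mathbb{R}^n\to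 U$ with $\mathbf{k}(0)=0$ such that $\nabla P(x)f(x,\mathbf{k}(x))\le -2\mu|x|^2$ for all $x\in\mathbb{R}^n$ with $V(x)\le R$. 3. There are a symmetric positive definite matrix $Q\in\mathbb{R}^{n\times n}$, constants $\omega>0$, $b>R$ and a matrix $L\in\mathbb{R}^{n\times k}$ such that $$(z-x)'Q\bigl(f(z,u)+L(h(z)-h(x))-f(x,u)\bigr)\le-\omega|z-x|^2$$ for all $u\in U$, $z,x\in\mathbb{R}^n$ with $V(z)\le b$ and $V(x)\le R$. 4. There are constants $c\in(0,1)$ and $a$ with $R\le a<b$ such that $$\nabla V(z)\bigl(f(z,u)+L(h(z)-h(x))\bigr)\le -W(z)+(1-c)|\nabla V(z)|^2\,\frac{(z-x)'Q\bigl(f(z,u)+L(h(z)-h(x))-f(x,u)\bigr)}{\nabla V(z)Q(z-x)}$$ for all $u\in U$, $z,x\in\mathbb{R}^n$ with $a<V(z)\le b$, $\nabla V(z)Q(z-x)<0$ and $V(x)\le R$. Moreover, suppose there exists a locally Lipschitz vector field $g:\mathbb{R}^l\times\mathbb{R}^m\to\mathbb{R}^l$ with $g(0,0)=0$ such that $\nabla a_1(x)\tilde f(x,v)=g(a_1(x),v)$ for all $(x,v)\in\mathbb{R}^n\times\mathbb{R}^m$, and assume that the system $$\dot\theta(t)=g(\theta(t),a_2(\theta(t))+u(t)),\qquad \theta(t)\in\mathbb{R}^l,\ u(t)\in U$$ is forward complete. Finally, suppose there exists a mapping $\Phi:\mathbb{R}^k\times L^\infty([-\tau-r,0];\mathbb{R}^m)\to\mathbb{R}^l$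 such that for every $(x_0,v)\in\mathbb{R}^n\times L^\infty([-\tau,+\infty);\mathbb{R}^m)$ the solution $x(t)\in\mathbb{R}^n$ of (S) with initial condition $x(0)=x_0$ corresponding to input $v$ satisfies, for all $t\ge r$, $$a_1(x(t+\tau))=\Phi(h(x(t-r)),v_t),\qquad\text{where } (v_t)(s)=v(t+s)\ \text{for } s\in[-\tau-r,0].$$ **Definitions.** Let $p:\mathbb{R}_+\to[0,1]$ be a locally Lipschitz function with $p(s)=1$ for all $s\ge b$ and $p(s)=0$ for all $s\le a$. Define $\varphi:\mathbb{R}^n\times\mathbb{R}^k\times\mathbb{R}^m\to\mathbb{R}_+$ by $$\varphi(z,y,u):=\max\bigl(0,\ \nabla V(z)f(z,u)+W(z)+p(V(z))\nabla V(z)L(h(z)-y)\bigr)$$ and, for $(z,y,u)\in\mathbb{R}^n\times\mathbb{R}^k\times U$, $$\hat k(z,y,u):=L(h(z)-y)\ \text{ if } V(z)\le R,\qquad \hat k(z,y,u):=L(h(z)-y)-\frac{\varphi(z,y,u)}{|\nabla V(z)|^2}(\nabla V(z))'\ \text{ if } V(z)>R .$$ Let $q:\mathbb{R}\to\mathbb{R}_+$ be continuously differentiable with $q(s)=1$ for $s\le1$ and $s\,q(s)\le K$ for $s\ge1$, where $K\ge1$ is a constant. Let $\psi:\mathbb{R}^n\to[1,+\infty)$ be a smooth function satisfying the implication $$V(x)\le\max(V(z),b)\ \Rightarrow\ |x|\le\psi(z).$$ Let $N>0$ be an integer, $\delta:=\frac{r+\tau}{N}$, and put $$\rho(s):=\max\{|f(z,u)|:(z,u)\in\mathbb{R}^n\times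 U,\ |z|\le s\},$$ $$S_1:=\{x\in\mathbb{R}^n:V(x)\le R\},\quad S_2:=\{x\in\mathbb{R}^n:V(x)\le b\},$$ $$S_3:=\{x\in\mathbb{R}^n:|x|\le K\psi(z)+\delta\rho(K\psi(z)),\ z\in S_2\},\quad S_4:=\{x\in\mathbb{R}^n:|x|\le K\psi(z),\ z\in S_2\}$$ (in $S_3,S_4$ the inequality is required for some $z\in S_2$), $$M_1^q:=\sup\left\{\frac{\left|q\left(\frac{|\xi|}{\psi(z)}\right)\xi-q\left(\frac{|x|}{\psi(z)}\right)x\right|}{|x-\xi|}:x\in S_1,\ \xi\in S_3,\ z\in S_2,\ x\ne\xi\right\},$$ $$M_1^f:=\sup\left\{\frac{|f(x,u)-f(\xi,u)|}{|x-\xi|}:x\in S_1,\ \xi\in S_4,\ u\in U,\ x\ne\xi\right\},$$ $$G_1:=\sup\left\{\frac{|\nabla h(x)f(x,u)-\nabla h(z)f(z,u)|}{|x-z|}:x\in S_1,\ z\in S_2,\ u\in U,\ x\ne z\right\},$$ $$G_2:=\sup\left\{\frac{|\hat k(z,y,u)-\hat k(z,w,u)|}{|y-w|}:y,w\in\mathbb{R}^k,\ z\in S_2,\ u\in U,\ y\ne w\right\},$$ $$\widetilde P:=\max\{|\nabla^2P(x)|:x\in \mathrm{co}(S_1)\},$$ where $\mathrm{co}(S_1)$ is the convex hull of $S_1$, and let $K_2\in(0,|Q|]$ be a constant with $K_2|x|^2\le x'Qx$ for all $x\in\mathbb{R}^n$. Let $T_s>0$, $\sigma>0$ be constants such that $$\sigma\le\min\left(\frac{\mu}{\sqrt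 n\,\widetilde P},\ \frac{c\omega}{4|Q|}\right),\qquad \delta M_1^qM_1^fe^{\sigma\delta}<1,\qquad T_sG_1e^{\sigma T_s}\sqrt{\frac{2|Q|}{K_2}}\,\frac{G_2|Q|}{c\omega}<1 .$$ **Conclusion.** For every partition $\{\tau_i\}_{i=0}^\infty$ of $\mathbb{R}_+$ with $\sup_{i\ge0}(\tau_{i+1}-\tau_i)\le T_s$, every $\xi_{i,0}\in L^\infty([-\delta,0);\mathbb{R}^n)$ ($i=1,\dots,N$), $(z_0,w_0,\theta_0)\in\mathbb{R}^n\times\mathbb{R}^k\times\mathbb{R}^l$, $x_0\in C^0([-r,0];\mathbb{R}^n)$, $u_0\in L^\infty([-r-\tau,0);U)$ and $v_0\in L^\infty([-r-\tau,0);\mathbb{R}^m)$, the solution of (S), (M) together with $$\dot z(t)=f(z(t),u(t-r-\tau))+\hat k(z(t),w(t),u(t-r-\tau)),\quad t\ge0,$$ $$\dot w(t)=\nabla h(z(t))f(z(t),u(t-r-\tau)),\quad t\in[\tau_i,\tau_{i+1}),\ i\ge0,$$ $$w(\tau_i)=y(\tau_i),\quad i\ge1,$$ $$\xi_j(t)=q\left(\frac{|\xi_{j-1}(t)|}{\psi(z(t))}\right)\xi_{j-1}(t)+\int_0^\delta f\left(q\left(\frac{|\xi_j(t+s-\delta)|}{\psi(z(t))}\right)\xi_j(t+s-\delta),\ u(t+(j-1)\delta-\tau-r+s)\right)ds,\quad t\ge0,\ j=1,\dots,N,$$ $$u(t)=\mathbf{k}(\xi_N(t)),\quad t\ge0,$$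 $$v(t)=u(t)+a_2(\theta(t)),\quad t\ge0,$$ $$\dot\theta(t)=g(\theta(t),a_2(\theta(t))+u(t)),\quad t\in[\tau_i,\tau_{i+1}),\ i\ge0,$$ $$\theta(\tau_i)=\Phi(y(\tau_i),v_{\tau_i}),\quad i\ge1,$$ with $\xi_0(t)=z(t)$ and initial condition $\xi_j(s)=\xi_{j,0}(s)$ for $s\in[-\delta,0)$ ($j=1,\dots,N$), $(z(0),w(0),\theta(0))=(z_0,w_0,\theta_0)$, $x(s)=x_0(s)$ for $s\in[-r,0]$, $u(s)=u_0(s)$ for $s\in[-r-\tau,0)$, $v(s)=v_0(s)$ for $s\in[-r-\tau,0)$, exists for all $t\ge0$ and satisfies $$\limsup_{t\to+\infty}\bigl(e^{\sigma t}E(t)\bigr)<+\infty,$$ where $$E(t):=\sup_{-r\le s\le0}|x(t+s)|+|w(t)|+|z(t)|+|\theta(t)|+\sum_{j=1}^N\sup_{-\delta\le s<0}|\xi_j(t+s)|+\sup_{-r-\tau\le s<0}|u(t+s)| .$$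
   Context: $\mathbb{R}_+:=[0,+\infty)$. A partition of $\mathbb{R}_+$ is an increasing sequence $\{\tau_i\}_{i=0}^\infty$ with $\tau_0=0$ and $\lim_{i\to\infty}\tau_i=+\infty$. For a vector $x$, $x'$ is its transpose and $|x|$ its Euclidean norm; for a matrix $A$, $A'$ is its transpose and $|A|=\sup\{|Ax|:|x|=1\}$ its induced norm. The gradient $\nabla V(x)$ of a scalar function is a row vector; $\nabla h(x)$, $\nabla a_1(x)$ are the Jacobian matrices of $h$, $a_1$; $\nabla^2P(x)$ is the Hessian matrix of $P$. A function $V:\mathbb{R}^n\to\mathbb{R}_+$ is positive definite if $V(0)=0$ and $V(x)>0$ for all $x\ne0$; it is radially unbounded if for every $M\ge0$ the set $\{x:V(x)\le M\}$ is either empty or bounded. $C^k(A;\Omega)$ is the class of functions on $A$ with values in $\Omega$ and continuous derivatives of order $k$ ($C^0$: continuous functions). A control system is forward complete if its solution exists for all times $t\ge0$, for all initial conditions and all measurable and locally essentially bounded inputs (with values in the indicated input set). For a function $v$ and time $t$, $v_t$ denotes the function $(v_t)(s)=v(t+s)$, $s\in[-\tau-r,0]$. Differential equations driven by measurable inputs are satisfied almost everywhere by absolutely continuous functions ($w$ and $\theta$ are absolutely continuous on each sampling interval and are reset at the times $\tau_i$, $i\ge1$).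
   Formalization: The formal theorem adds the assumption V(0) < R. As stated the claim fails when V(0) = R (e.g. V = 1 + x², R = 1, x' = -x³, where S_1 = {0} and x decays only like t^(-1/2)), and P̃ is undefined when S_1 is empty. *)

theory Defs
  imports "HOL-Analysis.Analysis"
begin

subsection \<open>Calculus\<close>

text \<open>Class \<open>C\<^sup>k\<close> on the whole space. The derivative of \<open>f\<close> is represented by the family of all
  directional derivatives, so that the recursion stays within one type.\<close>

primrec C_k :: "nat \<Rightarrow> ('a::euclidean_space \<Rightarrow> 'b::euclidean_space) \<Rightarrow> bool" where
  "C_k 0 f \<longleftrightarrow> continuous_on UNIV f"
| "C_k (Suc k) f \<longleftrightarrow> (\<forall>x. f differentiable (at x)) \<and>
     (\<forall>d. C_k k (\<lambda>x. frechet_derivative f (at x) d))"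

definition smooth :: "('a::euclidean_space \<Rightarrow> 'b::euclidean_space) \<Rightarrow> bool" where
  "smooth f \<longleftrightarrow> (\<forall>k. C_k k f)"

text \<open>The gradient is a row vector; the product of the row \<open>\<nabla>V(x)\<close> with a column \<open>y\<close> is written
  \<open>grad V x \<bullet> y\<close> below, and \<open>x' y\<close> is written \<open>x \<bullet> y\<close>.\<close>

definition grad :: "(real^'n::finite \<Rightarrow> real) \<Rightarrow> real^'n \<Rightarrow> real^'n" where
  "grad V x = (\<chi> i. frechet_derivative V (at x) (axis i 1))"

definition hessian :: "(real^'n::finite \<Rightarrow> real) \<Rightarrow> real^'n \<Rightarrow> real^'n^'n" where
  "hessian P x = jacobian (grad P) (at x)"

definition mat_norm :: "real^'n::finite^'m::finite \<Rightarrow> real" where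
  "mat_norm A = onorm ((*v) A)"

definition pos_def_fun :: "(real^'n::finite \<Rightarrow> real) \<Rightarrow> bool" where
  "pos_def_fun V \<longleftrightarrow> V 0 = 0 \<and> (\<forall>x. x \<noteq> 0 \<longrightarrow> V x > 0)"

definition radially_unbounded :: "(real^'n::finite \<Rightarrow> real) \<Rightarrow> bool" where
  "radially_unbounded V \<longleftrightarrow> (\<forall>M\<ge>0. {x. V x \<le> M} = {} \<or> bounded {x. V x \<le> M})"

definition sym_pos_def :: "real^'n::finite^'n \<Rightarrow> bool" where
  "sym_pos_def Q \<longleftrightarrow> transpose Q = Q \<and> (\<forall>x. x \<noteq> 0 \<longrightarrow> x \<bullet> (Q *v x) > 0)"

definition locally_lipschitz_on :: "'a::metric_space set \<Rightarrow> ('a \<Rightarrow> 'b::metric_space) \<Rightarrow> bool" where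
  "locally_lipschitz_on X f \<longleftrightarrow> (\<forall>x\<in>X. \<exists>e>0. \<exists>C. C-lipschitz_on (cball x e \<inter> X) f)"

definition globally_lipschitz :: "('a::metric_space \<Rightarrow> 'b::metric_space) \<Rightarrow> bool" where
  "globally_lipschitz f \<longleftrightarrow> (\<exists>C. C-lipschitz_on UNIV f)"

subsection \<open>Essentially bounded functions\<close>

text \<open>Elements of \<open>L\<^sup>\<infinity>(S)\<close> are represented by functions on the whole line, of which only the
  values on \<open>S\<close> matter.\<close>

definition Linf_on :: "real set \<Rightarrow> (real \<Rightarrow> 'a::euclidean_space) \<Rightarrow> bool" where
  "Linf_on S v \<longleftrightarrow> v \<in> borel_measurable (lebesgue_on S) \<and>
     (\<exists>C. AE t in lebesgue_on S. norm (v t) \<le> C)"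

definition Linf_loc_on :: "real set \<Rightarrow> (real \<Rightarrow> 'a::euclidean_space) \<Rightarrow> bool" where
  "Linf_loc_on S v \<longleftrightarrow> (\<forall>a b. {a..b} \<subseteq> S \<longrightarrow> Linf_on {a..b} v)"

text \<open>A functional is a mapping on \<open>L\<^sup>\<infinity>(S)\<close> if it does not distinguish functions that are equal
  almost everywhere on \<open>S\<close>.\<close>

definition mapping_on_Linf :: "real set \<Rightarrow> ((real \<Rightarrow> 'a::euclidean_space) \<Rightarrow> 'b) \<Rightarrow> bool" where
  "mapping_on_Linf S F \<longleftrightarrow> (\<forall>v v'. Linf_on S v \<longrightarrow> Linf_on S v' \<longrightarrow>
     (AE s in lebesgue_on S. v s = v' s) \<longrightarrow> F v = F v')"

subsection \<open>Differential equations with measurable inputs\<close>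

definition abs_cont_on :: "real set \<Rightarrow> (real \<Rightarrow> 'a::real_normed_vector) \<Rightarrow> bool" where
  "abs_cont_on S f \<longleftrightarrow> (\<forall>\<epsilon>>0. \<exists>\<eta>>0. \<forall>(n::nat) a b.
     (\<forall>i<n. a i \<le> b i \<and> {a i..b i} \<subseteq> S) \<longrightarrow>
     (\<forall>i<n. \<forall>j<n. i \<noteq> j \<longrightarrow> {a i<..<b i} \<inter> {a j<..<b j} = {}) \<longrightarrow>
     (\<Sum>i<n. b i - a i) < \<eta> \<longrightarrow>
     (\<Sum>i<n. norm (f (b i) - f (a i))) < \<epsilon>)"

text \<open>\<open>y\<close> is absolutely continuous on every compact subinterval of \<open>J\<close> and its derivative is \<open>F\<close>
  almost everywhere on \<open>J\<close>.\<close>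

definition solves_ae_on :: "real set \<Rightarrow> (real \<Rightarrow> 'a::euclidean_space) \<Rightarrow> (real \<Rightarrow> 'a) \<Rightarrow> bool" where
  "solves_ae_on J F y \<longleftrightarrow> (\<forall>a b. {a..b} \<subseteq> J \<longrightarrow> abs_cont_on {a..b} y) \<and>
     (AE t in lebesgue. t \<in> J \<longrightarrow> (y has_vector_derivative F t) (at t))"

text \<open>Forward completeness of \<open>x'(t) = F(x(t), v(t - d))\<close> with inputs defined on \<open>[-d, \<infinity>)\<close>
  and taking values in \<open>\<Omega>\<close>.\<close>

definition forward_complete ::
  "('a::euclidean_space \<Rightarrow> 'b::euclidean_space \<Rightarrow> 'a) \<Rightarrow> real \<Rightarrow> 'b set \<Rightarrow> bool" where
  "forward_complete F d \<Omega> \<longleftrightarrow>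
     (\<forall>x0 v. Linf_loc_on {-d..} v \<longrightarrow> (\<forall>t\<ge>-d. v t \<in> \<Omega>) \<longrightarrow>
        (\<exists>x. x 0 = x0 \<and> solves_ae_on {0..} (\<lambda>t. F (x t) (v (t - d))) x))"

subsection \<open>The closed-loop system\<close>

text \<open>Strict monotonicity makes the sampling intervals nondegenerate; in particular no reset happens
  at time \<open>0\<close>.\<close>

definition sampling_partition :: "(nat \<Rightarrow> real) \<Rightarrow> bool" where
  "sampling_partition ts \<longleftrightarrow> strict_mono ts \<and> ts 0 = 0 \<and> filterlim ts at_top sequentially"

text \<open>The interval \<open>[a, T)\<close>, where \<open>T = \<infinity>\<close> is allowed.\<close>

definition time_ivl :: "real \<Rightarrow> ereal \<Rightarrow> real set" where
  "time_ivl a T = {t. a \<le> t \<and> ereal t < T}"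

text \<open>The closed loop on the time interval \<open>[0, T)\<close>. The signals are \<open>x\<close> on \<open>[-r, T)\<close>,
  \<open>z, w, \<theta>\<close> on \<open>[0, T)\<close>, \<open>\<xi>\<^sub>1, \<dots>, \<xi>\<^sub>N\<close> on \<open>[-\<delta>, T)\<close> and \<open>u, v\<close> on
  \<open>[-r-\<tau>, T)\<close>; \<open>\<xi> 0\<close> stands for \<open>z\<close>. The local boundedness and measurability requirements make
  all integrals meaningful.\<close>

definition closed_loop_solution ::
  "(real^'n::finite \<Rightarrow> real^'m::finite \<Rightarrow> real^'n) \<Rightarrow> (real^'n \<Rightarrow> real^'k::finite) \<Rightarrow>
   (real^'n \<Rightarrow> real^'m \<Rightarrow> real^'n) \<Rightarrow> (real^'n \<Rightarrow> real^'k \<Rightarrow> real^'m \<Rightarrow> real^'n) \<Rightarrow>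
   (real \<Rightarrow> real) \<Rightarrow> (real^'n \<Rightarrow> real) \<Rightarrow> (real^'n \<Rightarrow> real^'m) \<Rightarrow>
   (real^'l::finite \<Rightarrow> real^'m) \<Rightarrow> (real^'l \<Rightarrow> real^'m \<Rightarrow> real^'l) \<Rightarrow>
   (real^'k \<Rightarrow> (real \<Rightarrow> real^'m) \<Rightarrow> real^'l) \<Rightarrow>
   real \<Rightarrow> real \<Rightarrow> real \<Rightarrow> nat \<Rightarrow> (nat \<Rightarrow> real) \<Rightarrow>
   (nat \<Rightarrow> real \<Rightarrow> real^'n) \<Rightarrow> real^'n \<Rightarrow> real^'k \<Rightarrow> real^'l \<Rightarrow> (real \<Rightarrow> real^'n) \<Rightarrow>
   (real \<Rightarrow> real^'m) \<Rightarrow> (real \<Rightarrow> real^'m) \<Rightarrow>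
   ereal \<Rightarrow>
   (real \<Rightarrow> real^'n) \<Rightarrow> (real \<Rightarrow> real^'n) \<Rightarrow> (real \<Rightarrow> real^'k) \<Rightarrow> (real \<Rightarrow> real^'l) \<Rightarrow>
   (nat \<Rightarrow> real \<Rightarrow> real^'n) \<Rightarrow> (real \<Rightarrow> real^'m) \<Rightarrow> (real \<Rightarrow> real^'m) \<Rightarrow> bool" where
  "closed_loop_solution ft h f khat q \<psi> kk a2 g \<Phi> \<tau> r \<delta> N ts \<xi>0 z0 w0 \<theta>0 x0 u0 v0 T x z w \<theta> \<xi> u v \<longleftrightarrow>
     Linf_loc_on (time_ivl (-r-\<tau>) T) u \<and>
     Linf_loc_on (time_ivl (-r-\<tau>) T) v \<and>
     (\<forall>j\<in>{1..N}. Linf_loc_on (time_ivl (-\<delta>) T) (\<xi> j)) \<and>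
     (\<forall>s\<in>{-r..0}. x s = x0 s) \<and> z 0 = z0 \<and> w 0 = w0 \<and> \<theta> 0 = \<theta>0 \<and>
     (\<forall>j\<in>{1..N}. \<forall>s\<in>{-\<delta>..<0}. \<xi> j s = \<xi>0 j s) \<and>
     (\<forall>s\<in>{-r-\<tau>..<0}. u s = u0 s \<and> v s = v0 s) \<and>
     solves_ae_on (time_ivl 0 T) (\<lambda>t. ft (x t) (v (t - \<tau>))) x \<and>
     solves_ae_on (time_ivl 0 T)
       (\<lambda>t. f (z t) (u (t - r - \<tau>)) + khat (z t) (w t) (u (t - r - \<tau>))) z \<and>
     (\<forall>i. solves_ae_on ({ts i..<ts (Suc i)} \<inter> time_ivl 0 T)
       (\<lambda>t. jacobian h (at (z t)) *v f (z t) (u (t - r - \<tau>))) w) \<and>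
     (\<forall>i\<ge>1. ts i \<in> time_ivl 0 T \<longrightarrow> w (ts i) = h (x (ts i - r))) \<and>
     (\<forall>t\<in>time_ivl 0 T. \<xi> 0 t = z t) \<and>
     (\<forall>t\<in>time_ivl 0 T. \<forall>j\<in>{1..N}.
        \<xi> j t = q (norm (\<xi> (j-1) t) / \<psi> (z t)) *\<^sub>R \<xi> (j-1) t +
          (LINT s:{0..\<delta>}|lebesgue.
             f (q (norm (\<xi> j (t + s - \<delta>)) / \<psi> (z t)) *\<^sub>R \<xi> j (t + s - \<delta>))
               (u (t + (real j - 1) * \<delta> - \<tau> - r + s)))) \<and>
     (\<forall>t\<in>time_ivl 0 T. u t = kk (\<xi> N t)) \<and>
     (\<forall>t\<in>time_ivl 0 T. v t = u t + a2 (\<theta> t)) \<and>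
     (\<forall>i. solves_ae_on ({ts i..<ts (Suc i)} \<inter> time_ivl 0 T)
       (\<lambda>t. g (\<theta> t) (a2 (\<theta> t) + u t)) \<theta>) \<and>
     (\<forall>i\<ge>1. ts i \<in> time_ivl 0 T \<longrightarrow> \<theta> (ts i) = \<Phi> (h (x (ts i - r))) (\<lambda>s. v (ts i + s)))"

text \<open>Suprema are taken in the extended reals, so that they are meaningful also at small times, when
  they involve the initial functions.\<close>

definition state_size ::
  "real \<Rightarrow> real \<Rightarrow> real \<Rightarrow> nat \<Rightarrow>
   (real \<Rightarrow> real^'n::finite) \<Rightarrow> (real \<Rightarrow> real^'n) \<Rightarrow> (real \<Rightarrow> real^'k::finite) \<Rightarrow>
   (real \<Rightarrow> real^'l::finite) \<Rightarrow> (nat \<Rightarrow> real \<Rightarrow> real^'n) \<Rightarrow> (real \<Rightarrow> real^'m::finite) \<Rightarrow>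
   real \<Rightarrow> ereal" where
  "state_size \<tau> r \<delta> N x z w \<theta> \<xi> u t =
     (SUP s\<in>{-r..0}. ereal (norm (x (t + s)))) + ereal (norm (w t)) + ereal (norm (z t)) +
     ereal (norm (\<theta> t)) +
     (\<Sum>j=1..N. SUP s\<in>{-\<delta>..<0}. ereal (norm (\<xi> j (t + s)))) +
     (SUP s\<in>{-r-\<tau>..<0}. ereal (norm (u (t + s))))"

end

theory Submission
  imports Defs
begin

text \<open>Well-posedness is a method of steps. Over a time step of length \<open>min \<tau> \<delta>\<close> the feedback enters
  only through past values of \<open>u\<close> and \<open>v\<close>, so that the plant, the observer, the inter-sample predictor and
  the chain \<open>\<xi>\<^sub>1, \<dots>, \<xi>\<^sub>N\<close> can be solved one after the other; the observer stays bounded because the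
  correction in \<open>khat\<close> makes \<open>V\<close> nonincreasing where \<open>V \<ge> b\<close>, and the integral equation of a predictor is a
  contraction in exponentially weighted norms.

  For convergence the loop becomes a cascade after finite time. Since \<open>\<Phi>\<close> is exact at the sampling times
  and \<open>g\<close> propagates \<open>a\<^sub>1\<close> along solutions, \<open>\<theta>(t) = a\<^sub>1(x(t + \<tau>))\<close>, hence \<open>x' = f(x, u(t - \<tau>))\<close> with
  \<open>u \<in> U\<close>, and \<open>V(x) \<le> R\<close>, \<open>V(z) \<le> b\<close> from some time on. The third and fourth conditions make the quadratic
  form of \<open>Q\<close> a Lyapunov function of the observer error \<open>z(t) - x(t - r)\<close>, perturbed by
  \<open>w(t) - h(x(t - r))\<close>, which vanishes at the sampling times and grows at rate at most \<open>G\<^sub>1\<close> times the error in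
  between; the bound on \<open>T\<^sub>s\<close> is the small-gain condition for norms weighted by \<open>exp(\<sigma> t)\<close>. The bound on
  \<open>\<delta>\<close> is the same condition for the prediction errors \<open>\<xi>\<^sub>j(t) - x(t - r + j \<delta>)\<close>. Finally
  \<open>u(t - \<tau>) - k(x(t))\<close> decays exponentially, and \<open>P\<close> gives the decay of \<open>x\<close>.\<close>

section \<open>Absolutely continuous functions and Caratheodory solutions\<close>

text \<open>Inputs are only measurable, so every argument runs through integrals: absolute
  continuity gives the integral form of a solution, Lebesgue differentiation leads back. Fixed
  points and uniqueness rest on the weight \<open>exp (2 * L * t)\<close>: multiplying by a
  Lipschitz constant \<open>L\<close> and integrating then costs a factor one half on an interval of
  any length. The fields are Lipschitz on compact sets only, so each fixed point needs an a priori
  bound; the saturation \<open>q\<close> supplies it for the predictors, a projection onto a ball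
  for the observer. The last predictor contains the present control and is solved as an implicit
  equation, while the loop itself is closed by causality: after \<open>k\<close> rounds the response
  map changes nothing before time \<open>k * lag\<close>. The hypothesis \<open>V 0 < R\<close>
  keeps the origin out of the region \<open>V x \<ge> R\<close>. There \<open>W\<close> is positive,
  so \<open>grad V\<close> does not vanish, the quotient in \<open>khat\<close> is Lipschitz on
  compact sets, and trajectories reach the levels \<open>R\<close> and \<open>b\<close> in finite
  time. In the small-gain arguments the weighted suprema must be finite beforehand, so they are
  taken over bounded time intervals and estimated independently of their length.\<close>

definition ac_modulus :: "real set \<Rightarrow> (real \<Rightarrow> 'a::real_normed_vector) \<Rightarrow> real \<Rightarrow> real \<Rightarrow> bool" where
  "ac_modulus S f \<epsilon> \<eta> \<longleftrightarrow> (\<forall>(n::nat) a b.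
     (\<forall>i<n. a i \<le> b i \<and> {a i..b i} \<subseteq> S) \<longrightarrow>
     (\<forall>i<n. \<forall>j<n. i \<noteq> j \<longrightarrow> {a i<..<b i} \<inter> {a j<..<b j} = {}) \<longrightarrow>
     (\<Sum>i<n. b i - a i) < \<eta> \<longrightarrow>
     (\<Sum>i<n. norm (f (b i) - f (a i))) < \<epsilon>)"

lemma abs_cont_on_iff_modulus: "abs_cont_on S f \<longleftrightarrow> (\<forall>\<epsilon>>0. \<exists>\<eta>>0. ac_modulus S f \<epsilon> \<eta>)"
  unfolding abs_cont_on_def ac_modulus_def ..

lemma ac_modulusD:
  assumes "ac_modulus S f e d" "\<And>i. i < n \<Longrightarrow> a i \<le> b i \<and> {a i..b i} \<subseteq> S"
    "\<And>i j. i < n \<Longrightarrow> j < n \<Longrightarrow> i \<noteq> j \<Longrightarrow> {a i<..<b i} \<inter> {a j<..<b j} = {}"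
    "(\<Sum>i<(n::nat). b i - a i) < d"
  shows "(\<Sum>i<n. norm (f (b i) - f (a i))) < e"
  using assms(1)[unfolded ac_modulus_def, rule_format, of n a b, OF assms(2,3,4)] by blast

text \<open>Tagged divisions are finite sets without an order, whereas the definition numbers its
  intervals; a bijection with an initial segment of the naturals bridges the two.\<close>

lemma ac_modulus_finiteD:
  assumes d: "ac_modulus S f e d"
    and I: "finite I" "\<And>i. i \<in> I \<Longrightarrow> a i \<le> b i \<and> {a i..b i} \<subseteq> S"
      "\<And>i j. i \<in> I \<Longrightarrow> j \<in> I \<Longrightarrow> i \<noteq> j \<Longrightarrow> {a i<..<b i} \<inter> {a j<..<b j} = {}"
      "(\<Sum>i\<in>I. b i - a i) < d"
  shows "(\<Sum>i\<in>I. norm (f (b i) - f (a i))) < e"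
proof -
  obtain g where g: "bij_betw g {0..<card I} I" using ex_bij_betw_nat_finite[OF I(1)] by blast
  then have gI: "\<And>i. i < card I \<Longrightarrow> g i \<in> I" and inj: "\<And>i j. i < card I \<Longrightarrow> j < card I \<Longrightarrow> g i = g j \<Longrightarrow> i = j"
    unfolding bij_betw_def inj_on_def by auto
  have r: "(\<Sum>i<card I. H (g i)) = (\<Sum>i\<in>I. H i)" for H
    using sum.reindex_bij_betw[OF g, of H] by (simp add: lessThan_atLeast0)
  have "(\<Sum>i<card I. norm (f ((\<lambda>k. b (g k)) i) - f ((\<lambda>k. a (g k)) i))) < e"
  proof (rule ac_modulusD[OF d])
    fix i j assume ij: "i < card I" "j < card I" "i \<noteq> j"
    then have "g i \<noteq> g j" using inj by blast
    then show "{a (g i)<..<b (g i)} \<inter> {a (g j)<..<b (g j)} = {}"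
      using I(3) gI ij by blast
  next
    show "(\<Sum>i<card I. b (g i) - a (g i)) < d"
      using I(4) r[of "\<lambda>i. b i - a i"] by simp
  qed (use I(2) gI in blast)
  then show ?thesis
    using r[of "\<lambda>i. norm (f (b i) - f (a i))"] by simp
qed

lemma ac_modulusI:
  assumes "\<And>(n::nat) a b. (\<And>i. i < n \<Longrightarrow> a i \<le> b i) \<Longrightarrow> (\<And>i. i < n \<Longrightarrow> {a i..b i} \<subseteq> S) \<Longrightarrow>
     (\<And>i. i < n \<Longrightarrow> a i \<in> S) \<Longrightarrow> (\<And>i. i < n \<Longrightarrow> b i \<in> S) \<Longrightarrow>
     (\<And>i j. i < n \<Longrightarrow> j < n \<Longrightarrow> i \<noteq> j \<Longrightarrow> {a i<..<b i} \<inter> {a j<..<b j} = {}) \<Longrightarrow>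
     (\<Sum>i<n. b i - a i) < d \<Longrightarrow> (\<Sum>i<n. norm (f (b i) - f (a i))) < e"
  shows "ac_modulus S f e d"
  unfolding ac_modulus_def
proof (intro allI impI)
  fix n and a b :: "nat \<Rightarrow> real"
  assume *: "\<forall>i<n. a i \<le> b i \<and> {a i..b i} \<subseteq> S"
    "\<forall>i<n. \<forall>j<n. i \<noteq> j \<longrightarrow> {a i<..<b i} \<inter> {a j<..<b j} = {}" "(\<Sum>i<n. b i - a i) < d"
  have mem: "a i \<in> S \<and> b i \<in> S" if "i < n" for i
    using *(1)[rule_format, OF that] by (meson atLeastAtMost_iff order_refl subsetD)
  show "(\<Sum>i<n. norm (f (b i) - f (a i))) < e"
    by (rule assms) (use * mem in blast)+
qed

lemma ac_modulus_compose:
  assumes d: "ac_modulus S f e d" and "C > 0"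
    and g: "\<And>x y. x \<in> S \<Longrightarrow> y \<in> S \<Longrightarrow> norm (g x - g y) \<le> C * norm (f x - f y)"
  shows "ac_modulus S g (C * e) d"
proof (rule ac_modulusI)
  fix n :: nat and a b :: "nat \<Rightarrow> real"
  assume *: "\<And>i. i < n \<Longrightarrow> a i \<le> b i" "\<And>i. i < n \<Longrightarrow> {a i..b i} \<subseteq> S" "\<And>i. i < n \<Longrightarrow> a i \<in> S" "\<And>i. i < n \<Longrightarrow> b i \<in> S"
     "\<And>i j. i < n \<Longrightarrow> j < n \<Longrightarrow> i \<noteq> j \<Longrightarrow> {a i<..<b i} \<inter> {a j<..<b j} = {}" "(\<Sum>i<n. b i - a i) < d"
  have "(\<Sum>i<n. norm (g (b i) - g (a i))) \<le> (\<Sum>i<n. C * norm (f (b i) - f (a i)))"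
    by (rule sum_mono) (use g * in auto)
  also have "\<dots> = C * (\<Sum>i<n. norm (f (b i) - f (a i)))" by (simp add: sum_distrib_left)
  also have "\<dots> < C * e"
    by (rule mult_strict_left_mono[OF ac_modulusD[OF d] \<open>C > 0\<close>]) (use * in blast)+
  finally show "(\<Sum>i<n. norm (g (b i) - g (a i))) < C * e" .
qed

lemma abs_cont_on_dominated:
  assumes "abs_cont_on S f"
    and "\<And>x y. x \<in> S \<Longrightarrow> y \<in> S \<Longrightarrow> norm (g x - g y) \<le> C * norm (f x - f y)"
  shows "abs_cont_on S g"
  unfolding abs_cont_on_iff_modulus
proof (intro allI impI)
  fix e :: real assume "e > 0"
  \<comment> \<open>\<open>C\<close> may be zero or negative, while
    \<open>ac_modulus_compose\<close> needs a positive factor.\<close>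
  define C' where "C' = \<bar>C\<bar> + 1"
  have C'0: "C' > 0" by (simp add: C'_def)
  have C': "norm (g x - g y) \<le> C' * norm (f x - f y)" if "x \<in> S" "y \<in> S" for x y
    using assms(2)[OF that] mult_right_mono[of C C' "norm (f x - f y)"]
    by (metis C'_def abs_ge_self add_increasing2 norm_ge_zero order_trans zero_le_one)
  have "e / C' > 0" using \<open>e > 0\<close> C'0 by simp
  then obtain d where "d > 0" "ac_modulus S f (e / C') d"
    using assms(1) unfolding abs_cont_on_iff_modulus by blast
  then show "\<exists>d>0. ac_modulus S g e d"
    using ac_modulus_compose[of S f "e / C'" d C' g] C' C'0 by auto
qed

lemma abs_cont_on_cong:
  assumes "abs_cont_on S f" "\<And>x. x \<in> S \<Longrightarrow> f x = g x" shows "abs_cont_on S g"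
  by (rule abs_cont_on_dominated[OF assms(1), of _ 1]) (use assms(2) in simp)

lemma abs_cont_on_imp_continuous_on:
  fixes f :: "real \<Rightarrow> 'a::real_normed_vector"
  assumes "abs_cont_on {a..b} f" shows "continuous_on {a..b} f"
  unfolding continuous_on_iff
proof (intro ballI allI impI)
  fix x e :: real assume x: "x \<in> {a..b}" and "e > 0"
  obtain d where "d > 0" and d: "ac_modulus {a..b} f e d"
    using assms(1) \<open>e > 0\<close> unfolding abs_cont_on_iff_modulus by blast
  have *: "dist (f u) (f v) < e" if "u \<in> {a..b}" "v \<in> {a..b}" "u \<le> v" "v - u < d" for u v
    using ac_modulusD[OF d, of 1 "\<lambda>_. u" "\<lambda>_. v"] that by (auto simp: dist_norm norm_minus_commute)
  show "\<exists>d>0. \<forall>x'\<in>{a..b}. dist x' x < d \<longrightarrow> dist (f x') (f x) < e"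
  proof (intro exI[of _ d] conjI ballI impI)
    fix x' assume "x' \<in> {a..b}" "dist x' x < d"
    show "dist (f x') (f x) < e"
    proof (cases "x' \<le> x")
      case True
      then show ?thesis
        using *[OF \<open>x' \<in> {a..b}\<close> x] \<open>dist x' x < d\<close> by (simp add: dist_real_def)
    next
      case False
      then show ?thesis
        using *[OF x \<open>x' \<in> {a..b}\<close>] \<open>dist x' x < d\<close> by (simp add: dist_real_def dist_commute)
    qed
  qed fact
qed

lemma abs_cont_on_lipschitz:
  fixes f :: "real \<Rightarrow> 'a::real_normed_vector"
  assumes "\<And>x y. x \<in> S \<Longrightarrow> y \<in> S \<Longrightarrow> x \<le> y \<Longrightarrow> norm (f y - f x) \<le> C * (y - x)"
  shows "abs_cont_on S f"
proof -
  have id: "abs_cont_on S (\<lambda>x::real. x)"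
    unfolding abs_cont_on_iff_modulus
  proof (intro allI impI exI conjI)
    fix e :: real assume "e > 0"
    show "ac_modulus S (\<lambda>x. x) e e"
    proof (rule ac_modulusI)
      fix n :: nat and a b :: "nat \<Rightarrow> real"
      assume "\<And>i. i < n \<Longrightarrow> a i \<le> b i" and s: "(\<Sum>i<n. b i - a i) < e"
      then have "(\<Sum>i<n. norm (b i - a i)) = (\<Sum>i<n. b i - a i)" by (intro sum.cong) auto
      then show "(\<Sum>i<n. norm (b i - a i)) < e" using s by simp
    qed
  qed
  show ?thesis
  proof (rule abs_cont_on_dominated[OF id])
    fix x y assume "x \<in> S" "y \<in> S"
    then show "norm (f x - f y) \<le> C * norm (x - y)"
      using assms[of x y] assms[of y x] by (cases "x \<le> y") (auto simp: norm_minus_commute abs_real_def)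
  qed
qed

lemma abs_cont_on_Pair:
  fixes f :: "real \<Rightarrow> 'a::real_normed_vector" and g :: "real \<Rightarrow> 'b::real_normed_vector"
  assumes "abs_cont_on S f" "abs_cont_on S g"
  shows "abs_cont_on S (\<lambda>x. (f x, g x))"
  unfolding abs_cont_on_iff_modulus
proof (intro allI impI)
  fix e :: real assume "e > 0"
  then have "e / 2 > 0" by simp
  obtain d1 where "d1 > 0" and d1: "ac_modulus S f (e / 2) d1"
    using assms(1) \<open>e / 2 > 0\<close> unfolding abs_cont_on_iff_modulus by blast
  obtain d2 where "d2 > 0" and d2: "ac_modulus S g (e / 2) d2"
    using assms(2) \<open>e / 2 > 0\<close> unfolding abs_cont_on_iff_modulus by blast
  have "ac_modulus S (\<lambda>x. (f x, g x)) e (min d1 d2)"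
  proof (rule ac_modulusI)
    fix n :: nat and a b :: "nat \<Rightarrow> real"
    assume *: "\<And>i. i < n \<Longrightarrow> a i \<le> b i" "\<And>i. i < n \<Longrightarrow> {a i..b i} \<subseteq> S"
     "\<And>i j. i < n \<Longrightarrow> j < n \<Longrightarrow> i \<noteq> j \<Longrightarrow> {a i<..<b i} \<inter> {a j<..<b j} = {}" "(\<Sum>i<n. b i - a i) < min d1 d2"
    have "(\<Sum>i<n. norm ((f (b i), g (b i)) - (f (a i), g (a i)))) \<le>
      (\<Sum>i<n. norm (f (b i) - f (a i)) + norm (g (b i) - g (a i)))"
      by (rule sum_mono) (simp add: norm_Pair_le)
    moreover have "(\<Sum>i<n. norm (f (b i) - f (a i))) < e / 2"
      by (rule ac_modulusD[OF d1]) (use *(1-3) in blast, use *(3) in blast, use *(4) in simp)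
    moreover have "(\<Sum>i<n. norm (g (b i) - g (a i))) < e / 2"
      by (rule ac_modulusD[OF d2]) (use *(1-3) in blast, use *(3) in blast, use *(4) in simp)
    ultimately show "(\<Sum>i<n. norm ((f (b i), g (b i)) - (f (a i), g (a i)))) < e"
      by (simp add: sum.distrib)
  qed
  then show "\<exists>d>0. ac_modulus S (\<lambda>x. (f x, g x)) e d"
    using \<open>d1 > 0\<close> \<open>d2 > 0\<close> by (intro exI[of _ "min d1 d2"]) auto
qed

text \<open>Henstock gauge argument: tags outside \<open>N\<close> are controlled by differentiability, tags in \<open>N\<close>
  by absolute continuity and an open cover of \<open>N\<close> of small measure.\<close>

lemma abs_cont_on_ftc:
  fixes y :: "real \<Rightarrow> 'a::euclidean_space"
  assumes ac: "abs_cont_on {a..b} y" and ab: "a \<le> b" and N: "negligible N"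
    and der: "\<And>t. t \<in> {a..b} - N \<Longrightarrow> (y has_vector_derivative F t) (at t)"
  shows "(F has_integral (y b - y a)) {a..b}"
proof -
  \<comment> \<open>With the integrand set to zero on \<open>N\<close>, a tag in \<open>N\<close>
    contributes only the increment of \<open>y\<close>; the original \<open>F\<close> returns at the
    end because \<open>N\<close> is negligible.\<close>
  define F' where "F' = (\<lambda>t. if t \<in> N then 0 else F t)"
  have "(F' has_integral (y b - y a)) {a..b}"
    unfolding has_integral_real
  proof (intro allI impI)
    fix e :: real assume "e > 0"
    \<comment> \<open>Tags outside \<open>N\<close> may spend \<open>e / 2\<close> in total, spread
      over the length \<open>b - a\<close>; the summand 1 keeps the quotient meaningful when
      \<open>a = b\<close>.\<close>
    define \<epsilon> where "\<epsilon> = e / (2 * (b - a + 1))"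
    have \<epsilon>: "\<epsilon> > 0" "\<epsilon> * (b - a) < e / 2" using \<open>e > 0\<close> ab by (auto simp: \<epsilon>_def field_simps)
    have "e / 2 > 0" using \<open>e > 0\<close> by simp
    then obtain \<eta> where "\<eta> > 0" and \<eta>: "ac_modulus {a..b} y (e / 2) \<eta>"
      using ac unfolding abs_cont_on_iff_modulus by blast
    have "N \<in> lmeasurable" "measure lebesgue N = 0"
      using N negligible_iff_measure by auto
    then obtain O' where O': "open O'" "N \<subseteq> O'" "O' \<in> lmeasurable" "measure lebesgue O' < \<eta>"
    proof -
      obtain O' where O': "open O'" "N \<subseteq> O'" "O' - N \<in> lmeasurable" "emeasure lebesgue (O' - N) < ennreal \<eta>"
        using sets_lebesgue_outer_open[of N \<eta>] \<open>\<eta> > 0\<close> negligible_imp_sets[OF N] by blast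
      have eq: "O' = N \<union> (O' - N)" using O' by blast
      have "O' \<in> lmeasurable" using fmeasurable.Un[OF \<open>N \<in> lmeasurable\<close> O'(3)] eq by simp
      moreover have "measure lebesgue O' \<le> measure lebesgue N + measure lebesgue (O' - N)"
        using measure_Un_le[of N lebesgue "O' - N"] \<open>N \<in> lmeasurable\<close> O'(3) eq by (metis fmeasurableD)
      moreover have "measure lebesgue (O' - N) < \<eta>"
        using O'(3,4) by (simp add: emeasure_eq_measure2 ennreal_less_iff)
      ultimately show ?thesis using O' that \<open>measure lebesgue N = 0\<close> by auto
    qed
    have "\<exists>d>0. \<forall>z. \<bar>z - x\<bar> < d \<longrightarrow> norm (y z - y x - (z - x) *\<^sub>R F x) \<le> \<epsilon> * \<bar>z - x\<bar>"
      if "x \<in> {a..b} - N" for x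
      using der[OF that] \<epsilon>(1) unfolding has_vector_derivative_def has_derivative_at_alt by auto
    then obtain d where d0: "\<And>x. x \<in> {a..b} - N \<Longrightarrow> d x > 0"
      and d: "\<And>x z. x \<in> {a..b} - N \<Longrightarrow> \<bar>z - x\<bar> < d x \<Longrightarrow> norm (y z - y x - (z - x) *\<^sub>R F x) \<le> \<epsilon> * \<bar>z - x\<bar>"
      by metis
    define \<gamma> where "\<gamma> = (\<lambda>x. if x \<in> N then O' else if x \<in> {a..b} then ball x (d x) else ball x 1)"
    have gauge: "gauge \<gamma>"
      unfolding gauge_def \<gamma>_def using O' d0 by auto
    have fin_est: "norm ((\<Sum>(x, k)\<in>p. measure lborel k *\<^sub>R F' x) - (y b - y a)) < e"
      if p: "p tagged_division_of {a..b}" "\<gamma> fine p" for p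
    proof -
      note pD = tagged_division_ofD[OF p(1)]
      have ivl: "k = {Inf k..Sup k} \<and> Inf k \<le> Sup k \<and> x \<in> {Inf k..Sup k} \<and> {Inf k..Sup k} \<subseteq> {a..b}"
        if xk: "(x, k) \<in> p" for x k
      proof -
        obtain u v where k: "k = {u..v}" using pD(4)[OF xk] by auto
        have "x \<in> k" "k \<subseteq> {a..b}" using pD(2,3)[OF xk] by auto
        then have "u \<le> v" using k by auto
        then have "Inf k = u" "Sup k = v" using k by auto
        then show ?thesis using k \<open>x \<in> k\<close> \<open>k \<subseteq> {a..b}\<close> \<open>u \<le> v\<close> by auto
      qed
      define p1 where "p1 = {(x, k). (x, k) \<in> p \<and> x \<in> N}"
      define p2 where "p2 = {(x, k). (x, k) \<in> p \<and> x \<notin> N}"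
      have pp: "p = p1 \<union> p2" "p1 \<inter> p2 = {}" "p1 \<subseteq> p" "p2 \<subseteq> p" by (auto simp: p1_def p2_def)
      have fin: "finite p" "finite p1" "finite p2" using pD(1) pp finite_subset by blast+
      have c: "measure lborel k = Sup k - Inf k" if "(x, k) \<in> p" for x k
        using ivl[OF that] by (metis content_real)
      have fin_ioo: "emeasure lborel {u<..<v} \<noteq> top" for u v :: real
        by (cases "u \<le> v") auto
      \<comment> \<open>The increments of \<open>y\<close> over the division telescope to
        \<open>y b - y a\<close>, so the error splits into one term per tagged interval.\<close>
      have tot: "(\<Sum>(x, k)\<in>p. measure lborel k *\<^sub>R F' x) - (y b - y a) =
         (\<Sum>(x, k)\<in>p. measure lborel k *\<^sub>R F' x - (y (Sup k) - y (Inf k)))"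
        unfolding additive_tagged_division_1[OF ab p(1), of y, symmetric] sum_subtractf[symmetric]
        by (rule sum.cong) auto
      have "norm (\<Sum>(x, k)\<in>p1. measure lborel k *\<^sub>R F' x - (y (Sup k) - y (Inf k))) \<le>
         (\<Sum>i\<in>p1. norm (y (Sup (snd i)) - y (Inf (snd i))))"
        by (rule order_trans[OF norm_sum]) (auto intro!: sum_mono simp: p1_def F'_def norm_minus_commute)
      also have "\<dots> < e / 2"
      proof (rule ac_modulus_finiteD[OF \<eta> fin(2)])
        show "Inf (snd i) \<le> Sup (snd i) \<and> {Inf (snd i)..Sup (snd i)} \<subseteq> {a..b}" if "i \<in> p1" for i
        proof -
          have "(fst i, snd i) \<in> p" using that pp by auto
          from ivl[OF this] show ?thesis by blast
        qed
        show disj: "{Inf (snd i)<..<Sup (snd i)} \<inter> {Inf (snd j)<..<Sup (snd j)} = {}"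
          if ij: "i \<in> p1" "j \<in> p1" "i \<noteq> j" for i j
        proof -
          have "interior (snd i) \<inter> interior (snd j) = {}"
            using pD(5)[of "fst i" "snd i" "fst j" "snd j"] ij pp by auto
          moreover have "interior (snd i) = {Inf (snd i)<..<Sup (snd i)}" if "i \<in> p1" for i
            using ivl[of "fst i" "snd i"] that pp by (metis interior_atLeastAtMost_real prod.collapse subset_eq)
          ultimately show ?thesis using ij by simp
        qed
        \<comment> \<open>The open intervals are disjoint subsets of \<open>O'\<close>, so their
          total length is the measure of a subset of \<open>O'\<close> and stays below
          \<open>\<eta>\<close>.\<close>
        have "(\<Sum>i\<in>p1. Sup (snd i) - Inf (snd i)) = (\<Sum>i\<in>p1. measure lebesgue {Inf (snd i)<..<Sup (snd i)})"
        proof (rule sum.cong[OF refl])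
          fix i assume "i \<in> p1"
          then have "(fst i, snd i) \<in> p" using pp by auto
          from ivl[OF this] have "Inf (snd i) \<le> Sup (snd i)" by blast
          then show "Sup (snd i) - Inf (snd i) = measure lebesgue {Inf (snd i)<..<Sup (snd i)}" by simp
        qed
        also have "\<dots> = measure lebesgue (\<Union>i\<in>p1. {Inf (snd i)<..<Sup (snd i)})"
          using fin disj by (intro measure_finite_Union[symmetric]) (auto simp: disjoint_family_on_def fin_ioo)
        also have "\<dots> \<le> measure lebesgue O'"
        proof (rule measure_mono_fmeasurable)
          show "(\<Union>i\<in>p1. {Inf (snd i)<..<Sup (snd i)}) \<subseteq> O'"
          proof (rule UN_least)
            fix i assume i: "i \<in> p1"
            obtain x k where ik: "i = (x, k)" by force
            have "x \<in> N" "(x, k) \<in> p" using i ik by (auto simp: p1_def)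
            then have "k \<subseteq> \<gamma> x" using p(2) unfolding fine_def by blast
            then have "k \<subseteq> O'" using \<open>x \<in> N\<close> by (simp add: \<gamma>_def)
            then show "{Inf (snd i)<..<Sup (snd i)} \<subseteq> O'"
              using ivl[OF \<open>(x, k) \<in> p\<close>] ik by (metis snd_conv greaterThanLessThan_subseteq_atLeastAtMost_iff order_refl subset_trans)
          qed
          show "(\<Union>i\<in>p1. {Inf (snd i)<..<Sup (snd i)}) \<in> sets lebesgue"
            by (rule sets.finite_UN) (use fin in auto)
        qed (use O' in auto)
        finally show "(\<Sum>i\<in>p1. Sup (snd i) - Inf (snd i)) < \<eta>" using O' by simp
      qed
      finally have 1: "norm (\<Sum>(x, k)\<in>p1. measure lborel k *\<^sub>R F' x - (y (Sup k) - y (Inf k))) < e / 2" .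
      have "norm (\<Sum>(x, k)\<in>p2. measure lborel k *\<^sub>R F' x - (y (Sup k) - y (Inf k))) \<le>
         (\<Sum>(x, k)\<in>p2. \<epsilon> * measure lborel k)"
      proof (rule order_trans[OF norm_sum], rule sum_mono, clarsimp)
        fix x k assume xk: "(x, k) \<in> p2"
        then have "(x, k) \<in> p" "x \<notin> N" by (auto simp: p2_def)
        note i = ivl[OF this(1)]
        have ix: "Inf k \<le> x" "x \<le> Sup k" using i by (meson atLeastAtMost_iff)+
        have x: "x \<in> {a..b} - N" using i \<open>x \<notin> N\<close> by blast
        have "k \<subseteq> \<gamma> x" using p(2) \<open>(x, k) \<in> p\<close> unfolding fine_def by blast
        then have "k \<subseteq> ball x (d x)" using x by (simp add: \<gamma>_def)
        then have "\<bar>Sup k - x\<bar> < d x" "\<bar>Inf k - x\<bar> < d x"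
          using i by (metis atLeastAtMost_iff dist_commute dist_real_def mem_ball order_refl subsetD)+
        \<comment> \<open>Straddle argument: both ends of \<open>k\<close> are compared with the tag
          between them, and the two distances to the tag add up to the length of
          \<open>k\<close>.\<close>
        note D = d[OF x this(1)] d[OF x this(2)]
        have "measure lborel k *\<^sub>R F' x - (y (Sup k) - y (Inf k)) =
          (y (Inf k) - y x - (Inf k - x) *\<^sub>R F x) - (y (Sup k) - y x - (Sup k - x) *\<^sub>R F x)"
          unfolding c[OF \<open>(x, k) \<in> p\<close>] using \<open>x \<notin> N\<close> by (simp add: F'_def scaleR_diff_left)
        also have "norm \<dots> \<le> \<epsilon> * \<bar>Inf k - x\<bar> + \<epsilon> * \<bar>Sup k - x\<bar>"
          using D norm_triangle_ineq4 by (smt (verit))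
        also have "\<dots> = \<epsilon> * measure lborel k" unfolding c[OF \<open>(x, k) \<in> p\<close>] using ix by (simp add: right_diff_distrib)
        finally show "norm (measure lborel k *\<^sub>R F' x - (y (Sup k) - y (Inf k))) \<le> \<epsilon> * measure lborel k" .
      qed
      also have "\<dots> \<le> (\<Sum>(x, k)\<in>p. \<epsilon> * measure lborel k)"
        by (rule sum_mono2) (use fin pp \<epsilon> in auto)
      also have "\<dots> = \<epsilon> * (\<Sum>(x, k)\<in>p. measure lborel k)"
        by (simp add: sum_distrib_left case_prod_unfold)
      also have "(\<Sum>(x, k)\<in>p. measure lborel k) = b - a"
        using additive_content_tagged_division[of p a b] p(1) ab by simp
      also have "\<epsilon> * (b - a) < e / 2" by (rule \<epsilon>)
      finally have 2: "norm (\<Sum>(x, k)\<in>p2. measure lborel k *\<^sub>R F' x - (y (Sup k) - y (Inf k))) < e / 2" .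
      have "(\<Sum>(x, k)\<in>p1 \<union> p2. measure lborel k *\<^sub>R F' x - (y (Sup k) - y (Inf k))) =
         (\<Sum>(x, k)\<in>p1. measure lborel k *\<^sub>R F' x - (y (Sup k) - y (Inf k))) +
         (\<Sum>(x, k)\<in>p2. measure lborel k *\<^sub>R F' x - (y (Sup k) - y (Inf k)))"
        by (rule sum.union_disjoint[OF fin(2,3) pp(2)])
      then have split: "(\<Sum>(x, k)\<in>p. measure lborel k *\<^sub>R F' x - (y (Sup k) - y (Inf k))) =
         (\<Sum>(x, k)\<in>p1. measure lborel k *\<^sub>R F' x - (y (Sup k) - y (Inf k))) +
         (\<Sum>(x, k)\<in>p2. measure lborel k *\<^sub>R F' x - (y (Sup k) - y (Inf k)))"
        by (simp only: pp(1)[symmetric])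
      have *: "norm (A + B) < e" if "norm A < e / 2" "norm B < e / 2" for A B :: 'a
        using norm_triangle_ineq[of A B] that by linarith
      show ?thesis unfolding tot split by (rule *[OF 1 2])
    qed
    show "\<exists>\<gamma>. gauge \<gamma> \<and> (\<forall>\<D>. \<D> tagged_division_of {a..b} \<and> \<gamma> fine \<D> \<longrightarrow>
        norm ((\<Sum>(x, k)\<in>\<D>. measure lborel k *\<^sub>R F' x) - (y b - y a)) < e)"
      by (intro exI[of _ \<gamma>] conjI allI impI gauge) (erule conjE, rule fin_est)
  qed
  then show ?thesis
    by (rule has_integral_spike[OF N, rotated]) (auto simp: F'_def)
qed

text \<open>\<open>integrable_ccontinuous_explicit\<close> controls averages over intervals to the
  right of a point; applied to the reflected function it gives those to the left. One exceptional
  set serves every lower limit \<open>c\<close>.\<close>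

lemma lebesgue_differentiation:
  fixes f :: "real \<Rightarrow> 'b::euclidean_space"
  assumes f: "\<And>a b. f integrable_on {a..b}"
  obtains N where "negligible N"
    "\<And>t c. t \<notin> N \<Longrightarrow> c < t \<Longrightarrow> ((\<lambda>s. integral {c..s} f) has_vector_derivative f t) (at t)"
proof -
  obtain N1 where N1: "negligible N1" "\<And>x e. \<lbrakk>x \<notin> N1; 0 < e\<rbrakk> \<Longrightarrow>
      \<exists>d>0. \<forall>h. 0 < h \<and> h < d \<longrightarrow> norm (integral {x..x + h} f /\<^sub>R h - f x) < e"
    using integrable_ccontinuous_explicit[where f=f] f by (auto simp: cbox_interval)
  have f': "(\<lambda>x. f (- x)) integrable_on {a..b}" for a b
    using f[of "-b" "-a"] Henstock_Kurzweil_Integration.integrable_reflect_real[where f=f and a="-b" and b="-a"] by simp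
  obtain N2 where N2: "negligible N2" "\<And>x e. \<lbrakk>x \<notin> N2; 0 < e\<rbrakk> \<Longrightarrow>
      \<exists>d>0. \<forall>h. 0 < h \<and> h < d \<longrightarrow> norm (integral {x..x + h} (\<lambda>x. f (-x)) /\<^sub>R h - f (-x)) < e"
    using integrable_ccontinuous_explicit[where f="\<lambda>x. f (- x)"] f' by (auto simp: cbox_interval)
  have "negligible (uminus ` N2)"
    by (rule negligible_differentiable_image_negligible) (auto intro!: N2 differentiable_on_minus differentiable_on_ident)
  then have neg: "negligible (N1 \<union> uminus ` N2)" using N1 by simp
  show ?thesis
  proof (rule that[OF neg])
    fix t c assume t: "t \<notin> N1 \<union> uminus ` N2" and c: "(c::real) < t"
    have t1: "t \<notin> N1" and t2: "- t \<notin> N2" using t by force+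
    show "((\<lambda>s. integral {c..s} f) has_vector_derivative f t) (at t)"
      unfolding has_vector_derivative_def has_derivative_at_alt
    proof (intro conjI allI impI)
      show "bounded_linear (\<lambda>x. x *\<^sub>R f t)" by (rule bounded_linear_scaleR_left)
      fix e :: real assume "e > 0"
      obtain d1 where d1: "d1 > 0" "\<And>h. 0 < h \<Longrightarrow> h < d1 \<Longrightarrow> norm (integral {t..t + h} f /\<^sub>R h - f t) < e"
        using N1(2)[OF t1 \<open>e > 0\<close>] by blast
      obtain d2 where d2: "d2 > 0" "\<And>h. 0 < h \<Longrightarrow> h < d2 \<Longrightarrow> norm (integral {-t..-t + h} (\<lambda>x. f (-x)) /\<^sub>R h - f t) < e"
        using N2(2)[OF t2 \<open>e > 0\<close>] by auto
      have sc: "norm (v - h *\<^sub>R w) \<le> e * h" if "norm (v /\<^sub>R h - w) < e" "h > 0" for v w :: 'b and h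
      proof -
        have "v - h *\<^sub>R w = h *\<^sub>R (v /\<^sub>R h - w)" using that by (simp add: algebra_simps)
        then have "norm (v - h *\<^sub>R w) = h * norm (v /\<^sub>R h - w)" using that by simp
        also have "\<dots> \<le> h * e" using that by (intro mult_left_mono) auto
        finally show ?thesis by (simp add: mult.commute)
      qed
      show "\<exists>d>0. \<forall>y. norm (y - t) < d \<longrightarrow> norm (integral {c..y} f - integral {c..t} f - (y - t) *\<^sub>R f t) \<le> e * norm (y - t)"
      proof (intro exI[of _ "min (min d1 d2) (t - c)"] conjI allI impI)
        fix y assume y: "norm (y - t) < min (min d1 d2) (t - c)"
        consider "y = t" | "y > t" | "y < t" by linarith
        then show "norm (integral {c..y} f - integral {c..t} f - (y - t) *\<^sub>R f t) \<le> e * norm (y - t)"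
        proof cases
          case 2
          have "integral {c..y} f = integral {c..t} f + integral {t..y} f"
            using Henstock_Kurzweil_Integration.integral_combine[where a=c and c=t and b=y and f=f] c 2 f by auto
          then show ?thesis using sc[OF d1(2), of "y - t"] 2 y by auto
        next
          case 3
          have 1: "integral {c..t} f = integral {c..y} f + integral {y..t} f"
            using Henstock_Kurzweil_Integration.integral_combine[where a=c and c=y and b=t and f=f] c 3 f y by auto
          have 2: "integral {-t..-t + (t - y)} (\<lambda>x. f (-x)) = integral {y..t} f"
            by simp
          have 4: "integral {c..y} f - integral {c..t} f - (y - t) *\<^sub>R f t = - (integral {y..t} f - (t - y) *\<^sub>R f t)"
            unfolding 1 by (simp add: algebra_simps)
          show ?thesis unfolding 4 norm_minus_cancel
            using sc[OF d2(2), of "t - y"] 3 y unfolding 2 by auto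
        qed simp
      qed (use d1 d2 c in auto)
    qed
  qed
qed

section \<open>Almost-everywhere statements on the real line\<close>

lemma AE_lebesgue_iff_negligible:
  "(AE t in lebesgue. P t) \<longleftrightarrow> (\<exists>N. negligible N \<and> (\<forall>t. t \<notin> N \<longrightarrow> P t))"
  unfolding eventually_ae_filter negligible_iff_null_sets by auto

lemma AE_lebesgue_shift:
  fixes c :: real
  assumes "AE t in lebesgue. P t" shows "AE t in lebesgue. P (t + c)"
proof -
  obtain N where N: "negligible N" "\<And>t. t \<notin> N \<Longrightarrow> P t"
    using assms unfolding AE_lebesgue_iff_negligible by blast
  have "negligible ((+) (- c) ` N)" using N(1) by (rule negligible_translation)
  moreover have "P (t + c)" if "t \<notin> (+) (- c) ` N" for t
  proof (rule N(2), rule notI)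
    assume "t + c \<in> N"
    then have "- c + (t + c) \<in> (+) (- c) ` N" by blast
    then show False using that by simp
  qed
  ultimately show ?thesis unfolding AE_lebesgue_iff_negligible by blast
qed

lemma AE_lebesgue_neq: "AE t in lebesgue. t \<noteq> (c::real)"
  unfolding AE_lebesgue_iff_negligible by (intro exI[of _ "{c}"]) auto

lemma AE_lebesgue_on_iff:
  assumes "S \<in> sets lebesgue"
  shows "(AE t in lebesgue_on S. P t) \<longleftrightarrow> (AE t in lebesgue. t \<in> S \<longrightarrow> P t)"
  by (rule AE_restrict_space_iff) (use assms in simp)

lemma integral_le_AE:
  fixes F G :: "real \<Rightarrow> real"
  assumes "(F has_integral i) S" "(G has_integral j) S" "AE t in lebesgue. t \<in> S \<longrightarrow> F t \<le> G t"
  shows "i \<le> j"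
proof -
  obtain N where N: "negligible N" "\<And>t. t \<notin> N \<Longrightarrow> t \<in> S \<Longrightarrow> F t \<le> G t"
    using assms(3) unfolding AE_lebesgue_iff_negligible by blast
  have "((\<lambda>t. if t \<in> N then G t else F t) has_integral i) S"
    by (rule has_integral_spike[OF N(1) _ assms(1)]) auto
  then show ?thesis by (rule has_integral_le[OF _ assms(2)]) (use N in auto)
qed

lemma norm_integral_le_AE:
  fixes F :: "real \<Rightarrow> 'a::euclidean_space"
  assumes "F integrable_on S" "(G has_integral j) S" "AE t in lebesgue. t \<in> S \<longrightarrow> norm (F t) \<le> G t"
  shows "norm (integral S F) \<le> j"
proof -
  obtain N where N: "negligible N" "\<And>t. t \<notin> N \<Longrightarrow> t \<in> S \<Longrightarrow> norm (F t) \<le> G t"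
    using assms(3) unfolding AE_lebesgue_iff_negligible by blast
  define F' where "F' = (\<lambda>t. if t \<in> N then 0 else F t)"
  define G' where "G' = (\<lambda>t. if t \<in> N then 0 else G t)"
  have 1: "(F' has_integral integral S F) S"
    by (rule has_integral_spike[OF N(1) _ integrable_integral[OF assms(1)]]) (auto simp: F'_def)
  have 2: "(G' has_integral j) S"
    by (rule has_integral_spike[OF N(1) _ assms(2)]) (auto simp: G'_def)
  have "norm (integral S F') \<le> integral S G'"
    by (rule integral_norm_bound_integral) (use 1 2 N in \<open>auto simp: F'_def G'_def integrable_on_def\<close>)
  then show ?thesis using 1 2 by (simp add: integral_unique)
qed

section \<open>Half-open time intervals, possibly unbounded\<close>

lemma time_ivl_infinity [simp]: "time_ivl a \<infinity> = {a..}"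
  by (auto simp: time_ivl_def)

lemma time_ivl_ereal [simp]: "time_ivl a (ereal b) = {a..<b}"
  by (auto simp: time_ivl_def)

lemma time_ivl_subset: "d \<in> time_ivl a T \<Longrightarrow> a \<le> c \<Longrightarrow> {c..d} \<subseteq> time_ivl a T"
  unfolding time_ivl_def by (auto intro: order.strict_trans1[of "ereal _" "ereal d"])

text \<open>Being half-open, the interval has room to the right of each of its points, also when
  \<open>T\<close> is infinite; local claims can thus be checked on compact pieces.\<close>

lemma time_ivl_right:
  assumes "t \<in> time_ivl a T" obtains d where "t < d" "d \<in> time_ivl a T"
proof -
  obtain e where e: "ereal t < e" "e < T" using assms dense[of "ereal t" T] by (auto simp: time_ivl_def)
  obtain d where "e = ereal d" using e by (cases e) auto
  then show ?thesis using e assms by (intro that[of d]) (auto simp: time_ivl_def)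
qed

lemma continuous_on_time_ivlI:
  assumes "\<And>d. d \<in> time_ivl a T \<Longrightarrow> continuous_on {a..d} y"
  shows "continuous_on (time_ivl a T) (y :: real \<Rightarrow> 'a::metric_space)"
  unfolding continuous_on_iff
proof (intro ballI allI impI)
  fix t e :: real assume t: "t \<in> time_ivl a T" and "e > 0"
  obtain d where d: "t < d" "d \<in> time_ivl a T" using time_ivl_right[OF t] .
  have "t \<in> {a..d}" using t d by (auto simp: time_ivl_def)
  then obtain k where "k > 0" and k: "\<And>x. x \<in> {a..d} \<Longrightarrow> dist x t < k \<Longrightarrow> dist (y x) (y t) < e"
    using assms[OF d(2)] \<open>e > 0\<close> unfolding continuous_on_iff by blast
  show "\<exists>k>0. \<forall>x\<in>time_ivl a T. dist x t < k \<longrightarrow> dist (y x) (y t) < e"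
  proof (intro exI[of _ "min k (d - t)"] conjI ballI impI)
    fix x assume "x \<in> time_ivl a T" "dist x t < min k (d - t)"
    then show "dist (y x) (y t) < e" by (intro k) (auto simp: time_ivl_def dist_real_def)
  qed (use \<open>k > 0\<close> d in auto)
qed

section \<open>Solutions in the sense of Caratheodory\<close>

lemma solves_ae_onE:
  assumes "solves_ae_on J F y"
  obtains N where "negligible N" "\<And>t. t \<in> J - N \<Longrightarrow> (y has_vector_derivative F t) (at t)"
  using assms that unfolding solves_ae_on_def AE_lebesgue_iff_negligible by blast

lemma solves_ae_on_has_integral:
  assumes "solves_ae_on J F y" "c \<le> d" "{c..d} \<subseteq> J"
  shows "(F has_integral (y d - y c)) {c..d}"
proof -
  obtain N where N: "negligible N" "\<And>t. t \<in> J - N \<Longrightarrow> (y has_vector_derivative F t) (at t)"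
    using solves_ae_onE[OF assms(1)] by blast
  show ?thesis
    by (rule abs_cont_on_ftc[OF _ assms(2) N(1)]) (use assms N in \<open>auto simp: solves_ae_on_def\<close>)
qed

lemma solves_ae_on_subset:
  assumes "solves_ae_on J F y" "J' \<subseteq> J" shows "solves_ae_on J' F y"
  using assms unfolding solves_ae_on_def by (auto elim!: AE_mp)

lemma solves_ae_on_continuous_on:
  assumes "solves_ae_on J F y" "{c..d} \<subseteq> J" shows "continuous_on {c..d} y"
  using assms unfolding solves_ae_on_def by (blast intro: abs_cont_on_imp_continuous_on)

lemma solves_ae_on_continuous_on_time_ivl:
  assumes "solves_ae_on (time_ivl a T) F y" shows "continuous_on (time_ivl a T) y"
  by (rule continuous_on_time_ivlI, rule solves_ae_on_continuous_on[OF assms]) (rule time_ivl_subset, auto)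

lemma solves_ae_on_cong_rhs:
  assumes "solves_ae_on J F y" "AE t in lebesgue. t \<in> J \<longrightarrow> F t = G t" shows "solves_ae_on J G y"
  using assms unfolding solves_ae_on_def by (auto elim!: AE_mp[OF conjunct2])

lemma solves_ae_on_Pair:
  assumes "solves_ae_on J F y" "solves_ae_on J G z"
  shows "solves_ae_on J (\<lambda>t. (F t, G t)) (\<lambda>t. (y t, z t))"
  using assms unfolding solves_ae_on_def
  by (auto intro!: abs_cont_on_Pair has_vector_derivative_Pair elim!: eventually_elim2)

lemma solves_ae_on_shift:
  assumes s: "solves_ae_on J F y" and J: "\<And>t. t \<in> J' \<Longrightarrow> t + c \<in> J"
  shows "solves_ae_on J' (\<lambda>t. F (t + c)) (\<lambda>t. y (t + c))"
  unfolding solves_ae_on_def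
proof (intro conjI allI impI)
  fix a b assume ab: "{a..b} \<subseteq> J'"
  have sub: "{a + c..b + c} \<subseteq> J"
  proof
    fix s assume "s \<in> {a + c..b + c}"
    then have "s - c \<in> J'" using ab by auto
    then show "s \<in> J" using J[of "s - c"] by simp
  qed
  show "abs_cont_on {a..b} (\<lambda>t. y (t + c))"
    unfolding abs_cont_on_iff_modulus
  proof (intro allI impI)
    fix e :: real assume "e > 0"
    then obtain d where "d > 0" and d: "ac_modulus {a + c..b + c} y e d"
      using s sub unfolding solves_ae_on_def abs_cont_on_iff_modulus by blast
    have "ac_modulus {a..b} (\<lambda>t. y (t + c)) e d"
    proof (rule ac_modulusI)
      fix n :: nat and u v :: "nat \<Rightarrow> real"
      assume *: "\<And>i. i < n \<Longrightarrow> u i \<le> v i" "\<And>i. i < n \<Longrightarrow> u i \<in> {a..b}" "\<And>i. i < n \<Longrightarrow> v i \<in> {a..b}"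
        "\<And>i j. i < n \<Longrightarrow> j < n \<Longrightarrow> i \<noteq> j \<Longrightarrow> {u i<..<v i} \<inter> {u j<..<v j} = {}" "(\<Sum>i<n. v i - u i) < d"
      have "{u i + c<..<v i + c} \<inter> {u j + c<..<v j + c} = {}" if ij: "i < n" "j < n" "i \<noteq> j" for i j
      proof (rule equals0I)
        fix x assume "x \<in> {u i + c<..<v i + c} \<inter> {u j + c<..<v j + c}"
        then have "x - c \<in> {u i<..<v i} \<inter> {u j<..<v j}" by auto
        then show False using *(4)[OF ij] by blast
      qed
      then show "(\<Sum>i<n. norm (y (v i + c) - y (u i + c))) < e"
        using * by (intro ac_modulusD[OF d]) auto
    qed
    then show "\<exists>d>0. ac_modulus {a..b} (\<lambda>t. y (t + c)) e d" using \<open>d > 0\<close> by blast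
  qed
next
  have "AE t in lebesgue. t + c \<in> J \<longrightarrow> (y has_vector_derivative F (t + c)) (at (t + c))"
    using AE_lebesgue_shift[of "\<lambda>t. t \<in> J \<longrightarrow> (y has_vector_derivative F t) (at t)"] s
    unfolding solves_ae_on_def by blast
  then show "AE t in lebesgue. t \<in> J' \<longrightarrow> ((\<lambda>t. y (t + c)) has_vector_derivative F (t + c)) (at t)"
  proof eventually_elim
    case (elim t)
    show ?case
    proof
      assume "t \<in> J'"
      then have "(y has_vector_derivative F (t + c)) (at (t + c))" using elim J by blast
      then show "((\<lambda>t. y (t + c)) has_vector_derivative F (t + c)) (at t)"
        using vector_diff_chain_at[OF has_vector_derivative_add_const[THEN iffD2, OF has_vector_derivative_id], of y "F (t + c)" t c]
        by (simp add: o_def)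
    qed
  qed
qed

text \<open>The derivative is two-sided, so at the left end \<open>a\<close> it also sees values
  before \<open>a\<close>, where \<open>y\<close> and \<open>y'\<close> need not agree; this single
  point is discarded as a null set. On the right a half-open interval leaves room.\<close>

lemma solves_ae_on_cong:
  assumes s: "solves_ae_on (time_ivl a T) F y" and eq: "\<And>t. t \<in> time_ivl a T \<Longrightarrow> y t = y' t"
  shows "solves_ae_on (time_ivl a T) F y'"
  unfolding solves_ae_on_def
proof (intro conjI allI impI)
  fix c d assume "{c..d} \<subseteq> time_ivl a T"
  then show "abs_cont_on {c..d} y'"
    using s eq unfolding solves_ae_on_def by (blast intro: abs_cont_on_cong)
next
  have "AE t in lebesgue. t \<in> time_ivl a T \<longrightarrow> (y has_vector_derivative F t) (at t)"
    using s unfolding solves_ae_on_def by blast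
  then show "AE t in lebesgue. t \<in> time_ivl a T \<longrightarrow> (y' has_vector_derivative F t) (at t)"
    using AE_lebesgue_neq[of a]
  proof eventually_elim
    case (elim t)
    show ?case
    proof
      assume t: "t \<in> time_ivl a T"
      obtain d where d: "t < d" "d \<in> time_ivl a T" using time_ivl_right[OF t] .
      have "a < t" using t elim by (auto simp: time_ivl_def)
      show "(y' has_vector_derivative F t) (at t)"
      proof (rule has_vector_derivative_transform_within_open)
        show "(y has_vector_derivative F t) (at t)" using elim t by blast
        show "y s = y' s" if "s \<in> {a<..<d}" for s
          using eq subsetD[OF time_ivl_subset[OF d(2), of a], of s] that by auto
      qed (use \<open>a < t\<close> d in auto)
    qed
  qed
qed

text \<open>Converse of \<open>solves_ae_on_has_integral\<close>. The essential bound makes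
  \<open>y\<close> Lipschitz, hence absolutely continuous, on compact intervals; the derivative
  comes from Lebesgue differentiation.\<close>

lemma solves_ae_on_integralI:
  fixes F :: "real \<Rightarrow> 'a::euclidean_space"
  assumes int: "\<And>c d. a \<le> c \<Longrightarrow> c \<le> d \<Longrightarrow> d \<in> time_ivl a T \<Longrightarrow> (F has_integral (y d - y c)) {c..d}"
    and bnd: "\<And>d. d \<in> time_ivl a T \<Longrightarrow> \<exists>C. AE t in lebesgue. t \<in> {a..d} \<longrightarrow> norm (F t) \<le> C"
  shows "solves_ae_on (time_ivl a T) F y"
  unfolding solves_ae_on_def
proof (intro conjI allI impI)
  fix c d assume cd: "{c..d} \<subseteq> time_ivl a T"
  show "abs_cont_on {c..d} y"
  proof (cases "c \<le> d")
    case True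
    then have d: "d \<in> time_ivl a T" "a \<le> c" using cd by (auto simp: time_ivl_def)
    obtain C where C: "AE t in lebesgue. t \<in> {a..d} \<longrightarrow> norm (F t) \<le> C" using bnd[OF d(1)] by blast
    show ?thesis
    proof (rule abs_cont_on_lipschitz)
      fix u v assume uv: "u \<in> {c..d}" "v \<in> {c..d}" "u \<le> v"
      then have v: "v \<in> time_ivl a T" "a \<le> u" using cd d by auto
      have i: "(F has_integral (y v - y u)) {u..v}" using int[OF v(2) uv(3) v(1)] .
      have "norm (integral {u..v} F) \<le> C * (v - u)"
      proof (rule norm_integral_le_AE)
        show "((\<lambda>_. C) has_integral C * (v - u)) {u..v}"
          using has_integral_const_real[of C u v] uv by (simp add: mult.commute)
        show "AE t in lebesgue. t \<in> {u..v} \<longrightarrow> norm (F t) \<le> C"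
          using C by eventually_elim (use uv d in auto)
      qed (use i in \<open>auto simp: integrable_on_def\<close>)
      then show "norm (y v - y u) \<le> C * (v - u)" using i by (simp add: integral_unique)
    qed
  next
    case False
    then show ?thesis by (intro abs_cont_on_lipschitz[of _ _ 0]) auto
  qed
next
  have "\<exists>N. negligible N \<and> (\<forall>t. t \<in> {a<..<d} - N \<longrightarrow> (y has_vector_derivative F t) (at t))" if d: "d \<in> time_ivl a T" for d
  proof -
    have ad: "a \<le> d" using d by (auto simp: time_ivl_def)
    \<comment> \<open>\<open>lebesgue_differentiation\<close> asks for integrability on all
      intervals, so \<open>F\<close> is cut off outside \<open>{a..d}\<close>.\<close>
    define F' where "F' = (\<lambda>t. if t \<in> {a..d} then F t else 0)"
    have "F integrable_on {a..d}" using int[OF order_refl ad d] by (auto simp: integrable_on_def)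
    then have "F' integrable_on {c..e}" for c e
      unfolding F'_def using integrable_altD(1)[of F "{a..d}" c e] by (simp add: cbox_interval)
    then obtain N where N: "negligible N"
      "\<And>t c. t \<notin> N \<Longrightarrow> c < t \<Longrightarrow> ((\<lambda>s. integral {c..s} F') has_vector_derivative F' t) (at t)"
      using lebesgue_differentiation[of F'] by blast
    have "(y has_vector_derivative F t) (at t)" if t: "t \<in> {a<..<d} - N" for t
    proof (rule has_vector_derivative_transform_within_open)
      show "((\<lambda>s. y a + integral {a..s} F') has_vector_derivative F t) (at t)"
        using N(2)[of t a] t by (auto simp: F'_def intro!: derivative_eq_intros)
      show "y a + integral {a..s} F' = y s" if "s \<in> {a<..<d}" for s
      proof -
        have "s \<in> time_ivl a T" using that time_ivl_subset[OF d, of a] by auto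
        then have "(F has_integral (y s - y a)) {a..s}" using int that by auto
        then have "(F' has_integral (y s - y a)) {a..s}"
          by (rule has_integral_eq[rotated]) (use that in \<open>auto simp: F'_def\<close>)
        then show ?thesis by (simp add: integral_unique)
      qed
    qed (use t in auto)
    then show ?thesis using N(1) by blast
  qed
  then obtain N where N: "\<And>d. d \<in> time_ivl a T \<Longrightarrow> negligible (N d)"
    "\<And>d t. d \<in> time_ivl a T \<Longrightarrow> t \<in> {a<..<d} - N d \<Longrightarrow> (y has_vector_derivative F t) (at t)"
    by metis
  \<comment> \<open>The exceptional set depends on the right end \<open>d\<close>; rational right
    ends suffice and keep the union countable. The point \<open>a\<close> is removed because the
    derivative is two-sided.\<close>
  define N' where "N' = {a} \<union> (\<Union>d\<in>\<rat> \<inter> time_ivl a T. N d)"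
  have "negligible (\<Union>(N ` (\<rat> \<inter> time_ivl a T)))"
    by (rule negligible_countable_Union) (use N countable_rat in auto)
  then have "negligible N'" unfolding N'_def by simp
  moreover have "(y has_vector_derivative F t) (at t)" if t: "t \<in> time_ivl a T" "t \<notin> N'" for t
  proof -
    obtain e where e: "t < e" "e \<in> time_ivl a T" using time_ivl_right[OF t(1)] .
    obtain d where d: "d \<in> \<rat>" "t < d" "d < e" using Rats_dense_in_real[OF e(1)] by blast
    have "d \<in> time_ivl a T" using subsetD[OF time_ivl_subset[OF e(2), of a], of d] d e t by (auto simp: time_ivl_def)
    then show ?thesis using N(2)[of d t] d t unfolding N'_def by (auto simp: time_ivl_def)
  qed
  ultimately show "AE t in lebesgue. t \<in> time_ivl a T \<longrightarrow> (y has_vector_derivative F t) (at t)"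
    unfolding AE_lebesgue_iff_negligible by blast
qed

text \<open>This form composes directly: the image of a compact set under a function that is
  Lipschitz on it is again compact. It is the regularity shared by all fields of the loop, including
  those built with \<open>norm\<close> and \<open>max\<close>, which are not differentiable.\<close>

definition lip_compact :: "'a::metric_space set \<Rightarrow> ('a \<Rightarrow> 'b::metric_space) \<Rightarrow> bool" where
  "lip_compact S f \<longleftrightarrow> (\<forall>K. compact K \<longrightarrow> K \<subseteq> S \<longrightarrow> (\<exists>C. C-lipschitz_on K f))"

text \<open>The chain rule gives the derivative almost everywhere; absolute continuity survives
  because \<open>G\<close> is Lipschitz on the compact image of the trajectory. All Lyapunov
  functions are differentiated along solutions in this way.\<close>

lemma solves_ae_on_compose:
  fixes G :: "'a::euclidean_space \<Rightarrow> 'b::euclidean_space"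
  assumes s: "solves_ae_on J F y" and lip: "lip_compact UNIV G"
    and der: "\<And>x. (G has_derivative G' x) (at x)"
  shows "solves_ae_on J (\<lambda>t. G' (y t) (F t)) (\<lambda>t. G (y t))"
  unfolding solves_ae_on_def
proof (intro conjI allI impI)
  fix a b assume ab: "{a..b} \<subseteq> J"
  have ac: "abs_cont_on {a..b} y" using s ab unfolding solves_ae_on_def by blast
  have "compact (y ` {a..b})"
    by (rule compact_continuous_image[OF abs_cont_on_imp_continuous_on[OF ac]]) simp
  then obtain C where C: "C-lipschitz_on (y ` {a..b}) G" using lip unfolding lip_compact_def by blast
  show "abs_cont_on {a..b} (\<lambda>t. G (y t))"
    by (rule abs_cont_on_dominated[OF ac, of _ C])
      (use lipschitz_onD[OF C] in \<open>auto simp: dist_norm\<close>)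
next
  have "AE t in lebesgue. t \<in> J \<longrightarrow> (y has_vector_derivative F t) (at t)"
    using s unfolding solves_ae_on_def by blast
  then show "AE t in lebesgue. t \<in> J \<longrightarrow> ((\<lambda>t. G (y t)) has_vector_derivative G' (y t) (F t)) (at t)"
  proof eventually_elim
    case (elim t)
    show ?case
    proof
      assume "t \<in> J"
      with elim have "(y has_derivative (\<lambda>h. h *\<^sub>R F t)) (at t)" by (simp add: has_vector_derivative_def)
      from has_derivative_compose[OF this der]
      have "((\<lambda>t. G (y t)) has_derivative (\<lambda>h. G' (y t) (h *\<^sub>R F t))) (at t)" .
      moreover have "G' (y t) (h *\<^sub>R F t) = h *\<^sub>R G' (y t) (F t)" for h
        by (rule linear_cmul) (use der has_derivative_linear in blast)
      ultimately show "((\<lambda>t. G (y t)) has_vector_derivative G' (y t) (F t)) (at t)"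
        by (simp add: has_vector_derivative_def)
    qed
  qed
qed

section \<open>Weighted contractions, uniqueness and Picard iteration\<close>

lemma continuous_on_interval_bounded:
  fixes f :: "real \<Rightarrow> 'a::real_normed_vector"
  assumes "continuous_on {a..b} f"
  shows "\<exists>M\<ge>0. \<forall>s\<in>{a..b}. norm (f s) \<le> M"
proof -
  have "bounded (f ` {a..b})" using assms by (intro compact_imp_bounded compact_continuous_image) auto
  then obtain M where "M > 0" "\<forall>x\<in>f ` {a..b}. norm x \<le> M" unfolding bounded_pos by blast
  then show ?thesis by (intro exI[of _ M]) auto
qed

text \<open>Takes the place of Gronwall's inequality: \<open>step\<close> halves every constant for
  which the weighted bound holds, so starting from \<open>B\<close> the bound holds with
  \<open>B / 2^n\<close> for all \<open>n\<close>.\<close>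

lemma contraction_vanish:
  fixes d :: "real \<Rightarrow> real"
  assumes bd: "\<And>t. t \<in> S \<Longrightarrow> d t \<le> B * e t" and "B \<ge> 0" and e: "\<And>t. t \<in> S \<Longrightarrow> e t \<ge> 0"
    and step: "\<And>M. M \<ge> 0 \<Longrightarrow> (\<And>s. s \<in> S \<Longrightarrow> d s \<le> M * e s) \<Longrightarrow> (\<And>t. t \<in> S \<Longrightarrow> d t \<le> M / 2 * e t)"
    and t: "t \<in> S"
  shows "d t \<le> 0"
proof -
  have *: "\<forall>t\<in>S. d t \<le> B * (1/2)^n * e t" for n
  proof (induction n)
    case (Suc n)
    have "\<forall>t\<in>S. d t \<le> (B * (1/2)^n) / 2 * e t"
      using step[of "B * (1/2)^n"] Suc \<open>B \<ge> 0\<close> by simp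
    then show ?case by simp
  qed (use bd in simp)
  have "(\<lambda>n. B * (1/2)^n * e t) \<longlonglongrightarrow> B * 0 * e t"
    by (intro tendsto_intros LIMSEQ_power_zero) simp
  then show ?thesis
    using LIMSEQ_le_const[of _ _ "d t"] * t by fastforce
qed

lemma has_integral_exp_weight:
  fixes a c t L M :: real
  assumes "c \<le> t" "L > 0"
  shows "((\<lambda>s. L * (M * exp (2 * L * (s - a)))) has_integral
    (M / 2 * exp (2 * L * (t - a)) - M / 2 * exp (2 * L * (c - a)))) {c..t}"
  by (rule fundamental_theorem_of_calculus)
    (use assms in \<open>auto intro!: derivative_eq_intros simp: has_real_derivative_iff_has_vector_derivative[symmetric]\<close>)

text \<open>The weight grows at twice the Lipschitz constant, so its antiderivative carries the
  factor \<open>1 / (2 * L)\<close>: multiplying by \<open>L\<close> and integrating halves the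
  constant, whatever the length of \<open>{c..t}\<close>. The parameter \<open>a\<close> only places
  the weight in time.\<close>

lemma volterra_step:
  fixes D :: "real \<Rightarrow> 'a::euclidean_space"
  assumes "c \<le> t" "L > 0" "M \<ge> 0" "D integrable_on {c..t}"
    and "AE s in lebesgue. s \<in> {c..t} \<longrightarrow> norm (D s) \<le> L * (M * exp (2 * L * (s - a)))"
  shows "norm (integral {c..t} D) \<le> M / 2 * exp (2 * L * (t - a))"
proof -
  have "norm (integral {c..t} D) \<le> M / 2 * exp (2 * L * (t - a)) - M / 2 * exp (2 * L * (c - a))"
    by (rule norm_integral_le_AE[OF assms(4) has_integral_exp_weight[OF assms(1,2)] assms(5)])
  moreover have "M / 2 * exp (2 * L * (c - a)) \<ge> 0" using \<open>M \<ge> 0\<close> by simp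
  ultimately show ?thesis by linarith
qed

text \<open>The right-hand sides are functions of time alone, with the solutions already
  substituted, and \<open>lip\<close> compares them along these two solutions only; any dependence
  on inputs is hidden in \<open>F1\<close> and \<open>F2\<close>.\<close>

lemma ode_unique:
  fixes y1 y2 :: "real \<Rightarrow> 'a::euclidean_space"
  assumes s1: "solves_ae_on (time_ivl a T) F1 y1" and s2: "solves_ae_on (time_ivl a T) F2 y2"
    and init: "y1 a = y2 a"
    and lip: "\<And>d. d \<in> time_ivl a T \<Longrightarrow> \<exists>L. AE t in lebesgue. t \<in> {a..d} \<longrightarrow> norm (F1 t - F2 t) \<le> L * norm (y1 t - y2 t)"
    and t: "t \<in> time_ivl a T"
  shows "y1 t = y2 t"
proof -
  obtain L0 where L0: "AE s in lebesgue. s \<in> {a..t} \<longrightarrow> norm (F1 s - F2 s) \<le> L0 * norm (y1 s - y2 s)"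
    using lip[OF t] by blast
  define L where "L = \<bar>L0\<bar> + 1"
  have "L > 0" by (simp add: L_def)
  have L: "AE s in lebesgue. s \<in> {a..t} \<longrightarrow> norm (F1 s - F2 s) \<le> L * norm (y1 s - y2 s)"
    using L0
  proof eventually_elim
    case (elim s)
    have "L0 * norm (y1 s - y2 s) \<le> L * norm (y1 s - y2 s)"
      by (rule mult_right_mono) (auto simp: L_def)
    then show ?case using elim by linarith
  qed
  have at: "a \<le> t" using t by (simp add: time_ivl_def)
  have sub: "{a..s} \<subseteq> time_ivl a T" if "s \<in> {a..t}" for s
    using time_ivl_subset[OF t, of a] that by auto
  have "continuous_on {a..t} (\<lambda>s. norm (y1 s - y2 s))"
    using solves_ae_on_continuous_on[OF s1 sub] solves_ae_on_continuous_on[OF s2 sub] at by (intro continuous_intros) auto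
  then obtain M0 where M00: "M0 \<ge> 0" and M0: "\<And>s. s \<in> {a..t} \<Longrightarrow> norm (y1 s - y2 s) \<le> M0"
    using continuous_on_interval_bounded by fastforce
  have "norm (y1 t - y2 t) \<le> 0"
  proof (rule contraction_vanish[where S="{a..t}" and B=M0 and e="\<lambda>s. exp (2 * L * (s - a))" and d="\<lambda>s. norm (y1 s - y2 s)"])
    fix s assume s: "s \<in> {a..t}"
    have "M0 * 1 \<le> M0 * exp (2 * L * (s - a))"
      using s \<open>L > 0\<close> M00 by (intro mult_left_mono) auto
    then show "norm (y1 s - y2 s) \<le> M0 * exp (2 * L * (s - a))" using M0[OF s] by linarith
  next
    fix M s assume M: "M \<ge> 0" "\<And>s. s \<in> {a..t} \<Longrightarrow> norm (y1 s - y2 s) \<le> M * exp (2 * L * (s - a))"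
      and s: "s \<in> {a..t}"
    have i1: "(F1 has_integral (y1 s - y1 a)) {a..s}" and i2: "(F2 has_integral (y2 s - y2 a)) {a..s}"
      using solves_ae_on_has_integral[OF s1 _ sub[OF s]] solves_ae_on_has_integral[OF s2 _ sub[OF s]] s by auto
    have "((\<lambda>s. F1 s - F2 s) has_integral (y1 s - y2 s)) {a..s}"
      using has_integral_diff[OF i1 i2] init by simp
    moreover have "norm (integral {a..s} (\<lambda>s. F1 s - F2 s)) \<le> M / 2 * exp (2 * L * (s - a))"
    proof (rule volterra_step[OF _ \<open>L > 0\<close> \<open>M \<ge> 0\<close>])
      show "AE q in lebesgue. q \<in> {a..s} \<longrightarrow> norm (F1 q - F2 q) \<le> L * (M * exp (2 * L * (q - a)))"
        using L
      proof eventually_elim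
        case (elim q)
        show ?case
        proof
          assume "q \<in> {a..s}"
          then have q: "q \<in> {a..t}" using s by auto
          have "L * norm (y1 q - y2 q) \<le> L * (M * exp (2 * L * (q - a)))"
            using M(2)[OF q] \<open>L > 0\<close> by (intro mult_left_mono) auto
          then show "norm (F1 q - F2 q) \<le> L * (M * exp (2 * L * (q - a)))" using elim q by linarith
        qed
      qed
    qed (use calculation s in \<open>auto simp: integrable_on_def\<close>)
    ultimately show "norm (y1 s - y2 s) \<le> M / 2 * exp (2 * L * (s - a))"
      by (simp add: integral_unique)
  qed (use M00 at in auto)
  then show ?thesis by simp
qed

text \<open>Iteration from zero. The exponent of the weight may depend on the horizon
  \<open>T\<close>, so convergence is uniform on each \<open>{0..T}\<close> and the limit is one
  function on the half-line. \<open>adm\<close> carries an a priori bound that \<open>\<T>\<close>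
  preserves and limits inherit; a map that is Lipschitz only on bounded sets contracts only under
  such a bound.\<close>

lemma picard:
  fixes \<T> :: "(real \<Rightarrow> 'a::euclidean_space) \<Rightarrow> real \<Rightarrow> 'a"
  assumes cont: "\<And>y. continuous_on {0..} y \<Longrightarrow> continuous_on {0..} (\<T> y)"
    and adm0: "adm (\<lambda>_. 0)" and adm: "\<And>y. continuous_on {0..} y \<Longrightarrow> adm y \<Longrightarrow> adm (\<T> y)"
    and adm_lim: "\<And>Y y. (\<And>n. adm (Y n)) \<Longrightarrow> (\<And>t. t \<ge> 0 \<Longrightarrow> (\<lambda>n. Y n t) \<longlonglongrightarrow> y t) \<Longrightarrow> adm y"
    and contr: "\<And>T. T > 0 \<Longrightarrow> \<exists>\<kappa>\<ge>0. \<forall>y1 y2 M. continuous_on {0..} y1 \<longrightarrow> continuous_on {0..} y2 \<longrightarrow> adm y1 \<longrightarrow> adm y2 \<longrightarrow> M \<ge> 0 \<longrightarrow>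
       (\<forall>s\<in>{0..T}. norm (y1 s - y2 s) \<le> M * exp (\<kappa> * s)) \<longrightarrow>
       (\<forall>t\<in>{0..T}. norm (\<T> y1 t - \<T> y2 t) \<le> M / 2 * exp (\<kappa> * t))"
  obtains y where "continuous_on {0..} y" "\<And>t. t \<ge> 0 \<Longrightarrow> \<T> y t = y t"
proof -
  define Y where "Y n = (\<T> ^^ n) (\<lambda>_. 0)" for n
  have Yc: "continuous_on {0..} (Y n)" for n
    by (induction n) (auto simp: Y_def intro!: cont)
  have Ya: "adm (Y n)" for n
  proof (induction n)
    case (Suc n)
    then show ?case using adm[OF Yc] by (simp add: Y_def)
  qed (simp add: Y_def adm0)
  define D where "D n t = Y (Suc n) t - Y n t" for n t
  define y where "y t = (\<Sum>n. D n t)" for t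
  \<comment> \<open>For each horizon the increments shrink geometrically in the weighted norm, hence
    uniformly on \<open>{0..T}\<close>, which is what the Weierstrass test needs.\<close>
  have key: "\<exists>\<kappa>\<ge>0. \<exists>M0\<ge>0. (\<forall>n. \<forall>t\<in>{0..T}. norm (D n t) \<le> M0 * (1/2)^n * exp (\<kappa> * t)) \<and>
     (\<forall>y1 y2 M. continuous_on {0..} y1 \<longrightarrow> continuous_on {0..} y2 \<longrightarrow> adm y1 \<longrightarrow> adm y2 \<longrightarrow> M \<ge> 0 \<longrightarrow>
       (\<forall>s\<in>{0..T}. norm (y1 s - y2 s) \<le> M * exp (\<kappa> * s)) \<longrightarrow>
       (\<forall>t\<in>{0..T}. norm (\<T> y1 t - \<T> y2 t) \<le> M / 2 * exp (\<kappa> * t)))" if T0: "T > 0" for T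
  proof -
    obtain l where l: "l \<ge> 0" and step: "\<forall>y1 y2 M. continuous_on {0..} y1 \<longrightarrow> continuous_on {0..} y2 \<longrightarrow> adm y1 \<longrightarrow> adm y2 \<longrightarrow> M \<ge> 0 \<longrightarrow>
       (\<forall>s\<in>{0..T}. norm (y1 s - y2 s) \<le> M * exp (l * s)) \<longrightarrow>
       (\<forall>t\<in>{0..T}. norm (\<T> y1 t - \<T> y2 t) \<le> M / 2 * exp (l * t))" using contr[OF T0] by blast
    have "continuous_on {0..T} (D 0)" unfolding D_def
      by (intro continuous_intros continuous_on_subset[OF Yc]) auto
    then obtain M0 where "M0 \<ge> 0" and M0: "\<And>s. s \<in> {0..T} \<Longrightarrow> norm (D 0 s) \<le> M0"
      using continuous_on_interval_bounded by blast
    have "\<forall>t\<in>{0..T}. norm (D n t) \<le> M0 * (1/2)^n * exp (l * t)" for n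
    proof (induction n)
      case 0
      show ?case
      proof
        fix t assume t: "t \<in> {0..T}"
        have "M0 * 1 \<le> M0 * exp (l * t)" using t l \<open>M0 \<ge> 0\<close> by (intro mult_left_mono) auto
        then show "norm (D 0 t) \<le> M0 * (1/2)^0 * exp (l * t)" using M0[OF t] by simp
      qed
    next
      case (Suc n)
      have "\<forall>t\<in>{0..T}. norm (\<T> (Y (Suc n)) t - \<T> (Y n) t) \<le> (M0 * (1/2)^n) / 2 * exp (l * t)"
        using step[rule_format, OF Yc[of "Suc n"] Yc[of n] Ya Ya, of "M0 * (1/2)^n"] Suc \<open>M0 \<ge> 0\<close> unfolding D_def by auto
      then show ?case unfolding D_def Y_def by simp
    qed
    then show ?thesis using l \<open>M0 \<ge> 0\<close> step by blast
  qed
  have sumD: "(\<Sum>k<n. D k t) = Y n t" for n t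
    unfolding D_def by (subst sum_lessThan_telescope) (simp add: Y_def)
  have ul: "uniform_limit {0..T} Y y sequentially" if T0: "T > 0" for T
  proof -
    obtain l M0 where l: "l \<ge> 0" "M0 \<ge> 0" and D: "\<And>n t. t \<in> {0..T} \<Longrightarrow> norm (D n t) \<le> M0 * (1/2)^n * exp (l * t)"
      using key[OF T0] by blast
    have "norm (D n t) \<le> M0 * exp (l * T) * (1/2)^n" if "t \<in> {0..T}" for n t
    proof -
      have "M0 * (1/2)^n * exp (l * t) \<le> M0 * (1/2)^n * exp (l * T)"
        using that l by (intro mult_left_mono) (auto intro: mult_left_mono)
      then show ?thesis using D[OF that, of n] by (simp add: mult.assoc mult.commute mult.left_commute)
    qed
    then have "uniform_limit {0..T} (\<lambda>n t. \<Sum>k<n. D k t) (\<lambda>t. \<Sum>k. D k t) sequentially"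
      by (rule Weierstrass_m_test) (auto intro!: summable_mult summable_geometric)
    then show ?thesis unfolding sumD y_def[abs_def] by (simp add: eta_contract_eq)
  qed
  have yc: "continuous_on {0..} y"
  proof -
    have "continuous_on {0..d} y" if "d \<in> time_ivl 0 \<infinity>" for d
    proof -
      have "continuous_on {0..d+1} y"
        by (rule uniform_limit_theorem[OF _ ul]) (use that in \<open>auto intro!: always_eventually continuous_on_subset[OF Yc]\<close>)
      then show ?thesis by (rule continuous_on_subset) auto
    qed
    from continuous_on_time_ivlI[where T=\<infinity> and a=0, OF this] show ?thesis by simp
  qed
  have ya: "adm y"
  proof (rule adm_lim[of Y])
    show "(\<lambda>n. Y n t) \<longlonglongrightarrow> y t" if "t \<ge> 0" for t
      by (rule tendsto_uniform_limitI[OF ul[of "t + 1"]]) (use that in auto)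
  qed (rule Ya)
  have "\<T> y t = y t" if t: "t \<ge> 0" for t
  proof -
    define T where "T = t + 1"
    have T: "T > 0" "t \<in> {0..T}" using t by (auto simp: T_def)
    obtain l where l: "l \<ge> 0" and step: "\<And>y1 y2 M. continuous_on {0..} y1 \<Longrightarrow> continuous_on {0..} y2 \<Longrightarrow> adm y1 \<Longrightarrow> adm y2 \<Longrightarrow> M \<ge> 0 \<Longrightarrow>
       (\<forall>s\<in>{0..T}. norm (y1 s - y2 s) \<le> M * exp (l * s)) \<Longrightarrow>
       (\<forall>t\<in>{0..T}. norm (\<T> y1 t - \<T> y2 t) \<le> M / 2 * exp (l * t))" using key[OF T(1)] by meson
    have lim1: "(\<lambda>n. Y (Suc n) t) \<longlonglongrightarrow> y t"
      by (rule LIMSEQ_Suc[OF tendsto_uniform_limitI[OF ul[OF T(1)] T(2)]])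
    have lim2: "(\<lambda>n. Y (Suc n) t) \<longlonglongrightarrow> \<T> y t"
    proof (rule LIMSEQ_I)
      fix e :: real assume "e > 0"
      \<comment> \<open>Chosen so that a uniform distance \<open>m\<close> between
        \<open>Y n\<close> and \<open>y\<close> becomes at most \<open>e / 2\<close> at time
        \<open>t\<close> after one application of \<open>\<T>\<close>.\<close>
      define m where "m = e / exp (l * t)"
      have "m > 0" using \<open>e > 0\<close> by (simp add: m_def)
      obtain n0 where n0: "\<And>n s. n \<ge> n0 \<Longrightarrow> s \<in> {0..T} \<Longrightarrow> dist (Y n s) (y s) < m"
        using uniform_limitD[OF ul[OF T(1)] \<open>m > 0\<close>] unfolding eventually_sequentially by blast
      have "norm (Y (Suc n) t - \<T> y t) < e" if "n \<ge> n0" for n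
      proof -
        have "norm (Y n s - y s) \<le> m * exp (l * s)" if "s \<in> {0..T}" for s
        proof -
          have "m * 1 \<le> m * exp (l * s)" using that l \<open>m > 0\<close> by (intro mult_left_mono) auto
          then show ?thesis using n0[OF \<open>n \<ge> n0\<close> that] by (simp add: dist_norm)
        qed
        then have "norm (\<T> (Y n) t - \<T> y t) \<le> m / 2 * exp (l * t)"
          using step[OF Yc yc Ya ya, of m n] \<open>m > 0\<close> T(2) by auto
        also have "\<dots> < e" using \<open>e > 0\<close> by (simp add: m_def)
        finally show ?thesis by (simp add: Y_def)
      qed
      then show "\<exists>n0. \<forall>n\<ge>n0. norm (Y (Suc n) t - \<T> y t) < e" by blast
    qed
    show ?thesis using LIMSEQ_unique[OF lim2 lim1] .
  qed
  then show ?thesis using that yc by blast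
qed

text \<open>Time as a state component: pairing with it makes \<open>solves_ae_on_compose\<close>
  applicable to functions that depend on \<open>t\<close> explicitly.\<close>

lemma solves_ae_on_id: "solves_ae_on J (\<lambda>_. 1) (\<lambda>t::real. t)"
  unfolding solves_ae_on_def
  by (auto intro!: abs_cont_on_lipschitz[of _ _ 1] has_vector_derivative_id always_eventually)

text \<open>Mean value inequality on a ball around \<open>K\<close>, since \<open>K\<close> need not
  be convex. Continuity of each directional derivative suffices, as the operator norm is at most the
  sum over a basis.\<close>

lemma lip_compact_C1:
  fixes G :: "'a::euclidean_space \<Rightarrow> 'b::euclidean_space"
  assumes der: "\<And>x. (G has_derivative G' x) (at x)"
    and cont: "\<And>d. continuous_on UNIV (\<lambda>x. G' x d)"
  shows "lip_compact UNIV G"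
  unfolding lip_compact_def
proof (intro allI impI)
  fix K :: "'a set" assume "compact K"
  then obtain r where "r > 0" and r: "K \<subseteq> cball 0 r"
    using compact_imp_bounded[of K] unfolding bounded_pos by (auto simp: subset_eq)
  have "continuous_on (cball 0 r) (\<lambda>x. \<Sum>b\<in>Basis. norm (G' x b))"
    by (intro continuous_intros continuous_on_subset[OF cont]) auto
  then have "compact ((\<lambda>x. \<Sum>b\<in>Basis. norm (G' x b)) ` cball 0 r)"
    by (rule compact_continuous_image) simp
  then have "bounded ((\<lambda>x. \<Sum>b\<in>Basis. norm (G' x b)) ` cball 0 r)"
    by (rule compact_imp_bounded)
  then obtain C where C: "\<And>x. x \<in> cball 0 r \<Longrightarrow> norm (\<Sum>b\<in>Basis. norm (G' x b)) \<le> C" and "C > 0"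
    unfolding bounded_pos by blast
  have on: "onorm (G' x) \<le> C" if "x \<in> cball 0 r" for x
  proof -
    have "onorm (G' x) \<le> (\<Sum>b\<in>Basis. norm (G' x b))"
      by (rule onorm_componentwise) (use der has_derivative_bounded_linear in blast)
    then show ?thesis using C[OF that] by simp
  qed
  have "C-lipschitz_on K G"
  proof (rule lipschitz_onI)
    fix x y assume "x \<in> K" "y \<in> K"
    then have "x \<in> cball 0 r" "y \<in> cball 0 r" using r by auto
    then have "norm (G x - G y) \<le> C * norm (x - y)"
      by (intro differentiable_bound[OF convex_cball[of 0 r] has_derivative_at_withinI[OF der] on]) auto
    then show "dist (G x) (G y) \<le> C * dist x y" by (simp add: dist_norm)
  qed (use \<open>C > 0\<close> in auto)
  then show "\<exists>C. C-lipschitz_on K G" by blast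
qed

section \<open>Scalar differential inequalities\<close>

lemma solves_scalar_le:
  fixes m :: "real \<Rightarrow> real"
  assumes "solves_ae_on J F m" "c \<le> d" "{c..d} \<subseteq> J" "AE t in lebesgue. t \<in> {c..d} \<longrightarrow> F t \<le> k"
  shows "m d \<le> m c + k * (d - c)"
proof -
  have "((\<lambda>_. k) has_integral k * (d - c)) {c..d}"
    using has_integral_const_real[of k c d] assms(2) by (simp add: mult.commute)
  from integral_le_AE[OF solves_ae_on_has_integral[OF assms(1,2,3)] this assms(4)] show ?thesis by simp
qed

text \<open>After the last time at which \<open>m\<close> is at most \<open>max (m c) B\<close>, it
  exceeds \<open>B\<close> and therefore cannot increase; hence it never gets above that value at
  all.\<close>

lemma solves_scalar_invariant:
  fixes m :: "real \<Rightarrow> real"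
  assumes s: "solves_ae_on J F m" and cd: "c \<le> d" "{c..d} \<subseteq> J"
    and der: "AE t in lebesgue. t \<in> {c..d} \<longrightarrow> B < m t \<longrightarrow> F t \<le> 0"
  shows "m d \<le> max (m c) B"
proof (rule ccontr)
  assume neg: "\<not> m d \<le> max (m c) B"
  define M where "M = max (m c) B"
  define S where "S = {c..d} \<inter> m -` {..M}"
  have "closed S"
    unfolding S_def by (rule continuous_closed_preimage[OF solves_ae_on_continuous_on[OF s cd(2)]]) auto
  moreover have "bounded S" by (rule bounded_subset[of "{c..d}"]) (auto simp: S_def)
  ultimately have "compact S" by (simp add: compact_eq_bounded_closed)
  moreover have "c \<in> S" using cd by (auto simp: S_def M_def)
  ultimately obtain q where q: "q \<in> S" "\<And>t. t \<in> S \<Longrightarrow> t \<le> q"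
    using compact_attains_sup[of S] by blast
  have qd: "q \<le> d" "c \<le> q" "m q \<le> M" using q by (auto simp: S_def)
  have "AE t in lebesgue. t \<in> {q..d} \<longrightarrow> F t \<le> 0"
    using der AE_lebesgue_neq[of q]
  proof eventually_elim
    case (elim t)
    show ?case
    proof
      assume t: "t \<in> {q..d}"
      then have "t \<notin> S" using q(2)[of t] elim by auto
      then have "B < m t" using t qd by (auto simp: S_def M_def)
      then show "F t \<le> 0" using elim t qd by auto
    qed
  qed
  note AE = this
  have "m d \<le> m q + 0 * (d - q)"
    by (rule solves_scalar_le[OF s qd(1) _ AE]) (use cd qd in auto)
  then show False using neg qd by (simp add: M_def)
qed

lemma solves_scalar_eventually_le:
  fixes m :: "real \<Rightarrow> real"
  assumes s: "solves_ae_on {c..} F m" and k: "k > 0"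
    and der: "AE t in lebesgue. t \<ge> c \<longrightarrow> B \<le> m t \<longrightarrow> F t \<le> - k"
  obtains t1 where "t1 \<ge> c" "\<And>t. t \<ge> t1 \<Longrightarrow> m t \<le> B"
proof -
  have "\<exists>t1\<ge>c. m t1 \<le> B"
  proof (rule ccontr)
    assume "\<not> (\<exists>t1\<ge>c. m t1 \<le> B)"
    then have gt: "m t > B" if "t \<ge> c" for t using that by (meson not_le)
    \<comment> \<open>Decrease at rate at least \<open>k\<close> uses up the excess
      \<open>m c - B\<close> by this time.\<close>
    define d where "d = c + (m c - B) / k"
    have "d \<ge> c" using gt[of c] k by (simp add: d_def)
    have "m d \<le> m c + (- k) * (d - c)"
      by (rule solves_scalar_le[OF s \<open>d \<ge> c\<close>])
        (use der gt in \<open>auto elim!: eventually_mono simp: less_imp_le\<close>)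
    then have "m d \<le> B" using k by (simp add: d_def)
    then show False using gt[OF \<open>d \<ge> c\<close>] by simp
  qed
  then obtain t1 where t1: "t1 \<ge> c" "m t1 \<le> B" by blast
  have "m t \<le> B" if "t \<ge> t1" for t
  proof -
    have "m t \<le> max (m t1) B"
      by (rule solves_scalar_invariant[OF s that])
        (use t1 der k in \<open>auto elim!: eventually_mono\<close>)
    then show ?thesis using t1 by simp
  qed
  then show ?thesis using that t1 by blast
qed

text \<open>\<open>\<beta> / (k - \<nu>)\<close> is the level above which the derivative of
  \<open>exp (\<nu> * t) * m t\<close> is nonpositive, so \<open>solves_scalar_invariant\<close>
  applies. The maximum in the conclusion, instead of a sum, keeps the initial value apart from the
  gain in the small-gain argument.\<close>

lemma solves_scalar_exp:
  fixes m :: "real \<Rightarrow> real"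
  assumes s: "solves_ae_on J F m" and cd: "c \<le> d" "{c..d} \<subseteq> J" and "\<nu> < k"
    and der: "AE t in lebesgue. t \<in> {c..d} \<longrightarrow> F t \<le> - k * m t + \<beta> * exp (- \<nu> * t)"
  shows "exp (\<nu> * d) * m d \<le> max (exp (\<nu> * c) * m c) (\<beta> / (k - \<nu>))"
proof -
  define G where "G = (\<lambda>(t::real, m::real). exp (\<nu> * t) * m)"
  define G' where "G' = (\<lambda>(t::real, m::real) (dt::real, dm::real). exp (\<nu> * t) * dm + (\<nu> * dt * exp (\<nu> * t)) * m)"
  have G': "(G has_derivative G' x) (at x)" for x
    unfolding G_def G'_def case_prod_unfold by (auto intro!: derivative_eq_intros)
  have "lip_compact UNIV G"
    by (rule lip_compact_C1[OF G']) (auto simp: G'_def case_prod_unfold intro!: continuous_intros)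
  from solves_ae_on_compose[OF solves_ae_on_Pair[OF solves_ae_on_id s] this G']
  have "solves_ae_on J (\<lambda>t. G' (t, m t) (1, F t)) (\<lambda>t. G (t, m t))" .
  then have "G (d, m d) \<le> max (G (c, m c)) (\<beta> / (k - \<nu>))"
  proof (rule solves_scalar_invariant[OF _ cd])
    show "AE t in lebesgue. t \<in> {c..d} \<longrightarrow> \<beta> / (k - \<nu>) < G (t, m t) \<longrightarrow> G' (t, m t) (1, F t) \<le> 0"
      using der
    proof eventually_elim
      case (elim t)
      show ?case
      proof (intro impI)
        assume t: "t \<in> {c..d}" and "\<beta> / (k - \<nu>) < G (t, m t)"
        then have b: "\<beta> < (k - \<nu>) * (exp (\<nu> * t) * m t)" using \<open>\<nu> < k\<close> by (simp add: G_def field_simps)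
        have "G' (t, m t) (1, F t) = exp (\<nu> * t) * F t + \<nu> * (exp (\<nu> * t) * m t)" by (simp add: G'_def)
        also have "\<dots> \<le> exp (\<nu> * t) * (- k * m t + \<beta> * exp (- \<nu> * t)) + \<nu> * (exp (\<nu> * t) * m t)"
          using elim t by (intro add_right_mono mult_left_mono) auto
        also have "\<dots> = \<beta> * (exp (\<nu> * t) * exp (- \<nu> * t)) - (k - \<nu>) * (exp (\<nu> * t) * m t)" by (simp add: algebra_simps)
        also have "exp (\<nu> * t) * exp (- \<nu> * t) = 1" by (simp add: exp_minus_inverse)
        finally show "G' (t, m t) (1, F t) \<le> 0" using b by simp
      qed
    qed
  qed
  then show ?thesis by (simp add: G_def)
qed

section \<open>Functions that are Lipschitz on compact sets\<close>

lemma lip_compactD: "lip_compact S f \<Longrightarrow> compact K \<Longrightarrow> K \<subseteq> S \<Longrightarrow> \<exists>C. C-lipschitz_on K f"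
  unfolding lip_compact_def by blast

lemma lip_compactI: "(\<And>K. compact K \<Longrightarrow> K \<subseteq> S \<Longrightarrow> \<exists>C. C-lipschitz_on K f) \<Longrightarrow> lip_compact S f"
  unfolding lip_compact_def by blast

lemma lip_compact_normE:
  assumes "lip_compact S (f :: 'a::real_normed_vector \<Rightarrow> 'b::real_normed_vector)" "compact K" "K \<subseteq> S"
  obtains C where "C \<ge> 0" "\<And>x y. x \<in> K \<Longrightarrow> y \<in> K \<Longrightarrow> norm (f x - f y) \<le> C * norm (x - y)"
proof -
  obtain C where C: "C-lipschitz_on K f" using lip_compactD[OF assms] by blast
  show ?thesis
    by (rule that[of C]) (use lipschitz_on_nonneg[OF C] lipschitz_onD[OF C] in \<open>auto simp: dist_norm\<close>)
qed

lemma lip_compact_normI: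
  fixes f :: "'a::real_normed_vector \<Rightarrow> 'b::real_normed_vector"
  assumes "\<And>K. compact K \<Longrightarrow> K \<subseteq> S \<Longrightarrow> \<exists>C. \<forall>x\<in>K. \<forall>y\<in>K. norm (f x - f y) \<le> C * norm (x - y)"
  shows "lip_compact S f"
proof (rule lip_compactI)
  fix K assume "compact K" "K \<subseteq> S"
  then have "\<exists>C. \<forall>x\<in>K. \<forall>y\<in>K. norm (f x - f y) \<le> C * norm (x - y)" by (rule assms)
  then obtain C where C: "\<And>x y. x \<in> K \<Longrightarrow> y \<in> K \<Longrightarrow> norm (f x - f y) \<le> C * norm (x - y)"
    by blast
  have "\<bar>C\<bar>-lipschitz_on K f"
  proof (rule lipschitz_onI)
    fix x y assume "x \<in> K" "y \<in> K"
    then have "norm (f x - f y) \<le> C * norm (x - y)" by (rule C)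
    also have "\<dots> \<le> \<bar>C\<bar> * norm (x - y)" by (rule mult_right_mono) auto
    finally show "dist (f x) (f y) \<le> \<bar>C\<bar> * dist x y" by (simp add: dist_norm)
  qed simp
  then show "\<exists>C. C-lipschitz_on K f" by blast
qed

lemma lip_compact_subset: "lip_compact S f \<Longrightarrow> T \<subseteq> S \<Longrightarrow> lip_compact T f"
  unfolding lip_compact_def by (meson order_trans)

lemma lip_compact_cong: "lip_compact S f \<Longrightarrow> (\<And>x. x \<in> S \<Longrightarrow> f x = g x) \<Longrightarrow> lip_compact S g"
  unfolding lip_compact_def by (metis lipschitz_on_transform subsetD)

lemma lip_compact_const: "lip_compact S (\<lambda>_. c)"
  unfolding lip_compact_def using lipschitz_on_constant by blast

lemma lip_compact_bounded_linear:
  assumes "bounded_linear f" shows "lip_compact S f"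
proof (rule lip_compact_normI)
  obtain C where "\<And>x. norm (f x) \<le> norm x * C" using bounded_linear.bounded[OF assms] by blast
  then have "norm (f x - f y) \<le> C * norm (x - y)" for x y
    using bounded_linear.linear[OF assms] by (metis linear_diff mult.commute)
  then show "\<exists>C. \<forall>x\<in>K. \<forall>y\<in>K. norm (f x - f y) \<le> C * norm (x - y)" for K by blast
qed

lemma lip_compact_compose:
  assumes f: "lip_compact S f" and g: "lip_compact T g" and "f ` S \<subseteq> T"
  shows "lip_compact S (\<lambda>x. g (f x))"
proof (rule lip_compactI)
  fix K assume K: "compact K" "K \<subseteq> S"
  obtain C where C: "C-lipschitz_on K f" using lip_compactD[OF f K] by blast
  have "compact (f ` K)" using compact_continuous_image[OF lipschitz_on_continuous_on[OF C] K(1)] .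
  moreover have "f ` K \<subseteq> T" using K assms(3) by blast
  ultimately obtain D where D: "D-lipschitz_on (f ` K) g" using lip_compactD[OF g] by blast
  show "\<exists>C. C-lipschitz_on K (\<lambda>x. g (f x))"
    using lipschitz_on_compose2[OF C D] by blast
qed

lemma lip_compact_compose_UNIV:
  "lip_compact UNIV g \<Longrightarrow> lip_compact S f \<Longrightarrow> lip_compact S (\<lambda>x. g (f x))"
  by (rule lip_compact_compose) auto

lemma lip_compact_Pair:
  assumes "lip_compact S f" "lip_compact S g" shows "lip_compact S (\<lambda>x. (f x, g x))"
proof (rule lip_compactI)
  fix K assume K: "compact K" "K \<subseteq> S"
  obtain C D where "C-lipschitz_on K f" "D-lipschitz_on K g"
    using lip_compactD[OF assms(1) K] lip_compactD[OF assms(2) K] by blast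
  from lipschitz_on_Pair[OF this] show "\<exists>C. C-lipschitz_on K (\<lambda>x. (f x, g x))" by blast
qed

lemma lip_compact_add:
  fixes f g :: "'a::real_normed_vector \<Rightarrow> 'b::real_normed_vector"
  assumes "lip_compact S f" "lip_compact S g" shows "lip_compact S (\<lambda>x. f x + g x)"
proof (rule lip_compactI)
  fix K assume K: "compact K" "K \<subseteq> S"
  obtain C D where "C-lipschitz_on K f" "D-lipschitz_on K g"
    using lip_compactD[OF assms(1) K] lip_compactD[OF assms(2) K] by blast
  from lipschitz_on_add[OF this] show "\<exists>C. C-lipschitz_on K (\<lambda>x. f x + g x)" by blast
qed

lemma lip_compact_minus:
  fixes f g :: "'a::real_normed_vector \<Rightarrow> 'b::real_normed_vector"
  assumes "lip_compact S f" "lip_compact S g" shows "lip_compact S (\<lambda>x. f x - g x)"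
proof (rule lip_compactI)
  fix K assume K: "compact K" "K \<subseteq> S"
  obtain C D where "C-lipschitz_on K f" "D-lipschitz_on K g"
    using lip_compactD[OF assms(1) K] lip_compactD[OF assms(2) K] by blast
  from lipschitz_on_diff[OF this] show "\<exists>C. C-lipschitz_on K (\<lambda>x. f x - g x)" by blast
qed

lemma lip_compact_sum:
  fixes f :: "'i \<Rightarrow> 'a::real_normed_vector \<Rightarrow> 'b::real_normed_vector"
  assumes "\<And>i. i \<in> I \<Longrightarrow> lip_compact S (f i)" shows "lip_compact S (\<lambda>x. \<Sum>i\<in>I. f i x)"
  using assms by (induction I rule: infinite_finite_induct) (auto intro: lip_compact_const lip_compact_add)

lemma lip_compact_image_bounded:
  fixes f :: "'a::real_normed_vector \<Rightarrow> 'b::real_normed_vector"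
  assumes "lip_compact S f" "compact K" "K \<subseteq> S"
  obtains B where "B > 0" "\<And>x. x \<in> K \<Longrightarrow> norm (f x) \<le> B"
proof -
  obtain C where C: "C-lipschitz_on K f" using lip_compactD[OF assms] by blast
  have "bounded (f ` K)"
    by (intro compact_imp_bounded compact_continuous_image[OF lipschitz_on_continuous_on[OF C] assms(2)])
  then show ?thesis using that unfolding bounded_pos by blast
qed

lemma lip_compact_bilinear:
  fixes f :: "'a::real_normed_vector \<Rightarrow> 'b::real_normed_vector" and g :: "'a \<Rightarrow> 'c::real_normed_vector"
    and prod :: "'b \<Rightarrow> 'c \<Rightarrow> 'd::real_normed_vector"
  assumes bb: "bounded_bilinear prod" and f: "lip_compact S f" and g: "lip_compact S g"
  shows "lip_compact S (\<lambda>x. prod (f x) (g x))"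
proof (rule lip_compact_normI)
  fix K assume K: "compact K" "K \<subseteq> S"
  interpret bounded_bilinear prod by fact
  obtain Bf where Bf: "Bf > 0" "\<And>x. x \<in> K \<Longrightarrow> norm (f x) \<le> Bf" using lip_compact_image_bounded[OF f K] by blast
  obtain Bg where Bg: "Bg > 0" "\<And>x. x \<in> K \<Longrightarrow> norm (g x) \<le> Bg" using lip_compact_image_bounded[OF g K] by blast
  obtain Cf where Cf: "Cf \<ge> 0" "\<And>x y. x \<in> K \<Longrightarrow> y \<in> K \<Longrightarrow> norm (f x - f y) \<le> Cf * norm (x - y)"
    using lip_compact_normE[OF f K] by blast
  obtain Cg where Cg: "Cg \<ge> 0" "\<And>x y. x \<in> K \<Longrightarrow> y \<in> K \<Longrightarrow> norm (g x - g y) \<le> Cg * norm (x - y)"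
    using lip_compact_normE[OF g K] by blast
  obtain B where B: "B \<ge> 0" "\<And>a b. norm (prod a b) \<le> norm a * norm b * B" using nonneg_bounded by blast
  show "\<exists>C. \<forall>x\<in>K. \<forall>y\<in>K. norm (prod (f x) (g x) - prod (f y) (g y)) \<le> C * norm (x - y)"
  proof (intro exI ballI)
    fix x y assume xy: "x \<in> K" "y \<in> K"
    have "prod (f x) (g x) - prod (f y) (g y) = prod (f x) (g x - g y) + prod (f x - f y) (g y)"
      by (simp add: diff_left diff_right)
    also have "norm \<dots> \<le> norm (prod (f x) (g x - g y)) + norm (prod (f x - f y) (g y))"
      by (rule norm_triangle_ineq)
    also have "norm (prod (f x) (g x - g y)) \<le> norm (f x) * norm (g x - g y) * B" by (rule B)
    also have "\<dots> \<le> Bf * (Cg * norm (x - y)) * B"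
      using xy Bf Cg B by (intro mult_mono mult_right_mono) auto
    also have "norm (prod (f x - f y) (g y)) \<le> norm (f x - f y) * norm (g y) * B" by (rule B)
    also have "\<dots> \<le> (Cf * norm (x - y)) * Bg * B"
      using xy Bg Cf B by (intro mult_mono mult_right_mono) auto
    finally show "norm (prod (f x) (g x) - prod (f y) (g y)) \<le> (Bf * Cg * B + Cf * Bg * B) * norm (x - y)"
      by (simp add: algebra_simps)
  qed
qed

lemmas lip_compact_scaleR = lip_compact_bilinear[OF bounded_bilinear_scaleR]
lemmas lip_compact_mult = lip_compact_bilinear[OF bounded_bilinear_mult]
lemmas lip_compact_inner = lip_compact_bilinear[OF bounded_bilinear_inner]

lemma lip_compact_fst: "lip_compact S (fst :: 'a::real_normed_vector \<times> 'b::real_normed_vector \<Rightarrow> 'a)"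
  by (rule lip_compact_bounded_linear[OF bounded_linear_fst])

lemma lip_compact_snd: "lip_compact S (snd :: 'a::real_normed_vector \<times> 'b::real_normed_vector \<Rightarrow> 'b)"
  by (rule lip_compact_bounded_linear[OF bounded_linear_snd])

lemma lip_compact_ident: "lip_compact S (\<lambda>x. x)"
  unfolding lip_compact_def using lipschitz_on_id by (metis (no_types, lifting) id_def lipschitz_on_transform lipschitz_intros(1))

lemma lip_compact_norm: "lip_compact S (norm :: 'a::real_normed_vector \<Rightarrow> real)"
  by (rule lip_compact_normI, rule exI[of _ 1]) (simp add: norm_triangle_ineq3)

lemma lip_compact_max0: "lip_compact S (\<lambda>x::real. max 0 x)"
  by (rule lip_compact_normI, rule exI[of _ 1]) auto

lemma lip_compact_inverse: "lip_compact {c..} (inverse :: real \<Rightarrow> real)" if "c > 0"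
proof (rule lip_compact_normI)
  fix K :: "real set" assume "K \<subseteq> {c..}"
  show "\<exists>C. \<forall>x\<in>K. \<forall>y\<in>K. norm (inverse x - inverse y) \<le> C * norm (x - y)"
  proof (intro exI[of _ "inverse c * inverse c"] ballI)
    fix x y assume "x \<in> K" "y \<in> K"
    then have "c \<le> x" "c \<le> y" using \<open>K \<subseteq> {c..}\<close> by auto
    then have p: "0 < x" "0 < y" "inverse x \<le> inverse c" "inverse y \<le> inverse c" using that by auto
    have "\<bar>inverse x - inverse y\<bar> = (inverse x * inverse y) * \<bar>x - y\<bar>"
      using p by (simp add: field_simps abs_mult abs_divide abs_minus_commute)
    also have "\<dots> \<le> (inverse c * inverse c) * \<bar>x - y\<bar>"
      using p that by (intro mult_right_mono mult_mono) auto
    finally show "norm (inverse x - inverse y) \<le> inverse c * inverse c * norm (x - y)" by simp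
  qed
qed

lemma lip_compact_vec:
  fixes f :: "'a::real_normed_vector \<Rightarrow> real^'n::finite"
  assumes "\<And>i. lip_compact S (\<lambda>x. f x $ i)" shows "lip_compact S f"
proof -
  have "lip_compact S (\<lambda>x. \<Sum>i\<in>UNIV. (f x $ i) *\<^sub>R (axis i 1 :: real^'n))"
    by (intro lip_compact_sum lip_compact_scaleR lip_compact_const assms)
  moreover have "(\<Sum>i\<in>UNIV. (f x $ i) *\<^sub>R (axis i 1 :: real^'n)) = f x" for x
    using basis_expansion[of "f x"] by (simp add: scalar_mult_eq_scaleR)
  ultimately show ?thesis by simp
qed

text \<open>Closedness makes \<open>S \<inter> cball x 1\<close> compact, and continuity at
  \<open>x\<close> is decided there.\<close>

lemma lip_compact_continuous_on:
  fixes f :: "'a::euclidean_space \<Rightarrow> 'b::metric_space"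
  assumes f: "lip_compact S f" and S: "closed S"
  shows "continuous_on S f"
proof (rule continuous_on_eq_continuous_within[THEN iffD2, rule_format])
  fix x assume "x \<in> S"
  have "compact (S \<inter> cball x 1)" using S by (simp add: closed_Int_compact)
  then obtain C where "C-lipschitz_on (S \<inter> cball x 1) f" using lip_compactD[OF f] by blast
  then have "continuous_on (S \<inter> cball x 1) f" by (rule lipschitz_on_continuous_on)
  then have "continuous (at x within S \<inter> cball x 1) f"
    using \<open>x \<in> S\<close> by (simp add: continuous_on_eq_continuous_within)
  moreover have "at x within S \<inter> cball x 1 = at x within S"
    by (rule at_within_nhd[of x "ball x 1"]) auto
  ultimately show "continuous (at x within S) f" by simp
qed

text \<open>With the one-point time set \<open>{0}\<close> the condition becomes
  \<open>local_lipschitz\<close>, whose compactness theorem supplies the constant.\<close>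

lemma locally_lipschitz_on_imp_lip_compact:
  assumes "locally_lipschitz_on S f" shows "lip_compact S f"
proof (rule lip_compactI)
  fix K assume K: "compact K" "K \<subseteq> S"
  have "local_lipschitz {0::real} K (\<lambda>_. f)"
    unfolding local_lipschitz_def
  proof (intro ballI)
    fix x and t :: real assume "x \<in> K" "t \<in> {0}"
    then obtain e C where "e > 0" "C-lipschitz_on (cball x e \<inter> S) f"
      using assms K unfolding locally_lipschitz_on_def by blast
    then have "C-lipschitz_on (cball x e \<inter> K) f" using K by (auto intro: lipschitz_on_subset)
    then show "\<exists>u>0. \<exists>L. \<forall>t\<in>cball t u \<inter> {0}. L-lipschitz_on (cball x u \<inter> K) f"
      using \<open>e > 0\<close> by blast
  qed
  from local_lipschitz_compact_implies_lipschitz[OF this K(1)]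
  show "\<exists>C. C-lipschitz_on K f" by auto
qed

section \<open>Class C_k, gradients and Jacobians\<close>

lemma C_k_Suc_imp: "C_k (Suc k) f \<Longrightarrow> C_k k f"
proof (induction k arbitrary: f)
  case 0
  then show ?case
    by (auto intro!: differentiable_imp_continuous_on simp: differentiable_on_def differentiable_at_withinI)
next
  case (Suc k)
  then show ?case by (metis C_k.simps(2))
qed

lemma C_k_1_has_derivative:
  assumes "C_k (Suc k) f"
  shows "(f has_derivative frechet_derivative f (at x)) (at x)"
  using assms by (auto simp: frechet_derivative_works[symmetric])

lemma C_k_le: "C_k m f \<Longrightarrow> k \<le> m \<Longrightarrow> C_k k f"
  by (induction m) (auto simp: le_Suc_eq C_k_Suc_imp simp del: C_k.simps)

lemma C_k_1_lip_compact:
  fixes f :: "'a::euclidean_space \<Rightarrow> 'b::euclidean_space"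
  assumes "C_k (Suc k) f" shows "lip_compact S f"
proof -
  have "C_k (Suc 0) f" by (rule C_k_le[OF assms]) simp
  then have "lip_compact UNIV f"
    by (intro lip_compact_C1[OF C_k_1_has_derivative[OF assms]]) simp
  then show ?thesis by (rule lip_compact_subset) simp
qed

lemma smooth_lip_compact: "smooth f \<Longrightarrow> lip_compact S f"
  unfolding smooth_def using C_k_1_lip_compact by blast

lemma C_k_2_frechet:
  assumes "C_k (Suc (Suc k)) f"
  shows "C_k (Suc k) (\<lambda>x. frechet_derivative f (at x) d)"
  using assms by simp

lemma grad_inner:
  assumes "V differentiable (at x)"
  shows "grad V x \<bullet> d = frechet_derivative V (at x) d"
proof -
  have lin: "linear (frechet_derivative V (at x))"
    using assms linear_frechet_derivative by blast
  have "frechet_derivative V (at x) d = frechet_derivative V (at x) (\<Sum>i\<in>UNIV. (d $ i) *\<^sub>R axis i 1)"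
    using basis_expansion[of d] by (simp add: scalar_mult_eq_scaleR)
  also have "\<dots> = (\<Sum>i\<in>UNIV. (d $ i) * frechet_derivative V (at x) (axis i 1))"
    by (simp add: linear_sum[OF lin] linear_cmul[OF lin])
  finally show ?thesis by (simp add: grad_def inner_vec_def mult.commute)
qed

lemma grad_has_derivative:
  assumes "C_k (Suc k) V" shows "(V has_derivative (\<lambda>d. grad V x \<bullet> d)) (at x)"
proof -
  have "V differentiable (at x)" using assms by simp
  then show ?thesis using C_k_1_has_derivative[OF assms, of x] grad_inner by (metis (no_types, lifting) ext)
qed

lemma lip_compact_grad:
  assumes "C_k (Suc (Suc k)) V" shows "lip_compact S (grad V)"
proof (rule lip_compact_vec)
  fix i
  show "lip_compact S (\<lambda>x. grad V x $ i)"
    using C_k_1_lip_compact[OF C_k_2_frechet[OF assms]] by (simp add: grad_def)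
qed

lemma jacobian_frechet:
  fixes h :: "real^'n::finite \<Rightarrow> real^'k::finite"
  assumes "h differentiable (at x)"
  shows "jacobian h (at x) *v d = frechet_derivative h (at x) d"
proof -
  have "(h has_derivative (\<lambda>d. jacobian h (at x) *v d)) (at x)"
    using assms by (rule jacobian_works[THEN iffD1])
  from frechet_derivative_at[OF this] show ?thesis by metis
qed

text \<open>Expanding the vector in the standard basis leaves finitely many partial derivatives of
  \<open>h\<close>, each continuously differentiable.\<close>

lemma lip_compact_jacobian:
  fixes h :: "real^'n::finite \<Rightarrow> real^'k::finite" and f :: "'a::euclidean_space \<Rightarrow> real^'n"
  assumes h: "C_k (Suc (Suc k)) h" and g: "lip_compact S g" and f: "lip_compact S f"
  shows "lip_compact S (\<lambda>x. jacobian h (at (g x)) *v f x)"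
proof -
  have "lip_compact S (\<lambda>x. \<Sum>i\<in>UNIV. (f x $ i) *\<^sub>R frechet_derivative h (at (g x)) (axis i 1))"
    by (intro lip_compact_sum lip_compact_scaleR lip_compact_compose_UNIV[OF C_k_1_lip_compact[OF C_k_2_frechet[OF h]] g]
      lip_compact_compose_UNIV[OF lip_compact_bounded_linear[OF bounded_linear_vec_nth] f])
  moreover have "(\<Sum>i\<in>UNIV. (f x $ i) *\<^sub>R frechet_derivative h (at (g x)) (axis i 1)) = jacobian h (at (g x)) *v f x" for x
  proof -
    have d: "h differentiable (at (g x))" using h by simp
    have lin: "linear (frechet_derivative h (at (g x)))" using d linear_frechet_derivative by blast
    have "frechet_derivative h (at (g x)) (f x) = frechet_derivative h (at (g x)) (\<Sum>i\<in>UNIV. (f x $ i) *\<^sub>R axis i 1)"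
      using basis_expansion[of "f x"] by (simp add: scalar_mult_eq_scaleR)
    also have "\<dots> = (\<Sum>i\<in>UNIV. (f x $ i) *\<^sub>R frechet_derivative h (at (g x)) (axis i 1))"
      by (simp add: linear_sum[OF lin] linear_cmul[OF lin])
    finally show ?thesis using jacobian_frechet[OF d] by simp
  qed
  ultimately show ?thesis by simp
qed

text \<open>The norm is not differentiable at 0, so the argument composes Lipschitz functions
  instead of taking derivatives; \<open>psi1\<close> keeps the denominator away from zero.\<close>

lemma lip_compact_saturation:
  fixes \<psi> :: "'a::euclidean_space \<Rightarrow> real"
  assumes q: "C_k (Suc k) q" and psi: "lip_compact UNIV \<psi>" and psi1: "\<And>z. \<psi> z \<ge> 1"
  shows "lip_compact UNIV (\<lambda>(z, \<xi> :: 'b::euclidean_space). q (norm \<xi> / \<psi> z) *\<^sub>R \<xi>)"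
proof -
  have "lip_compact UNIV (\<lambda>x::'a \<times> 'b. inverse (\<psi> (fst x)))"
    by (rule lip_compact_compose[OF lip_compact_compose_UNIV[OF psi lip_compact_fst] lip_compact_inverse[of 1]])
      (use psi1 in auto)
  then have "lip_compact UNIV (\<lambda>x::'a \<times> 'b. q (norm (snd x) * inverse (\<psi> (fst x))) *\<^sub>R snd x)"
    by (intro lip_compact_scaleR lip_compact_snd lip_compact_compose_UNIV[OF C_k_1_lip_compact[OF q]]
      lip_compact_mult lip_compact_compose_UNIV[OF lip_compact_norm lip_compact_snd])
  then show ?thesis by (simp add: case_prod_unfold divide_inverse)
qed

text \<open>A function vanishing on the interface \<open>V = R\<close> is extended by zero; a segment joining the two
  sides crosses the interface, so the Lipschitz constant survives.\<close>

lemma lip_compact_extend_zero: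
  fixes m :: "'a::euclidean_space \<times> 'b::euclidean_space \<Rightarrow> 'c::euclidean_space" and V :: "'a \<Rightarrow> real"
  assumes cont: "continuous_on UNIV V" and U: "closed U"
    and m: "lip_compact ({z. V z \<ge> R} \<times> U) m"
    and zero: "\<And>z u. V z = R \<Longrightarrow> u \<in> U \<Longrightarrow> m (z, u) = 0"
  shows "lip_compact (UNIV \<times> U) (\<lambda>(z, u). if V z \<le> R then 0 else m (z, u))"
proof (rule lip_compact_normI)
  fix K :: "('a \<times> 'b) set" assume K: "compact K" "K \<subseteq> UNIV \<times> U"
  then obtain r where "r > 0" and r: "\<And>x. x \<in> K \<Longrightarrow> norm x \<le> r"
    using compact_imp_bounded[of K] unfolding bounded_pos by blast
  define D where "D = ({z. V z \<ge> R} \<inter> cball 0 r) \<times> (U \<inter> cball 0 r)"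
  have "compact D"
    unfolding D_def
    by (intro compact_Times closed_Int_compact closed_Collect_le continuous_intros cont U) auto
  moreover have "D \<subseteq> {z. V z \<ge> R} \<times> U" by (auto simp: D_def)
  ultimately obtain C where C: "C \<ge> 0" "\<And>x y. x \<in> D \<Longrightarrow> y \<in> D \<Longrightarrow> norm (m x - m y) \<le> C * norm (x - y)"
    using lip_compact_normE[OF m] by blast
  have KD: "norm z \<le> r \<and> norm u \<le> r \<and> u \<in> U" if "(z, u) \<in> K" for z u
    using r[OF that] norm_fst_le[of z u] norm_snd_le[of u z] K that by fastforce
  define M where "M = (\<lambda>(z, u). if V z \<le> R then 0 else m (z, u))"
  have cross: "norm (M (z1, u1) - M (z2, u2)) \<le> C * norm ((z1, u1) - (z2, u2))"
    if z: "(z1, u1) \<in> K" "(z2, u2) \<in> K" and V: "V z1 > R" "V z2 \<le> R" for z1 u1 z2 u2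
  proof -
    have "\<exists>z3\<in>closed_segment z2 z1. V z3 = R"
    proof -
      have "connected (V ` closed_segment z2 z1)"
        by (intro connected_continuous_image continuous_on_subset[OF cont]) auto
      then have "R \<in> V ` closed_segment z2 z1"
        using V unfolding connected_iff_interval by (meson ends_in_segment image_eqI less_imp_le)
      then show ?thesis by blast
    qed
    then obtain z3 where z3: "z3 \<in> closed_segment z1 z2" "V z3 = R" by (metis closed_segment_commute)
    have "z3 \<in> cball 0 r"
      using z3 closed_segment_subset[of z1 "cball 0 r" z2] KD[OF z(1)] KD[OF z(2)] by auto
    \<comment> \<open>Only the first component moves to the interface; the second stays
      \<open>u1\<close>, so \<open>U\<close> needs no convexity.\<close>
    then have d3: "(z3, u1) \<in> D" using z3 KD[OF z(1)] by (auto simp: D_def)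
    have d1: "(z1, u1) \<in> D" using V KD[OF z(1)] by (auto simp: D_def)
    have "M (z1, u1) - M (z2, u2) = m (z1, u1) - m (z3, u1)"
      using V zero[of z3 u1] z3 KD[OF z(1)] by (simp add: M_def)
    also have "norm \<dots> \<le> C * norm ((z1, u1) - (z3, u1))" using C(2)[OF d1 d3] .
    also have "norm ((z1, u1) - (z3, u1)) = norm (z1 - z3)" by (simp add: norm_Pair)
    also have "\<dots> \<le> norm (z1 - z2)"
      using segment_bound(1)[OF z3(1)] by (simp add: norm_minus_commute)
    also have "\<dots> \<le> norm ((z1, u1) - (z2, u2))" using norm_fst_le[of "z1 - z2" "u1 - u2"] by simp
    finally show ?thesis using C(1) by (simp add: mult_left_mono)
  qed
  have "norm (M x - M y) \<le> C * norm (x - y)" if xy: "x \<in> K" "y \<in> K" for x y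
  proof -
    obtain z1 u1 z2 u2 where eq: "x = (z1, u1)" "y = (z2, u2)" by (metis surj_pair)
    consider "V z1 \<le> R" "V z2 \<le> R" | "V z1 > R" "V z2 \<le> R" | "V z1 \<le> R" "V z2 > R" | "V z1 > R" "V z2 > R" by linarith
    then show ?thesis
    proof cases
      case 1 then show ?thesis using C(1) by (simp add: M_def eq)
    next
      case 2 then show ?thesis using cross[of z1 u1 z2 u2] xy eq by simp
    next
      case 3 then show ?thesis using cross[of z2 u2 z1 u1] xy eq by (metis norm_minus_commute)
    next
      case 4
      then have "x \<in> D" "y \<in> D" using KD xy eq by (auto simp: D_def)
      from C(2)[OF this] show ?thesis using 4 by (simp add: M_def eq)
    qed
  qed
  then show "\<exists>C. \<forall>x\<in>K. \<forall>y\<in>K. norm ((case x of (z, u) \<Rightarrow> if V z \<le> R then 0 else m (z, u)) -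
      (case y of (z, u) \<Rightarrow> if V z \<le> R then 0 else m (z, u))) \<le> C * norm (x - y)"
    unfolding M_def by blast
qed

section \<open>Essentially bounded functions\<close>

lemma Linf_on_iff:
  assumes "S \<in> sets lebesgue"
  shows "Linf_on S v \<longleftrightarrow> (\<lambda>t. if t \<in> S then v t else 0) \<in> borel_measurable lebesgue \<and>
    (\<exists>C. AE t in lebesgue. t \<in> S \<longrightarrow> norm (v t) \<le> C)"
  unfolding Linf_on_def AE_lebesgue_on_iff[OF assms] using borel_measurable_if[OF assms] by blast

lemma Linf_onE:
  assumes "Linf_on S v" "S \<in> sets lebesgue"
  obtains C where "C \<ge> 0" "AE t in lebesgue. t \<in> S \<longrightarrow> norm (v t) \<le> C"
proof -
  obtain C where C: "AE t in lebesgue. t \<in> S \<longrightarrow> norm (v t) \<le> C" using assms by (auto simp: Linf_on_iff)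
  have "AE t in lebesgue. t \<in> S \<longrightarrow> norm (v t) \<le> max C 0" using C by eventually_elim auto
  then show ?thesis using that[of "max C 0"] by auto
qed

lemma Linf_on_measurable: "Linf_on S v \<Longrightarrow> v \<in> borel_measurable (lebesgue_on S)"
  by (simp add: Linf_on_def)

lemma Linf_on_subset:
  assumes "Linf_on S v" "T \<subseteq> S" "S \<in> sets lebesgue" "T \<in> sets lebesgue" shows "Linf_on T v"
proof -
  obtain C where C: "AE t in lebesgue. t \<in> S \<longrightarrow> norm (v t) \<le> C" using Linf_onE assms by metis
  have "AE t in lebesgue. t \<in> T \<longrightarrow> norm (v t) \<le> C" using C by eventually_elim (use assms in auto)
  moreover have "v \<in> borel_measurable (lebesgue_on T)"
    using measurable_restrict_mono[OF Linf_on_measurable[OF assms(1)] assms(2)] .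
  ultimately show ?thesis unfolding Linf_on_def AE_lebesgue_on_iff[OF assms(4)] by blast
qed

lemma Linf_on_cong:
  assumes "Linf_on S v" "\<And>t. t \<in> S \<Longrightarrow> v t = w t" "S \<in> sets lebesgue" shows "Linf_on S w"
proof -
  have "(\<lambda>t. if t \<in> S then w t else 0) = (\<lambda>t. if t \<in> S then v t else 0)" using assms(2) by auto
  moreover have "(t \<in> S \<longrightarrow> norm (w t) \<le> C) = (t \<in> S \<longrightarrow> norm (v t) \<le> C)" for t C using assms(2) by auto
  ultimately show ?thesis using assms(1) unfolding Linf_on_iff[OF assms(3)] by presburger
qed

lemma Linf_on_continuous:
  assumes "continuous_on {a..b} v" shows "Linf_on {a..b} v"
proof -
  have "v \<in> borel_measurable (lebesgue_on {a..b})"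
    by (rule continuous_imp_measurable_on_sets_lebesgue[OF assms]) simp
  moreover obtain M where "\<forall>s\<in>{a..b}. norm (v s) \<le> M"
    using continuous_on_interval_bounded[OF assms] by blast
  ultimately show ?thesis unfolding Linf_on_def
    by (auto simp: AE_lebesgue_on_iff intro!: exI[of _ M] always_eventually)
qed

lemma Linf_on_Un:
  assumes "Linf_on S v" "Linf_on T v" "S \<in> sets lebesgue" "T \<in> sets lebesgue" shows "Linf_on (S \<union> T) v"
proof -
  have ST: "S \<union> T \<in> sets lebesgue" using assms by auto
  obtain C1 where C1: "AE t in lebesgue. t \<in> S \<longrightarrow> norm (v t) \<le> C1" using Linf_onE[OF assms(1,3)] by metis
  obtain C2 where C2: "AE t in lebesgue. t \<in> T \<longrightarrow> norm (v t) \<le> C2" using Linf_onE[OF assms(2,4)] by metis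
  have "AE t in lebesgue. t \<in> S \<union> T \<longrightarrow> norm (v t) \<le> max C1 C2"
    using C1 C2 by eventually_elim auto
  moreover have "(\<lambda>t. if t \<in> S then (if t \<in> S then v t else 0) else (if t \<in> T then v t else 0)) \<in> borel_measurable lebesgue"
    by (rule measurable_If_set) (use assms in \<open>auto simp: Linf_on_iff\<close>)
  moreover have "(\<lambda>t. if t \<in> S then (if t \<in> S then v t else 0) else (if t \<in> T then v t else 0)) = (\<lambda>t. if t \<in> S \<union> T then v t else 0)"
    by auto
  ultimately show ?thesis unfolding Linf_on_iff[OF ST] by auto
qed

lemma Linf_on_Pair:
  assumes "Linf_on S v" "Linf_on S w" "S \<in> sets lebesgue" shows "Linf_on S (\<lambda>t. (v t, w t))"
proof -
  obtain C1 where C1: "AE t in lebesgue. t \<in> S \<longrightarrow> norm (v t) \<le> C1" using Linf_onE[OF assms(1,3)] by metis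
  obtain C2 where C2: "AE t in lebesgue. t \<in> S \<longrightarrow> norm (w t) \<le> C2" using Linf_onE[OF assms(2,3)] by metis
  have "AE t in lebesgue. t \<in> S \<longrightarrow> norm (v t, w t) \<le> C1 + C2"
    using C1 C2 by eventually_elim (auto intro: order_trans[OF norm_Pair_le])
  moreover have "(\<lambda>t. (v t, w t)) \<in> borel_measurable (lebesgue_on S)"
    by (intro borel_measurable_Pair Linf_on_measurable assms)
  ultimately show ?thesis unfolding Linf_on_def AE_lebesgue_on_iff[OF assms(3)] by blast
qed

text \<open>Lebesgue measure is complete: whatever \<open>f\<close> does on \<open>N\<close>, its
  preimages differ from those of \<open>g\<close> by subsets of a null set.\<close>

lemma measurable_lebesgue_negligible_cong:
  fixes f g :: "'a::euclidean_space \<Rightarrow> 'b::euclidean_space"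
  assumes N: "negligible N" and eq: "\<And>t. t \<in> S - N \<Longrightarrow> f t = g t"
    and g: "g \<in> borel_measurable (lebesgue_on S)" and S: "S \<in> sets lebesgue"
  shows "f \<in> borel_measurable (lebesgue_on S)"
proof (rule measurableI)
  fix A :: "'b set" assume "A \<in> sets borel"
  then have "g -` A \<inter> space (lebesgue_on S) \<in> sets (lebesgue_on S)" by (rule measurable_sets[OF g])
  then have 1: "g -` A \<inter> S \<in> sets lebesgue"
    using S by (auto simp: sets_restrict_space_iff)
  have "negligible (f -` A \<inter> S \<inter> N)" by (rule negligible_subset[OF N]) auto
  then have "f -` A \<inter> S \<inter> N \<in> sets lebesgue" by (rule negligible_imp_sets)
  moreover have "(g -` A \<inter> S) - N \<in> sets lebesgue" using 1 negligible_imp_sets[OF N] by auto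
  moreover have "f -` A \<inter> S = ((g -` A \<inter> S) - N) \<union> (f -` A \<inter> S \<inter> N)" using eq by auto
  ultimately have "f -` A \<inter> S \<in> sets lebesgue" by (metis sets.Un)
  then show "f -` A \<inter> space (lebesgue_on S) \<in> sets (lebesgue_on S)"
    using S by (auto simp: sets_restrict_space_iff)
qed simp

text \<open>\<open>F\<close> is controlled on \<open>S\<close> only, and \<open>v\<close> may leave
  \<open>S\<close> on a null set; there it is redirected to a point \<open>s0\<close> of
  \<open>S\<close>, which makes the composition measurable.\<close>

lemma Linf_on_compose:
  fixes F :: "'a::euclidean_space \<Rightarrow> 'b::euclidean_space"
  assumes v: "Linf_on J v" and J: "J \<in> sets lebesgue" and S: "closed S" "S \<noteq> {}" and F: "continuous_on S F"
    and vS: "AE t in lebesgue. t \<in> J \<longrightarrow> v t \<in> S"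
  shows "Linf_on J (\<lambda>t. F (v t))"
proof -
  obtain s0 where "s0 \<in> S" using S by blast
  define v' where "v' t = (if v t \<in> S then v t else s0)" for t
  have "v' \<in> borel_measurable (lebesgue_on J)"
    unfolding v'_def
  proof (rule measurable_If)
    have "v -` S \<inter> space (lebesgue_on J) \<in> sets (lebesgue_on J)"
      by (rule measurable_sets[OF Linf_on_measurable[OF v]]) (use S in auto)
    then show "{t \<in> space (lebesgue_on J). v t \<in> S} \<in> sets (lebesgue_on J)"
      by (simp add: vimage_def Int_def conj_commute)
  qed (use Linf_on_measurable[OF v] in auto)
  then have v'm: "v' \<in> measurable (lebesgue_on J) (restrict_space borel S)"
    by (rule measurable_restrict_space2[rotated]) (auto simp: v'_def \<open>s0 \<in> S\<close>)
  have Fm: "(\<lambda>t. F (v' t)) \<in> borel_measurable (lebesgue_on J)"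
    by (rule measurable_compose[OF v'm borel_measurable_continuous_on_restrict[OF F]])
  obtain N where N: "negligible N" "\<And>t. t \<notin> N \<Longrightarrow> t \<in> J \<longrightarrow> v t \<in> S"
    using vS unfolding AE_lebesgue_iff_negligible by blast
  have "(\<lambda>t. F (v t)) \<in> borel_measurable (lebesgue_on J)"
  proof (rule measurable_lebesgue_negligible_cong[OF N(1) _ Fm J])
    show "F (v t) = F (v' t)" if "t \<in> J - N" for t using N(2)[of t] that by (auto simp: v'_def)
  qed
  moreover
  obtain C where C: "AE t in lebesgue. t \<in> J \<longrightarrow> norm (v t) \<le> C" using Linf_onE[OF v J] by metis
  have "compact (S \<inter> cball 0 C)" using S by (simp add: closed_Int_compact)
  then have "bounded (F ` (S \<inter> cball 0 C))"
    by (intro compact_imp_bounded compact_continuous_image continuous_on_subset[OF F]) auto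
  then obtain B where B0: "\<forall>y\<in>F ` (S \<inter> cball 0 C). norm y \<le> B" unfolding bounded_pos by blast
  have B: "norm (F x) \<le> B" if "x \<in> S" "norm x \<le> C" for x
    using B0 that by auto
  have "AE t in lebesgue. t \<in> J \<longrightarrow> norm (F (v t)) \<le> B"
    using C vS by eventually_elim (use B in auto)
  ultimately show ?thesis unfolding Linf_on_def AE_lebesgue_on_iff[OF J] by blast
qed

lemma Linf_on_absolutely_integrable:
  assumes "Linf_on {a..b} (v :: real \<Rightarrow> 'a::euclidean_space)" shows "v absolutely_integrable_on {a..b}"
proof -
  obtain C where C: "AE t in lebesgue. t \<in> {a..b} \<longrightarrow> norm (v t) \<le> C" using Linf_onE[OF assms] by auto
  obtain N where N: "negligible N" "\<And>t. t \<notin> N \<Longrightarrow> t \<in> {a..b} \<longrightarrow> norm (v t) \<le> C"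
    using C unfolding AE_lebesgue_iff_negligible by blast
  define v' where "v' t = (if t \<in> N then 0 else v t)" for t
  have m: "v' \<in> borel_measurable (lebesgue_on {a..b})"
    by (rule measurable_lebesgue_negligible_cong[OF N(1) _ Linf_on_measurable[OF assms]]) (auto simp: v'_def)
  have bd: "norm (v' t) \<le> \<bar>C\<bar>" if "t \<in> {a..b}" for t using N(2)[of t] that by (auto simp: v'_def)
  have "v' absolutely_integrable_on {a..b}"
    by (rule measurable_bounded_by_integrable_imp_absolutely_integrable[OF m _ _ bd]) auto
  then show ?thesis
    by (rule absolutely_integrable_spike[OF _ N(1)]) (auto simp: v'_def)
qed

lemma Linf_on_integrable:
  assumes "Linf_on {a..b} (v :: real \<Rightarrow> 'a::euclidean_space)" shows "v integrable_on {a..b}"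
  using Linf_on_absolutely_integrable[OF assms] set_lebesgue_integral_eq_integral(1) by blast

lemma Linf_on_shift:
  assumes v: "Linf_on S v" and S: "S \<in> sets lebesgue" "S' \<in> sets lebesgue"
    and eq: "\<And>t. t \<in> S' \<Longrightarrow> t + c \<in> S"
  shows "Linf_on S' (\<lambda>t. v (t + c))"
proof -
  obtain C where C: "AE t in lebesgue. t \<in> S \<longrightarrow> norm (v t) \<le> C" using Linf_onE[OF v S(1)] by metis
  have "AE t in lebesgue. t \<in> S' \<longrightarrow> norm (v (t + c)) \<le> C"
    using AE_lebesgue_shift[OF C, of c] by eventually_elim (use eq in auto)
  moreover
  define G where "G t = (if t \<in> S then v t else 0)" for t
  have G: "G \<in> borel_measurable lebesgue" using v S unfolding G_def by (simp add: Linf_on_iff)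
  have "(\<lambda>t::real. c + t) \<in> measurable lebesgue lebesgue"
    using lebesgue_affine_measurable[of "\<lambda>_. 1" c] by simp
  from measurable_compose[OF this G] have "(\<lambda>t. G (c + t)) \<in> borel_measurable lebesgue" .
  then have "(\<lambda>t. G (c + t)) \<in> borel_measurable (lebesgue_on S')"
    by (rule measurable_restrict_space1)
  then have "(\<lambda>t. v (t + c)) \<in> borel_measurable (lebesgue_on S')"
    by (rule measurable_cong[THEN iffD1, rotated]) (use eq in \<open>auto simp: G_def add.commute\<close>)
  ultimately show ?thesis unfolding Linf_on_def AE_lebesgue_on_iff[OF S(2)] by blast
qed

lemma Linf_loc_onD: "Linf_loc_on S v \<Longrightarrow> {a..b} \<subseteq> S \<Longrightarrow> Linf_on {a..b} v"
  unfolding Linf_loc_on_def by blast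

lemma Linf_on_interval_subset: "Linf_on {a..b::real} v \<Longrightarrow> a \<le> c \<Longrightarrow> d \<le> b \<Longrightarrow> Linf_on {c..d} v"
  by (rule Linf_on_subset) auto

text \<open>Both solutions are bounded on \<open>{a..d}\<close> and the input is essentially
  bounded, so almost all values lie in a compact subset of \<open>UNIV \<times> \<Omega>\<close>,
  where \<open>F\<close> is Lipschitz. Closedness of \<open>\<Omega>\<close> makes that subset
  compact.\<close>

lemma ode_input_unique:
  fixes y1 y2 :: "real \<Rightarrow> 'a::euclidean_space" and u :: "real \<Rightarrow> 'b::euclidean_space"
  assumes s1: "solves_ae_on (time_ivl a T) (\<lambda>t. F (y1 t, u t)) y1"
    and s2: "solves_ae_on (time_ivl a T) (\<lambda>t. F (y2 t, u t)) y2"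
    and init: "y1 a = y2 a" and lip: "lip_compact (UNIV \<times> \<Omega>) F" and \<Omega>: "closed \<Omega>"
    and u: "\<And>d. d \<in> time_ivl a T \<Longrightarrow> Linf_on {a..d} u"
    and u\<Omega>: "AE t in lebesgue. t \<in> time_ivl a T \<longrightarrow> u t \<in> \<Omega>"
    and t: "t \<in> time_ivl a T"
  shows "y1 t = y2 t"
proof (rule ode_unique[OF s1 s2 init _ t])
  fix d assume d: "d \<in> time_ivl a T"
  have sub: "{a..d} \<subseteq> time_ivl a T" using time_ivl_subset[OF d] by auto
  obtain B1 where B1: "\<forall>s\<in>{a..d}. norm (y1 s) \<le> B1"
    using continuous_on_interval_bounded[OF solves_ae_on_continuous_on[OF s1 sub]] by blast
  obtain B2 where B2: "\<forall>s\<in>{a..d}. norm (y2 s) \<le> B2"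
    using continuous_on_interval_bounded[OF solves_ae_on_continuous_on[OF s2 sub]] by blast
  obtain C where C: "AE s in lebesgue. s \<in> {a..d} \<longrightarrow> norm (u s) \<le> C" using Linf_onE[OF u[OF d]] by auto
  define K where "K = cball (0::'a) (max B1 B2) \<times> (\<Omega> \<inter> cball 0 C)"
  have "compact K" unfolding K_def using \<Omega> by (intro compact_Times closed_Int_compact) auto
  moreover have "K \<subseteq> UNIV \<times> \<Omega>" by (auto simp: K_def)
  ultimately obtain L where L: "\<And>x y. x \<in> K \<Longrightarrow> y \<in> K \<Longrightarrow> norm (F x - F y) \<le> L * norm (x - y)"
    using lip_compact_normE[OF lip] by metis
  have "AE s in lebesgue. s \<in> {a..d} \<longrightarrow> norm (F (y1 s, u s) - F (y2 s, u s)) \<le> L * norm (y1 s - y2 s)"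
    using C u\<Omega>
  proof eventually_elim
    case (elim s)
    show ?case
    proof
      assume s: "s \<in> {a..d}"
      then have "(y1 s, u s) \<in> K" "(y2 s, u s) \<in> K"
        using B1 B2 elim sub by (auto simp: K_def intro: max.coboundedI1 max.coboundedI2)
      from L[OF this] show "norm (F (y1 s, u s) - F (y2 s, u s)) \<le> L * norm (y1 s - y2 s)"
        by (simp add: norm_Pair)
    qed
  qed
  then show "\<exists>L. AE s in lebesgue. s \<in> {a..d} \<longrightarrow> norm (F (y1 s, u s) - F (y2 s, u s)) \<le> L * norm (y1 s - y2 s)"
    by blast
qed

lemma solves_ae_on_of_integral:
  fixes F :: "real \<Rightarrow> 'a::euclidean_space"
  assumes y: "\<And>t. t \<in> time_ivl a T \<Longrightarrow> y t = y0 + integral {a..t} F"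
    and F: "\<And>d. d \<in> time_ivl a T \<Longrightarrow> Linf_on {a..d} F"
  shows "solves_ae_on (time_ivl a T) F y"
proof (rule solves_ae_on_integralI)
  fix c d assume cd: "a \<le> c" "c \<le> d" "d \<in> time_ivl a T"
  then have c: "c \<in> time_ivl a T" using time_ivl_subset[OF cd(3) cd(1)] by auto
  have i: "F integrable_on {a..d}" by (rule Linf_on_integrable[OF F[OF cd(3)]])
  have "F integrable_on {c..d}" by (rule integrable_subinterval_real[OF i]) (use cd in auto)
  moreover have "integral {a..c} F + integral {c..d} F = integral {a..d} F"
    by (rule Henstock_Kurzweil_Integration.integral_combine) (use cd i in auto)
  then have "y d - y c = integral {c..d} F" using y[OF cd(3)] y[OF c] by (simp add: algebra_simps)
  ultimately show "(F has_integral y d - y c) {c..d}" by (simp add: integrable_integral)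
next
  fix d assume "d \<in> time_ivl a T"
  then obtain C where "AE t in lebesgue. t \<in> {a..d} \<longrightarrow> norm (F t) \<le> C" using Linf_onE[OF F] by auto
  then show "\<exists>C. AE t in lebesgue. t \<in> {a..d} \<longrightarrow> norm (F t) \<le> C" by blast
qed

section \<open>Predictor equations and sampled systems\<close>

lemma integral_window_shift:
  fixes H :: "real \<Rightarrow> 'a::euclidean_space"
  assumes "H integrable_on {t - \<delta>..t}"
  shows "integral {0..\<delta>} (\<lambda>s. H (t + s - \<delta>)) = integral {t - \<delta>..t} H"
proof -
  have "((\<lambda>s. H (1 *\<^sub>R s + (t - \<delta>))) has_integral (1 / \<bar>1\<bar> ^ DIM(real)) *\<^sub>R integral {t - \<delta>..t} H)
     ((\<lambda>x. (1 / 1) *\<^sub>R x + - ((1 / 1) *\<^sub>R (t - \<delta>))) ` cbox (t - \<delta>) t)"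
    by (rule has_integral_affinity) (use assms in \<open>auto simp: integrable_integral\<close>)
  moreover have "(\<lambda>x. (1 / 1) *\<^sub>R x + - ((1 / 1) *\<^sub>R (t - \<delta>))) ` cbox (t - \<delta>) t = {0..\<delta>}"
    by (auto simp: image_iff intro: bexI[of _ "_ + (t - \<delta>)"])
  moreover have "(\<lambda>s. H (1 *\<^sub>R s + (t - \<delta>))) = (\<lambda>s. H (t + s - \<delta>))"
    by (simp add: algebra_simps)
  ultimately show ?thesis by (simp add: integral_unique)
qed

text \<open>One predictor equation with unknown \<open>\<xi>\<close>. \<open>F\<close> contains the
  saturation and so satisfies \<open>F_bound\<close>: bounded \<open>z\<close> bounds it whatever
  \<open>\<xi>\<close> is. \<open>\<kappa> \<sigma> \<xi>\<close> is the control that goes with the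
  window time \<open>\<sigma>\<close>; it may depend on the unknown, because the last predictor
  contains the control it generates.\<close>

locale window_equation =
  fixes F :: "'z::euclidean_space \<times> 'n::euclidean_space \<times> 'm::euclidean_space \<Rightarrow> 'n"
    and \<kappa> :: "real \<Rightarrow> 'n \<Rightarrow> 'm" and U :: "'m set" and \<delta> Lk :: real
  assumes delta: "\<delta> > 0"
    and F_lip: "lip_compact UNIV F"
    and F_bound: "\<And>B. \<exists>C. \<forall>z \<xi>. \<forall>u\<in>U. norm z \<le> B \<longrightarrow> norm (F (z, \<xi>, u)) \<le> C"
    and U: "compact U"
    and \<kappa>_lip: "\<And>\<sigma> \<xi> \<xi>'. norm (\<kappa> \<sigma> \<xi> - \<kappa> \<sigma> \<xi>') \<le> Lk * norm (\<xi> - \<xi>')"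
    and \<kappa>_U: "AE \<sigma> in lebesgue. \<sigma> \<ge> - \<delta> \<longrightarrow> (\<forall>\<xi>. \<kappa> \<sigma> \<xi> \<in> U)"
    and \<kappa>_Linf: "\<And>a b \<xi>. - \<delta> \<le> a \<Longrightarrow> Linf_on {a..b} \<xi> \<Longrightarrow> Linf_on {a..b} (\<lambda>\<sigma>. \<kappa> \<sigma> (\<xi> \<sigma>))"
begin

text \<open>\<open>p\<close> is \<open>z\<close> at the present time and stays frozen while
  \<open>\<sigma>\<close> runs through the past window.\<close>

definition integrand :: "(real \<Rightarrow> 'n) \<Rightarrow> 'z \<Rightarrow> real \<Rightarrow> 'n" where
  "integrand \<xi> p \<sigma> = F (p, \<xi> \<sigma>, \<kappa> \<sigma> (\<xi> \<sigma>))"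

lemma Lk_nonneg: "Lk \<ge> 0"
proof -
  obtain v :: 'n where "norm v = 1" using vector_choose_size[of 1] by auto
  then show ?thesis using \<kappa>_lip[of 0 v 0] norm_ge_zero[of "\<kappa> 0 v - \<kappa> 0 0"] by (simp del: norm_ge_zero)
qed

lemma F_continuous: "continuous_on UNIV F"
  by (rule lip_compact_continuous_on[OF F_lip]) simp

lemma integrand_Linf:
  assumes "- \<delta> \<le> a" "Linf_on {a..b} \<xi>" shows "Linf_on {a..b} (integrand \<xi> p)"
  unfolding integrand_def
proof (rule Linf_on_compose[where S=UNIV and F=F and v="\<lambda>t. (p, \<xi> t, \<kappa> t (\<xi> t))"])
  show "Linf_on {a..b} (\<lambda>t. (p, \<xi> t, \<kappa> t (\<xi> t)))"
    by (intro Linf_on_Pair Linf_on_continuous[OF continuous_on_const] \<kappa>_Linf assms) auto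
qed (auto intro: F_continuous)

lemma integrand_window_Linf:
  assumes "t \<ge> 0" "Linf_on {t - \<delta>..t} \<xi>" shows "Linf_on {0..\<delta>} (\<lambda>s. integrand \<xi> p (t + s - \<delta>))"
proof -
  have "Linf_on {0..\<delta>} (\<lambda>s. integrand \<xi> p (s + (t - \<delta>)))"
    by (rule Linf_on_shift[OF integrand_Linf]) (use assms in auto)
  then show ?thesis by (simp add: algebra_simps)
qed

text \<open>\<open>volterra_step\<close> on the window, with the origin \<open>\<delta> - t\<close>
  of the weight chosen so that it becomes \<open>exp (2 * L * \<sigma>)\<close> at
  \<open>\<sigma> = t + s - \<delta>\<close>. The factor \<open>1 + Lk\<close> accounts for the
  control moving along with \<open>\<xi>\<close>.\<close>

lemma window_diff:
  assumes "norm z \<le> B" "t \<ge> 0" "M \<ge> 0" "L > 0"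
    and xi: "Linf_on {t - \<delta>..t} \<xi>1" "Linf_on {t - \<delta>..t} \<xi>2"
    and L: "\<And>x y. x \<in> cball 0 B \<times> cball 0 C \<times> U \<Longrightarrow> y \<in> cball 0 B \<times> cball 0 C \<times> U \<Longrightarrow> norm (F x - F y) \<le> LF * norm (x - y)"
      "LF * (1 + Lk) \<le> L" "LF \<ge> 0"
    and bd: "AE \<sigma> in lebesgue. \<sigma> \<in> {t - \<delta>..t} \<longrightarrow> norm (\<xi>1 \<sigma>) \<le> C" "AE \<sigma> in lebesgue. \<sigma> \<in> {t - \<delta>..t} \<longrightarrow> norm (\<xi>2 \<sigma>) \<le> C"
    and diff: "\<And>\<sigma>. \<sigma> \<in> {t - \<delta>..t} \<Longrightarrow> norm (\<xi>1 \<sigma> - \<xi>2 \<sigma>) \<le> M * exp (2 * L * \<sigma>)"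
  shows "norm (integral {0..\<delta>} (\<lambda>s. integrand \<xi>1 z (t + s - \<delta>)) - integral {0..\<delta>} (\<lambda>s. integrand \<xi>2 z (t + s - \<delta>)))
     \<le> M / 2 * exp (2 * L * t)"
proof -
  have 1: "(\<lambda>s. integrand \<xi>1 z (t + s - \<delta>)) integrable_on {0..\<delta>}" "(\<lambda>s. integrand \<xi>2 z (t + s - \<delta>)) integrable_on {0..\<delta>}"
    using integrand_window_Linf[OF \<open>t \<ge> 0\<close>] xi by (auto intro: Linf_on_integrable)
  have "norm (integral {0..\<delta>} (\<lambda>s. integrand \<xi>1 z (t + s - \<delta>) - integrand \<xi>2 z (t + s - \<delta>))) \<le> M / 2 * exp (2 * L * (\<delta> - (\<delta> - t)))"
  proof (rule volterra_step)
    show "AE s in lebesgue. s \<in> {0..\<delta>} \<longrightarrow> norm (integrand \<xi>1 z (t + s - \<delta>) - integrand \<xi>2 z (t + s - \<delta>)) \<le> L * (M * exp (2 * L * (s - (\<delta> - t))))"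
      using AE_lebesgue_shift[OF bd(1), of "t - \<delta>"] AE_lebesgue_shift[OF bd(2), of "t - \<delta>"] AE_lebesgue_shift[OF \<kappa>_U, of "t - \<delta>"]
    proof eventually_elim
      case (elim s)
      show ?case
      proof
        assume s: "s \<in> {0..\<delta>}"
        define \<sigma> where "\<sigma> = t + s - \<delta>"
        have eq: "s + (t - \<delta>) = \<sigma>" by (simp add: \<sigma>_def)
        have \<sigma>: "\<sigma> \<in> {t - \<delta>..t}" "\<sigma> \<ge> - \<delta>" using s \<open>t \<ge> 0\<close> by (auto simp: \<sigma>_def)
        have mem: "(z, \<xi>1 \<sigma>, \<kappa> \<sigma> (\<xi>1 \<sigma>)) \<in> cball 0 B \<times> cball 0 C \<times> U" "(z, \<xi>2 \<sigma>, \<kappa> \<sigma> (\<xi>2 \<sigma>)) \<in> cball 0 B \<times> cball 0 C \<times> U"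
          using elim[unfolded eq] \<sigma> assms(1) by auto
        have "norm ((z, \<xi>1 \<sigma>, \<kappa> \<sigma> (\<xi>1 \<sigma>)) - (z, \<xi>2 \<sigma>, \<kappa> \<sigma> (\<xi>2 \<sigma>))) \<le> norm (\<xi>1 \<sigma> - \<xi>2 \<sigma>) + norm (\<kappa> \<sigma> (\<xi>1 \<sigma>) - \<kappa> \<sigma> (\<xi>2 \<sigma>))"
          using norm_Pair_le[of "\<xi>1 \<sigma> - \<xi>2 \<sigma>" "\<kappa> \<sigma> (\<xi>1 \<sigma>) - \<kappa> \<sigma> (\<xi>2 \<sigma>)"] by (simp add: norm_Pair[of 0])
        also have "\<dots> \<le> (1 + Lk) * norm (\<xi>1 \<sigma> - \<xi>2 \<sigma>)" using \<kappa>_lip[of \<sigma> "\<xi>1 \<sigma>" "\<xi>2 \<sigma>"] by (simp add: algebra_simps)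
        finally have n: "norm ((z, \<xi>1 \<sigma>, \<kappa> \<sigma> (\<xi>1 \<sigma>)) - (z, \<xi>2 \<sigma>, \<kappa> \<sigma> (\<xi>2 \<sigma>))) \<le> (1 + Lk) * norm (\<xi>1 \<sigma> - \<xi>2 \<sigma>)" .
        have "norm (integrand \<xi>1 z \<sigma> - integrand \<xi>2 z \<sigma>) \<le> LF * norm ((z, \<xi>1 \<sigma>, \<kappa> \<sigma> (\<xi>1 \<sigma>)) - (z, \<xi>2 \<sigma>, \<kappa> \<sigma> (\<xi>2 \<sigma>)))"
          unfolding integrand_def by (rule L(1)[OF mem])
        also have "\<dots> \<le> LF * ((1 + Lk) * norm (\<xi>1 \<sigma> - \<xi>2 \<sigma>))" by (rule mult_left_mono[OF n L(3)])
        also have "\<dots> = (LF * (1 + Lk)) * norm (\<xi>1 \<sigma> - \<xi>2 \<sigma>)" by simp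
        also have "\<dots> \<le> L * (M * exp (2 * L * \<sigma>))"
          using diff[OF \<sigma>(1)] L(2) \<open>L > 0\<close> by (intro mult_mono) auto
        finally show "norm (integrand \<xi>1 z (t + s - \<delta>) - integrand \<xi>2 z (t + s - \<delta>)) \<le> L * (M * exp (2 * L * (s - (\<delta> - t))))"
          by (simp add: \<sigma>_def algebra_simps)
      qed
    qed
  qed (use assms delta 1 in \<open>auto intro: integrable_diff\<close>)
  then show ?thesis using 1 by (simp add: integral_diff)
qed

text \<open>Uniform in \<open>\<xi>\<close> thanks to \<open>F_bound\<close>; this is the a priori
  bound behind both uniqueness and existence.\<close>

lemma window_bound:
  assumes "norm z \<le> B" "t \<ge> 0" and xi: "Linf_on {t - \<delta>..t} \<xi>"
    and C: "\<forall>z \<xi>. \<forall>u\<in>U. norm z \<le> B \<longrightarrow> norm (F (z, \<xi>, u)) \<le> C"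
  shows "norm (integral {0..\<delta>} (\<lambda>s. integrand \<xi> z (t + s - \<delta>))) \<le> C * \<delta>"
proof (rule norm_integral_le_AE)
  show "(\<lambda>s. integrand \<xi> z (t + s - \<delta>)) integrable_on {0..\<delta>}"
    by (rule Linf_on_integrable[OF integrand_window_Linf[OF \<open>t \<ge> 0\<close> xi]])
  show "((\<lambda>_. C) has_integral C * \<delta>) {0..\<delta>}"
    using has_integral_const_real[of C 0 \<delta>] delta by (simp add: mult.commute)
  show "AE s in lebesgue. s \<in> {0..\<delta>} \<longrightarrow> norm (integrand \<xi> z (t + s - \<delta>)) \<le> C"
    using AE_lebesgue_shift[OF \<kappa>_U, of "t - \<delta>"]
  proof eventually_elim
    case (elim s)
    show ?case
    proof
      assume s: "s \<in> {0..\<delta>}"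
      have eq: "s + (t - \<delta>) = t + s - \<delta>" by simp
      have "\<kappa> (t + s - \<delta>) (\<xi> (t + s - \<delta>)) \<in> U" using elim[unfolded eq] s \<open>t \<ge> 0\<close> by auto
      then show "norm (integrand \<xi> z (t + s - \<delta>)) \<le> C" using C assms(1) by (simp add: integrand_def)
    qed
  qed
qed

lemma window_lebesgue:
  assumes "t \<ge> 0" "Linf_on {t - \<delta>..t} \<xi>"
  shows "(LINT s:{0..\<delta>}|lebesgue. integrand \<xi> z (t + s - \<delta>)) = integral {0..\<delta>} (\<lambda>s. integrand \<xi> z (t + s - \<delta>))"
  by (rule set_lebesgue_integral_eq_integral(2)[OF Linf_on_absolutely_integrable[OF integrand_window_Linf[OF assms]]])

lemma Lipschitz_F:
  obtains LF where "LF \<ge> 0" "\<And>x y. x \<in> cball 0 B \<times> cball 0 C \<times> U \<Longrightarrow> y \<in> cball 0 B \<times> cball 0 C \<times> U \<Longrightarrow> norm (F x - F y) \<le> LF * norm (x - y)"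
proof -
  have "compact (cball (0::'z) B \<times> cball (0::'n) C \<times> U)" using U by (intro compact_Times compact_cball)
  from lip_compact_normE[OF F_lip this] show ?thesis using that by auto
qed

text \<open>The solutions are only essentially bounded, but their difference is a difference of two
  bounded window integrals and hence bounded at every point of \<open>{0..t0}\<close>; that starts
  the halving argument of \<open>contraction_vanish\<close>.\<close>

lemma unique:
  assumes eq1: "\<And>t. t \<in> time_ivl 0 T \<Longrightarrow> \<xi>1 t = A t + (LINT s:{0..\<delta>}|lebesgue. integrand \<xi>1 (z t) (t + s - \<delta>))"
    and eq2: "\<And>t. t \<in> time_ivl 0 T \<Longrightarrow> \<xi>2 t = A t + (LINT s:{0..\<delta>}|lebesgue. integrand \<xi>2 (z t) (t + s - \<delta>))"
    and init: "\<And>s. s \<in> {-\<delta>..<0} \<Longrightarrow> \<xi>1 s = \<xi>2 s"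
    and L1: "Linf_loc_on (time_ivl (-\<delta>) T) \<xi>1" and L2: "Linf_loc_on (time_ivl (-\<delta>) T) \<xi>2"
    and z: "\<And>d. d \<in> time_ivl 0 T \<Longrightarrow> continuous_on {0..d} z"
    and t0: "t0 \<in> time_ivl 0 T"
  shows "\<xi>1 t0 = \<xi>2 t0"
proof -
  have t00: "t0 \<ge> 0" using t0 by (simp add: time_ivl_def)
  have tm: "t \<in> time_ivl 0 T" if "t \<in> {0..t0}" for t using time_ivl_subset[OF t0, of 0] that by auto
  have "t0 \<in> time_ivl (-\<delta>) T" using t0 delta by (auto simp: time_ivl_def)
  from time_ivl_subset[OF this] have sub: "{-\<delta>..t0} \<subseteq> time_ivl (-\<delta>) T" by auto
  have xi: "Linf_on {-\<delta>..t0} \<xi>1" "Linf_on {-\<delta>..t0} \<xi>2" using L1 L2 sub by (auto intro: Linf_loc_onD)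
  have xit: "Linf_on {t-\<delta>..t} \<xi>1" "Linf_on {t-\<delta>..t} \<xi>2" if "t \<in> {0..t0}" for t
    using xi that by (auto intro: Linf_on_interval_subset)
  obtain B where "B \<ge> 0" and B: "\<And>t. t \<in> {0..t0} \<Longrightarrow> norm (z t) \<le> B"
    using continuous_on_interval_bounded[OF z[OF t0]] by blast
  obtain C0 where C0: "\<forall>z \<xi>. \<forall>u\<in>U. norm z \<le> B \<longrightarrow> norm (F (z, \<xi>, u)) \<le> C0" using F_bound by blast
  obtain c1 where c1: "AE \<sigma> in lebesgue. \<sigma> \<in> {-\<delta>..t0} \<longrightarrow> norm (\<xi>1 \<sigma>) \<le> c1" using Linf_onE[OF xi(1)] by auto
  obtain c2 where c2: "AE \<sigma> in lebesgue. \<sigma> \<in> {-\<delta>..t0} \<longrightarrow> norm (\<xi>2 \<sigma>) \<le> c2" using Linf_onE[OF xi(2)] by auto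
  define C where "C = max c1 c2"
  obtain LF where LF: "LF \<ge> 0" "\<And>x y. x \<in> cball 0 B \<times> cball 0 C \<times> U \<Longrightarrow> y \<in> cball 0 B \<times> cball 0 C \<times> U \<Longrightarrow> norm (F x - F y) \<le> LF * norm (x - y)"
    using Lipschitz_F by blast
  define L where "L = LF * (1 + Lk) + 1"
  have L: "L > 0" "LF * (1 + Lk) \<le> L" using LF Lk_nonneg by (auto simp: L_def intro: add_nonneg_pos)
  have e: "\<xi>1 t - \<xi>2 t = integral {0..\<delta>} (\<lambda>s. integrand \<xi>1 (z t) (t + s - \<delta>)) - integral {0..\<delta>} (\<lambda>s. integrand \<xi>2 (z t) (t + s - \<delta>))"
    if t: "t \<in> {0..t0}" for t
    using eq1[OF tm[OF t]] eq2[OF tm[OF t]] window_lebesgue[OF _ xit(1)[OF t]] window_lebesgue[OF _ xit(2)[OF t]] t by simp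
  have bound: "norm (\<xi>1 t - \<xi>2 t) \<le> \<bar>2 * (C0 * \<delta>)\<bar>" if t: "t \<in> {0..t0}" for t
    unfolding e[OF t]
    using window_bound[OF B[OF t] _ xit(1)[OF t] C0] window_bound[OF B[OF t] _ xit(2)[OF t] C0] t
      norm_triangle_ineq4[of "integral {0..\<delta>} (\<lambda>s. integrand \<xi>1 (z t) (t + s - \<delta>))" "integral {0..\<delta>} (\<lambda>s. integrand \<xi>2 (z t) (t + s - \<delta>))"]
    by auto
  have "norm (\<xi>1 t0 - \<xi>2 t0) \<le> 0"
  proof (rule contraction_vanish[where S="{0..t0}" and B="\<bar>2 * (C0 * \<delta>)\<bar>" and e="\<lambda>t. exp (2 * L * t)" and d="\<lambda>t. norm (\<xi>1 t - \<xi>2 t)"])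
    fix t assume t: "t \<in> {0..t0}"
    have "\<bar>2 * (C0 * \<delta>)\<bar> * 1 \<le> \<bar>2 * (C0 * \<delta>)\<bar> * exp (2 * L * t)"
      using t L by (intro mult_left_mono) auto
    then show "norm (\<xi>1 t - \<xi>2 t) \<le> \<bar>2 * (C0 * \<delta>)\<bar> * exp (2 * L * t)" using bound[OF t] by linarith
  next
    fix M t assume M: "M \<ge> 0" "\<And>s. s \<in> {0..t0} \<Longrightarrow> norm (\<xi>1 s - \<xi>2 s) \<le> M * exp (2 * L * s)" and t: "t \<in> {0..t0}"
    show "norm (\<xi>1 t - \<xi>2 t) \<le> M / 2 * exp (2 * L * t)"
      unfolding e[OF t]
    proof (rule window_diff[where B=B and C=C and LF=LF])
      show "AE \<sigma> in lebesgue. \<sigma> \<in> {t - \<delta>..t} \<longrightarrow> norm (\<xi>1 \<sigma>) \<le> C"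
        using c1 by eventually_elim (use t in \<open>auto simp: C_def\<close>)
      show "AE \<sigma> in lebesgue. \<sigma> \<in> {t - \<delta>..t} \<longrightarrow> norm (\<xi>2 \<sigma>) \<le> C"
        using c2 by eventually_elim (use t in \<open>auto simp: C_def\<close>)
      show "norm (\<xi>1 \<sigma> - \<xi>2 \<sigma>) \<le> M * exp (2 * L * \<sigma>)" if "\<sigma> \<in> {t - \<delta>..t}" for \<sigma>
      proof (cases "\<sigma> < 0")
        case True
        then show ?thesis using init[of \<sigma>] that t M by auto
      next
        case False
        then show ?thesis using M(2)[of \<sigma>] that t by auto
      qed
    qed (use B t M L LF xit in auto)
  qed (use t00 in auto)
  then show ?thesis by simp
qed

text \<open>Picard iteration with the history \<open>\<xi>0\<close> glued on before time 0. The side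
  condition is the bound \<open>R T\<close> on each \<open>{0..T}\<close>, valid for every image
  under \<open>\<T>\<close>; it gives one Lipschitz constant of \<open>F\<close> for the whole
  iteration.\<close>

lemma exists:
  assumes A: "continuous_on {0..} A" and z: "continuous_on {0..} z" and init: "Linf_on {-\<delta>..<0} \<xi>0"
  obtains \<xi> where "continuous_on {0..} \<xi>" "\<And>s. s < 0 \<Longrightarrow> \<xi> s = \<xi>0 s" "\<And>d. Linf_on {-\<delta>..d} \<xi>"
    "\<And>t. t \<ge> 0 \<Longrightarrow> \<xi> t = A t + (LINT s:{0..\<delta>}|lebesgue. integrand \<xi> (z t) (t + s - \<delta>))"
proof -
  define ext where "ext \<xi> s = (if s < 0 then \<xi>0 s else \<xi> s)" for \<xi> :: "real \<Rightarrow> 'n" and s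
  have ext_Linf: "Linf_on {-\<delta>..d} (ext \<xi>)" if "continuous_on {0..} \<xi>" for \<xi> d
  proof -
    have 1: "Linf_on {-\<delta>..<0} (ext \<xi>)"
      by (rule Linf_on_cong[OF init]) (auto simp: ext_def)
    have "Linf_on {0..max 0 d} \<xi>"
      by (rule Linf_on_continuous[OF continuous_on_subset[OF that]]) auto
    then have 2: "Linf_on {0..max 0 d} (ext \<xi>)" by (rule Linf_on_cong) (auto simp: ext_def)
    have "Linf_on ({-\<delta>..<0} \<union> {0..max 0 d}) (ext \<xi>)" by (rule Linf_on_Un[OF 1 2]) auto
    then show ?thesis by (rule Linf_on_subset) auto
  qed
  have ext_w: "Linf_on {t-\<delta>..t} (ext \<xi>)" if "continuous_on {0..} \<xi>" "t \<ge> 0" for \<xi> t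
    by (rule Linf_on_interval_subset[OF ext_Linf[OF that(1), of t]]) (use that in auto)
  have ext_bd: "\<exists>C. AE \<sigma> in lebesgue. \<sigma> \<in> {-\<delta>..T} \<longrightarrow> norm (ext \<xi> \<sigma>) \<le> C" if "continuous_on {0..} \<xi>" for \<xi> T
    using Linf_onE[OF ext_Linf[OF that, of T]] by auto
  define \<T> where "\<T> \<xi> t = A t + integral {0..\<delta>} (\<lambda>s. integrand (ext \<xi>) (z t) (t + s - \<delta>))" for \<xi> t
  have "\<exists>B R. R \<ge> 0 \<and> (\<forall>t\<in>{0..T}. norm (z t) \<le> B) \<and>
      (\<forall>\<xi>. continuous_on {0..} \<xi> \<longrightarrow> (\<forall>t\<in>{0..T}. norm (\<T> \<xi> t) \<le> R))" for T
  proof -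
    have "continuous_on {0..T} z" using z by (rule continuous_on_subset) auto
    then obtain B where B: "\<And>t. t \<in> {0..T} \<Longrightarrow> norm (z t) \<le> B" using continuous_on_interval_bounded by blast
    have "continuous_on {0..T} A" using A by (rule continuous_on_subset) auto
    then obtain BA where BA: "\<And>t. t \<in> {0..T} \<Longrightarrow> norm (A t) \<le> BA" using continuous_on_interval_bounded by blast
    obtain C where C: "\<forall>z \<xi>. \<forall>u\<in>U. norm z \<le> B \<longrightarrow> norm (F (z, \<xi>, u)) \<le> C" using F_bound by blast
    have "norm (\<T> \<xi> t) \<le> \<bar>BA\<bar> + \<bar>C * \<delta>\<bar>" if "continuous_on {0..} \<xi>" "t \<in> {0..T}" for \<xi> t
      unfolding \<T>_def
    proof (rule norm_triangle_mono)
      have t0: "t \<ge> 0" using that by simp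
      show "norm (integral {0..\<delta>} (\<lambda>s. integrand (ext \<xi>) (z t) (t + s - \<delta>))) \<le> \<bar>C * \<delta>\<bar>"
        using window_bound[OF B[OF that(2)] t0 ext_w[OF that(1) t0] C] by linarith
    qed (use BA[OF that(2)] in linarith)
    then show ?thesis using B by (intro exI[of _ B] exI[of _ "\<bar>BA\<bar> + \<bar>C * \<delta>\<bar>"]) auto
  qed
  then obtain B R where R0: "\<And>T. R T \<ge> 0" and B: "\<And>T t. t \<in> {0..T} \<Longrightarrow> norm (z t) \<le> B T"
    and R: "\<And>\<xi> T t. continuous_on {0..} \<xi> \<Longrightarrow> t \<in> {0..T} \<Longrightarrow> norm (\<T> \<xi> t) \<le> R T"
    by metis
  obtain \<xi> where \<xi>: "continuous_on {0..} \<xi>" "\<And>t. t \<ge> 0 \<Longrightarrow> \<T> \<xi> t = \<xi> t"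
  proof (rule picard[of \<T> "\<lambda>y. \<forall>T>0. \<forall>t\<in>{0..T}. norm (y t) \<le> R T"])
    fix \<xi> :: "real \<Rightarrow> 'n" assume cont: "continuous_on {0..} \<xi>"
    show "continuous_on {0..} (\<T> \<xi>)"
      unfolding \<T>_def
    proof (intro continuous_on_add A)
      show "continuous_on {0..} (\<lambda>t. integral {0..\<delta>} (\<lambda>s. integrand (ext \<xi>) (z t) (t + s - \<delta>)))"
        unfolding continuous_on_def
      proof (rule ballI)
        fix t' :: real assume t': "t' \<in> {0..}"
        define I where "I t = integral {0..\<delta>} (\<lambda>s. integrand (ext \<xi>) (z t) (t + s - \<delta>))" for t
        define Q where "Q t = integral {0..\<delta>} (\<lambda>s. integrand (ext \<xi>) (z t') (t + s - \<delta>))" for t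
        define T where "T = t' + 1"
        have "continuous_on {0..T} z" using z by (rule continuous_on_subset) auto
        then obtain B where B: "\<And>t. t \<in> {0..T} \<Longrightarrow> norm (z t) \<le> B" using continuous_on_interval_bounded by blast
        obtain C where C: "AE \<sigma> in lebesgue. \<sigma> \<in> {-\<delta>..T} \<longrightarrow> norm (ext \<xi> \<sigma>) \<le> C" using ext_bd[OF cont] by blast
        obtain LF where LF: "LF \<ge> 0" "\<And>x y. x \<in> cball 0 B \<times> cball 0 C \<times> U \<Longrightarrow> y \<in> cball 0 B \<times> cball 0 C \<times> U \<Longrightarrow> norm (F x - F y) \<le> LF * norm (x - y)"
          using Lipschitz_F by blast
        have IQ: "norm (I t - Q t) \<le> (LF * norm (z t - z t')) * \<delta>" if t: "t \<in> {0..T}" for t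
        proof -
          have i: "(\<lambda>s. integrand (ext \<xi>) p (t + s - \<delta>)) integrable_on {0..\<delta>}" for p
            using integrand_window_Linf[OF _ ext_w[OF cont]] t by (auto intro: Linf_on_integrable)
          have "norm (integral {0..\<delta>} (\<lambda>s. integrand (ext \<xi>) (z t) (t + s - \<delta>) - integrand (ext \<xi>) (z t') (t + s - \<delta>))) \<le> (LF * norm (z t - z t')) * \<delta>"
          proof (rule norm_integral_le_AE)
            show "((\<lambda>_. LF * norm (z t - z t')) has_integral (LF * norm (z t - z t')) * \<delta>) {0..\<delta>}"
              using has_integral_const_real[of "LF * norm (z t - z t')" 0 \<delta>] delta by (simp add: mult.commute)
            show "AE s in lebesgue. s \<in> {0..\<delta>} \<longrightarrow> norm (integrand (ext \<xi>) (z t) (t + s - \<delta>) - integrand (ext \<xi>) (z t') (t + s - \<delta>)) \<le> LF * norm (z t - z t')"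
              using AE_lebesgue_shift[OF C, of "t - \<delta>"] AE_lebesgue_shift[OF \<kappa>_U, of "t - \<delta>"]
            proof eventually_elim
              case (elim s)
              show ?case
              proof
                assume s: "s \<in> {0..\<delta>}"
                define \<sigma> where "\<sigma> = t + s - \<delta>"
                have eq: "s + (t - \<delta>) = \<sigma>" by (simp add: \<sigma>_def)
                have \<sigma>: "\<sigma> \<in> {-\<delta>..T}" using s t by (auto simp: \<sigma>_def)
                have "(z t, ext \<xi> \<sigma>, \<kappa> \<sigma> (ext \<xi> \<sigma>)) \<in> cball 0 B \<times> cball 0 C \<times> U" "(z t', ext \<xi> \<sigma>, \<kappa> \<sigma> (ext \<xi> \<sigma>)) \<in> cball 0 B \<times> cball 0 C \<times> U"
                  using elim[unfolded eq] \<sigma> B[OF t] B[of t'] t' by (auto simp: T_def)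
                from LF(2)[OF this] show "norm (integrand (ext \<xi>) (z t) (t + s - \<delta>) - integrand (ext \<xi>) (z t') (t + s - \<delta>)) \<le> LF * norm (z t - z t')"
                  by (simp add: integrand_def \<sigma>_def norm_Pair)
              qed
            qed
          qed (use i in \<open>auto intro: integrable_diff\<close>)
          then show ?thesis using i by (simp add: integral_diff I_def Q_def)
        qed
        define H where "H = integrand (ext \<xi>) (z t')"
        have Hi: "H integrable_on {-\<delta>..d}" for d
          unfolding H_def by (rule Linf_on_integrable[OF integrand_Linf[OF _ ext_Linf[OF cont]]]) simp
        have Qt: "Q t = integral {-\<delta>..t} H - integral {-\<delta>..t - \<delta>} H" if "t \<ge> 0" for t
        proof -
          have "H integrable_on {t - \<delta>..t}" by (rule integrable_subinterval_real[OF Hi[of t]]) (use that in auto)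
          then have "Q t = integral {t - \<delta>..t} H" unfolding Q_def H_def by (rule integral_window_shift)
          moreover have "integral {-\<delta>..t - \<delta>} H + integral {t - \<delta>..t} H = integral {-\<delta>..t} H"
            by (rule Henstock_Kurzweil_Integration.integral_combine[OF _ _ Hi]) (use that delta in auto)
          ultimately show ?thesis by (simp add: algebra_simps)
        qed
        have Qc: "continuous_on {0..T} Q"
        proof -
          have c: "continuous_on {-\<delta>..T} (\<lambda>t. integral {-\<delta>..t} H)" by (rule indefinite_integral_continuous_1[OF Hi])
          have "continuous_on {0..T} (\<lambda>t. integral {-\<delta>..t} H - integral {-\<delta>..t - \<delta>} H)"
            using delta by (intro continuous_intros continuous_on_subset[OF c] continuous_on_compose2[OF c]) auto
          then show ?thesis by (rule continuous_on_cong[THEN iffD1, rotated 2]) (auto simp: Qt)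
        qed
        have near: "at t' within {0..} = at t' within {0..T}"
          by (rule at_within_nhd[of t' "{..<T}"]) (auto simp: T_def)
        have Ql: "(Q \<longlongrightarrow> Q t') (at t' within {0..T})" using Qc t' unfolding continuous_on_def by (auto simp: T_def)
        have zl: "(z \<longlongrightarrow> z t') (at t' within {0..T})"
          using z t' unfolding continuous_on_def near[symmetric] by auto
        have "((\<lambda>t. I t - Q t) \<longlongrightarrow> 0) (at t' within {0..T})"
        proof (rule Lim_null_comparison)
          show "\<forall>\<^sub>F t in at t' within {0..T}. norm (I t - Q t) \<le> (LF * norm (z t - z t')) * \<delta>"
            using IQ by (auto simp: eventually_at_filter)
          have "((\<lambda>t. (LF * norm (z t - z t')) * \<delta>) \<longlongrightarrow> (LF * norm (z t' - z t')) * \<delta>) (at t' within {0..T})"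
            by (intro tendsto_intros zl)
          then show "((\<lambda>t. (LF * norm (z t - z t')) * \<delta>) \<longlongrightarrow> 0) (at t' within {0..T})" by simp
        qed
        from tendsto_add[OF this Ql] have "(I \<longlongrightarrow> Q t') (at t' within {0..T})" by simp
        then show "((\<lambda>t. integral {0..\<delta>} (\<lambda>s. integrand (ext \<xi>) (z t) (t + s - \<delta>))) \<longlongrightarrow>
            integral {0..\<delta>} (\<lambda>s. integrand (ext \<xi>) (z t') (t' + s - \<delta>))) (at t' within {0..})"
          unfolding near I_def[abs_def] Q_def .
      qed
    qed
  next
    show "\<forall>T>0. \<forall>t\<in>{0..T}. norm (0::'n) \<le> R T" using R0 by simp
  next
    fix y :: "real \<Rightarrow> 'n" assume "continuous_on {0..} y"
    then show "\<forall>T>0. \<forall>t\<in>{0..T}. norm (\<T> y t) \<le> R T" using R by blast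
  next
    fix Y :: "nat \<Rightarrow> real \<Rightarrow> 'n" and y :: "real \<Rightarrow> 'n"
    assume Y: "\<And>n. \<forall>T>0. \<forall>t\<in>{0..T}. norm (Y n t) \<le> R T" "\<And>t. 0 \<le> t \<Longrightarrow> (\<lambda>n. Y n t) \<longlonglongrightarrow> y t"
    show "\<forall>T>0. \<forall>t\<in>{0..T}. norm (y t) \<le> R T"
    proof (intro allI impI ballI)
      fix T t :: real assume "T > 0" "t \<in> {0..T}"
      then have "(\<lambda>n. norm (Y n t)) \<longlonglongrightarrow> norm (y t)" "\<And>n. norm (Y n t) \<le> R T"
        using Y by (auto intro: tendsto_norm)
      then show "norm (y t) \<le> R T" using LIMSEQ_le_const2 by blast
    qed
  next
    fix T :: real assume T: "T > 0"
    obtain c0 where c0: "AE \<sigma> in lebesgue. \<sigma> \<in> {-\<delta>..<0} \<longrightarrow> norm (\<xi>0 \<sigma>) \<le> c0" using Linf_onE[OF init] by auto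
    \<comment> \<open>Covers the history and every admissible iterate, so that one Lipschitz
      constant of \<open>F\<close> serves the whole horizon.\<close>
    define C where "C = max c0 (R T)"
    obtain LF where LF: "LF \<ge> 0" "\<And>x y. x \<in> cball 0 (B T) \<times> cball 0 C \<times> U \<Longrightarrow> y \<in> cball 0 (B T) \<times> cball 0 C \<times> U \<Longrightarrow> norm (F x - F y) \<le> LF * norm (x - y)"
      using Lipschitz_F by blast
    define L where "L = LF * (1 + Lk) + 1"
    have L: "L > 0" "LF * (1 + Lk) \<le> L" using LF Lk_nonneg by (auto simp: L_def intro: add_nonneg_pos)
    have bd: "AE \<sigma> in lebesgue. \<sigma> \<in> {t - \<delta>..t} \<longrightarrow> norm (ext y \<sigma>) \<le> C"
      if "\<forall>T>0. \<forall>t\<in>{0..T}. norm (y t) \<le> R T" "t \<in> {0..T}" for y :: "real \<Rightarrow> 'n" and t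
      using c0
    proof eventually_elim
      case (elim \<sigma>)
      show ?case
      proof
        assume \<sigma>: "\<sigma> \<in> {t - \<delta>..t}"
        show "norm (ext y \<sigma>) \<le> C"
        proof (cases "\<sigma> < 0")
          case True
          then show ?thesis using elim \<sigma> that(2) by (auto simp: ext_def C_def)
        next
          case False
          then have "norm (y \<sigma>) \<le> R T" using that \<sigma> T by auto
          then show ?thesis using False by (auto simp: ext_def C_def)
        qed
      qed
    qed
    show "\<exists>k\<ge>0. \<forall>\<xi>1 \<xi>2 M. continuous_on {0..} \<xi>1 \<longrightarrow> continuous_on {0..} \<xi>2 \<longrightarrow>
         (\<forall>T>0. \<forall>t\<in>{0..T}. norm (\<xi>1 t) \<le> R T) \<longrightarrow> (\<forall>T>0. \<forall>t\<in>{0..T}. norm (\<xi>2 t) \<le> R T) \<longrightarrow> 0 \<le> M \<longrightarrow>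
         (\<forall>s\<in>{0..T}. norm (\<xi>1 s - \<xi>2 s) \<le> M * exp (k * s)) \<longrightarrow>
         (\<forall>t\<in>{0..T}. norm (\<T> \<xi>1 t - \<T> \<xi>2 t) \<le> M / 2 * exp (k * t))"
    proof (intro exI[of _ "2 * L"] conjI allI impI ballI)
      fix \<xi>1 \<xi>2 :: "real \<Rightarrow> 'n" and M t
      assume c: "continuous_on {0..} \<xi>1" "continuous_on {0..} \<xi>2"
        and R: "\<forall>T>0. \<forall>t\<in>{0..T}. norm (\<xi>1 t) \<le> R T" "\<forall>T>0. \<forall>t\<in>{0..T}. norm (\<xi>2 t) \<le> R T"
        and M: "0 \<le> M" "\<forall>s\<in>{0..T}. norm (\<xi>1 s - \<xi>2 s) \<le> M * exp (2 * L * s)" and t: "t \<in> {0..T}"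
      have "norm (integral {0..\<delta>} (\<lambda>s. integrand (ext \<xi>1) (z t) (t + s - \<delta>)) - integral {0..\<delta>} (\<lambda>s. integrand (ext \<xi>2) (z t) (t + s - \<delta>)))
          \<le> M / 2 * exp (2 * L * t)"
      proof (rule window_diff[where B="B T" and C=C and LF=LF])
        show "norm (ext \<xi>1 \<sigma> - ext \<xi>2 \<sigma>) \<le> M * exp (2 * L * \<sigma>)" if "\<sigma> \<in> {t - \<delta>..t}" for \<sigma>
          using M that t by (cases "\<sigma> < 0") (auto simp: ext_def)
      qed (use bd[OF R(1) t] bd[OF R(2) t] B[OF t] t M L LF ext_w c in auto)
      then show "norm (\<T> \<xi>1 t - \<T> \<xi>2 t) \<le> M / 2 * exp (2 * L * t)" by (simp add: \<T>_def)
    qed (use L in auto)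
  qed blast
  have "ext \<xi> t = A t + (LINT s:{0..\<delta>}|lebesgue. integrand (ext \<xi>) (z t) (t + s - \<delta>))" if "t \<ge> 0" for t
    unfolding window_lebesgue[OF that ext_w[OF \<xi>(1) that]] using \<xi>(2)[OF that] that by (simp add: ext_def \<T>_def)
  moreover have "continuous_on {0..} (ext \<xi>)"
    by (rule continuous_on_cong[THEN iffD1, OF refl _ \<xi>(1)]) (auto simp: ext_def)
  ultimately show ?thesis
    using that[of "ext \<xi>"] ext_Linf[OF \<xi>(1)] by (auto simp: ext_def)
qed

end

section \<open>Systems with resets at the sampling times\<close>

locale sampling =
  fixes ts :: "nat \<Rightarrow> real"
  assumes partition: "sampling_partition ts"
begin

lemma ts_strict_mono: "strict_mono ts" and ts_0 [simp]: "ts 0 = 0" and ts_at_top: "filterlim ts at_top sequentially"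
  using partition by (auto simp: sampling_partition_def)

lemma ts_less_iff: "ts i < ts j \<longleftrightarrow> i < j" and ts_le_iff: "ts i \<le> ts j \<longleftrightarrow> i \<le> j"
  using strict_mono_less[OF ts_strict_mono] strict_mono_less_eq[OF ts_strict_mono] by auto

lemma ts_nonneg: "ts i \<ge> 0"
  using ts_le_iff[of 0 i] by simp

lemma ts_unbounded: "\<exists>i. t < ts i"
proof -
  have "\<forall>\<^sub>F i in sequentially. t < ts i" using ts_at_top by (simp add: filterlim_at_top_dense)
  then show ?thesis by (auto simp: eventually_sequentially)
qed

definition idx :: "real \<Rightarrow> nat" where "idx t = (LEAST i. t < ts (Suc i))"

lemma idx: assumes "t \<ge> 0" shows "ts (idx t) \<le> t" "t < ts (Suc (idx t))"
proof -
  obtain j where "t < ts j" using ts_unbounded by blast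
  then have j: "t < ts (Suc j)" using ts_less_iff[of j "Suc j"] by simp
  then show "t < ts (Suc (idx t))" unfolding idx_def by (rule LeastI)
  show "ts (idx t) \<le> t"
  proof (cases "idx t")
    case 0 then show ?thesis using assms by simp
  next
    case (Suc k)
    then have "\<not> t < ts (Suc k)" using not_less_Least[of k "\<lambda>i. t < ts (Suc i)"] by (simp add: idx_def)
    then show ?thesis using Suc by simp
  qed
qed

lemma idx_eq: assumes "ts i \<le> t" "t < ts (Suc i)" shows "idx t = i"
proof -
  have t: "t \<ge> 0" using assms ts_nonneg[of i] by linarith
  have "ts i < ts (Suc (idx t))" "ts (idx t) < ts (Suc i)" using idx[OF t] assms by linarith+
  then show ?thesis by (simp add: ts_less_iff)
qed

lemma idx_mono: assumes "0 \<le> s" "s \<le> t" shows "idx s \<le> idx t"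
proof -
  have "ts (idx s) < ts (Suc (idx t))" using idx[of s] idx[of t] assms by linarith
  then show ?thesis by (simp add: ts_less_iff)
qed

lemma sampling_ivl: "{ts i..<ts (Suc i)} \<inter> time_ivl 0 T = time_ivl (ts i) (min (ereal (ts (Suc i))) T)"
  using ts_nonneg[of i] by (auto simp: time_ivl_def)

lemma piecewise_Linf:
  assumes "\<And>i. Linf_on {ts i..<ts (Suc i)} v" shows "Linf_on {0..d} v"
proof -
  have "Linf_on {0..<ts n} v" for n
  proof (induction n)
    case 0
    show ?case using Linf_on_subset[OF assms[of 0], of "{}"] by simp
  next
    case (Suc n)
    have "Linf_on ({0..<ts n} \<union> {ts n..<ts (Suc n)}) v" by (rule Linf_on_Un[OF Suc assms]) auto
    moreover have "{0..<ts n} \<union> {ts n..<ts (Suc n)} = {0..<ts (Suc n)}"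
      using ts_nonneg[of n] ts_less_iff[of n "Suc n"] by auto
    ultimately show ?case by simp
  qed
  moreover obtain n where "d < ts n" using ts_unbounded by blast
  ultimately show ?thesis by (rule_tac Linf_on_subset[of "{0..<ts n}"]) auto
qed

text \<open>Between resets \<open>w\<close> is its reset value plus an integral along
  \<open>z\<close>, so the fixed point is sought for \<open>z\<close> alone. The fields are
  Lipschitz on compact sets only; \<open>z\<close> is therefore projected onto a ball inside them,
  and \<open>dec\<close> shows afterwards that the projection never acts.\<close>

lemma hybrid_exists:
  fixes FF :: "'z::euclidean_space \<times> 'w::euclidean_space \<times> 'u::euclidean_space \<Rightarrow> 'z" and G :: "'z \<times> 'u \<Rightarrow> 'w"
    and V :: "'z \<Rightarrow> real"
  assumes FF: "lip_compact (UNIV \<times> UNIV \<times> U) FF" and G: "lip_compact (UNIV \<times> U) G"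
    and U: "compact U" "U \<noteq> {}" and u: "\<And>d. Linf_on {0..d} u" and uU: "AE t in lebesgue. t \<ge> 0 \<longrightarrow> u t \<in> U"
    and V: "\<And>x. (V has_derivative V' x) (at x)" "lip_compact UNIV V"
    and M: "V z0 \<le> M" "\<And>z. V z \<le> M \<Longrightarrow> norm z < B"
    and dec: "\<And>z w u. u \<in> U \<Longrightarrow> M < V z \<Longrightarrow> V' z (FF (z, w, u)) \<le> 0"
  obtains z w where "z 0 = z0" "solves_ae_on {0..} (\<lambda>t. FF (z t, w t, u t)) z"
    "\<And>i. w (ts i) = y i" "\<And>i. solves_ae_on {ts i..<ts (Suc i)} (\<lambda>t. G (z t, u t)) w"
proof -
  have B0: "B > 0" using M norm_ge_zero[of z0] by (meson order.strict_trans1)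
  \<comment> \<open>The metric projection onto a ball is nonexpansive and so leaves all Lipschitz
    estimates intact.\<close>
  define clip where "clip = closest_point (cball (0::'z) B)"
  have clip_B: "norm (clip z) \<le> B" for z
    using closest_point_in_set[of "cball 0 B" z] B0 by (auto simp: clip_def)
  have clip_lip: "norm (clip z1 - clip z2) \<le> norm (z1 - z2)" for z1 z2
    using closest_point_lipschitz[of "cball 0 B" z1 z2] B0 by (auto simp: clip_def dist_norm)
  have clip_id: "clip z = z" if "norm z \<le> B" for z
    using closest_point_self[of z "cball 0 B"] that by (simp add: clip_def)
  have clip_cont: "continuous_on S clip" for S
    unfolding clip_def by (rule continuous_on_closest_point) (use B0 in auto)
  have Ucl: "closed U" using U by (rule_tac compact_imp_closed) auto
  have FFc: "continuous_on (UNIV \<times> UNIV \<times> U) FF" and Gc: "continuous_on (UNIV \<times> U) G"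
    using lip_compact_continuous_on[OF FF] lip_compact_continuous_on[OF G] Ucl by (auto intro: closed_Times)
  define Gz where "Gz z s = G (clip (z s), u s)" for z s
  define om where "om z t = integral {0..t} (Gz z)" for z t
  \<comment> \<open>Subtracting the value of \<open>om\<close> at the last sampling time restarts
    the integral at each reset.\<close>
  define wz where "wz z t = y (idx t) + (om z t - om z (ts (idx t)))" for z t
  define Fz where "Fz z s = FF (clip (z s), wz z s, u s)" for z s
  define \<T> where "\<T> z t = z0 + integral {0..t} (Fz z)" for z t
  have zL: "Linf_on {0..d} (\<lambda>s. clip (z s))" if "continuous_on {0..} z" for z d
    by (intro Linf_on_continuous continuous_on_compose2[OF clip_cont[of UNIV]] continuous_on_subset[OF that]) auto
  have GL: "Linf_on {0..d} (Gz z)" if "continuous_on {0..} z" for z d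
    unfolding Gz_def
  proof (rule Linf_on_compose[where S="UNIV \<times> U" and F=G and v="\<lambda>s. (clip (z s), u s)"])
    show "Linf_on {0..d} (\<lambda>s. (clip (z s), u s))" by (intro Linf_on_Pair zL that u) auto
    show "AE t in lebesgue. t \<in> {0..d} \<longrightarrow> (clip (z t), u t) \<in> UNIV \<times> U"
      using uU by eventually_elim auto
  qed (use U Ucl Gc in \<open>auto intro: closed_Times\<close>)
  have om_diff: "om z t - om z c = integral {c..t} (Gz z)" if "continuous_on {0..} z" "0 \<le> c" "c \<le> t" for z c t
    using Henstock_Kurzweil_Integration.integral_combine[OF that(2,3) Linf_on_integrable[OF GL[OF that(1)]]]
    by (simp add: om_def algebra_simps)
  have Gi: "Gz z integrable_on {c..t}" if "continuous_on {0..} z" "0 \<le> c" for z c t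
    by (rule integrable_subinterval_real[OF Linf_on_integrable[OF GL[OF that(1), of t]]]) (use that in auto)
  have wz_piece: "wz z t = y i + integral {ts i..t} (Gz z)" if "continuous_on {0..} z" "ts i \<le> t" "t < ts (Suc i)" for z i t
    using om_diff[OF that(1) ts_nonneg that(2)] idx_eq[OF that(2,3)] by (simp add: wz_def)
  have wL: "Linf_on {0..d} (wz z)" if "continuous_on {0..} z" for z d
  proof (rule piecewise_Linf)
    fix i
    have "Linf_on {ts i..ts (Suc i)} (\<lambda>t. y i + integral {ts i..t} (Gz z))"
      by (intro Linf_on_continuous continuous_intros indefinite_integral_continuous_1 Gi that ts_nonneg)
    then have "Linf_on {ts i..<ts (Suc i)} (\<lambda>t. y i + integral {ts i..t} (Gz z))"
      by (rule Linf_on_subset) auto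
    then show "Linf_on {ts i..<ts (Suc i)} (wz z)"
      by (rule Linf_on_cong) (use wz_piece[OF that] in auto)
  qed
  have FL: "Linf_on {0..d} (Fz z)" if "continuous_on {0..} z" for z d
    unfolding Fz_def
  proof (rule Linf_on_compose[where S="UNIV \<times> UNIV \<times> U" and F=FF and v="\<lambda>s. (clip (z s), wz z s, u s)"])
    show "Linf_on {0..d} (\<lambda>s. (clip (z s), wz z s, u s))" by (intro Linf_on_Pair zL wL that u) auto
    show "AE t in lebesgue. t \<in> {0..d} \<longrightarrow> (clip (z t), wz z t, u t) \<in> UNIV \<times> UNIV \<times> U"
      using uU by eventually_elim auto
  qed (use U Ucl FFc in \<open>auto intro: closed_Times\<close>)
  have cBU: "compact (cball (0::'z) B \<times> U)" using U by (intro compact_Times) auto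
  obtain CG where CG0: "CG > 0" and CG: "\<And>x. x \<in> cball 0 B \<times> U \<Longrightarrow> norm (G x) \<le> CG"
    using lip_compact_image_bounded[OF G cBU] by auto
  obtain L1 where L1: "L1 \<ge> 0" "\<And>x y. x \<in> cball 0 B \<times> U \<Longrightarrow> y \<in> cball 0 B \<times> U \<Longrightarrow> norm (G x - G y) \<le> L1 * norm (x - y)"
    using lip_compact_normE[OF G cBU] by auto
  \<comment> \<open>Bounds \<open>wz\<close> for all \<open>z\<close> at once, because
    \<open>G\<close> sees projected states only; hence \<open>picard\<close> is applied with a
    trivial side condition.\<close>
  define W where "W T = (\<Sum>i\<le>idx T. norm (y i)) + CG * T" for T
  have wz_bound: "norm (wz z t) \<le> W T" if z: "continuous_on {0..} z" and t: "t \<in> {0..T}" for z t T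
  proof -
    have t0: "t \<ge> 0" using t by simp
    note i = idx[OF t0]
    have "norm (integral {ts (idx t)..t} (Gz z)) \<le> CG * (t - ts (idx t))"
    proof (rule norm_integral_le_AE[OF Gi[OF z ts_nonneg]])
      show "((\<lambda>_. CG) has_integral CG * (t - ts (idx t))) {ts (idx t)..t}"
        using has_integral_const_real[of CG "ts (idx t)" t] i by (simp add: mult.commute)
      show "AE s in lebesgue. s \<in> {ts (idx t)..t} \<longrightarrow> norm (Gz z s) \<le> CG"
        using uU
      proof eventually_elim
        case (elim s)
        then show ?case using CG[of "(clip (z s), u s)"] clip_B[of "z s"] ts_nonneg[of "idx t"] by (auto simp: Gz_def)
      qed
    qed
    also have "\<dots> \<le> CG * T" using CG0 t ts_nonneg[of "idx t"] by (intro mult_left_mono) auto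
    finally have 1: "norm (integral {ts (idx t)..t} (Gz z)) \<le> CG * T" .
    have "norm (y (idx t)) \<le> (\<Sum>i\<le>idx T. norm (y i))"
      by (rule member_le_sum) (use idx_mono[of t T] t in auto)
    then show ?thesis unfolding wz_piece[OF z i] W_def
      using 1 norm_triangle_ineq[of "y (idx t)" "integral {ts (idx t)..t} (Gz z)"] by linarith
  qed
  obtain z where z: "continuous_on {0..} z" and zfix: "\<And>t. t \<ge> 0 \<Longrightarrow> \<T> z t = z t"
  proof (rule picard[of \<T> "\<lambda>_. True"])
    fix z :: "real \<Rightarrow> 'z" assume c: "continuous_on {0..} z"
    have "continuous_on {0..d} (\<T> z)" for d
      unfolding \<T>_def by (intro continuous_intros indefinite_integral_continuous_1 Linf_on_integrable FL c)
    then show "continuous_on {0..} (\<T> z)"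
      using continuous_on_time_ivlI[of 0 \<infinity> "\<T> z"] by simp
  next
    fix T :: real assume T: "T > 0"
    define K where "K = cball (0::'z) B \<times> cball (0::'w) (W T) \<times> U"
    have "compact K" unfolding K_def using U by (intro compact_Times) auto
    then obtain L2 where L2: "L2 \<ge> 0" "\<And>x y. x \<in> K \<Longrightarrow> y \<in> K \<Longrightarrow> norm (FF x - FF y) \<le> L2 * norm (x - y)"
      using lip_compact_normE[OF FF, of K] by (auto simp: K_def)
    \<comment> \<open>\<open>L2\<close> meets a difference of \<open>3 / 2\<close> units: one from
      \<open>z\<close>, and one half from \<open>wz\<close>, which has already passed through one
      integration.\<close>
    define L where "L = 2 * L2 + L1 + 1"
    have L: "L > 0" "L1 \<le> L" "L2 * (3 / 2) \<le> L" using L1 L2 by (auto simp: L_def)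
    show "\<exists>k\<ge>0. \<forall>z1 z2 M. continuous_on {0..} z1 \<longrightarrow> continuous_on {0..} z2 \<longrightarrow> True \<longrightarrow> True \<longrightarrow> 0 \<le> M \<longrightarrow>
         (\<forall>s\<in>{0..T}. norm (z1 s - z2 s) \<le> M * exp (k * s)) \<longrightarrow>
         (\<forall>t\<in>{0..T}. norm (\<T> z1 t - \<T> z2 t) \<le> M / 2 * exp (k * t))"
    proof (intro exI[of _ "2 * L"] conjI allI impI ballI)
      fix z1 z2 :: "real \<Rightarrow> 'z" and M t
      assume c: "continuous_on {0..} z1" "continuous_on {0..} z2"
        and M: "0 \<le> M" "\<forall>s\<in>{0..T}. norm (z1 s - z2 s) \<le> M * exp (2 * L * s)" and t: "t \<in> {0..T}"
      have w: "norm (wz z1 s - wz z2 s) \<le> M / 2 * exp (2 * L * s)" if s: "s \<in> {0..T}" for s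
      proof -
        have s0: "s \<ge> 0" using s by simp
        note i = idx[OF s0]
        have "norm (integral {ts (idx s)..s} (\<lambda>q. Gz z1 q - Gz z2 q)) \<le> M / 2 * exp (2 * L * (s - 0))"
        proof (rule volterra_step)
          show "AE q in lebesgue. q \<in> {ts (idx s)..s} \<longrightarrow> norm (Gz z1 q - Gz z2 q) \<le> L * (M * exp (2 * L * (q - 0)))"
            using uU
          proof eventually_elim
            case (elim q)
            show ?case
            proof
              assume q: "q \<in> {ts (idx s)..s}"
              then have q': "q \<in> {0..T}" using s ts_nonneg[of "idx s"] by auto
              have "norm (Gz z1 q - Gz z2 q) \<le> L1 * norm ((clip (z1 q), u q) - (clip (z2 q), u q))"
                unfolding Gz_def by (rule L1(2)) (use elim q' clip_B in auto)
              also have "\<dots> = L1 * norm (clip (z1 q) - clip (z2 q))" by (simp add: norm_Pair)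
              also have "\<dots> \<le> L * (M * exp (2 * L * q))"
                using L L1 M q' order_trans[OF clip_lip] by (intro mult_mono) auto
              finally show "norm (Gz z1 q - Gz z2 q) \<le> L * (M * exp (2 * L * (q - 0)))" by simp
            qed
          qed
        qed (use i L M Gi[OF c(1) ts_nonneg] Gi[OF c(2) ts_nonneg] in \<open>auto intro: integrable_diff\<close>)
        then show ?thesis
          unfolding wz_piece[OF c(1) i] wz_piece[OF c(2) i]
          by (simp add: integral_diff[OF Gi[OF c(1) ts_nonneg] Gi[OF c(2) ts_nonneg]])
      qed
      have Fi: "Fz z1 integrable_on {0..t}" "Fz z2 integrable_on {0..t}"
        by (intro Linf_on_integrable FL c)+
      have "norm (integral {0..t} (\<lambda>q. Fz z1 q - Fz z2 q)) \<le> M / 2 * exp (2 * L * (t - 0))"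
      proof (rule volterra_step)
        show "AE q in lebesgue. q \<in> {0..t} \<longrightarrow> norm (Fz z1 q - Fz z2 q) \<le> L * (M * exp (2 * L * (q - 0)))"
          using uU
        proof eventually_elim
          case (elim q)
          show ?case
          proof
            assume q: "q \<in> {0..t}"
            then have q': "q \<in> {0..T}" using t by auto
            have m: "(clip (z1 q), wz z1 q, u q) \<in> K" "(clip (z2 q), wz z2 q, u q) \<in> K"
              using elim q' clip_B wz_bound[OF c(1) q'] wz_bound[OF c(2) q'] by (auto simp: K_def)
            have "norm (Fz z1 q - Fz z2 q) \<le> L2 * norm ((clip (z1 q), wz z1 q, u q) - (clip (z2 q), wz z2 q, u q))"
              unfolding Fz_def by (rule L2(2)[OF m])
            also have "norm ((clip (z1 q), wz z1 q, u q) - (clip (z2 q), wz z2 q, u q)) \<le> norm (clip (z1 q) - clip (z2 q)) + norm (wz z1 q - wz z2 q)"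
              using norm_Pair_le[of "clip (z1 q) - clip (z2 q)" "(wz z1 q - wz z2 q, 0::'u)"] by (simp add: norm_Pair[of _ 0])
            also have "\<dots> \<le> M * exp (2 * L * q) + M / 2 * exp (2 * L * q)"
              using w[OF q'] M q' by (intro add_mono order_trans[OF clip_lip]) auto
            also have "\<dots> = 3 / 2 * (M * exp (2 * L * q))" by simp
            finally have "norm (Fz z1 q - Fz z2 q) \<le> L2 * (3 / 2 * (M * exp (2 * L * q)))"
              using L2(1) by (simp add: mult_left_mono)
            also have "\<dots> = (L2 * (3 / 2)) * (M * exp (2 * L * q))" by simp
            also have "\<dots> \<le> L * (M * exp (2 * L * q))"
              using L M by (intro mult_right_mono) auto
            finally show "norm (Fz z1 q - Fz z2 q) \<le> L * (M * exp (2 * L * (q - 0)))" by simp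
          qed
        qed
      qed (use t L M Fi in \<open>auto intro: integrable_diff\<close>)
      then show "norm (\<T> z1 t - \<T> z2 t) \<le> M / 2 * exp (2 * L * t)"
        using Fi by (simp add: \<T>_def integral_diff)
    qed (use L in auto)
  qed auto
  have z_0: "z 0 = z0" using zfix[of 0] by (simp add: \<T>_def)
  have zs: "solves_ae_on (time_ivl 0 \<infinity>) (Fz z) z"
    by (rule solves_ae_on_of_integral[where ?y0.0=z0]) (use zfix FL[OF z] in \<open>auto simp: \<T>_def\<close>)
  have zb: "norm (z t) < B" if t: "t \<ge> 0" for t
  proof (rule ccontr)
    assume neg: "\<not> norm (z t) < B"
    \<comment> \<open>The least element of \<open>S\<close> is the first time the norm reaches
      \<open>B\<close>. Until then the projection is inactive, so \<open>V\<close> is at most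
      \<open>M\<close> up to and including that time, and then the norm is below
      \<open>B\<close>.\<close>
    define S where "S = {0..t} \<inter> (\<lambda>s. norm (z s)) -` {B..}"
    have c: "continuous_on {0..t} (\<lambda>s. norm (z s))"
      by (intro continuous_intros continuous_on_subset[OF z]) auto
    have "closed S" unfolding S_def by (rule continuous_closed_preimage[OF c]) auto
    moreover have "bounded S" by (rule bounded_subset[of "{0..t}"]) (auto simp: S_def)
    ultimately have "compact S" by (simp add: compact_eq_bounded_closed)
    moreover have "t \<in> S" using neg t by (auto simp: S_def)
    ultimately obtain q where q: "q \<in> S" "\<And>s. s \<in> S \<Longrightarrow> q \<le> s"
      using compact_attains_inf[of S] by blast
    have q0: "0 \<le> q" "q \<le> t" "norm (z q) \<ge> B" using q by (auto simp: S_def)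
    have lt: "norm (z s) < B" if "s \<in> {0..q}" "s \<noteq> q" for s
    proof (rule ccontr)
      assume "\<not> norm (z s) < B"
      then have "s \<in> S" using that q0 by (auto simp: S_def)
      then show False using q(2) that by force
    qed
    have "solves_ae_on {0..} (\<lambda>s. V' (z s) (Fz z s)) (\<lambda>s. V (z s))"
      using solves_ae_on_compose[OF zs V(2) V(1)] by simp
    then have "V (z q) \<le> max (V (z 0)) M"
    proof (rule solves_scalar_invariant[OF _ q0(1)])
      show "AE s in lebesgue. s \<in> {0..q} \<longrightarrow> M < V (z s) \<longrightarrow> V' (z s) (Fz z s) \<le> 0"
        using uU AE_lebesgue_neq[of q]
      proof eventually_elim
        case (elim s)
        show ?case
        proof (intro impI)
          assume s: "s \<in> {0..q}" and MV: "M < V (z s)"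
          have "clip (z s) = z s" using lt[OF s] elim by (intro clip_id) auto
          then show "V' (z s) (Fz z s) \<le> 0"
            unfolding Fz_def using dec[OF _ MV] elim s by auto
        qed
      qed
    qed auto
    then have "V (z q) \<le> M" using M z_0 by simp
    then show False using M(2) q0 by force
  qed
  have cz: "clip (z t) = z t" if "t \<ge> 0" for t using zb[OF that] by (intro clip_id) auto
  show ?thesis
  proof (rule that[of z "wz z"])
    show "z 0 = z0" by (rule z_0)
    show "solves_ae_on {0..} (\<lambda>t. FF (z t, wz z t, u t)) z"
    proof (rule solves_ae_on_cong_rhs)
      show "solves_ae_on {0..} (Fz z) z" using zs by simp
    qed (auto simp: Fz_def cz)
    show "wz z (ts i) = y i" for i
      using wz_piece[OF z, of i "ts i"] ts_less_iff[of i "Suc i"] by simp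
    show "solves_ae_on {ts i..<ts (Suc i)} (\<lambda>t. G (z t, u t)) (wz z)" for i
    proof -
      have "solves_ae_on (time_ivl (ts i) (ts (Suc i))) (Gz z) (wz z)"
      proof (rule solves_ae_on_of_integral)
        show "wz z t = y i + integral {ts i..t} (Gz z)" if "t \<in> time_ivl (ts i) (ts (Suc i))" for t
          using wz_piece[OF z] that by simp
        show "Linf_on {ts i..d} (Gz z)" for d
          by (rule Linf_on_interval_subset[OF GL[OF z, of d] ts_nonneg]) simp
      qed
      then have "solves_ae_on {ts i..<ts (Suc i)} (Gz z) (wz z)" by simp
      then show ?thesis
        by (rule solves_ae_on_cong_rhs) (use ts_nonneg[of i] in \<open>auto simp: Gz_def cz\<close>)
    qed
  qed
qed

end

section \<open>Well-posedness of the closed loop\<close>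

text \<open>Induction over the sampling intervals gives agreement strictly before a sampling time; a
  signal without reset carries it over by continuity.\<close>

lemma continuous_eq_at_end:
  fixes y1 y2 :: "real \<Rightarrow> 'a::real_normed_vector"
  assumes "continuous_on {a..d} y1" "continuous_on {a..d} y2" "a < d" "\<And>t. t \<in> {a..<d} \<Longrightarrow> y1 t = y2 t"
  shows "y1 d = y2 d"
proof -
  have c: "continuous_on {a..d} (\<lambda>t. y1 t - y2 t)" by (intro continuous_intros assms)
  have "closure {a..<d} = {a..d}" using assms(3) by simp
  then have "y1 d - y2 d = 0"
    using continuous_constant_on_closure[of "{a..<d}" "\<lambda>t. y1 t - y2 t" 0 d] c assms by auto
  then show ?thesis by simp
qed

lemma solves_ae_on_cong_on:
  assumes "solves_ae_on J F y" "\<And>t. t \<in> J \<Longrightarrow> F t = G t" shows "solves_ae_on J G y"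
  by (rule solves_ae_on_cong_rhs[OF assms(1)]) (use assms(2) in \<open>auto intro!: always_eventually\<close>)

lemma time_ivl_mono: "T \<le> T' \<Longrightarrow> time_ivl a T \<subseteq> time_ivl a T'"
  by (auto simp: time_ivl_def)

text \<open>What well-posedness uses of the data: regularity, completeness, saturation, and
  nonincrease of \<open>V\<close> above \<open>b\<close>. The quantitative hypotheses enter with
  \<open>stable_loop\<close>.\<close>

locale loop = sampling ts for ts :: "nat \<Rightarrow> real" +
  fixes \<tau> r \<delta> Lk b K :: real and N :: nat
    and ft :: "real^'n::finite \<Rightarrow> real^'m::finite \<Rightarrow> real^'n" and h :: "real^'n \<Rightarrow> real^'k::finite"
    and f :: "real^'n \<Rightarrow> real^'m \<Rightarrow> real^'n" and khat :: "real^'n \<Rightarrow> real^'k \<Rightarrow> real^'m \<Rightarrow> real^'n"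
    and q :: "real \<Rightarrow> real" and \<psi> :: "real^'n \<Rightarrow> real" and kk :: "real^'n \<Rightarrow> real^'m"
    and a2 :: "real^'l::finite \<Rightarrow> real^'m" and g :: "real^'l \<Rightarrow> real^'m \<Rightarrow> real^'l"
    and \<Phi> :: "real^'k \<Rightarrow> (real \<Rightarrow> real^'m) \<Rightarrow> real^'l" and U :: "(real^'m) set" and V :: "real^'n \<Rightarrow> real"
    and \<xi>0 :: "nat \<Rightarrow> real \<Rightarrow> real^'n" and z0 :: "real^'n" and w0 :: "real^'k" and \<theta>0 :: "real^'l"
    and x0 :: "real \<Rightarrow> real^'n" and u0 v0 :: "real \<Rightarrow> real^'m"
  assumes tau: "\<tau> > 0" and r: "r \<ge> 0" and N: "N > 0" and delta: "\<delta> = (r + \<tau>) / real N"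
    and ft_lip: "lip_compact UNIV (\<lambda>(x, v). ft x v)" and ft_complete: "forward_complete ft \<tau> UNIV"
    and f_lip: "lip_compact UNIV (\<lambda>(x, u). f x u)"
    and khat_lip: "lip_compact (UNIV \<times> UNIV \<times> U) (\<lambda>(z, y, u). khat z y u)"
    and hf_lip: "lip_compact UNIV (\<lambda>(z, u). jacobian h (at z) *v f z u)"
    and sat_lip: "lip_compact UNIV (\<lambda>(z, \<xi> :: real^'n). q (norm \<xi> / \<psi> z) *\<^sub>R \<xi>)"
    and sat_bound: "\<And>z (\<xi> :: real^'n). norm (q (norm \<xi> / \<psi> z) *\<^sub>R \<xi>) \<le> K * \<psi> z"
    and psi_cont: "continuous_on UNIV \<psi>"
    and U_compact: "compact U" and U_0: "0 \<in> U"
    and kk_lip: "Lk-lipschitz_on UNIV kk" and kk_U: "\<And>x. kk x \<in> U"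
    and a2_lip: "lip_compact UNIV a2" and g_lip: "lip_compact UNIV (\<lambda>(\<theta>, v). g \<theta> v)"
    and g_complete: "forward_complete (\<lambda>\<theta> u. g \<theta> (a2 \<theta> + u)) 0 U"
    and Phi: "\<And>y. mapping_on_Linf {-\<tau>-r..0} (\<Phi> y)"
    and V_der: "\<And>x. (V has_derivative (\<lambda>d. grad V x \<bullet> d)) (at x)" and V_lip: "lip_compact UNIV V"
    and V_bdd: "\<And>M. bounded {x. V x \<le> M}"
    and V_dec: "\<And>z y u. u \<in> U \<Longrightarrow> b \<le> V z \<Longrightarrow> grad V z \<bullet> (f z u + khat z y u) \<le> 0"
    and xi0_Linf: "\<And>j. j \<in> {1..N} \<Longrightarrow> Linf_on {-\<delta>..<0} (\<xi>0 j)"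
    and u0_Linf: "Linf_on {-r-\<tau>..<0} u0" and u0_U: "AE s in lebesgue. s \<in> {-r-\<tau>..<0} \<longrightarrow> u0 s \<in> U"
    and v0_Linf: "Linf_on {-r-\<tau>..<0} v0"
begin

text \<open>The inputs \<open>ui, vi\<close> applied to the delayed terms are decoupled from the signals \<open>u, v\<close> the loop
  produces, so that the closed loop is the fixed point \<open>ui = u, vi = v\<close>. The last predictor keeps \<open>u\<close>: its
  predictor_window ends at the present time.\<close>

definition open_loop :: "ereal \<Rightarrow> (real \<Rightarrow> real^'m) \<Rightarrow> (real \<Rightarrow> real^'m) \<Rightarrow>
   (real \<Rightarrow> real^'n) \<Rightarrow> (real \<Rightarrow> real^'n) \<Rightarrow> (real \<Rightarrow> real^'k) \<Rightarrow> (real \<Rightarrow> real^'l) \<Rightarrow>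
   (nat \<Rightarrow> real \<Rightarrow> real^'n) \<Rightarrow> (real \<Rightarrow> real^'m) \<Rightarrow> (real \<Rightarrow> real^'m) \<Rightarrow> bool" where
  "open_loop T ui vi x z w \<theta> \<xi> u v \<longleftrightarrow>
     Linf_loc_on (time_ivl (-r-\<tau>) T) u \<and>
     Linf_loc_on (time_ivl (-r-\<tau>) T) v \<and>
     (\<forall>j\<in>{1..N}. Linf_loc_on (time_ivl (-\<delta>) T) (\<xi> j)) \<and>
     (\<forall>s\<in>{-r..0}. x s = x0 s) \<and> z 0 = z0 \<and> w 0 = w0 \<and> \<theta> 0 = \<theta>0 \<and>
     (\<forall>j\<in>{1..N}. \<forall>s\<in>{-\<delta>..<0}. \<xi> j s = \<xi>0 j s) \<and>
     (\<forall>s\<in>{-r-\<tau>..<0}. u s = u0 s \<and> v s = v0 s) \<and>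
     solves_ae_on (time_ivl 0 T) (\<lambda>t. ft (x t) (vi (t - \<tau>))) x \<and>
     solves_ae_on (time_ivl 0 T)
       (\<lambda>t. f (z t) (ui (t - r - \<tau>)) + khat (z t) (w t) (ui (t - r - \<tau>))) z \<and>
     (\<forall>i. solves_ae_on ({ts i..<ts (Suc i)} \<inter> time_ivl 0 T)
       (\<lambda>t. jacobian h (at (z t)) *v f (z t) (ui (t - r - \<tau>))) w) \<and>
     (\<forall>i\<ge>1. ts i \<in> time_ivl 0 T \<longrightarrow> w (ts i) = h (x (ts i - r))) \<and>
     (\<forall>t\<in>time_ivl 0 T. \<xi> 0 t = z t) \<and>
     (\<forall>t\<in>time_ivl 0 T. \<forall>j\<in>{1..N}.
        \<xi> j t = q (norm (\<xi> (j-1) t) / \<psi> (z t)) *\<^sub>R \<xi> (j-1) t +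
          (LINT s:{0..\<delta>}|lebesgue.
             f (q (norm (\<xi> j (t + s - \<delta>)) / \<psi> (z t)) *\<^sub>R \<xi> j (t + s - \<delta>))
               ((if j = N then u else ui) (t + (real j - 1) * \<delta> - \<tau> - r + s)))) \<and>
     (\<forall>t\<in>time_ivl 0 T. u t = kk (\<xi> N t)) \<and>
     (\<forall>t\<in>time_ivl 0 T. v t = u t + a2 (\<theta> t)) \<and>
     (\<forall>i. solves_ae_on ({ts i..<ts (Suc i)} \<inter> time_ivl 0 T)
       (\<lambda>t. g (\<theta> t) (a2 (\<theta> t) + u t)) \<theta>) \<and>
     (\<forall>i\<ge>1. ts i \<in> time_ivl 0 T \<longrightarrow> \<theta> (ts i) = \<Phi> (h (x (ts i - r))) (\<lambda>s. v (ts i + s)))"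

lemma
  assumes "open_loop T ui vi x z w \<theta> \<xi> u v"
  shows open_loop_Linf_u: "Linf_loc_on (time_ivl (-r-\<tau>) T) u"
    and open_loop_Linf_v: "Linf_loc_on (time_ivl (-r-\<tau>) T) v"
    and open_loop_Linf_xi: "(\<forall>j\<in>{1..N}. Linf_loc_on (time_ivl (-\<delta>) T) (\<xi> j))"
    and open_loop_x_init: "(\<forall>s\<in>{-r..0}. x s = x0 s)"
    and open_loop_z_init: "z 0 = z0"
    and open_loop_w_init: "w 0 = w0"
    and open_loop_th_init: "\<theta> 0 = \<theta>0"
    and open_loop_xi_init: "(\<forall>j\<in>{1..N}. \<forall>s\<in>{-\<delta>..<0}. \<xi> j s = \<xi>0 j s)"
    and open_loop_uv_init: "(\<forall>s\<in>{-r-\<tau>..<0}. u s = u0 s \<and> v s = v0 s)"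
    and open_loop_x_ode: "solves_ae_on (time_ivl 0 T) (\<lambda>t. ft (x t) (vi (t - \<tau>))) x"
    and open_loop_z_ode: "solves_ae_on (time_ivl 0 T)
       (\<lambda>t. f (z t) (ui (t - r - \<tau>)) + khat (z t) (w t) (ui (t - r - \<tau>))) z"
    and open_loop_w_ode: "(\<forall>i. solves_ae_on ({ts i..<ts (Suc i)} \<inter> time_ivl 0 T)
       (\<lambda>t. jacobian h (at (z t)) *v f (z t) (ui (t - r - \<tau>))) w)"
    and open_loop_w_reset: "(\<forall>i\<ge>1. ts i \<in> time_ivl 0 T \<longrightarrow> w (ts i) = h (x (ts i - r)))"
    and open_loop_xi_0: "(\<forall>t\<in>time_ivl 0 T. \<xi> 0 t = z t)"
    and open_loop_xi_eq: "(\<forall>t\<in>time_ivl 0 T. \<forall>j\<in>{1..N}.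
        \<xi> j t = q (norm (\<xi> (j-1) t) / \<psi> (z t)) *\<^sub>R \<xi> (j-1) t +
          (LINT s:{0..\<delta>}|lebesgue.
             f (q (norm (\<xi> j (t + s - \<delta>)) / \<psi> (z t)) *\<^sub>R \<xi> j (t + s - \<delta>))
               ((if j = N then u else ui) (t + (real j - 1) * \<delta> - \<tau> - r + s))))"
    and open_loop_u_eq: "(\<forall>t\<in>time_ivl 0 T. u t = kk (\<xi> N t))"
    and open_loop_v_eq: "(\<forall>t\<in>time_ivl 0 T. v t = u t + a2 (\<theta> t))"
    and open_loop_th_ode: "(\<forall>i. solves_ae_on ({ts i..<ts (Suc i)} \<inter> time_ivl 0 T)
       (\<lambda>t. g (\<theta> t) (a2 (\<theta> t) + u t)) \<theta>)"
    and open_loop_th_reset: "(\<forall>i\<ge>1. ts i \<in> time_ivl 0 T \<longrightarrow> \<theta> (ts i) = \<Phi> (h (x (ts i - r))) (\<lambda>s. v (ts i + s)))"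
  using assms unfolding open_loop_def by - (elim conjE, assumption)+

abbreviation "closed_loop \<equiv> closed_loop_solution ft h f khat q \<psi> kk a2 g \<Phi> \<tau> r \<delta> N ts \<xi>0 z0 w0 \<theta>0 x0 u0 v0"

lemma closed_loop_iff_open_loop: "closed_loop T x z w \<theta> \<xi> u v \<longleftrightarrow> open_loop T u v x z w \<theta> \<xi> u v"
  unfolding closed_loop_solution_def open_loop_def if_cancel ..

text \<open>Membership in \<open>U\<close> is asked for almost everywhere only, since no more is
  known of the initial function \<open>u0\<close>.\<close>

definition admissible :: "(real \<Rightarrow> real^'m) \<Rightarrow> (real \<Rightarrow> real^'m) \<Rightarrow> bool" where
  "admissible ui vi \<longleftrightarrow> (\<forall>d. Linf_on {-r-\<tau>..d} ui \<and> Linf_on {-r-\<tau>..d} vi) \<and> (AE t in lebesgue. t \<ge> -r-\<tau> \<longrightarrow> ui t \<in> U)"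

lemma delta_pos: "\<delta> > 0" and N_delta: "real N * \<delta> = r + \<tau>" and delta_le: "\<delta> \<le> r + \<tau>"
proof -
  show "\<delta> > 0" using tau r N by (simp add: delta)
  show "real N * \<delta> = r + \<tau>" using N by (simp add: delta)
  have "1 * \<delta> \<le> real N * \<delta>" using \<open>\<delta> > 0\<close> N by (intro mult_right_mono) auto
  then show "\<delta> \<le> r + \<tau>" using \<open>real N * \<delta> = r + \<tau>\<close> by simp
qed

lemma j_delta:
  assumes "j \<in> {1..N}" shows "(real j - 1) * \<delta> \<ge> 0" "real j * \<delta> \<le> r + \<tau>" "j < N \<Longrightarrow> real j * \<delta> + \<delta> \<le> r + \<tau>"
proof -
  show "(real j - 1) * \<delta> \<ge> 0" using assms delta_pos by auto
  have "real j * \<delta> \<le> real N * \<delta>" using assms delta_pos by (intro mult_right_mono) auto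
  then show "real j * \<delta> \<le> r + \<tau>" by (simp add: N_delta)
  assume "j < N"
  then have "(real j + 1) * \<delta> \<le> real N * \<delta>" using delta_pos by (intro mult_right_mono) auto
  then show "real j * \<delta> + \<delta> \<le> r + \<tau>" unfolding N_delta by (simp add: distrib_right)
qed

lemma U_closed: "closed U"
  using U_compact compact_imp_closed by blast

lemma f_cont: "continuous_on UNIV (\<lambda>(x, u). f x u)"
  by (rule lip_compact_continuous_on[OF f_lip]) simp

definition window_field :: "(real^'n) \<times> (real^'n) \<times> (real^'m) \<Rightarrow> real^'n" where
  "window_field = (\<lambda>(z, \<xi>, u). f (q (norm \<xi> / \<psi> z) *\<^sub>R \<xi>) u)"

text \<open>For \<open>j = N\<close> the shift \<open>N * \<delta> - \<tau> - r\<close> is zero: the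
  control is read at \<open>\<sigma>\<close> itself, and from time 0 on it is the feedback of the
  unknown. For \<open>j < N\<close> it is read at least \<open>\<delta>\<close> before the end of
  the window, so the given input \<open>ui\<close> can be used.\<close>

definition window_input :: "(real \<Rightarrow> real^'m) \<Rightarrow> nat \<Rightarrow> real \<Rightarrow> real^'n \<Rightarrow> real^'m" where
  "window_input ui j \<sigma> \<xi> = (if j = N then (if \<sigma> < 0 then u0 \<sigma> else kk \<xi>) else ui (\<sigma> + (real j * \<delta> - \<tau> - r)))"

lemma window_field_lip: "lip_compact UNIV window_field"
proof -
  have 1: "lip_compact UNIV (\<lambda>x :: (real^'n) \<times> (real^'n) \<times> (real^'m). (fst x, fst (snd x)))"
    by (intro lip_compact_Pair lip_compact_fst lip_compact_compose_UNIV[OF lip_compact_fst lip_compact_snd])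
  have 2: "lip_compact UNIV (\<lambda>x :: (real^'n) \<times> (real^'n) \<times> (real^'m). snd (snd x))"
    by (rule lip_compact_compose_UNIV[OF lip_compact_snd lip_compact_snd])
  note lip_compact_compose_UNIV[OF f_lip lip_compact_Pair[OF lip_compact_compose_UNIV[OF sat_lip 1] 2]]
  then show ?thesis by (simp add: window_field_def case_prod_unfold)
qed

lemma window_field_bound: "\<exists>C. \<forall>z \<xi>. \<forall>u\<in>U. norm z \<le> B \<longrightarrow> norm (window_field (z, \<xi>, u)) \<le> C"
proof -
  have "bounded (\<psi> ` cball 0 B)"
    by (intro compact_imp_bounded compact_continuous_image continuous_on_subset[OF psi_cont]) auto
  then obtain P where P: "\<forall>y\<in>\<psi> ` cball 0 B. norm y \<le> P" unfolding bounded_iff by blast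
  have "compact (cball (0::real^'n) (\<bar>K\<bar> * P) \<times> U)" using U_compact by (intro compact_Times) auto
  then have "bounded ((\<lambda>(x, u). f x u) ` (cball (0::real^'n) (\<bar>K\<bar> * P) \<times> U))"
    by (intro compact_imp_bounded compact_continuous_image continuous_on_subset[OF f_cont]) auto
  then obtain C where C: "\<forall>y\<in>(\<lambda>(x, u). f x u) ` (cball (0::real^'n) (\<bar>K\<bar> * P) \<times> U). norm y \<le> C"
    unfolding bounded_iff by blast
  have "norm (window_field (z, \<xi>, u)) \<le> C" if "u \<in> U" "norm z \<le> B" for z \<xi> u
  proof -
    have "\<bar>\<psi> z\<bar> \<le> P" using P that by simp
    then have "K * \<psi> z \<le> \<bar>K\<bar> * P"
      using abs_ge_self[of "K * \<psi> z"] mult_left_mono[of "\<bar>\<psi> z\<bar>" P "\<bar>K\<bar>"] by (simp add: abs_mult)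
    then have "norm (q (norm \<xi> / \<psi> z) *\<^sub>R \<xi>) \<le> \<bar>K\<bar> * P" using sat_bound[where z=z and \<xi>=\<xi>] by linarith
    then have "(q (norm \<xi> / \<psi> z) *\<^sub>R \<xi>, u) \<in> cball 0 (\<bar>K\<bar> * P) \<times> U" using that by simp
    then have "norm ((\<lambda>(x, u). f x u) (q (norm \<xi> / \<psi> z) *\<^sub>R \<xi>, u)) \<le> C" using C by blast
    then show ?thesis by (simp add: window_field_def)
  qed
  then show ?thesis by blast
qed

lemma predictor_window:
  assumes ad: "admissible ui vi" and j: "j \<in> {1..N}" shows "window_equation window_field (window_input ui j) U \<delta> Lk"
proof
  have Lk0: "Lk \<ge> 0" using lipschitz_on_nonneg[OF kk_lip] .
  note jd = j_delta[OF j]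
  show "norm (window_input ui j \<sigma> \<xi> - window_input ui j \<sigma> \<xi>') \<le> Lk * norm (\<xi> - \<xi>')" for \<sigma> \<xi> \<xi>'
    using lipschitz_onD[OF kk_lip, of \<xi> \<xi>'] Lk0 by (simp add: window_input_def dist_norm)
  show "AE \<sigma> in lebesgue. - \<delta> \<le> \<sigma> \<longrightarrow> (\<forall>\<xi>. window_input ui j \<sigma> \<xi> \<in> U)"
  proof -
    have "AE t in lebesgue. t \<ge> -r-\<tau> \<longrightarrow> ui t \<in> U" using ad by (simp add: admissible_def)
    from AE_lebesgue_shift[OF this, of "real j * \<delta> - \<tau> - r"] u0_U show ?thesis
    proof eventually_elim
      case (elim \<sigma>)
      show ?case
      proof (intro impI allI)
        fix \<xi> assume "- \<delta> \<le> \<sigma>"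
        then show "window_input ui j \<sigma> \<xi> \<in> U"
          using elim jd delta_le kk_U by (auto simp: window_input_def algebra_simps)
      qed
    qed
  qed
  show "Linf_on {a..b} (\<lambda>\<sigma>. window_input ui j \<sigma> (\<xi> \<sigma>))" if a: "- \<delta> \<le> a" and xi: "Linf_on {a..b} \<xi>" for a b \<xi>
  proof (cases "j = N")
    case False
    have "Linf_on {-r-\<tau>..b + (real j * \<delta> - \<tau> - r)} ui" using ad by (simp add: admissible_def)
    then have "Linf_on {a..b} (\<lambda>\<sigma>. ui (\<sigma> + (real j * \<delta> - \<tau> - r)))"
      by (rule Linf_on_shift) (use a jd in \<open>auto simp: algebra_simps\<close>)
    then show ?thesis using False by (simp add: window_input_def)
  next
    case True
    have 1: "Linf_on ({a..b} \<inter> {..<0}) (\<lambda>\<sigma>. window_input ui j \<sigma> (\<xi> \<sigma>))"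
      by (rule Linf_on_cong[OF Linf_on_subset[OF u0_Linf]]) (use a True delta_le in \<open>auto simp: window_input_def\<close>)
    have "Linf_on {a..b} (\<lambda>\<sigma>. kk (\<xi> \<sigma>))"
      by (rule Linf_on_compose[OF xi, where S=UNIV]) (use lipschitz_on_continuous_on[OF kk_lip] in auto)
    then have "Linf_on ({a..b} \<inter> {0..}) (\<lambda>\<sigma>. kk (\<xi> \<sigma>))" by (rule Linf_on_subset) auto
    then have 2: "Linf_on ({a..b} \<inter> {0..}) (\<lambda>\<sigma>. window_input ui j \<sigma> (\<xi> \<sigma>))"
      by (rule Linf_on_cong) (use True in \<open>auto simp: window_input_def\<close>)
    have "Linf_on (({a..b} \<inter> {..<0}) \<union> ({a..b} \<inter> {0..})) (\<lambda>\<sigma>. window_input ui j \<sigma> (\<xi> \<sigma>))"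
      by (rule Linf_on_Un[OF 1 2]) auto
    moreover have "({a..b} \<inter> {..<0}) \<union> ({a..b} \<inter> {0..}) = {a..b}" by auto
    ultimately show ?thesis by simp
  qed
qed (use delta_pos window_field_lip window_field_bound U_compact in auto)

text \<open>Translates the integral in the loop into \<open>window_equation\<close>: with
  \<open>\<sigma> = t + s - \<delta>\<close> the control is read at
  \<open>\<sigma> + (j * \<delta> - \<tau> - r)\<close>, which is \<open>\<sigma>\<close> for
  \<open>j = N\<close>.\<close>

lemma window_rhs:
  assumes u: "\<And>s. s \<in> {-r-\<tau>..<0} \<Longrightarrow> u s = u0 s" "\<And>s. 0 \<le> s \<Longrightarrow> s \<le> t \<Longrightarrow> u s = kk (\<xi> N s)"
    and j: "j \<in> {1..N}" and t: "t \<ge> 0" and ad: "admissible ui vi"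
  shows "(LINT s:{0..\<delta>}|lebesgue.
             f (q (norm (\<xi> j (t + s - \<delta>)) / \<psi> z) *\<^sub>R \<xi> j (t + s - \<delta>))
               ((if j = N then u else ui) (t + (real j - 1) * \<delta> - \<tau> - r + s))) =
    (LINT s:{0..\<delta>}|lebesgue. window_equation.integrand window_field (window_input ui j) (\<xi> j) z (t + s - \<delta>))"
proof (rule set_lebesgue_integral_cong)
  show "\<forall>s. s \<in> {0..\<delta>} \<longrightarrow> f (q (norm (\<xi> j (t + s - \<delta>)) / \<psi> z) *\<^sub>R \<xi> j (t + s - \<delta>))
               ((if j = N then u else ui) (t + (real j - 1) * \<delta> - \<tau> - r + s)) =
      window_equation.integrand window_field (window_input ui j) (\<xi> j) z (t + s - \<delta>)"
  proof (intro allI impI)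
    fix s assume s: "s \<in> {0..\<delta>}"
    have "(if j = N then u else ui) (t + (real j - 1) * \<delta> - \<tau> - r + s) = window_input ui j (t + s - \<delta>) (\<xi> j (t + s - \<delta>))"
    proof (cases "j = N")
      case True
      have e: "t + (real j - 1) * \<delta> - \<tau> - r + s = t + s - \<delta>"
        using True N_delta by (simp add: algebra_simps)
      show ?thesis unfolding e using True u[of "t + s - \<delta>"] s t delta_le by (simp add: window_input_def)
    next
      case False
      have e: "t + (real j - 1) * \<delta> - \<tau> - r + s = t + s - \<delta> + (real j * \<delta> - \<tau> - r)"
        by (simp add: algebra_simps)
      show ?thesis unfolding e using False by (simp add: window_input_def)
    qed
    then show "f (q (norm (\<xi> j (t + s - \<delta>)) / \<psi> z) *\<^sub>R \<xi> j (t + s - \<delta>))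
               ((if j = N then u else ui) (t + (real j - 1) * \<delta> - \<tau> - r + s)) =
      window_equation.integrand window_field (window_input ui j) (\<xi> j) z (t + s - \<delta>)"
      unfolding window_equation.integrand_def[OF predictor_window[OF ad j]] by (simp add: window_field_def)
  qed
qed simp

section \<open>Causality and uniqueness of the open-loop response\<close>

lemma open_loop_restrict:
  assumes "open_loop T ui vi x z w \<theta> \<xi> u v" "T' \<le> T" shows "open_loop T' ui vi x z w \<theta> \<xi> u v"
proof -
  note O = assms(1)
  have s0: "time_ivl 0 T' \<subseteq> time_ivl 0 T" and s1: "time_ivl (-r-\<tau>) T' \<subseteq> time_ivl (-r-\<tau>) T"
    and s2: "time_ivl (-\<delta>) T' \<subseteq> time_ivl (-\<delta>) T" using time_ivl_mono[OF assms(2)] by auto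
  have m: "Linf_loc_on S y \<Longrightarrow> S' \<subseteq> S \<Longrightarrow> Linf_loc_on S' y" for S S' and y :: "real \<Rightarrow> 'q::euclidean_space"
    unfolding Linf_loc_on_def by blast
  show ?thesis
    unfolding open_loop_def
  proof (intro conjI)
    show "\<forall>j\<in>{1..N}. Linf_loc_on (time_ivl (-\<delta>) T') (\<xi> j)" using open_loop_Linf_xi[OF O] m[OF _ s2] by blast
    show "\<forall>i. solves_ae_on ({ts i..<ts (Suc i)} \<inter> time_ivl 0 T') (\<lambda>t. jacobian h (at (z t)) *v f (z t) (ui (t - r - \<tau>))) w"
      using open_loop_w_ode[OF O] solves_ae_on_subset s0 by (meson Int_mono order_refl)
    show "\<forall>i. solves_ae_on ({ts i..<ts (Suc i)} \<inter> time_ivl 0 T') (\<lambda>t. g (\<theta> t) (a2 (\<theta> t) + u t)) \<theta>"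
      using open_loop_th_ode[OF O] solves_ae_on_subset s0 by (meson Int_mono order_refl)
    show "\<forall>i\<ge>1. ts i \<in> time_ivl 0 T' \<longrightarrow> w (ts i) = h (x (ts i - r))" using open_loop_w_reset[OF O] s0 by blast
    show "\<forall>i\<ge>1. ts i \<in> time_ivl 0 T' \<longrightarrow> \<theta> (ts i) = \<Phi> (h (x (ts i - r))) (\<lambda>s. v (ts i + s))" using open_loop_th_reset[OF O] s0 by blast
    show "\<forall>t\<in>time_ivl 0 T'. \<xi> 0 t = z t" using open_loop_xi_0[OF O] s0 by blast
    show "\<forall>t\<in>time_ivl 0 T'. u t = kk (\<xi> N t)" using open_loop_u_eq[OF O] s0 by blast
    show "\<forall>t\<in>time_ivl 0 T'. v t = u t + a2 (\<theta> t)" using open_loop_v_eq[OF O] s0 by blast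
    show "\<forall>t\<in>time_ivl 0 T'. \<forall>j\<in>{1..N}. \<xi> j t = q (norm (\<xi> (j-1) t) / \<psi> (z t)) *\<^sub>R \<xi> (j-1) t +
          (LINT s:{0..\<delta>}|lebesgue. f (q (norm (\<xi> j (t + s - \<delta>)) / \<psi> (z t)) *\<^sub>R \<xi> j (t + s - \<delta>))
               ((if j = N then u else ui) (t + (real j - 1) * \<delta> - \<tau> - r + s)))"
      by (rule ballI, rule bspec[OF open_loop_xi_eq[OF O]]) (use s0 in blast)
  qed (rule m[OF open_loop_Linf_u[OF O] s1] m[OF open_loop_Linf_v[OF O] s1] open_loop_x_init[OF O] open_loop_z_init[OF O] open_loop_w_init[OF O]
      open_loop_th_init[OF O] open_loop_xi_init[OF O] open_loop_uv_init[OF O] solves_ae_on_subset[OF open_loop_x_ode[OF O] s0] solves_ae_on_subset[OF open_loop_z_ode[OF O] s0])+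
qed

text \<open>Least delay with which an input acts: \<open>\<tau>\<close> in the plant,
  \<open>r + \<tau>\<close> in the observer, at least \<open>\<delta>\<close> in the predictors
  before the last.\<close>

definition lag :: real where "lag = min \<tau> \<delta>"

lemma lag: "lag > 0" "lag \<le> \<tau>" "lag \<le> \<delta>"
  using tau delta_pos by (auto simp: lag_def)

text \<open>Strict causality: every input value read before time \<open>T\<close> is at least
  \<open>lag\<close> old.\<close>

lemma open_loop_cong_input:
  assumes O: "open_loop T ui vi x z w \<theta> \<xi> u v"
    and eq: "\<And>s. s \<ge> -r-\<tau> \<Longrightarrow> ereal (s + lag) < T \<Longrightarrow> ui' s = ui s \<and> vi' s = vi s"
  shows "open_loop T ui' vi' x z w \<theta> \<xi> u v"
proof -
  have lt: "ereal s < T" if "t \<in> time_ivl 0 T" "s \<le> t" for s t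
    using that by (auto simp: time_ivl_def intro: order.strict_trans1[of "ereal s" "ereal t"])
  have ev: "vi' (t - \<tau>) = vi (t - \<tau>)" if "t \<in> time_ivl 0 T" for t
    using eq[of "t - \<tau>"] lt[OF that, of "t - \<tau> + lag"] that lag r by (auto simp: time_ivl_def)
  have eu: "ui' (t - r - \<tau>) = ui (t - r - \<tau>)" if "t \<in> time_ivl 0 T" for t
    using eq[of "t - r - \<tau>"] lt[OF that, of "t - r - \<tau> + lag"] that lag r by (auto simp: time_ivl_def)
  show ?thesis
    unfolding open_loop_def
  proof (intro conjI)
    show "solves_ae_on (time_ivl 0 T) (\<lambda>t. ft (x t) (vi' (t - \<tau>))) x"
      by (rule solves_ae_on_cong_rhs[OF open_loop_x_ode[OF O]]) (use ev in auto)
    show "solves_ae_on (time_ivl 0 T) (\<lambda>t. f (z t) (ui' (t - r - \<tau>)) + khat (z t) (w t) (ui' (t - r - \<tau>))) z"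
      by (rule solves_ae_on_cong_rhs[OF open_loop_z_ode[OF O]]) (use eu in auto)
    show "\<forall>i. solves_ae_on ({ts i..<ts (Suc i)} \<inter> time_ivl 0 T) (\<lambda>t. jacobian h (at (z t)) *v f (z t) (ui' (t - r - \<tau>))) w"
      by (rule allI, rule solves_ae_on_cong_rhs[OF open_loop_w_ode[OF O, rule_format]]) (use eu in auto)
    show "\<forall>t\<in>time_ivl 0 T. \<forall>j\<in>{1..N}. \<xi> j t = q (norm (\<xi> (j-1) t) / \<psi> (z t)) *\<^sub>R \<xi> (j-1) t +
          (LINT s:{0..\<delta>}|lebesgue. f (q (norm (\<xi> j (t + s - \<delta>)) / \<psi> (z t)) *\<^sub>R \<xi> j (t + s - \<delta>))
               ((if j = N then u else ui') (t + (real j - 1) * \<delta> - \<tau> - r + s)))"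
    proof (intro ballI)
      fix t j assume t: "t \<in> time_ivl 0 T" and j: "j \<in> {1..N}"
      have "(LINT s:{0..\<delta>}|lebesgue. f (q (norm (\<xi> j (t + s - \<delta>)) / \<psi> (z t)) *\<^sub>R \<xi> j (t + s - \<delta>))
               ((if j = N then u else ui') (t + (real j - 1) * \<delta> - \<tau> - r + s))) =
           (LINT s:{0..\<delta>}|lebesgue. f (q (norm (\<xi> j (t + s - \<delta>)) / \<psi> (z t)) *\<^sub>R \<xi> j (t + s - \<delta>))
               ((if j = N then u else ui) (t + (real j - 1) * \<delta> - \<tau> - r + s)))"
      proof (rule set_lebesgue_integral_cong)
        have "ui' (t + (real j - 1) * \<delta> - \<tau> - r + s) = ui (t + (real j - 1) * \<delta> - \<tau> - r + s)"
          if s: "s \<in> {0..\<delta>}" and "j \<noteq> N" for s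
        proof -
          have "t + (real j - 1) * \<delta> - \<tau> - r + s + lag \<le> t"
            using j_delta(3)[OF j] j that lag by (auto simp: algebra_simps)
          moreover have "t + (real j - 1) * \<delta> - \<tau> - r + s \<ge> -r-\<tau>"
            using j_delta(1)[OF j] t s by (auto simp: time_ivl_def)
          ultimately show ?thesis using eq[of "t + (real j - 1) * \<delta> - \<tau> - r + s"] lt[OF t] by auto
        qed
        then show "\<forall>s. s \<in> {0..\<delta>} \<longrightarrow> f (q (norm (\<xi> j (t + s - \<delta>)) / \<psi> (z t)) *\<^sub>R \<xi> j (t + s - \<delta>))
               ((if j = N then u else ui') (t + (real j - 1) * \<delta> - \<tau> - r + s)) =
           f (q (norm (\<xi> j (t + s - \<delta>)) / \<psi> (z t)) *\<^sub>R \<xi> j (t + s - \<delta>))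
               ((if j = N then u else ui) (t + (real j - 1) * \<delta> - \<tau> - r + s))" by auto
      qed simp
      then show "\<xi> j t = q (norm (\<xi> (j-1) t) / \<psi> (z t)) *\<^sub>R \<xi> (j-1) t +
          (LINT s:{0..\<delta>}|lebesgue. f (q (norm (\<xi> j (t + s - \<delta>)) / \<psi> (z t)) *\<^sub>R \<xi> j (t + s - \<delta>))
               ((if j = N then u else ui') (t + (real j - 1) * \<delta> - \<tau> - r + s)))"
        using bspec[OF bspec[OF open_loop_xi_eq[OF O] t] j] by simp
    qed
  qed (rule open_loop_Linf_u[OF O] open_loop_Linf_v[OF O] open_loop_Linf_xi[OF O] open_loop_x_init[OF O] open_loop_z_init[OF O] open_loop_w_init[OF O]
      open_loop_th_init[OF O] open_loop_xi_init[OF O] open_loop_uv_init[OF O] open_loop_w_reset[OF O] open_loop_xi_0[OF O] open_loop_u_eq[OF O] open_loop_v_eq[OF O]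
      open_loop_th_ode[OF O] open_loop_th_reset[OF O])+
qed

lemma delayed_inputs:
  assumes ad: "admissible ui vi" and a: "0 \<le> a"
  shows "Linf_on {a..d} (\<lambda>t. ui (t - r - \<tau>))" "Linf_on {a..d} (\<lambda>t. vi (t - \<tau>))"
    "AE t in lebesgue. t \<ge> 0 \<longrightarrow> ui (t - r - \<tau>) \<in> U"
proof -
  have e: "t - r - \<tau> = t + (- r - \<tau>)" "t - \<tau> = t + (- \<tau>)" for t by auto
  have L: "Linf_on {-r-\<tau>..d} ui" "Linf_on {-r-\<tau>..d} vi" using ad by (auto simp: admissible_def)
  show "Linf_on {a..d} (\<lambda>t. ui (t - r - \<tau>))"
    unfolding e(1) by (rule Linf_on_shift[OF L(1)]) (use a r tau in auto)
  show "Linf_on {a..d} (\<lambda>t. vi (t - \<tau>))"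
    unfolding e(2) by (rule Linf_on_shift[OF L(2)]) (use a r tau in auto)
  have "AE t in lebesgue. t \<ge> -r-\<tau> \<longrightarrow> ui t \<in> U" using ad by (simp add: admissible_def)
  from AE_lebesgue_shift[OF this, of "-r-\<tau>"] show "AE t in lebesgue. t \<ge> 0 \<longrightarrow> ui (t - r - \<tau>) \<in> U"
  proof eventually_elim
    case (elim t)
    then show ?case unfolding e(1) by auto
  qed
qed

text \<open>Between samples \<open>z\<close> and \<open>w\<close> form one differential equation;
  the paired field gives uniqueness for both at once.\<close>

definition observer_field :: "((real^'n) \<times> (real^'k)) \<times> (real^'m) \<Rightarrow> (real^'n) \<times> (real^'k)" where
  "observer_field = (\<lambda>((z, w), u). (f z u + khat z w u, jacobian h (at z) *v f z u))"

lemma observer_lip: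
  "lip_compact (UNIV \<times> UNIV \<times> U) (\<lambda>(z, w, u). f z u + khat z w u)"
  "lip_compact (UNIV \<times> U) observer_field"
proof -
  have 1: "lip_compact (UNIV \<times> UNIV \<times> U) (\<lambda>x :: (real^'n) \<times> (real^'k) \<times> (real^'m). (fst x, snd (snd x)))"
    by (intro lip_compact_Pair lip_compact_fst lip_compact_compose_UNIV[OF lip_compact_snd lip_compact_snd])
  from lip_compact_add[OF lip_compact_compose_UNIV[OF f_lip 1] khat_lip]
  show A: "lip_compact (UNIV \<times> UNIV \<times> U) (\<lambda>(z, w, u). f z u + khat z w u)"
    by (simp add: case_prod_unfold)
  have 2: "lip_compact (UNIV \<times> U) (\<lambda>x :: ((real^'n) \<times> (real^'k)) \<times> (real^'m). (fst (fst x), snd (fst x), snd x))"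
    by (intro lip_compact_Pair lip_compact_snd lip_compact_compose_UNIV[OF lip_compact_snd lip_compact_fst]
      lip_compact_compose_UNIV[OF lip_compact_fst lip_compact_fst])
  have B: "lip_compact (UNIV \<times> U) (\<lambda>x :: ((real^'n) \<times> (real^'k)) \<times> (real^'m). (\<lambda>(z, w, u). f z u + khat z w u) (fst (fst x), snd (fst x), snd x))"
    by (rule lip_compact_compose[OF 2 A]) auto
  have 3: "lip_compact (UNIV \<times> U) (\<lambda>x :: ((real^'n) \<times> (real^'k)) \<times> (real^'m). (fst (fst x), snd x))"
    by (intro lip_compact_Pair lip_compact_snd lip_compact_compose_UNIV[OF lip_compact_fst lip_compact_fst])
  from lip_compact_Pair[OF B lip_compact_compose_UNIV[OF hf_lip 3]]
  show "lip_compact (UNIV \<times> U) observer_field" by (simp add: observer_field_def case_prod_unfold)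
qed

lemma inter_sample_lip: "lip_compact UNIV (\<lambda>(\<theta>, u). g \<theta> (a2 \<theta> + u))"
proof -
  have "lip_compact UNIV (\<lambda>x :: (real^'l) \<times> (real^'m). (fst x, a2 (fst x) + snd x))"
    by (intro lip_compact_Pair lip_compact_add lip_compact_fst lip_compact_snd lip_compact_compose_UNIV[OF a2_lip lip_compact_fst])
  from lip_compact_compose_UNIV[OF g_lip this] show ?thesis by (simp add: case_prod_unfold)
qed

text \<open>For given inputs the blocks form a triangular system. Where resets occur, agreement
  passes from one sampling interval to the next by induction, since a reset value depends only on
  signals already known to agree: \<open>w\<close> on the delayed plant state,
  \<open>\<theta>\<close> on the plant state and on \<open>v\<close> before the sampling
  time.\<close>

lemma open_loop_unique:
  assumes O1: "open_loop T ui vi x z w \<theta> \<xi> u v" and O2: "open_loop T ui vi x' z' w' \<theta>' \<xi>' u' v'" and ad: "admissible ui vi"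
    and t: "t \<in> time_ivl 0 T"
  shows "x' t = x t \<and> z' t = z t \<and> w' t = w t \<and> \<theta>' t = \<theta> t \<and> (\<forall>j\<in>{1..N}. \<xi>' j t = \<xi> j t) \<and> u' t = u t \<and> v' t = v t"
proof -
  have x: "x' t = x t" if t: "t \<ge> - r" "ereal t < T" for t
  proof (cases "t < 0")
    case True
    then have "t \<in> {-r..0}" using t by auto
    then show ?thesis using open_loop_x_init[OF O1] open_loop_x_init[OF O2] by simp
  next
    case False
    show ?thesis
    proof (rule ode_input_unique[where F="\<lambda>(x, v). ft x v" and u="\<lambda>t. vi (t - \<tau>)" and \<Omega>=UNIV and a=0 and T=T])
      show "x' 0 = x 0" using open_loop_x_init[OF O1] open_loop_x_init[OF O2] r by simp
    qed (use open_loop_x_ode[OF O1] open_loop_x_ode[OF O2] ft_lip delayed_inputs(2)[OF ad] t False in \<open>auto simp: time_ivl_def\<close>)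
  qed
  have zw: "\<forall>t\<in>time_ivl 0 T. t < ts n \<longrightarrow> z' t = z t \<and> w' t = w t" for n
  proof (induction n)
    case 0
    show ?case by (auto simp: time_ivl_def)
  next
    case (Suc n)
    show ?case
    proof (cases "ts n \<in> time_ivl 0 T")
      case False
      show ?thesis
      proof (intro ballI impI)
        fix t assume "t \<in> time_ivl 0 T" "t < ts (Suc n)"
        moreover from this have "t < ts n" using False ts_nonneg[of n] by (auto simp: time_ivl_def intro: order.strict_trans1[of "ereal (ts n)" "ereal t"] not_le_imp_less)
        ultimately show "z' t = z t \<and> w' t = w t" using Suc by blast
      qed
    next
      case True
      \<comment> \<open>\<open>z\<close> crosses the sampling time by continuity, whereas
        \<open>w\<close> needs its reset value.\<close>
      have zn: "z' (ts n) = z (ts n)"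
      proof (cases "n = 0")
        case True then show ?thesis using open_loop_z_init[OF O1] open_loop_z_init[OF O2] by simp
      next
        case False
        have sub: "{0..ts n} \<subseteq> time_ivl 0 T" using time_ivl_subset[OF True] by simp
        show ?thesis
        proof (rule continuous_eq_at_end)
          show "continuous_on {0..ts n} z'" "continuous_on {0..ts n} z"
            using solves_ae_on_continuous_on[OF open_loop_z_ode[OF O1] sub] solves_ae_on_continuous_on[OF open_loop_z_ode[OF O2] sub] by auto
          show "0 < ts n" using False ts_less_iff[of 0 n] by simp
          show "z' t = z t" if "t \<in> {0..<ts n}" for t using Suc subsetD[OF sub, of t] that by auto
        qed
      qed
      have wn: "w' (ts n) = w (ts n)"
      proof (cases "n = 0")
        case True then show ?thesis using open_loop_w_init[OF O1] open_loop_w_init[OF O2] by simp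
      next
        case False
        then have "n \<ge> 1" by simp
        then have "w (ts n) = h (x (ts n - r))" "w' (ts n) = h (x' (ts n - r))"
          using open_loop_w_reset[OF O1] open_loop_w_reset[OF O2] True by blast+
        moreover have "ereal (ts n - r) < T"
          using True r by (auto simp: time_ivl_def intro: order.strict_trans1[of "ereal (ts n - r)" "ereal (ts n)"])
        then have "x' (ts n - r) = x (ts n - r)" using ts_nonneg[of n] by (intro x) auto
        ultimately show ?thesis by simp
      qed
      define T' where "T' = min (ereal (ts (Suc n))) T"
      have J: "{ts n..<ts (Suc n)} \<inter> time_ivl 0 T = time_ivl (ts n) T'" unfolding T'_def by (rule sampling_ivl)
      have sub: "time_ivl (ts n) T' \<subseteq> time_ivl 0 T" using J by blast
      have p1: "solves_ae_on (time_ivl (ts n) T') (\<lambda>t. observer_field ((z t, w t), ui (t - r - \<tau>))) (\<lambda>t. (z t, w t))"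
        using solves_ae_on_Pair[OF solves_ae_on_subset[OF open_loop_z_ode[OF O1] sub] open_loop_w_ode[OF O1, rule_format, of n, unfolded J]]
        by (simp add: observer_field_def)
      have p2: "solves_ae_on (time_ivl (ts n) T') (\<lambda>t. observer_field ((z' t, w' t), ui (t - r - \<tau>))) (\<lambda>t. (z' t, w' t))"
        using solves_ae_on_Pair[OF solves_ae_on_subset[OF open_loop_z_ode[OF O2] sub] open_loop_w_ode[OF O2, rule_format, of n, unfolded J]]
        by (simp add: observer_field_def)
      have zwp: "(z' t, w' t) = (z t, w t)" if t: "t \<in> time_ivl (ts n) T'" for t
      proof (rule ode_input_unique[OF p2 p1 _ observer_lip(2) U_closed _ _ t])
        show "Linf_on {ts n..d} (\<lambda>t. ui (t - r - \<tau>))" for d by (rule delayed_inputs(1)[OF ad ts_nonneg])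
        show "AE t in lebesgue. t \<in> time_ivl (ts n) T' \<longrightarrow> ui (t - r - \<tau>) \<in> U"
          using delayed_inputs(3)[OF ad order_refl] by eventually_elim (use sub in \<open>auto simp: time_ivl_def\<close>)
      qed (simp add: zn wn)
      have zw1: "z' t = z t \<and> w' t = w t" if t: "t \<in> time_ivl (ts n) T'" for t using zwp[OF t] by simp

      show ?thesis
      proof (intro ballI impI)
        fix t assume t: "t \<in> time_ivl 0 T" "t < ts (Suc n)"
        show "z' t = z t \<and> w' t = w t"
        proof (cases "t < ts n")
          case True
          then show ?thesis using Suc t by blast
        next
          case False
          then have "t \<in> {ts n..<ts (Suc n)} \<inter> time_ivl 0 T" using t by simp
          then show ?thesis unfolding J by (rule zw1)
        qed
      qed
    qed
  qed
  have zw': "z' t = z t \<and> w' t = w t" if "t \<in> time_ivl 0 T" for t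
    using ts_unbounded[of t] zw that by blast
  have uL: "s \<in> {-r-\<tau>..<0} \<Longrightarrow> u s = u0 s" "s \<in> {-r-\<tau>..<0} \<Longrightarrow> u' s = u0 s" for s
    using open_loop_uv_init[OF O1] open_loop_uv_init[OF O2] by blast+
  have sm: "s \<in> time_ivl 0 T" if "0 \<le> s" "s \<le> t" "t \<in> time_ivl 0 T" for s t
    using that time_ivl_subset[of t 0 T 0] by auto
  have xi: "\<forall>t\<in>time_ivl 0 T. \<xi>' j t = \<xi> j t" if "j \<le> N" for j
    using that
  proof (induction j)
    case 0
    then show ?case using open_loop_xi_0[OF O1] open_loop_xi_0[OF O2] zw' by simp
  next
    case (Suc j)
    then have j: "Suc j \<in> {1..N}" by simp
    interpret W: window_equation window_field "window_input ui (Suc j)" U \<delta> Lk by (rule predictor_window[OF ad j])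
    define A where "A t = q (norm (\<xi> j t) / \<psi> (z t)) *\<^sub>R \<xi> j t" for t
    have ue1: "u s = kk (\<xi> N s)" and ue2: "u' s = kk (\<xi>' N s)" if "t \<in> time_ivl 0 T" "0 \<le> s" "s \<le> t" for s t
      using open_loop_u_eq[OF O1] open_loop_u_eq[OF O2] sm[OF that(2,3,1)] by blast+
    show ?case
    proof
      fix t assume t: "t \<in> time_ivl 0 T"
      show "\<xi>' (Suc j) t = \<xi> (Suc j) t"
      proof (rule W.unique[where A=A and z=z and T=T])
        show "\<xi> (Suc j) t = A t + (LINT s:{0..\<delta>}|lebesgue. W.integrand (\<xi> (Suc j)) (z t) (t + s - \<delta>))" if t: "t \<in> time_ivl 0 T" for t
          using bspec[OF bspec[OF open_loop_xi_eq[OF O1] t] j]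
            window_rhs[where u=u and t=t and j="Suc j" and ui=ui and vi=vi and \<xi>=\<xi> and z="z t", OF uL(1) ue1[OF t] j _ ad] t
          by (simp add: A_def time_ivl_def)
        show "\<xi>' (Suc j) t = A t + (LINT s:{0..\<delta>}|lebesgue. W.integrand (\<xi>' (Suc j)) (z t) (t + s - \<delta>))" if t: "t \<in> time_ivl 0 T" for t
          using bspec[OF bspec[OF open_loop_xi_eq[OF O2] t] j] Suc zw'[OF t]
            window_rhs[where u=u' and t=t and j="Suc j" and ui=ui and vi=vi and \<xi>=\<xi>' and z="z t", OF uL(2) ue2[OF t] j _ ad] t
          by (simp add: A_def time_ivl_def)
        show "\<xi>' (Suc j) s = \<xi> (Suc j) s" if "s \<in> {-\<delta>..<0}" for s
          using open_loop_xi_init[OF O1] open_loop_xi_init[OF O2] j that by simp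
        show "continuous_on {0..d} z" if "d \<in> time_ivl 0 T" for d
          using solves_ae_on_continuous_on[OF open_loop_z_ode[OF O1] time_ivl_subset[OF that]] by simp
      qed (use open_loop_Linf_xi[OF O1] open_loop_Linf_xi[OF O2] j t in auto)
    qed
  qed
  have ueq: "u' t = u t" if "t \<in> time_ivl 0 T" for t
    using open_loop_u_eq[OF O1] open_loop_u_eq[OF O2] xi[OF order_refl] that by simp
  have thv: "\<forall>t\<in>time_ivl 0 T. t < ts n \<longrightarrow> \<theta>' t = \<theta> t \<and> v' t = v t" for n
  proof (induction n)
    case 0
    show ?case by (auto simp: time_ivl_def)
  next
    case (Suc n)
    show ?case
    proof (cases "ts n \<in> time_ivl 0 T")
      case False
      show ?thesis
      proof (intro ballI impI)
        fix t assume "t \<in> time_ivl 0 T" "t < ts (Suc n)"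
        moreover from this have "t < ts n" using False ts_nonneg[of n] by (auto simp: time_ivl_def intro: order.strict_trans1[of "ereal (ts n)" "ereal t"] not_le_imp_less)
        ultimately show "\<theta>' t = \<theta> t \<and> v' t = v t" using Suc by blast
      qed
    next
      case True
      have thn: "\<theta>' (ts n) = \<theta> (ts n)"
      proof (cases "n = 0")
        case True then show ?thesis using open_loop_th_init[OF O1] open_loop_th_init[OF O2] by simp
      next
        case False
        then have "n \<ge> 1" by simp
        then have th: "\<theta> (ts n) = \<Phi> (h (x (ts n - r))) (\<lambda>s. v (ts n + s))" "\<theta>' (ts n) = \<Phi> (h (x' (ts n - r))) (\<lambda>s. v' (ts n + s))"
          using open_loop_th_reset[OF O1] open_loop_th_reset[OF O2] True by blast+
        have "ereal (ts n - r) < T"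
          using True r by (auto simp: time_ivl_def intro: order.strict_trans1[of "ereal (ts n - r)" "ereal (ts n)"])
        then have xe: "x' (ts n - r) = x (ts n - r)" using ts_nonneg[of n] by (intro x) auto
        have subn: "{-r-\<tau>..ts n} \<subseteq> time_ivl (-r-\<tau>) T"
          by (rule time_ivl_subset) (use True r tau in \<open>auto simp: time_ivl_def\<close>)
        have L: "Linf_on {-\<tau>-r..0} (\<lambda>s. y (ts n + s))" if "Linf_loc_on (time_ivl (-r-\<tau>) T) y" for y :: "real \<Rightarrow> real^'m"
        proof -
          have "Linf_on {-\<tau>-r..0} (\<lambda>s. y (s + ts n))"
            by (rule Linf_on_shift[OF Linf_loc_onD[OF that subn]]) (use ts_nonneg[of n] in auto)
          then show ?thesis by (simp add: add.commute)
        qed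
        \<comment> \<open>The window of \<open>\<Phi>\<close> includes the sampling time itself,
          where \<open>v\<close> depends on the very \<open>\<theta>\<close> to be determined;
          \<open>\<Phi>\<close> does not see a single point.\<close>
        have ae: "AE s in lebesgue_on {-\<tau>-r..0}. v' (ts n + s) = v (ts n + s)"
        proof -
          have "AE s in lebesgue. s \<in> {-\<tau>-r..0} \<longrightarrow> v' (ts n + s) = v (ts n + s)"
            using AE_lebesgue_neq[of 0]
          proof eventually_elim
            case (elim s)
            show ?case
            proof
              assume s: "s \<in> {-\<tau>-r..0}"
              show "v' (ts n + s) = v (ts n + s)"
              proof (cases "ts n + s < 0")
                case True
                then show ?thesis using open_loop_uv_init[OF O1] open_loop_uv_init[OF O2] s ts_nonneg[of n] by simp
              next
                case False
                then have "ts n + s \<in> time_ivl 0 T" using sm[of "ts n + s" "ts n"] s True by simp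
                then show ?thesis using Suc s elim by simp
              qed
            qed
          qed
          then show ?thesis by (subst AE_lebesgue_on_iff) auto
        qed
        show ?thesis
          unfolding th xe using Phi L[OF open_loop_Linf_v[OF O1]] L[OF open_loop_Linf_v[OF O2]] ae
          unfolding mapping_on_Linf_def by blast
      qed
      define T' where "T' = min (ereal (ts (Suc n))) T"
      have J: "{ts n..<ts (Suc n)} \<inter> time_ivl 0 T = time_ivl (ts n) T'" unfolding T'_def by (rule sampling_ivl)
      have sub: "time_ivl (ts n) T' \<subseteq> time_ivl 0 T" using J by blast
      have p1: "solves_ae_on (time_ivl (ts n) T') (\<lambda>t. (\<lambda>(\<theta>, u). g \<theta> (a2 \<theta> + u)) (\<theta> t, u t)) \<theta>"
        using open_loop_th_ode[OF O1, rule_format, of n, unfolded J] by simp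
      have p2: "solves_ae_on (time_ivl (ts n) T') (\<lambda>t. (\<lambda>(\<theta>, u). g \<theta> (a2 \<theta> + u)) (\<theta>' t, u t)) \<theta>'"
        by (rule solves_ae_on_cong_on[OF open_loop_th_ode[OF O2, rule_format, of n, unfolded J]]) (use ueq sub in auto)
      have the: "\<theta>' t = \<theta> t" if t: "t \<in> time_ivl (ts n) T'" for t
      proof (rule ode_input_unique[OF p2 p1 thn, where \<Omega>=UNIV, OF _ _ _ _ t])
        show "Linf_on {ts n..d} u" if d: "d \<in> time_ivl (ts n) T'" for d
        proof (rule Linf_loc_onD[OF open_loop_Linf_u[OF O1]])
          have "d \<in> time_ivl (-r-\<tau>) T" using d sub r tau by (auto simp: time_ivl_def)
          then show "{ts n..d} \<subseteq> time_ivl (-r-\<tau>) T"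
            by (rule time_ivl_subset) (use ts_nonneg[of n] r tau in auto)
        qed
      qed (use inter_sample_lip in auto)
      have thv1: "\<theta>' t = \<theta> t \<and> v' t = v t" if t: "t \<in> time_ivl (ts n) T'" for t
        using the[OF t] open_loop_v_eq[OF O1] open_loop_v_eq[OF O2] ueq t sub by auto

      show ?thesis
      proof (intro ballI impI)
        fix t assume t: "t \<in> time_ivl 0 T" "t < ts (Suc n)"
        show "\<theta>' t = \<theta> t \<and> v' t = v t"
        proof (cases "t < ts n")
          case True
          then show ?thesis using Suc t by blast
        next
          case False
          then have "t \<in> {ts n..<ts (Suc n)} \<inter> time_ivl 0 T" using t by simp
          then show ?thesis unfolding J by (rule thv1)
        qed
      qed
    qed
  qed
  obtain n where "t < ts n" using ts_unbounded by blast
  then show ?thesis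
    using x[of t] zw'[OF t] thv[of n] xi ueq[OF t] t r by (auto simp: time_ivl_def)
qed

section \<open>Existence of the open-loop response\<close>

lemma Linf_loc_onI: "(\<And>d. Linf_on {c..d} y) \<Longrightarrow> Linf_loc_on {c..} y"
  for y :: "real \<Rightarrow> 'q::euclidean_space"
  unfolding Linf_loc_on_def by (intro allI impI, rule Linf_on_subset[of "{c.._}"]) auto

lemma piecewise_input_Linf:
  assumes "Linf_on {-r-\<tau>..<0} y0" "\<And>s. s \<in> {-r-\<tau>..<0} \<Longrightarrow> y s = y0 s" "\<And>d. Linf_on {0..d} y"
  shows "Linf_on {-r-\<tau>..d} y"
proof -
  have "Linf_on {-r-\<tau>..<0} y" by (rule Linf_on_cong[OF assms(1)]) (use assms(2) in auto)
  then have "Linf_on ({-r-\<tau>..<0} \<union> {0..d}) y" by (rule Linf_on_Un[OF _ assms(3)]) auto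
  moreover have "{-r-\<tau>..d} \<subseteq> {-r-\<tau>..<0} \<union> {0..d}" by auto
  ultimately show ?thesis by (rule Linf_on_subset) auto
qed

lemma predictor_exists:
  assumes ad: "admissible ui vi" and z: "continuous_on {0..} z"
  obtains \<xi> where "\<xi> 0 = z" "\<And>j. j \<le> N \<Longrightarrow> continuous_on {0..} (\<xi> j)"
    "\<And>j s. j \<in> {1..N} \<Longrightarrow> s < 0 \<Longrightarrow> \<xi> j s = \<xi>0 j s" "\<And>j d. j \<in> {1..N} \<Longrightarrow> Linf_on {-\<delta>..d} (\<xi> j)"
    "\<And>j t. j \<in> {1..N} \<Longrightarrow> t \<ge> 0 \<Longrightarrow> \<xi> j t = q (norm (\<xi> (j-1) t) / \<psi> (z t)) *\<^sub>R \<xi> (j-1) t +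
       (LINT s:{0..\<delta>}|lebesgue. window_equation.integrand window_field (window_input ui j) (\<xi> j) (z t) (t + s - \<delta>))"
proof -
  define Q where "Q j prev \<xi> \<longleftrightarrow> continuous_on {0..} \<xi> \<and> (\<forall>s<0. \<xi> s = \<xi>0 j s) \<and> (\<forall>d. Linf_on {-\<delta>..d} \<xi>) \<and>
     (\<forall>t\<ge>0. \<xi> t = q (norm (prev t) / \<psi> (z t)) *\<^sub>R prev t +
       (LINT s:{0..\<delta>}|lebesgue. window_equation.integrand window_field (window_input ui j) \<xi> (z t) (t + s - \<delta>)))" for j prev \<xi>
  have ex: "\<exists>\<xi>. Q j prev \<xi>" if prev: "continuous_on {0..} prev" and j: "j \<in> {1..N}" for j prev
  proof -
    interpret W: window_equation window_field "window_input ui j" U \<delta> Lk by (rule predictor_window[OF ad j])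
    have sat_cont: "continuous_on UNIV (\<lambda>(z, \<xi> :: real^'n). q (norm \<xi> / \<psi> z) *\<^sub>R \<xi>)"
      by (rule lip_compact_continuous_on[OF sat_lip]) simp
    have "continuous_on {0..} (\<lambda>t. (\<lambda>(z, \<xi> :: real^'n). q (norm \<xi> / \<psi> z) *\<^sub>R \<xi>) (z t, prev t))"
      by (rule continuous_on_compose2[OF sat_cont]) (auto intro!: continuous_intros z prev)
    then have c: "continuous_on {0..} (\<lambda>t. q (norm (prev t) / \<psi> (z t)) *\<^sub>R prev t)" by simp
    show ?thesis
    proof (rule W.exists[OF c z xi0_Linf[OF j]])
      fix \<xi>
      assume "continuous_on {0..} \<xi>" "\<And>s. s < 0 \<Longrightarrow> \<xi> s = \<xi>0 j s" "\<And>d. Linf_on {-\<delta>..d} \<xi>"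
        "\<And>t. t \<ge> 0 \<Longrightarrow> \<xi> t = q (norm (prev t) / \<psi> (z t)) *\<^sub>R prev t + (LINT s:{0..\<delta>}|lebesgue. W.integrand \<xi> (z t) (t + s - \<delta>))"
      then have "Q j prev \<xi>" unfolding Q_def by simp
      then show "\<exists>\<xi>. Q j prev \<xi>" by blast
    qed
  qed
  \<comment> \<open>Each predictor takes the previous one as data, so the chain is chosen by
    recursion on \<open>j\<close>.\<close>
  define \<xi> where "\<xi> = rec_nat z (\<lambda>j prev. SOME \<xi>. Q (Suc j) prev \<xi>)"
  have xi0: "\<xi> 0 = z" and xiS: "\<xi> (Suc j) = (SOME y. Q (Suc j) (\<xi> j) y)" for j by (auto simp: \<xi>_def)
  have c: "j \<le> N \<Longrightarrow> continuous_on {0..} (\<xi> j)" for j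
  proof (induction j)
    case (Suc j)
    have "\<exists>y. Q (Suc j) (\<xi> j) y" by (rule ex) (use Suc in auto)
    from someI_ex[OF this] have "Q (Suc j) (\<xi> j) (\<xi> (Suc j))" unfolding xiS .
    then show ?case unfolding Q_def by blast
  qed (simp add: xi0 z)
  have Q: "Q j (\<xi> (j - 1)) (\<xi> j)" if jN: "j \<in> {1..N}" for j
  proof -
    obtain i where i: "j = Suc i" using jN by (cases j) auto
    have "\<exists>y. Q (Suc i) (\<xi> i) y" by (rule ex[OF c]) (use jN i in auto)
    from someI_ex[OF this] show ?thesis unfolding i xiS by simp
  qed
  show ?thesis
  proof (rule that[of \<xi>])
    show "\<xi> 0 = z" by (rule xi0)
    show "continuous_on {0..} (\<xi> j)" if "j \<le> N" for j using that by (rule c)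
    fix j assume j: "j \<in> {1..N}"
    note Qj = Q[OF j, unfolded Q_def]
    show "s < 0 \<Longrightarrow> \<xi> j s = \<xi>0 j s" for s using Qj by blast
    show "Linf_on {-\<delta>..d} (\<xi> j)" for d using Qj by blast
    show "t \<ge> 0 \<Longrightarrow> \<xi> j t = q (norm (\<xi> (j-1) t) / \<psi> (z t)) *\<^sub>R \<xi> (j-1) t +
       (LINT s:{0..\<delta>}|lebesgue. window_equation.integrand window_field (window_input ui j) (\<xi> j) (z t) (t + s - \<delta>))" for t
      using Qj by blast
  qed
qed

text \<open>The reset of \<open>\<theta>\<close> reads the past of \<open>v\<close>, which itself
  contains \<open>a2 (\<theta> t)\<close>; the two signals are therefore built together, one
  sampling interval at a time. On each interval forward completeness is applied from time 0 with a
  shifted input.\<close>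

lemma inter_sample_exists:
  assumes u: "\<And>d. Linf_on {-r-\<tau>..d} u" and uU: "\<And>t. t \<ge> 0 \<Longrightarrow> u t \<in> U" and uc: "continuous_on {0..} u"
  obtains \<theta> v where "\<theta> 0 = \<theta>0" "\<And>s. s < 0 \<Longrightarrow> v s = v0 s" "\<And>t. t \<ge> 0 \<Longrightarrow> v t = u t + a2 (\<theta> t)"
    "\<And>d. Linf_on {-r-\<tau>..d} v" "\<And>i. solves_ae_on {ts i..<ts (Suc i)} (\<lambda>t. g (\<theta> t) (a2 (\<theta> t) + u t)) \<theta>"
    "\<And>i. i \<ge> 1 \<Longrightarrow> \<theta> (ts i) = \<Phi> (y i) (\<lambda>s. v (ts i + s))"
proof -
  have ex: "\<exists>\<eta>. \<eta> 0 = \<eta>0 \<and> solves_ae_on {0..} (\<lambda>t. g (\<eta> t) (a2 (\<eta> t) + u (ts i + t))) \<eta>" for \<eta>0 i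
  proof -
    have "Linf_loc_on {-0..} (\<lambda>t. u (ts i + t))"
    proof -
      have "Linf_on {0..d} (\<lambda>t. u (t + ts i))" for d
        by (rule Linf_on_shift[OF u[of "d + ts i"]]) (use ts_nonneg[of i] r tau in auto)
      then show ?thesis using Linf_loc_onI[of 0 "\<lambda>t. u (ts i + t)"] by (simp add: add.commute)
    qed
    moreover have "\<forall>t\<ge>-0. u (ts i + t) \<in> U" using uU ts_nonneg[of i] by simp
    ultimately show ?thesis using g_complete[unfolded forward_complete_def, rule_format, of "\<lambda>t. u (ts i + t)" \<eta>0] by simp
  qed
  define sol where "sol \<eta>0 i = (SOME \<eta>. \<eta> 0 = \<eta>0 \<and> solves_ae_on {0..} (\<lambda>t. g (\<eta> t) (a2 (\<eta> t) + u (ts i + t))) \<eta>)" for \<eta>0 i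
  have sol0: "sol \<eta>0 i 0 = \<eta>0"
    and sol: "solves_ae_on {0..} (\<lambda>t. g (sol \<eta>0 i t) (a2 (sol \<eta>0 i t) + u (ts i + t))) (sol \<eta>0 i)" for \<eta>0 i
    using someI_ex[OF ex[of \<eta>0 i]] unfolding sol_def by blast+
  define init where "init i w = (if i = 0 then \<theta>0 else \<Phi> (y i) (\<lambda>s. w (ts i + s)))" for i w
  \<comment> \<open>\<open>vv i\<close> is the part of \<open>v\<close> settled before
    \<open>ts i\<close>; its values from \<open>ts i\<close> on are provisional.\<close>
  define vv where "vv = rec_nat v0 (\<lambda>i w t. if t < ts i then w t else u t + a2 (sol (init i w) i (t - ts i)))"
  have vv0: "vv 0 = v0" and vvS: "vv (Suc i) = (\<lambda>t. if t < ts i then vv i t else u t + a2 (sol (init i (vv i)) i (t - ts i)))" for i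
    by (auto simp: vv_def)
  define S where "S i = sol (init i (vv i)) i" for i
  define \<theta> where "\<theta> t = S (idx t) (t - ts (idx t))" for t
  define v where "v t = (if t < 0 then v0 t else u t + a2 (\<theta> t))" for t
  have thp: "\<theta> t = S i (t - ts i)" if "ts i \<le> t" "t < ts (Suc i)" for t i
    using idx_eq[OF that] by (simp add: \<theta>_def)
  have vv: "\<forall>t<ts i. vv i t = v t" for i
  proof (induction i)
    case 0
    then show ?case by (simp add: vv0 v_def)
  next
    case (Suc i)
    show ?case
    proof (intro allI impI)
      fix t assume t: "t < ts (Suc i)"
      show "vv (Suc i) t = v t"
        using Suc t ts_nonneg[of i] thp[of i t] by (cases "t < ts i") (auto simp: vvS v_def S_def)
    qed
  qed
  have Sc: "continuous_on {0..d} (S i)" for d i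
    using solves_ae_on_continuous_on[OF sol, of 0 d] by (simp add: S_def)
  have a2c: "continuous_on UNIV a2" by (rule lip_compact_continuous_on[OF a2_lip]) simp
  have vL: "Linf_on {-r-\<tau>..d} v" for d
  proof (rule piecewise_input_Linf[OF v0_Linf])
    show "Linf_on {0..d} v" for d
    proof (rule piecewise_Linf)
      fix i
      have "continuous_on {ts i..ts (Suc i)} (\<lambda>t. u t + a2 (S i (t - ts i)))"
      proof (intro continuous_intros continuous_on_compose2[OF a2c])
        show "continuous_on {ts i..ts (Suc i)} u" by (rule continuous_on_subset[OF uc]) (use ts_nonneg[of i] in auto)
        show "continuous_on {ts i..ts (Suc i)} (\<lambda>t. S i (t - ts i))"
          by (rule continuous_on_compose2[OF Sc[of "ts (Suc i) - ts i"]]) (auto intro!: continuous_intros)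
      qed auto
      then have "Linf_on {ts i..<ts (Suc i)} (\<lambda>t. u t + a2 (S i (t - ts i)))"
        by (intro Linf_on_subset[OF Linf_on_continuous]) auto
      then show "Linf_on {ts i..<ts (Suc i)} v"
        by (rule Linf_on_cong) (use thp ts_nonneg[of i] in \<open>auto simp: v_def\<close>)
    qed
  qed (simp add: v_def)
  show ?thesis
  proof (rule that[of \<theta> v])
    show "\<theta> 0 = \<theta>0" using thp[of 0 0] ts_less_iff[of 0 1] by (simp add: S_def sol0 init_def)
    show "v t = u t + a2 (\<theta> t)" if "t \<ge> 0" for t using that by (simp add: v_def)
    show "v s = v0 s" if "s < 0" for s using that by (simp add: v_def)
    show "Linf_on {-r-\<tau>..d} v" for d by (rule vL)
    show "solves_ae_on {ts i..<ts (Suc i)} (\<lambda>t. g (\<theta> t) (a2 (\<theta> t) + u t)) \<theta>" for i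
    proof -
      have "solves_ae_on {ts i..<ts (Suc i)} (\<lambda>t. g (S i (t + - ts i)) (a2 (S i (t + - ts i)) + u (ts i + (t + - ts i)))) (\<lambda>t. S i (t + - ts i))"
        unfolding S_def by (rule solves_ae_on_shift[OF sol]) auto
      then have "solves_ae_on (time_ivl (ts i) (ts (Suc i))) (\<lambda>t. g (S i (t - ts i)) (a2 (S i (t - ts i)) + u t)) (\<lambda>t. S i (t - ts i))" by simp
      then have "solves_ae_on (time_ivl (ts i) (ts (Suc i))) (\<lambda>t. g (S i (t - ts i)) (a2 (S i (t - ts i)) + u t)) \<theta>"
        by (rule solves_ae_on_cong) (use thp in auto)
      then have "solves_ae_on {ts i..<ts (Suc i)} (\<lambda>t. g (S i (t - ts i)) (a2 (S i (t - ts i)) + u t)) \<theta>" by simp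
      then show ?thesis by (rule solves_ae_on_cong_on) (auto simp: thp)
    qed
    show "\<theta> (ts i) = \<Phi> (y i) (\<lambda>s. v (ts i + s))" if i: "i \<ge> 1" for i
    proof -
      have "\<theta> (ts i) = init i (vv i)" using thp[of i "ts i"] ts_less_iff[of i "Suc i"] by (simp add: S_def sol0)
      also have "\<dots> = \<Phi> (y i) (\<lambda>s. vv i (ts i + s))" using i by (simp add: init_def)
      also have "\<dots> = \<Phi> (y i) (\<lambda>s. v (ts i + s))"
      proof -
        have "Linf_on {-\<tau>-r..0} (\<lambda>s. v (s + ts i))"
          by (rule Linf_on_shift[OF vL[of "ts i"]]) (use ts_nonneg[of i] in auto)
        then have 1: "Linf_on {-\<tau>-r..0} (\<lambda>s. v (ts i + s))" by (simp add: add.commute)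
        then have "Linf_on {-\<tau>-r..<0} (\<lambda>s. v (ts i + s))" by (rule Linf_on_subset) auto
        then have "Linf_on {-\<tau>-r..<0} (\<lambda>s. vv i (ts i + s))" by (rule Linf_on_cong) (use vv in auto)
        then have "Linf_on ({-\<tau>-r..<0} \<union> {0..0}) (\<lambda>s. vv i (ts i + s))"
          by (rule Linf_on_Un[OF _ Linf_on_continuous]) auto
        then have 2: "Linf_on {-\<tau>-r..0} (\<lambda>s. vv i (ts i + s))"
          by (rule Linf_on_subset) auto
        \<comment> \<open>The two may differ at \<open>s = 0\<close>, the sampling time itself,
          which is a null set.\<close>
        have "AE s in lebesgue. s \<in> {-\<tau>-r..0} \<longrightarrow> vv i (ts i + s) = v (ts i + s)"
          using AE_lebesgue_neq[of 0] by eventually_elim (use vv in auto)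
        then have "AE s in lebesgue_on {-\<tau>-r..0}. vv i (ts i + s) = v (ts i + s)"
          by (subst AE_lebesgue_on_iff) auto
        then show ?thesis using Phi 1 2 unfolding mapping_on_Linf_def by blast
      qed
      finally show ?thesis .
    qed
  qed
qed

lemma open_loop_exists:
  assumes ad: "admissible ui vi"
  shows "\<exists>x z w \<theta> \<xi> u v. open_loop \<infinity> ui vi x z w \<theta> \<xi> u v"
proof -
  have "Linf_loc_on {-\<tau>..} vi"
    by (rule Linf_loc_onI, rule Linf_on_subset[of "{-r-\<tau>.._}"]) (use ad r in \<open>auto simp: admissible_def\<close>)
  then obtain xx where xx: "xx 0 = x0 0" "solves_ae_on {0..} (\<lambda>t. ft (xx t) (vi (t - \<tau>))) xx"
    using ft_complete unfolding forward_complete_def by blast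
  define x where "x t = (if t < 0 then x0 t else xx t)" for t
  have x: "solves_ae_on (time_ivl 0 \<infinity>) (\<lambda>t. ft (x t) (vi (t - \<tau>))) x"
  proof (rule solves_ae_on_cong)
    show "solves_ae_on (time_ivl 0 \<infinity>) (\<lambda>t. ft (x t) (vi (t - \<tau>))) xx"
      by (rule solves_ae_on_cong_rhs[of _ "\<lambda>t. ft (xx t) (vi (t - \<tau>))"]) (use xx in \<open>auto simp: x_def\<close>)
  qed (simp add: x_def)
  \<comment> \<open>\<open>V\<close> does not increase above \<open>b\<close>, so this sublevel set
    keeps the observer trajectory; the radius \<open>B + 1\<close> used below makes the norm bound
    strict.\<close>
  define M where "M = max (V z0) b"
  have "bounded {z. V z \<le> M}" by (rule V_bdd)
  then obtain B where B: "\<And>z. V z \<le> M \<Longrightarrow> norm z \<le> B" by (auto simp: bounded_iff)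
  have B1: "norm z < B + 1" if "V z \<le> M" for z using B[OF that] by simp
  obtain z w where z0: "z 0 = z0" and z: "solves_ae_on {0..} (\<lambda>t. (\<lambda>(z, w, u). f z u + khat z w u) (z t, w t, ui (t - r - \<tau>))) z"
    and w0: "\<And>i. w (ts i) = (if i = 0 then w0 else h (x (ts i - r)))"
    and w: "\<And>i. solves_ae_on {ts i..<ts (Suc i)} (\<lambda>t. (\<lambda>(z, u). jacobian h (at z) *v f z u) (z t, ui (t - r - \<tau>))) w"
  proof (rule hybrid_exists[where FF="\<lambda>(z, w, u). f z u + khat z w u" and G="\<lambda>(z, u). jacobian h (at z) *v f z u" and U=U
      and V=V and V'="\<lambda>x d. grad V x \<bullet> d" and M=M and B="B + 1" and u="\<lambda>t. ui (t - r - \<tau>)"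
      and y="\<lambda>i. if i = 0 then w0 else h (x (ts i - r))"])
    show "lip_compact (UNIV \<times> U) (\<lambda>(z, u). jacobian h (at z) *v f z u)"
      by (rule lip_compact_subset[OF hf_lip]) simp
    show "V z0 \<le> M" by (simp add: M_def)
    show "AE t in lebesgue. 0 \<le> t \<longrightarrow> ui (t - r - \<tau>) \<in> U" by (rule delayed_inputs(3)[OF ad order_refl])
    show "grad V z \<bullet> (case (z, w, u) of (z, w, u) \<Rightarrow> f z u + khat z w u) \<le> 0" if "u \<in> U" "M < V z" for z w u
      using V_dec[OF that(1)] that(2) by (simp add: M_def)
  qed (use observer_lip U_compact U_0 delayed_inputs[OF ad] V_der V_lip B1 in auto)
  have zc: "continuous_on {0..} z"
    using solves_ae_on_continuous_on_time_ivl[of 0 \<infinity>] z by simp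
  obtain \<xi> where xi: "\<xi> 0 = z" "\<And>j. j \<le> N \<Longrightarrow> continuous_on {0..} (\<xi> j)"
    "\<And>j s. j \<in> {1..N} \<Longrightarrow> s < 0 \<Longrightarrow> \<xi> j s = \<xi>0 j s" "\<And>j d. j \<in> {1..N} \<Longrightarrow> Linf_on {-\<delta>..d} (\<xi> j)"
    "\<And>j t. j \<in> {1..N} \<Longrightarrow> t \<ge> 0 \<Longrightarrow> \<xi> j t = q (norm (\<xi> (j-1) t) / \<psi> (z t)) *\<^sub>R \<xi> (j-1) t +
       (LINT s:{0..\<delta>}|lebesgue. window_equation.integrand window_field (window_input ui j) (\<xi> j) (z t) (t + s - \<delta>))"
    by (rule predictor_exists[OF ad zc]) blast
  define u where "u t = (if t < 0 then u0 t else kk (\<xi> N t))" for t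
  have "continuous_on {0..} (\<lambda>t. kk (\<xi> N t))"
    by (rule continuous_on_compose2[OF lipschitz_on_continuous_on[OF kk_lip] xi(2)]) auto
  then have uc: "continuous_on {0..} u" by (rule continuous_on_cong[THEN iffD1, rotated 2]) (auto simp: u_def)
  have uL: "Linf_on {-r-\<tau>..d} u" for d
  proof (rule piecewise_input_Linf[OF u0_Linf])
    show "Linf_on {0..d} u" for d by (rule Linf_on_continuous[OF continuous_on_subset[OF uc]]) auto
  qed (simp add: u_def)
  obtain \<theta> v where th: "\<theta> 0 = \<theta>0" "\<And>s. s < 0 \<Longrightarrow> v s = v0 s" "\<And>t. t \<ge> 0 \<Longrightarrow> v t = u t + a2 (\<theta> t)"
    "\<And>d. Linf_on {-r-\<tau>..d} v" "\<And>i. solves_ae_on {ts i..<ts (Suc i)} (\<lambda>t. g (\<theta> t) (a2 (\<theta> t) + u t)) \<theta>"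
    "\<And>i. i \<ge> 1 \<Longrightarrow> \<theta> (ts i) = \<Phi> (h (x (ts i - r))) (\<lambda>s. v (ts i + s))"
  proof (rule inter_sample_exists[OF uL _ uc, where y="\<lambda>i. h (x (ts i - r))"])
    show "u t \<in> U" if "t \<ge> 0" for t using that kk_U by (simp add: u_def)
  qed blast+
  have si: "{ts i..<ts (Suc i)} \<inter> time_ivl 0 \<infinity> = {ts i..<ts (Suc i)}" for i using ts_nonneg[of i] by auto
  have "open_loop \<infinity> ui vi x z w \<theta> \<xi> u v"
    unfolding open_loop_def si
  proof (intro conjI)
    show "\<forall>t\<in>time_ivl 0 \<infinity>. \<forall>j\<in>{1..N}. \<xi> j t = q (norm (\<xi> (j-1) t) / \<psi> (z t)) *\<^sub>R \<xi> (j-1) t +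
          (LINT s:{0..\<delta>}|lebesgue. f (q (norm (\<xi> j (t + s - \<delta>)) / \<psi> (z t)) *\<^sub>R \<xi> j (t + s - \<delta>))
               ((if j = N then u else ui) (t + (real j - 1) * \<delta> - \<tau> - r + s)))"
    proof (intro ballI)
      fix t j assume "t \<in> time_ivl 0 \<infinity>" and j: "j \<in> {1..N}"
      then have t: "t \<ge> 0" by simp
      show "\<xi> j t = q (norm (\<xi> (j-1) t) / \<psi> (z t)) *\<^sub>R \<xi> (j-1) t +
          (LINT s:{0..\<delta>}|lebesgue. f (q (norm (\<xi> j (t + s - \<delta>)) / \<psi> (z t)) *\<^sub>R \<xi> j (t + s - \<delta>))
               ((if j = N then u else ui) (t + (real j - 1) * \<delta> - \<tau> - r + s)))"
        using xi(5)[OF j t] window_rhs[OF _ _ j t ad, of u \<xi> "z t"] by (simp add: u_def)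
    qed
    show "Linf_loc_on (time_ivl (-r-\<tau>) \<infinity>) u" "Linf_loc_on (time_ivl (-r-\<tau>) \<infinity>) v"
      using uL th(4) by (auto intro: Linf_loc_onI)
    show "\<forall>j\<in>{1..N}. Linf_loc_on (time_ivl (-\<delta>) \<infinity>) (\<xi> j)"
      using xi(4) by (auto intro: Linf_loc_onI)
    show "\<forall>s\<in>{-r..0}. x s = x0 s" using xx by (auto simp: x_def)
    show "w 0 = w0" using w0[of 0] by simp
    show "\<forall>i\<ge>1. ts i \<in> time_ivl 0 \<infinity> \<longrightarrow> w (ts i) = h (x (ts i - r))" using w0 by auto
    show "\<forall>i. solves_ae_on {ts i..<ts (Suc i)} (\<lambda>t. jacobian h (at (z t)) *v f (z t) (ui (t - r - \<tau>))) w" using w by simp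
    show "solves_ae_on (time_ivl 0 \<infinity>) (\<lambda>t. f (z t) (ui (t - r - \<tau>)) + khat (z t) (w t) (ui (t - r - \<tau>))) z" using z by simp
    show "\<forall>t\<in>time_ivl 0 \<infinity>. u t = kk (\<xi> N t)" by (simp add: u_def)
    show "\<forall>s\<in>{-r-\<tau>..<0}. u s = u0 s \<and> v s = v0 s" using th(2) by (simp add: u_def)
  qed (use x z0 th xi in auto)
  then show ?thesis by blast
qed

lemma open_loop_admissible:
  assumes O: "open_loop \<infinity> ui vi x z w \<theta> \<xi> u v" shows "admissible u v"
proof -
  have "Linf_on {-r-\<tau>..d} u" "Linf_on {-r-\<tau>..d} v" for d
    using Linf_loc_onD[OF open_loop_Linf_u[OF O]] Linf_loc_onD[OF open_loop_Linf_v[OF O]] by auto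
  moreover have "AE t in lebesgue. t \<ge> -r-\<tau> \<longrightarrow> u t \<in> U"
    using u0_U
  proof eventually_elim
    case (elim t)
    show ?case
      using elim open_loop_uv_init[OF O] open_loop_u_eq[OF O] kk_U by (cases "t < 0") auto
  qed
  ultimately show ?thesis unfolding admissible_def by blast
qed

text \<open>The response map is iterated from some admissible input. By causality the first
  \<open>k * lag\<close> time units no longer change after \<open>k\<close> rounds, so at every time
  the iterates are eventually constant and their limit is a fixed point; no contraction estimate
  enters at this level.\<close>

lemma closed_loop_exists: "\<exists>x z w \<theta> \<xi> u v. closed_loop \<infinity> x z w \<theta> \<xi> u v"
proof -
  define R where "R p p' \<longleftrightarrow> (\<exists>x z w \<theta> \<xi>. open_loop \<infinity> (fst p) (snd p) x z w \<theta> \<xi> (fst p') (snd p'))" for p p'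
  \<comment> \<open>Zero lies in \<open>U\<close>, which keeps this extension of the initial data
    admissible.\<close>
  define p0 where "p0 = (\<lambda>t. if t < 0 then u0 t else 0, \<lambda>t. if t < 0 then v0 t else 0)"
  have p0: "admissible (fst p0) (snd p0)"
  proof -
    have "Linf_on {-r-\<tau>..d} (fst p0)" for d
    proof (rule piecewise_input_Linf[OF u0_Linf])
      have "Linf_on {0..d} (\<lambda>_. 0 :: real^'m)" for d by (rule Linf_on_continuous) simp
      then show "Linf_on {0..d} (fst p0)" for d by (rule Linf_on_cong) (auto simp: p0_def)
    qed (simp add: p0_def)
    moreover have "Linf_on {-r-\<tau>..d} (snd p0)" for d
    proof (rule piecewise_input_Linf[OF v0_Linf])
      have "Linf_on {0..d} (\<lambda>_. 0 :: real^'m)" for d by (rule Linf_on_continuous) simp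
      then show "Linf_on {0..d} (snd p0)" for d by (rule Linf_on_cong) (auto simp: p0_def)
    qed (simp add: p0_def)
    moreover have "AE t in lebesgue. t \<ge> -r-\<tau> \<longrightarrow> fst p0 t \<in> U"
      using u0_U by eventually_elim (use U_0 in \<open>auto simp: p0_def\<close>)
    ultimately show ?thesis unfolding admissible_def by blast
  qed
  have ex: "\<exists>p'. admissible (fst p') (snd p') \<and> R p p'" if "admissible (fst p) (snd p)" for p
    using open_loop_exists[OF that] open_loop_admissible unfolding R_def by (metis fst_conv snd_conv)
  define p where "p = rec_nat p0 (\<lambda>_ y. SOME y'. admissible (fst y') (snd y') \<and> R y y')"
  have pz: "p 0 = p0" and pS: "p (Suc k) = (SOME y'. admissible (fst y') (snd y') \<and> R (p k) y')" for k
    by (simp_all add: p_def)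
  have pa: "admissible (fst (p k)) (snd (p k))" for k
  proof (induction k)
    case (Suc k)
    then show ?case unfolding pS using someI_ex[OF ex[OF Suc]] by blast
  qed (simp add: pz p0)
  have pR: "R (p k) (p (Suc k))" for k
    unfolding pS using someI_ex[OF ex[OF pa[of k]]] by blast
  have init: "fst (p k) s = u0 s \<and> snd (p k) s = v0 s" if "s \<in> {-r-\<tau>..<0}" for k s
  proof (cases k)
    case 0 then show ?thesis using that by (simp add: pz p0_def)
  next
    case (Suc i)
    then show ?thesis using pR[of i] open_loop_uv_init that unfolding R_def by blast
  qed
  \<comment> \<open>By \<open>open_loop_cong_input\<close> both become responses to the same input
    on \<open>[0, T + lag)\<close>, and uniqueness applies there.\<close>
  have causal: "fst p1' t = fst p2' t \<and> snd p1' t = snd p2' t"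
    if pp: "R p1 p1'" "R p2 p2'" "admissible (fst p1) (snd p1)" "t \<ge> -r-\<tau>" "t < T + lag"
      "\<And>s. s \<ge> -r-\<tau> \<Longrightarrow> s < T \<Longrightarrow> fst p2 s = fst p1 s \<and> snd p2 s = snd p1 s" for p1 p1' p2 p2' t T
  proof (cases "t < 0")
    case True
    then show ?thesis using pp(1,2,4) open_loop_uv_init unfolding R_def by (metis atLeastLessThan_iff)
  next
    case False
    obtain x1 z1 w1 t1 y1 where O1: "open_loop \<infinity> (fst p1) (snd p1) x1 z1 w1 t1 y1 (fst p1') (snd p1')" using pp(1) unfolding R_def by blast
    obtain x2 z2 w2 t2 y2 where O2: "open_loop \<infinity> (fst p2) (snd p2) x2 z2 w2 t2 y2 (fst p2') (snd p2')" using pp(2) unfolding R_def by blast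
    have "open_loop (ereal (T + lag)) (fst p1) (snd p1) x2 z2 w2 t2 y2 (fst p2') (snd p2')"
      by (rule open_loop_cong_input[OF open_loop_restrict[OF O2]]) (use pp(6) in auto)
    from open_loop_unique[OF open_loop_restrict[OF O1] this pp(3), of "t"] show ?thesis
      using False pp(5) by simp
  qed
  have step: "\<forall>t. t \<ge> -r-\<tau> \<longrightarrow> t < real k * lag \<longrightarrow> fst (p (Suc k)) t = fst (p k) t \<and> snd (p (Suc k)) t = snd (p k) t" for k
  proof (induction k)
    case 0
    then show ?case using init by auto
  next
    case (Suc k)
    show ?case
    proof (intro allI impI)
      fix t assume t: "t \<ge> -r-\<tau>" "t < real (Suc k) * lag"
      show "fst (p (Suc (Suc k))) t = fst (p (Suc k)) t \<and> snd (p (Suc (Suc k))) t = snd (p (Suc k)) t"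
        by (rule causal[OF pR[of "Suc k"] pR[of k] pa t(1), of "real k * lag"]) (use t Suc in \<open>auto simp: algebra_simps\<close>)
    qed
  qed
  have stable: "fst (p (k + m)) t = fst (p k) t \<and> snd (p (k + m)) t = snd (p k) t" if "t \<ge> -r-\<tau>" "t < real k * lag" for k m t
  proof (induction m)
    case (Suc m)
    have "real k * lag \<le> real (k + m) * lag" using lag by (intro mult_right_mono) auto
    then show ?case using step[of "k + m"] that Suc by auto
  qed simp
  define k where "k t = nat \<lceil>t / lag\<rceil> + 1" for t :: real
  have k: "t < real (k t) * lag" for t
  proof -
    have "t / lag < real (k t)" unfolding k_def by linarith
    then show ?thesis using lag by (simp add: field_simps)
  qed
  \<comment> \<open>Diagonal choice: at time \<open>t\<close> all iterates from index
    \<open>k t\<close> on have the same value.\<close>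
  define u where "u t = fst (p (k t)) t" for t
  define v where "v t = snd (p (k t)) t" for t
  have uv: "u t = fst (p m) t \<and> v t = snd (p m) t" if "t \<ge> -r-\<tau>" "t < real m * lag" for t m
  proof (cases "m \<le> k t")
    case True
    then show ?thesis using stable[OF that, of "k t - m"] by (simp add: u_def v_def)
  next
    case False
    then show ?thesis using stable[OF that(1) k, of "m - k t"] by (simp add: u_def v_def)
  qed
  have ad: "admissible u v"
  proof -
    have "Linf_on {-r-\<tau>..d} u" "Linf_on {-r-\<tau>..d} v" for d
    proof -
      have L: "Linf_on {-r-\<tau>..d} (fst (p (k d)))" "Linf_on {-r-\<tau>..d} (snd (p (k d)))" using pa[of "k d"] by (auto simp: admissible_def)
      show "Linf_on {-r-\<tau>..d} u" by (rule Linf_on_cong[OF L(1)]) (use uv[of _ "k d"] k[of d] in auto)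
      show "Linf_on {-r-\<tau>..d} v" by (rule Linf_on_cong[OF L(2)]) (use uv[of _ "k d"] k[of d] in auto)
    qed
    moreover have "AE t in lebesgue. t \<ge> -r-\<tau> \<longrightarrow> u t \<in> U"
    proof -
      \<comment> \<open>\<open>u\<close> takes its values from different iterates at different
        times, so the null sets of all iterates are collected first.\<close>
      have "AE t in lebesgue. \<forall>m. t \<ge> -r-\<tau> \<longrightarrow> fst (p m) t \<in> U"
        unfolding AE_all_countable using pa by (auto simp: admissible_def)
      then show ?thesis by eventually_elim (simp add: u_def)
    qed
    ultimately show ?thesis unfolding admissible_def by blast
  qed
  obtain x z w \<theta> \<xi> u' v' where O: "open_loop \<infinity> u v x z w \<theta> \<xi> u' v'" using open_loop_exists[OF ad] by blast
  \<comment> \<open>The response to \<open>(u, v)\<close> is compared with the response to the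
    iterate of index \<open>k t\<close>, whose values agree with \<open>(u, v)\<close> up to
    \<open>k t * lag\<close>; that second response is the next iterate, already settled at
    \<open>t\<close>.\<close>
  have eq: "u' t = u t \<and> v' t = v t" if t: "t \<ge> -r-\<tau>" for t
  proof -
    have "R (u, v) (u', v')" unfolding R_def fst_conv snd_conv by (intro exI) (rule O)
    then have "fst (u', v') t = fst (p (Suc (k t))) t \<and> snd (u', v') t = snd (p (Suc (k t))) t"
      using causal[where T="real (k t) * lag" and t=t, OF _ pR[of "k t"], of "(u, v)" "(u', v')"] ad uv k[of t] lag t
      by (auto intro: less_trans)
    moreover have "t < real (Suc (k t)) * lag" using k[of t] lag by (simp add: algebra_simps)
    ultimately show ?thesis using uv[OF t, of "Suc (k t)"] by simp
  qed
  have "open_loop \<infinity> u' v' x z w \<theta> \<xi> u' v'" by (rule open_loop_cong_input[OF O]) (use eq in auto)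
  then show ?thesis unfolding closed_loop_iff_open_loop by blast
qed

text \<open>Proceeds in steps of \<open>lag\<close>: agreement of the controls before
  \<open>m * lag\<close> makes both solutions responses to the same input up to one
  \<open>lag\<close> later, where \<open>open_loop_unique\<close> applies. Thus every solution on
  some \<open>[0, T)\<close> is a restriction of the global one.\<close>

lemma closed_loop_unique:
  assumes C1: "closed_loop \<infinity> x z w \<theta> \<xi> u v" and C2: "closed_loop T x' z' w' \<theta>' \<xi>' u' v'" and t: "t \<in> time_ivl 0 T"
  shows "x' t = x t \<and> z' t = z t \<and> w' t = w t \<and> \<theta>' t = \<theta> t \<and> (\<forall>j\<in>{1..N}. \<xi>' j t = \<xi> j t) \<and> u' t = u t \<and> v' t = v t"
proof -
  have O1: "open_loop \<infinity> u v x z w \<theta> \<xi> u v" and O2: "open_loop T u' v' x' z' w' \<theta>' \<xi>' u' v'" using C1 C2 by (auto simp: closed_loop_iff_open_loop)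
  have ad: "admissible u v" using open_loop_admissible[OF O1] .
  have uni: "x' t = x t \<and> z' t = z t \<and> w' t = w t \<and> \<theta>' t = \<theta> t \<and> (\<forall>j\<in>{1..N}. \<xi>' j t = \<xi> j t) \<and> u' t = u t \<and> v' t = v t"
    if t: "t \<in> time_ivl 0 T" "t < m * lag + lag" and IH: "\<And>s. s \<in> time_ivl 0 T \<Longrightarrow> s < m * lag \<Longrightarrow> u' s = u s \<and> v' s = v s" for m t
  proof -
    define T2 where "T2 = min T (ereal (m * lag + lag))"
    have T2: "T2 \<le> T" "T2 \<le> \<infinity>" by (auto simp: T2_def)
    have "open_loop T2 u v x' z' w' \<theta>' \<xi>' u' v'"
    proof (rule open_loop_cong_input[OF open_loop_restrict[OF O2 T2(1)]])
      fix s assume s: "s \<ge> -r-\<tau>" "ereal (s + lag) < T2"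
      have "ereal s < T" using s lag by (auto simp: T2_def intro: order.strict_trans1[of "ereal s" "ereal (s + lag)"])
      then show "u s = u' s \<and> v s = v' s"
        using s IH[of s] open_loop_uv_init[OF O1] open_loop_uv_init[OF O2] by (cases "s < 0") (auto simp: T2_def time_ivl_def)
    qed
    from open_loop_unique[OF open_loop_restrict[OF O1 T2(2)] this ad] show ?thesis using t by (simp add: T2_def time_ivl_def)
  qed
  have "\<forall>s. s \<in> time_ivl 0 T \<longrightarrow> s < real m * lag \<longrightarrow> u' s = u s \<and> v' s = v s" for m
  proof (induction m)
    case 0
    then show ?case by (auto simp: time_ivl_def)
  next
    case (Suc m)
    show ?case
    proof (intro allI impI)
      fix s assume s: "s \<in> time_ivl 0 T" "s < real (Suc m) * lag"
      have "s < real m * lag + lag" using s by (simp add: algebra_simps)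
      from uni[OF s(1) this] Suc show "u' s = u s \<and> v' s = v s" by blast
    qed
  qed
  moreover obtain m :: nat where "t / lag < real m" using reals_Archimedean2 by blast
  then have "t < real m * lag + lag" using lag by (simp add: field_simps add_strict_increasing2)
  ultimately show ?thesis using uni[OF t, of "real m"] by blast
qed

end

section \<open>Exponential convergence\<close>

text \<open>An eventual bound with unspecified constants: the estimates start only after the
  trajectories have been absorbed, and a limes superior sees nothing earlier.\<close>

definition decays :: "real \<Rightarrow> (real \<Rightarrow> 'a::real_normed_vector) \<Rightarrow> bool" where
  "decays \<sigma> y \<longleftrightarrow> (\<exists>C T. \<forall>t\<ge>T. norm (y t) \<le> C * exp (- \<sigma> * t))"

lemma decaysE:
  assumes "decays \<sigma> y"
  obtains C T where "C > 0" "\<And>t. t \<ge> T \<Longrightarrow> norm (y t) \<le> C * exp (- \<sigma> * t)"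
proof -
  obtain C T where C: "\<And>t. t \<ge> T \<Longrightarrow> norm (y t) \<le> C * exp (- \<sigma> * t)" using assms unfolding decays_def by blast
  have "norm (y t) \<le> (\<bar>C\<bar> + 1) * exp (- \<sigma> * t)" if "t \<ge> T" for t
  proof -
    have "C * exp (- \<sigma> * t) \<le> (\<bar>C\<bar> + 1) * exp (- \<sigma> * t)" by (rule mult_right_mono) auto
    then show ?thesis using C[OF that] by linarith
  qed
  then show ?thesis using that[of "\<bar>C\<bar> + 1" T] by simp
qed

lemma decays_add:
  assumes "decays \<sigma> y" "decays \<sigma> z" shows "decays \<sigma> (\<lambda>t. y t + z t)"
proof -
  obtain C1 T1 where 1: "\<And>t. t \<ge> T1 \<Longrightarrow> norm (y t) \<le> C1 * exp (- \<sigma> * t)" using assms(1) unfolding decays_def by blast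
  obtain C2 T2 where 2: "\<And>t. t \<ge> T2 \<Longrightarrow> norm (z t) \<le> C2 * exp (- \<sigma> * t)" using assms(2) unfolding decays_def by blast
  have "norm (y t + z t) \<le> (C1 + C2) * exp (- \<sigma> * t)" if "t \<ge> max T1 T2" for t
    using 1[of t] 2[of t] that norm_triangle_ineq[of "y t" "z t"] by (simp add: distrib_right)
  then show ?thesis unfolding decays_def by blast
qed

lemma decays_cong:
  assumes "decays \<sigma> y" "\<And>t. t \<ge> T0 \<Longrightarrow> y t = z t" shows "decays \<sigma> z"
proof -
  obtain C T where C: "\<And>t. t \<ge> T \<Longrightarrow> norm (y t) \<le> C * exp (- \<sigma> * t)" using assms(1) unfolding decays_def by blast
  have "norm (z t) \<le> C * exp (- \<sigma> * t)" if "t \<ge> max T T0" for t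
    using C[of t] assms(2)[of t] that by simp
  then show ?thesis unfolding decays_def by blast
qed

lemma decays_shift:
  assumes "decays \<sigma> y" shows "decays \<sigma> (\<lambda>t. y (t + c))"
proof -
  obtain C T where C: "\<And>t. t \<ge> T \<Longrightarrow> norm (y t) \<le> C * exp (- \<sigma> * t)" using assms(1) unfolding decays_def by blast
  have "norm (y (t + c)) \<le> (C * exp (- \<sigma> * c)) * exp (- \<sigma> * t)" if "t \<ge> T - c" for t
    using C[of "t + c"] that by (simp add: distrib_left exp_add exp_diff exp_minus mult.assoc field_simps)
  then show ?thesis unfolding decays_def by blast
qed

lemma decays_lipschitz_image:
  fixes G :: "'a::euclidean_space \<Rightarrow> 'b::real_normed_vector"
  assumes "decays \<sigma> y" "lip_compact UNIV G" "G 0 = 0" "\<sigma> > 0" shows "decays \<sigma> (\<lambda>t. G (y t))"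
proof -
  obtain C T where C0: "C > 0" and C: "\<And>t. t \<ge> T \<Longrightarrow> norm (y t) \<le> C * exp (- \<sigma> * t)" using decaysE[OF assms(1)] by blast
  obtain L where L: "L \<ge> 0" "\<And>a b. a \<in> cball 0 C \<Longrightarrow> b \<in> cball 0 C \<Longrightarrow> norm (G a - G b) \<le> L * norm (a - b)"
    using lip_compact_normE[OF assms(2), of "cball 0 C"] by auto
  have "norm (G (y t)) \<le> (L * C) * exp (- \<sigma> * t)" if t: "t \<ge> max T 0" for t
  proof -
    have "exp (- \<sigma> * t) \<le> 1" using t assms(4) by simp
    then have "C * exp (- \<sigma> * t) \<le> C * 1" using C0 by (intro mult_left_mono) auto
    then have "y t \<in> cball 0 C" using C[of t] t by simp
    then have "norm (G (y t) - G 0) \<le> L * norm (y t - 0)" using C0 by (intro L(2)) auto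
    also have "\<dots> \<le> L * (C * exp (- \<sigma> * t))" using C[of t] t L(1) by (intro mult_left_mono) auto
    finally show ?thesis using assms(3) by simp
  qed
  then show ?thesis unfolding decays_def by blast
qed

text \<open>Looking back by at most \<open>d\<close> costs the factor
  \<open>exp (\<sigma> * d)\<close>.\<close>

lemma decays_SUP:
  assumes "decays \<sigma> y" and A: "A \<subseteq> {-d..0}" and "\<sigma> > 0"
  obtains C T where "\<And>t. t \<ge> T \<Longrightarrow> (SUP s\<in>A. ereal (norm (y (t + s)))) \<le> ereal (C * exp (- \<sigma> * t))"
proof -
  obtain C T where C0: "C > 0" and C: "\<And>t. t \<ge> T \<Longrightarrow> norm (y t) \<le> C * exp (- \<sigma> * t)" using decaysE[OF assms(1)] by blast
  have "(SUP s\<in>A. ereal (norm (y (t + s)))) \<le> ereal ((C * exp (\<sigma> * d)) * exp (- \<sigma> * t))" if t: "t \<ge> T + d" for t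
  proof (rule SUP_least)
    fix s assume "s \<in> A"
    then have s: "- d \<le> s" using A by auto
    have "norm (y (t + s)) \<le> C * exp (- \<sigma> * (t + s))" using C[of "t + s"] s t by simp
    also have "\<dots> \<le> C * exp (\<sigma> * d + - \<sigma> * t)"
      using C0 s \<open>\<sigma> > 0\<close> mult_left_mono[of "- d" s \<sigma>] by (intro mult_left_mono) (auto simp: algebra_simps)
    also have "\<dots> = (C * exp (\<sigma> * d)) * exp (- \<sigma> * t)" unfolding exp_add by simp
    finally show "ereal (norm (y (t + s))) \<le> ereal ((C * exp (\<sigma> * d)) * exp (- \<sigma> * t))" by simp
  qed
  then show ?thesis by (rule that)
qed

text \<open>Apply \<open>step\<close> to the supremum of \<open>\<phi>\<close> itself and solve for
  it, as \<open>\<gamma> < 1\<close>. \<open>B\<close> only makes this supremum finite and drops out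
  of the result, so that on intervals \<open>{T..t}\<close> the bound does not depend on
  \<open>t\<close>.\<close>

lemma small_gain:
  fixes \<phi> :: "real \<Rightarrow> real"
  assumes bdd: "\<And>t. t \<in> I \<Longrightarrow> \<phi> t \<le> B" and ge0: "\<And>t. t \<in> I \<Longrightarrow> 0 \<le> \<phi> t" and "0 \<le> \<gamma>" "\<gamma> < 1" "0 \<le> C"
    and step: "\<And>S. S \<ge> 0 \<Longrightarrow> (\<And>t. t \<in> I \<Longrightarrow> \<phi> t \<le> S) \<Longrightarrow> (\<And>t. t \<in> I \<Longrightarrow> \<phi> t \<le> max C (A + \<gamma> * S))"
    and t: "t \<in> I"
  shows "\<phi> t \<le> max C (A / (1 - \<gamma>))"
proof -
  define S where "S = (SUP s\<in>I. \<phi> s)"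
  have bd: "bdd_above (\<phi> ` I)" using bdd by (rule bdd_aboveI2)
  have up: "\<phi> s \<le> S" if "s \<in> I" for s unfolding S_def using that bd by (rule cSUP_upper)
  have S0: "S \<ge> 0" using up[OF t] ge0[OF t] by linarith
  have "S \<le> max C (A + \<gamma> * S)"
    unfolding S_def[symmetric] by (subst (1) S_def, rule cSUP_least) (use t step[OF S0 up] in auto)
  then have "S \<le> max C (A / (1 - \<gamma>))"
  proof (cases "S \<le> C")
    case False
    then have "S \<le> A + \<gamma> * S" using \<open>S \<le> max C (A + \<gamma> * S)\<close> by auto
    then have "S * (1 - \<gamma>) \<le> A" by (simp add: algebra_simps)
    then have "S \<le> A / (1 - \<gamma>)" using \<open>\<gamma> < 1\<close> by (simp add: pos_le_divide_eq)
    then show ?thesis by simp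
  qed simp
  then show ?thesis using up[OF t] by linarith
qed

text \<open>The suprema of the theorem enter through the inequalities they provide.
  \<open>nQ\<close> stands for the norm of \<open>Q\<close>, \<open>cw\<close> for
  \<open>c * \<omega>\<close>, and \<open>B3\<close> is a bound for the set
  \<open>S3\<close>.\<close>

locale stable_loop = loop ts \<tau> r \<delta> Lk b K N ft h f khat q \<psi> kk a2 g \<Phi> U V \<xi>0 z0 w0 \<theta>0 x0 u0 v0
  for ts :: "nat \<Rightarrow> real" and \<tau> r \<delta> Lk b K :: real and N :: nat
    and ft :: "real^'n::finite \<Rightarrow> real^'m::finite \<Rightarrow> real^'n" and h :: "real^'n \<Rightarrow> real^'k::finite"
    and f :: "real^'n \<Rightarrow> real^'m \<Rightarrow> real^'n" and khat :: "real^'n \<Rightarrow> real^'k \<Rightarrow> real^'m \<Rightarrow> real^'n"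
    and q :: "real \<Rightarrow> real" and \<psi> :: "real^'n \<Rightarrow> real" and kk :: "real^'n \<Rightarrow> real^'m"
    and a2 :: "real^'l::finite \<Rightarrow> real^'m" and g :: "real^'l \<Rightarrow> real^'m \<Rightarrow> real^'l"
    and \<Phi> :: "real^'k \<Rightarrow> (real \<Rightarrow> real^'m) \<Rightarrow> real^'l" and U :: "(real^'m) set" and V :: "real^'n \<Rightarrow> real"
    and \<xi>0 :: "nat \<Rightarrow> real \<Rightarrow> real^'n" and z0 :: "real^'n" and w0 :: "real^'k" and \<theta>0 :: "real^'l"
    and x0 :: "real \<Rightarrow> real^'n" and u0 v0 :: "real \<Rightarrow> real^'m" +
  fixes a1 :: "real^'n \<Rightarrow> real^'l" and W P :: "real^'n \<Rightarrow> real" and Q :: "real^'n^'n" and \<rho> :: "real \<Rightarrow> real"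
    and R \<sigma> nQ K2 cw G1 G2 Ts M1q M1f \<mu> K1 Pt B3 :: real
  assumes a1_der: "\<And>x. (a1 has_derivative (\<lambda>d. jacobian a1 (at x) *v d)) (at x)" and a1_lip: "lip_compact UNIV a1"
    and a1_g: "\<And>x v. jacobian a1 (at x) *v ft x v = g (a1 x) v" and a1_0: "a1 0 = 0"
    and f_eq: "\<And>x u. f x u = ft x (a2 (a1 x) + u)"
    and Phi_rep: "\<And>x v t. Linf_on {-\<tau>..} v \<Longrightarrow> solves_ae_on {0..} (\<lambda>t. ft (x t) (v (t - \<tau>))) x \<Longrightarrow> t \<ge> r \<Longrightarrow>
       a1 (x (t + \<tau>)) = \<Phi> (h (x (t - r))) (\<lambda>s. v (t + s))"
    and W_cont: "continuous_on UNIV W" and W_pos: "\<And>x. x \<noteq> 0 \<Longrightarrow> W x > 0" and V_0: "V 0 < R" and Rb: "R < b"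
    and V_dec_x: "\<And>x u. u \<in> U \<Longrightarrow> R \<le> V x \<Longrightarrow> grad V x \<bullet> f x u \<le> - W x"
    and V_dec_z: "\<And>z y u. u \<in> U \<Longrightarrow> b \<le> V z \<Longrightarrow> grad V z \<bullet> (f z u + khat z y u) \<le> - W z"
    and obs: "\<And>z x u. u \<in> U \<Longrightarrow> V z \<le> b \<Longrightarrow> V x \<le> R \<Longrightarrow>
       (z - x) \<bullet> (Q *v (f z u + khat z (h x) u - f x u)) \<le> - cw * (norm (z - x))\<^sup>2"
    and khat_G2: "\<And>z y y' u. u \<in> U \<Longrightarrow> V z \<le> b \<Longrightarrow> norm (khat z y u - khat z y' u) \<le> G2 * norm (y - y')"
    and Q_sym: "transpose Q = Q" and Q_norm: "\<And>x. norm (Q *v x) \<le> nQ * norm x" and Q_low: "\<And>x. K2 * (norm x)\<^sup>2 \<le> x \<bullet> (Q *v x)"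
    and K2: "0 < K2" and nQ: "0 < nQ" and cw: "0 < cw"
    and G1: "\<And>x z u. u \<in> U \<Longrightarrow> V x \<le> R \<Longrightarrow> V z \<le> b \<Longrightarrow>
       norm (jacobian h (at x) *v f x u - jacobian h (at z) *v f z u) \<le> G1 * norm (x - z)"
    and G_nonneg: "G1 \<ge> 0" "G2 \<ge> 0"
    and sigma: "\<sigma> > 0" "4 * \<sigma> * nQ \<le> cw" and gain: "Ts * G1 * exp (\<sigma> * Ts) * sqrt (2 * nQ / K2) * (G2 * nQ / cw) < 1"
    and Ts: "\<And>i. ts (Suc i) - ts i \<le> Ts"
    and h_der: "\<And>x. (h has_derivative (\<lambda>d. jacobian h (at x) *v d)) (at x)" and h_lip: "lip_compact UNIV h" and h_0: "h 0 = 0"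
    and psi_bound: "\<And>x z. V x \<le> R \<Longrightarrow> norm x \<le> \<psi> z" and psi_1: "\<And>z. 1 \<le> \<psi> z" and q_1: "\<And>s. s \<le> 1 \<Longrightarrow> q s = 1" and K_1: "K \<ge> 1"
    and psi_z: "\<And>z. norm z \<le> \<psi> z"
    and rho: "\<And>x u s. u \<in> U \<Longrightarrow> norm x \<le> s \<Longrightarrow> norm (f x u) \<le> \<rho> s"
    and M1q: "\<And>x z z' \<xi>. V x \<le> R \<Longrightarrow> V z \<le> b \<Longrightarrow> V z' \<le> b \<Longrightarrow> norm \<xi> \<le> K * \<psi> z' + \<delta> * \<rho> (K * \<psi> z') \<Longrightarrow>
       norm (q (norm \<xi> / \<psi> z) *\<^sub>R \<xi> - q (norm x / \<psi> z) *\<^sub>R x) \<le> M1q * norm (\<xi> - x)"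
    and M1f: "\<And>x z u \<xi>. u \<in> U \<Longrightarrow> V x \<le> R \<Longrightarrow> V z \<le> b \<Longrightarrow> norm \<xi> \<le> K * \<psi> z \<Longrightarrow> norm (f \<xi> u - f x u) \<le> M1f * norm (\<xi> - x)"
    and M1_nonneg: "M1q \<ge> 0" "M1f \<ge> 0" and gain_pred: "\<delta> * M1q * M1f * exp (\<sigma> * \<delta>) < 1"
    and S3_bound: "\<And>z (\<xi>::real^'n). V z \<le> b \<Longrightarrow> norm \<xi> \<le> K * \<psi> z + \<delta> * \<rho> (K * \<psi> z) \<Longrightarrow> norm \<xi> \<le> B3"
    and P_der: "\<And>x. (P has_derivative (\<lambda>d. grad P x \<bullet> d)) (at x)" and P_lip: "lip_compact UNIV P"
    and P_low: "\<And>x. V x \<le> R \<Longrightarrow> K1 * (norm x)\<^sup>2 \<le> P x" and P_up: "\<And>x. V x \<le> R \<Longrightarrow> P x \<le> Pt / 2 * (norm x)\<^sup>2"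
    and P_grad: "\<And>x. V x \<le> R \<Longrightarrow> norm (grad P x) \<le> Pt * norm x"
    and P_dec: "\<And>x. V x \<le> R \<Longrightarrow> grad P x \<bullet> f x (kk x) \<le> - 2 * \<mu> * (norm x)\<^sup>2"
    and K1: "K1 > 0" and mu: "\<mu> > 0" and Pt: "Pt > 0" and sigma_mu: "\<sigma> * Pt \<le> \<mu>" and kk_0: "kk 0 = 0"
begin

text \<open>On the compact shell between \<open>B\<close> and an upper bound of \<open>V\<close>
  along the trajectory, \<open>W\<close> has a positive minimum: the shell avoids the origin because
  \<open>V 0 < R\<close>. Decrease at that rate reaches \<open>B\<close> in finite time.\<close>

lemma eventually_below:
  assumes y: "solves_ae_on {c..} F y" and "R \<le> B"
    and dec: "AE t in lebesgue. t \<ge> c \<longrightarrow> B \<le> V (y t) \<longrightarrow> grad V (y t) \<bullet> F t \<le> - W (y t)"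
  obtains t1 where "t1 \<ge> c" "\<And>t. t \<ge> t1 \<Longrightarrow> V (y t) \<le> B"
proof -
  have s: "solves_ae_on {c..} (\<lambda>t. grad V (y t) \<bullet> F t) (\<lambda>t. V (y t))"
    using solves_ae_on_compose[OF y V_lip V_der] by simp
  have W_ge: "W x > 0" if "B \<le> V x" for x using that V_0 \<open>R \<le> B\<close> by (intro W_pos) auto
  define M where "M = max (V (y c)) B"
  have M: "V (y t) \<le> M" if "t \<ge> c" for t
    unfolding M_def
  proof (rule solves_scalar_invariant[OF s that])
    show "AE t' in lebesgue. t' \<in> {c..t} \<longrightarrow> B < V (y t') \<longrightarrow> grad V (y t') \<bullet> F t' \<le> 0"
      using dec
    proof eventually_elim
      case (elim q)
      then show ?case using W_ge[of "y q"] by auto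
    qed
  qed auto
  have Vc: "continuous_on UNIV V" using V_lip lip_compact_continuous_on by blast
  define D where "D = {x. B \<le> V x \<and> V x \<le> M}"
  have "closed D" unfolding D_def by (intro closed_Collect_conj closed_Collect_le continuous_intros Vc)
  moreover have "bounded D" using bounded_subset[OF V_bdd[of M], of D] by (auto simp: D_def)
  ultimately have cD: "compact D" by (simp add: compact_eq_bounded_closed)
  obtain k where k: "k > 0" "\<And>x. x \<in> D \<Longrightarrow> k \<le> W x"
  proof (cases "D = {}")
    case True then show ?thesis using that[of 1] by auto
  next
    case False
    obtain x0 where x0: "x0 \<in> D" "\<And>x. x \<in> D \<Longrightarrow> W x0 \<le> W x"
      using continuous_attains_inf[OF cD False continuous_on_subset[OF W_cont]] by auto
    then show ?thesis using that[of "W x0"] W_ge[of x0] by (auto simp: D_def)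
  qed
  show ?thesis
  proof (rule solves_scalar_eventually_le[OF s k(1)])
    show "AE t in lebesgue. t \<ge> c \<longrightarrow> B \<le> V (y t) \<longrightarrow> grad V (y t) \<bullet> F t \<le> - k"
      using dec
    proof eventually_elim
      case (elim q)
      show ?case
      proof (intro impI)
        assume "c \<le> q" "B \<le> V (y q)"
        moreover from this have "y q \<in> D" using M by (simp add: D_def)
        ultimately show "grad V (y q) \<bullet> F q \<le> - k" using elim k(2)[of "y q"] by auto
      qed
    qed
  qed (rule that)
qed

section \<open>Convergence along one closed-loop solution\<close>

context
  fixes x z :: "real \<Rightarrow> real^'n" and w :: "real \<Rightarrow> real^'k" and \<theta> :: "real \<Rightarrow> real^'l"
    and \<xi> :: "nat \<Rightarrow> real \<Rightarrow> real^'n" and u v :: "real \<Rightarrow> real^'m"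
  assumes closed_loop: "closed_loop \<infinity> x z w \<theta> \<xi> u v"
begin

lemma response: "open_loop \<infinity> u v x z w \<theta> \<xi> u v"
  using closed_loop by (simp add: closed_loop_iff_open_loop)

lemma inputs_admissible: "admissible u v"
  by (rule open_loop_admissible[OF response])

lemma x_solves: "solves_ae_on {0..} (\<lambda>t. ft (x t) (v (t - \<tau>))) x"
  using open_loop_x_ode[OF response] by simp

lemma v_Linf: "Linf_on {-r-\<tau>..d} v" and u_Linf: "Linf_on {-r-\<tau>..d} u" and u_U: "AE t in lebesgue. t \<ge> -r-\<tau> \<longrightarrow> u t \<in> U"
  using inputs_admissible by (auto simp: admissible_def)

lemma sampling_set: "{ts i..<ts (Suc i)} \<inter> time_ivl 0 \<infinity> = {ts i..<ts (Suc i)}"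
  using ts_nonneg[of i] by auto

text \<open>\<open>\<Phi>\<close> returns the exact value of \<open>a\<^sub>1\<close> at the predicted state, and \<open>g\<close> propagates it exactly
  between samples.\<close>

lemma theta_reset:
  assumes i: "i \<ge> 1" "ts i \<ge> r" shows "\<theta> (ts i) = a1 (x (ts i + \<tau>))"
proof -
  define T where "T = ts i + 1"
  \<comment> \<open>\<open>Phi_rep\<close> speaks of inputs that are essentially bounded on the
    whole half-line, while \<open>v\<close> is so only locally. Cutting \<open>v\<close> off after
    \<open>T = ts i + 1\<close> changes neither the plant before \<open>T + \<tau>\<close> nor the
    window that \<open>\<Phi>\<close> reads.\<close>
  define vc where "vc t = (if t \<le> T then v t else 0)" for t
  have "Linf_on {-\<tau>..T} v" by (rule Linf_on_interval_subset[OF v_Linf]) (use r in auto)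
  then have "Linf_on {-\<tau>..T} vc" by (rule Linf_on_cong) (auto simp: vc_def)
  moreover have "Linf_on {T<..} (\<lambda>_. 0 :: real^'m)" unfolding Linf_on_def by auto
  then have "Linf_on {T<..} vc" by (rule Linf_on_cong) (auto simp: vc_def)
  ultimately have "Linf_on ({-\<tau>..T} \<union> {T<..}) vc" by (rule Linf_on_Un) auto
  then have L: "Linf_on {-\<tau>..} vc" by (rule Linf_on_subset) auto
  have "Linf_loc_on {-\<tau>..} vc" unfolding Linf_loc_on_def
    by (intro allI impI, rule Linf_on_subset[OF L]) auto
  then obtain xc where xc: "xc 0 = x 0" "solves_ae_on {0..} (\<lambda>t. ft (xc t) (vc (t - \<tau>))) xc"
    using ft_complete unfolding forward_complete_def by blast
  have eq: "xc t = x t" if t: "0 \<le> t" "t < T + \<tau>" for t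
  proof (rule ode_input_unique[where F="\<lambda>(x, v). ft x v" and u="\<lambda>t. v (t - \<tau>)" and \<Omega>=UNIV and a=0 and T="ereal (T + \<tau>)"])
    show "solves_ae_on (time_ivl 0 (ereal (T + \<tau>))) (\<lambda>t. (\<lambda>(x, v). ft x v) (xc t, v (t - \<tau>))) xc"
      by (rule solves_ae_on_cong_on[OF solves_ae_on_subset[OF xc(2)]]) (auto simp: vc_def)
    show "solves_ae_on (time_ivl 0 (ereal (T + \<tau>))) (\<lambda>t. (\<lambda>(x, v). ft x v) (x t, v (t - \<tau>))) x"
    proof -
      have "solves_ae_on {0..<T + \<tau>} (\<lambda>t. ft (x t) (v (t - \<tau>))) x"
        by (rule solves_ae_on_subset[OF x_solves]) auto
      then show ?thesis by simp
    qed
  qed (use xc ft_lip delayed_inputs(2)[OF inputs_admissible] t in auto)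
  have rep: "a1 (xc (ts i + \<tau>)) = \<Phi> (h (xc (ts i - r))) (\<lambda>s. vc (ts i + s))"
    by (rule Phi_rep[OF L xc(2) i(2)])
  have e1: "xc (ts i + \<tau>) = x (ts i + \<tau>)" "xc (ts i - r) = x (ts i - r)"
    by (rule eq; use i tau r ts_nonneg[of i] in \<open>simp add: T_def\<close>)+
  have 1: "Linf_on {-\<tau>-r..0} (\<lambda>s. v (ts i + s))"
  proof -
    have "Linf_on {-\<tau>-r..0} (\<lambda>s. v (s + ts i))"
      by (rule Linf_on_shift[OF v_Linf[of "ts i"]]) (use ts_nonneg[of i] in auto)
    then show ?thesis by (simp add: add.commute)
  qed
  then have 2: "Linf_on {-\<tau>-r..0} (\<lambda>s. vc (ts i + s))"
    by (rule Linf_on_cong) (auto simp: vc_def T_def)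
  have "AE s in lebesgue_on {-\<tau>-r..0}. vc (ts i + s) = v (ts i + s)"
    by (subst AE_lebesgue_on_iff) (auto simp: vc_def T_def intro!: always_eventually)
  then have "\<Phi> (h (x (ts i - r))) (\<lambda>s. vc (ts i + s)) = \<Phi> (h (x (ts i - r))) (\<lambda>s. v (ts i + s))"
    using Phi 1 2 unfolding mapping_on_Linf_def by blast
  moreover have "\<theta> (ts i) = \<Phi> (h (x (ts i - r))) (\<lambda>s. v (ts i + s))"
    using open_loop_th_reset[OF response] i ts_nonneg[of i] by simp
  ultimately show ?thesis using rep e1 by simp
qed

text \<open>By \<open>a1_g\<close>, the function \<open>a1 (x (t + \<tau>))\<close> solves the
  equation of \<open>\<theta>\<close>, because the shift cancels the delay of \<open>v\<close>;
  equal at a reset, the two stay equal until the next one.\<close>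

lemma theta_exact:
  obtains t1 where "t1 \<ge> 0" "\<And>t. t \<ge> t1 \<Longrightarrow> \<theta> t = a1 (x (t + \<tau>))"
proof -
  \<comment> \<open>Taken beyond 0 as well as \<open>r\<close>, because no reset happens at time
    0.\<close>
  obtain i0 where i0: "max r 0 < ts i0" using ts_unbounded by blast
  have "\<theta> t = a1 (x (t + \<tau>))" if t: "t \<ge> ts i0" for t
  proof -
    have t0: "t \<ge> 0" using t ts_nonneg[of i0] by linarith
    define i where "i = idx t"
    have i: "ts i \<le> t" "t < ts (Suc i)" using idx[OF t0] by (auto simp: i_def)
    have "ts i0 < ts (Suc i)" using i t by linarith
    then have "i0 \<le> i" by (simp add: ts_less_iff)
    then have ii: "ts i0 \<le> ts i" by (simp add: ts_le_iff)
    then have i1: "i \<ge> 1" using i0 by (cases i) auto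
    have p1: "solves_ae_on (time_ivl (ts i) (ereal (ts (Suc i)))) (\<lambda>t. (\<lambda>(\<theta>, v). g \<theta> v) (\<theta> t, v t)) \<theta>"
      unfolding time_ivl_ereal
      by (rule solves_ae_on_cong_on[OF open_loop_th_ode[OF response, rule_format, of i, unfolded sampling_set]])
        (use open_loop_v_eq[OF response] ts_nonneg[of i] in \<open>auto simp: add.commute\<close>)
    have "solves_ae_on {0..} (\<lambda>t. jacobian a1 (at (x t)) *v ft (x t) (v (t - \<tau>))) (\<lambda>t. a1 (x t))"
      by (rule solves_ae_on_compose[OF x_solves a1_lip a1_der])
    then have "solves_ae_on {0..} (\<lambda>t. g (a1 (x t)) (v (t - \<tau>))) (\<lambda>t. a1 (x t))" by (simp add: a1_g)
    then have "solves_ae_on {ts i..<ts (Suc i)} (\<lambda>t. g (a1 (x (t + \<tau>))) (v (t + \<tau> - \<tau>))) (\<lambda>t. a1 (x (t + \<tau>)))"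
      by (rule solves_ae_on_shift) (use ts_nonneg[of i] tau in auto)
    then have p2: "solves_ae_on (time_ivl (ts i) (ereal (ts (Suc i)))) (\<lambda>t. (\<lambda>(\<theta>, v). g \<theta> v) (a1 (x (t + \<tau>)), v t)) (\<lambda>t. a1 (x (t + \<tau>)))"
      by simp
    show ?thesis
    proof (rule ode_input_unique[OF p1 p2, where \<Omega>=UNIV])
      show "\<theta> (ts i) = a1 (x (ts i + \<tau>))" using theta_reset[OF i1] i0 ii by simp
      show "Linf_on {ts i..d} v" for d
        by (rule Linf_on_interval_subset[OF v_Linf[of d]]) (use ts_nonneg[of i] r tau in auto)
    qed (use g_lip i in auto)
  qed
  then show ?thesis using that[of "ts i0"] ts_nonneg by blast
qed

lemma x_closed_loop:
  obtains T1 where "T1 \<ge> 0" "solves_ae_on {T1..} (\<lambda>t. f (x t) (u (t - \<tau>))) x"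
proof -
  obtain t1 where t1: "t1 \<ge> 0" "\<And>t. t \<ge> t1 \<Longrightarrow> \<theta> t = a1 (x (t + \<tau>))" using theta_exact by blast
  have "solves_ae_on {t1 + \<tau>..} (\<lambda>t. f (x t) (u (t - \<tau>))) x"
  proof (rule solves_ae_on_cong_on)
    show "solves_ae_on {t1 + \<tau>..} (\<lambda>t. ft (x t) (v (t - \<tau>))) x"
      by (rule solves_ae_on_subset[OF x_solves]) (use t1 tau in auto)
    show "ft (x t) (v (t - \<tau>)) = f (x t) (u (t - \<tau>))" if "t \<in> {t1 + \<tau>..}" for t
      using open_loop_v_eq[OF response] t1(2)[of "t - \<tau>"] that t1(1) by (simp add: f_eq add.commute)
  qed
  then show ?thesis using that[of "t1 + \<tau>"] t1 tau by simp
qed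

lemma u_delayed: "AE t in lebesgue. t \<ge> 0 \<longrightarrow> u (t - \<tau>) \<in> U"
  using AE_lebesgue_shift[OF u_U, of "- \<tau>"] by eventually_elim (use r in auto)

lemma absorbed:
  obtains T2 where "T2 \<ge> 0" "solves_ae_on {T2..} (\<lambda>t. f (x t) (u (t - \<tau>))) x"
    "\<And>t. t \<ge> T2 \<Longrightarrow> V (x t) \<le> R" "\<And>t. t \<ge> T2 \<Longrightarrow> V (z t) \<le> b"
proof -
  obtain T1 where T1: "T1 \<ge> 0" "solves_ae_on {T1..} (\<lambda>t. f (x t) (u (t - \<tau>))) x" using x_closed_loop by blast
  have "AE t in lebesgue. t \<ge> T1 \<longrightarrow> R \<le> V (x t) \<longrightarrow> grad V (x t) \<bullet> f (x t) (u (t - \<tau>)) \<le> - W (x t)"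
    using u_delayed by eventually_elim (use T1 V_dec_x in auto)
  from eventually_below[OF T1(2) order_refl this]
  obtain t2 where t2: "t2 \<ge> T1" "\<And>t. t \<ge> t2 \<Longrightarrow> V (x t) \<le> R" by blast
  have zs: "solves_ae_on {0..} (\<lambda>t. f (z t) (u (t - r - \<tau>)) + khat (z t) (w t) (u (t - r - \<tau>))) z"
    using open_loop_z_ode[OF response] by simp
  have "AE t in lebesgue. t \<ge> 0 \<longrightarrow> b \<le> V (z t) \<longrightarrow>
     grad V (z t) \<bullet> (f (z t) (u (t - r - \<tau>)) + khat (z t) (w t) (u (t - r - \<tau>))) \<le> - W (z t)"
    using delayed_inputs(3)[OF inputs_admissible order_refl] by eventually_elim (use V_dec_z in auto)
  from eventually_below[OF zs less_imp_le[OF Rb] this]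
  obtain t3 where t3: "t3 \<ge> 0" "\<And>t. t \<ge> t3 \<Longrightarrow> V (z t) \<le> b" by blast
  show ?thesis
  proof (rule that[of "max t2 t3"])
    show "solves_ae_on {max t2 t3..} (\<lambda>t. f (x t) (u (t - \<tau>))) x"
      by (rule solves_ae_on_subset[OF T1(2)]) (use t2 in auto)
  qed (use t2 t3 in auto)
qed

lemma x_past:
  assumes "solves_ae_on {T2..} (\<lambda>t. f (x t) (u (t - \<tau>))) x"
  shows "solves_ae_on {T2 + r..} (\<lambda>t. f (x (t - r)) (u (t - r - \<tau>))) (\<lambda>t. x (t - r))"
proof -
  have "solves_ae_on {T2 + r..} (\<lambda>t. f (x (t + - r)) (u (t + - r - \<tau>))) (\<lambda>t. x (t + - r))"
    by (rule solves_ae_on_shift[OF assms]) auto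
  then show ?thesis by simp
qed

text \<open>Both \<open>w\<close> and \<open>h(x(t-r))\<close> are reset to the same value at the sampling times.\<close>

lemma sample_error:
  assumes T: "solves_ae_on {T2..} (\<lambda>t. f (x t) (u (t - \<tau>))) x" "T2 \<ge> 0"
    "\<And>t. t \<ge> T2 \<Longrightarrow> V (x t) \<le> R" "\<And>t. t \<ge> T2 \<Longrightarrow> V (z t) \<le> b"
    and i0: "ts i0 \<ge> T2 + r" "i0 \<ge> 1" and t: "t \<ge> ts i0" and S: "S \<ge> 0"
    and e: "\<And>s. s \<in> {ts i0..t} \<Longrightarrow> norm (z s - x (s - r)) \<le> S * exp (- \<sigma> * s)"
  shows "norm (w t - h (x (t - r))) \<le> (Ts * G1 * exp (\<sigma> * Ts) * S) * exp (- \<sigma> * t)"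
proof -
  have t0: "t \<ge> 0" using t ts_nonneg[of i0] by linarith
  define i where "i = idx t"
  have i: "ts i \<le> t" "t < ts (Suc i)" using idx[OF t0] by (auto simp: i_def)
  have "ts i0 < ts (Suc i)" using i t by linarith
  then have "i0 \<le> i" by (simp add: ts_less_iff)
  then have ii: "ts i0 \<le> ts i" and i1: "i \<ge> 1" using i0 by (auto simp: ts_le_iff)
  let ?D = "\<lambda>s. jacobian h (at (z s)) *v f (z s) (u (s - r - \<tau>)) - jacobian h (at (x (s - r))) *v f (x (s - r)) (u (s - r - \<tau>))"
  have 1: "solves_ae_on {ts i..<ts (Suc i)} (\<lambda>t. jacobian h (at (z t)) *v f (z t) (u (t - r - \<tau>))) w"
    using open_loop_w_ode[OF response, rule_format, of i, unfolded sampling_set] .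
  have 2: "solves_ae_on {T2 + r..} (\<lambda>t. jacobian h (at (x (t - r))) *v f (x (t - r)) (u (t - r - \<tau>))) (\<lambda>t. h (x (t - r)))"
    by (rule solves_ae_on_compose[OF x_past[OF T(1)] h_lip h_der])
  have hi: "(?D has_integral ((w t - w (ts i)) - (h (x (t - r)) - h (x (ts i - r))))) {ts i..t}"
    by (rule has_integral_diff[OF solves_ae_on_has_integral[OF 1 i(1)] solves_ae_on_has_integral[OF 2 i(1)]])
      (use i i0 ii in auto)
  have "w (ts i) = h (x (ts i - r))" using open_loop_w_reset[OF response] i1 ts_nonneg[of i] by simp
  then have hi: "(?D has_integral (w t - h (x (t - r)))) {ts i..t}" using hi by simp
  have "norm (integral {ts i..t} ?D) \<le> (G1 * (S * exp (- \<sigma> * ts i))) * (t - ts i)"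
  proof (rule norm_integral_le_AE)
    show "?D integrable_on {ts i..t}" using hi by blast
    show "((\<lambda>_. G1 * (S * exp (- \<sigma> * ts i))) has_integral (G1 * (S * exp (- \<sigma> * ts i))) * (t - ts i)) {ts i..t}"
      using has_integral_const_real[of "G1 * (S * exp (- \<sigma> * ts i))" "ts i" t] i by (simp add: mult.commute)
    show "AE s in lebesgue. s \<in> {ts i..t} \<longrightarrow> norm (?D s) \<le> G1 * (S * exp (- \<sigma> * ts i))"
      using delayed_inputs(3)[OF inputs_admissible order_refl]
    proof eventually_elim
      case (elim s)
      show ?case
      proof
        assume s: "s \<in> {ts i..t}"
        then have s': "s \<in> {ts i0..t}" "s \<ge> 0" "s \<ge> T2 + r" using ii ts_nonneg[of i] i0 by auto
        have "norm (?D s) = norm (jacobian h (at (x (s - r))) *v f (x (s - r)) (u (s - r - \<tau>)) - jacobian h (at (z s)) *v f (z s) (u (s - r - \<tau>)))"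
          by (rule norm_minus_commute)
        also have "\<dots> \<le> G1 * norm (x (s - r) - z s)"
          by (rule G1) (use elim s' T(3)[of "s - r"] T(4)[of s] r in auto)
        also have "\<dots> = G1 * norm (z s - x (s - r))" by (simp add: norm_minus_commute)
        also have "\<dots> \<le> G1 * (S * exp (- \<sigma> * s))" using e[OF s'(1)] G_nonneg by (intro mult_left_mono) auto
        also have "\<dots> \<le> G1 * (S * exp (- \<sigma> * ts i))"
          using G_nonneg S s sigma by (intro mult_left_mono) auto
        finally show "norm (?D s) \<le> G1 * (S * exp (- \<sigma> * ts i))" .
      qed
    qed
  qed
  then have "norm (w t - h (x (t - r))) \<le> (G1 * (S * exp (- \<sigma> * ts i))) * (t - ts i)"
    using hi by (simp add: integral_unique)
  \<comment> \<open>The error was estimated by its bound at the last sampling time; expressing that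
    at \<open>t\<close>, at most \<open>Ts\<close> later, costs the factor
    \<open>exp (\<sigma> * Ts)\<close>.\<close>
  also have "\<dots> \<le> (G1 * (S * (exp (\<sigma> * Ts) * exp (- \<sigma> * t)))) * Ts"
  proof (rule mult_mono)
    have tTs: "t - ts i \<le> Ts" using i Ts[of i] by linarith
    show "t - ts i \<le> Ts" by (rule tTs)
    have "\<sigma> * (t - ts i) \<le> \<sigma> * Ts" using tTs sigma by (intro mult_left_mono) auto
    then have "exp (- \<sigma> * ts i) \<le> exp (\<sigma> * Ts + - \<sigma> * t)" by (simp add: algebra_simps)
    also have "\<dots> = exp (\<sigma> * Ts) * exp (- \<sigma> * t)" by (rule exp_add)
    finally show "G1 * (S * exp (- \<sigma> * ts i)) \<le> G1 * (S * (exp (\<sigma> * Ts) * exp (- \<sigma> * t)))"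
      using G_nonneg S by (intro mult_left_mono) auto
  qed (use i G_nonneg S in auto)
  finally show ?thesis by (simp add: mult_ac)
qed

text \<open>Small gain between the observer error \<open>e\<close> and the sampling error
  \<open>d\<close>: \<open>sample_error\<close> bounds \<open>d\<close> by \<open>e\<close>, and the
  differential inequality for \<open>Y\<close> bounds \<open>e\<close> by \<open>d\<close>. The
  product of the two gains is the quantity that the assumption \<open>gain\<close> keeps below
  1.\<close>

lemma observer_decay:
  obtains T2 where "T2 \<ge> 0" "solves_ae_on {T2..} (\<lambda>t. f (x t) (u (t - \<tau>))) x"
    "\<And>t. t \<ge> T2 \<Longrightarrow> V (x t) \<le> R" "\<And>t. t \<ge> T2 \<Longrightarrow> V (z t) \<le> b"
    "decays \<sigma> (\<lambda>t. z t - x (t - r))" "decays \<sigma> (\<lambda>t. w t - h (x (t - r)))"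
proof -
  obtain T2 where T: "T2 \<ge> 0" "solves_ae_on {T2..} (\<lambda>t. f (x t) (u (t - \<tau>))) x"
    "\<And>t. t \<ge> T2 \<Longrightarrow> V (x t) \<le> R" "\<And>t. t \<ge> T2 \<Longrightarrow> V (z t) \<le> b" using absorbed by blast
  obtain i0 where i0: "max (T2 + r) 0 < ts i0" using ts_unbounded by blast
  then have i01: "i0 \<ge> 1" by (cases i0) auto
  define T4 where "T4 = ts i0"
  have T4: "T4 \<ge> T2 + r" "T4 \<ge> 0" using i0 by (auto simp: T4_def)
  define e where "e t = z t - x (t - r)" for t
  define d where "d t = w t - h (x (t - r))" for t
  define E where "E t = (f (z t) (u (t - r - \<tau>)) + khat (z t) (w t) (u (t - r - \<tau>))) - f (x (t - r)) (u (t - r - \<tau>))" for t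
  have zs: "solves_ae_on {T4..} (\<lambda>t. f (z t) (u (t - r - \<tau>)) + khat (z t) (w t) (u (t - r - \<tau>))) z"
    using solves_ae_on_subset[OF open_loop_z_ode[OF response]] T4 by auto
  have xs: "solves_ae_on {T4..} (\<lambda>t. f (x (t - r)) (u (t - r - \<tau>))) (\<lambda>t. x (t - r))"
    by (rule solves_ae_on_subset[OF x_past[OF T(2)]]) (use T4 in auto)
  have blm: "bounded_linear (\<lambda>p :: (real^'n) \<times> (real^'n). fst p - snd p)" by (intro bounded_linear_intros)
  have es: "solves_ae_on {T4..} E e"
    unfolding E_def e_def
    using solves_ae_on_compose[OF solves_ae_on_Pair[OF zs xs] lip_compact_bounded_linear[OF blm] bounded_linear_imp_has_derivative[OF blm]]
    by simp
  define Y where "Y p = p \<bullet> (Q *v p)" for p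
  have Qlin: "bounded_linear ((*v) Q)" by (rule matrix_vector_mul_bounded_linear)
  have Qs: "p \<bullet> (Q *v p') = p' \<bullet> (Q *v p)" for p p'
    using dot_lmul_matrix[of p Q p'] Q_sym by (metis inner_commute transpose_matrix_vector)
  have Yd: "(Y has_derivative (\<lambda>d. 2 * (p \<bullet> (Q *v d)))) (at p)" for p
  proof -
    have "(Y has_derivative (\<lambda>d. p \<bullet> (Q *v d) + d \<bullet> (Q *v p))) (at p)"
      unfolding Y_def
      by (intro has_derivative_inner has_derivative_ident bounded_linear_imp_has_derivative Qlin)
    then show ?thesis using Qs[of _ p] by simp
  qed
  have Yl: "lip_compact UNIV Y"
    unfolding Y_def by (intro lip_compact_inner lip_compact_ident lip_compact_bounded_linear Qlin)
  have ys: "solves_ae_on {T4..} (\<lambda>t. 2 * (e t \<bullet> (Q *v E t))) (\<lambda>t. Y (e t))"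
    by (rule solves_ae_on_compose[OF es Yl Yd])
  \<comment> \<open>Coefficient from Young's inequality: half of the dissipation
    \<open>2 * cw\<close> absorbs the cross term between \<open>e\<close> and
    \<open>d\<close>.\<close>
  define B where "B = nQ\<^sup>2 * G2\<^sup>2 / cw"
  have B0: "B \<ge> 0" using cw by (simp add: B_def)
  have Ydot: "2 * (e t \<bullet> (Q *v E t)) \<le> - (cw / nQ) * Y (e t) + B * (norm (d t))\<^sup>2"
    if t: "t \<ge> T4" and uU: "u (t - r - \<tau>) \<in> U" for t
  proof -
    let ?u = "u (t - r - \<tau>)"
    have V: "V (z t) \<le> b" "V (x (t - r)) \<le> R" using T(3)[of "t - r"] T(4)[of t] t T4 r by auto
    define E0 where "E0 = f (z t) ?u + khat (z t) (h (x (t - r))) ?u - f (x (t - r)) ?u"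
    define D where "D = khat (z t) (w t) ?u - khat (z t) (h (x (t - r))) ?u"
    have "E t = E0 + D" by (simp add: E_def E0_def D_def)
    then have "e t \<bullet> (Q *v E t) = e t \<bullet> (Q *v E0) + e t \<bullet> (Q *v D)"
      by (simp add: matrix_vector_right_distrib inner_add_right)
    moreover have "e t \<bullet> (Q *v E0) \<le> - cw * (norm (e t))\<^sup>2"
      unfolding e_def E0_def by (rule obs[OF uU V])
    moreover have "e t \<bullet> (Q *v D) \<le> norm (e t) * (nQ * (G2 * norm (d t)))"
    proof -
      have "e t \<bullet> (Q *v D) \<le> norm (e t) * norm (Q *v D)" by (rule norm_cauchy_schwarz)
      also have "\<dots> \<le> norm (e t) * (nQ * norm D)" by (intro mult_left_mono Q_norm) auto
      also have "\<dots> \<le> norm (e t) * (nQ * (G2 * norm (d t)))"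
        unfolding D_def d_def using nQ by (intro mult_left_mono khat_G2 uU V) auto
      finally show ?thesis .
    qed
    moreover have "2 * (norm (e t) * (nQ * (G2 * norm (d t)))) \<le> cw * (norm (e t))\<^sup>2 + B * (norm (d t))\<^sup>2"
    proof -
      have "0 \<le> (cw * norm (e t) - nQ * G2 * norm (d t))\<^sup>2 / cw" using cw by simp
      also have "\<dots> = cw * (norm (e t))\<^sup>2 + B * (norm (d t))\<^sup>2 - 2 * (norm (e t) * (nQ * (G2 * norm (d t))))"
        using cw by (simp add: B_def power2_eq_square field_simps)
      finally show ?thesis by linarith
    qed
    ultimately have 1: "2 * (e t \<bullet> (Q *v E t)) \<le> - cw * (norm (e t))\<^sup>2 + B * (norm (d t))\<^sup>2" by linarith
    have "Y (e t) \<le> nQ * (norm (e t))\<^sup>2"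
    proof -
      have "Y (e t) \<le> norm (e t) * norm (Q *v e t)" unfolding Y_def by (rule norm_cauchy_schwarz)
      also have "\<dots> \<le> norm (e t) * (nQ * norm (e t))" by (intro mult_left_mono Q_norm) auto
      finally show ?thesis by (simp add: power2_eq_square mult_ac)
    qed
    then have "(cw / nQ) * Y (e t) \<le> (cw / nQ) * (nQ * (norm (e t))\<^sup>2)" using cw nQ by (intro mult_left_mono) auto
    also have "\<dots> = cw * (norm (e t))\<^sup>2" using nQ by simp
    finally show ?thesis using 1 by simp
  qed
  \<comment> \<open>Decay rate of \<open>Y\<close>. Since \<open>4 * \<sigma> \<le> k\<close>, the
    difference \<open>k - 2 * \<sigma>\<close> is at least \<open>k / 2\<close>, which produces the
    2 under the square root in the gain.\<close>
  define k where "k = cw / nQ"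
  have k: "4 * \<sigma> \<le> k" "k > 0" using sigma nQ cw by (auto simp: k_def field_simps)
  define \<gamma> where "\<gamma> = Ts * G1 * exp (\<sigma> * Ts) * sqrt (2 * nQ / K2) * (G2 * nQ / cw)"
  have Ts0: "Ts \<ge> 0" using Ts[of 0] ts_less_iff[of 0 1] by simp
  have g: "0 \<le> \<gamma>" "\<gamma> < 1" using gain Ts0 G_nonneg nQ K2 cw by (auto simp: \<gamma>_def)
  \<comment> \<open>The contribution of the initial value at \<open>T4\<close>; it does not depend
    on the final time \<open>t\<close>.\<close>
  define C where "C = sqrt (\<bar>exp (2 * \<sigma> * T4) * Y (e T4)\<bar> / K2)"
  have C0: "C \<ge> 0" using K2 by (simp add: C_def)
  define \<phi> where "\<phi> t = exp (\<sigma> * t) * norm (e t)" for t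
  have phi_iff: "\<phi> t \<le> S \<longleftrightarrow> norm (e t) \<le> S * exp (- \<sigma> * t)" for t S
    by (simp add: \<phi>_def exp_minus field_simps)
  have bound: "\<phi> t \<le> max C 0" if t: "t \<ge> T4" for t
  proof -
    have ec: "continuous_on {T4..t} e" by (rule solves_ae_on_continuous_on[OF es]) auto
    have pc: "continuous_on {T4..t} \<phi>" unfolding \<phi>_def by (intro continuous_intros ec)
    obtain M where M: "\<And>s. s \<in> {T4..t} \<Longrightarrow> norm (\<phi> s) \<le> M" using continuous_on_interval_bounded[OF pc] by blast
    have "\<phi> t \<le> max C (0 / (1 - \<gamma>))"
    proof (rule small_gain[where I="{T4..t}" and B=M and \<phi>=\<phi> and t=t and A=0 and C=C and \<gamma>=\<gamma>])
      show "\<phi> s \<le> M" if "s \<in> {T4..t}" for s using M[OF that] by simp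
      fix S s assume S: "S \<ge> 0" "\<And>s. s \<in> {T4..t} \<Longrightarrow> \<phi> s \<le> S" and s: "s \<in> {T4..t}"
      define D where "D = Ts * G1 * exp (\<sigma> * Ts) * S"
      have dD: "norm (d q) \<le> D * exp (- \<sigma> * q)" if q: "q \<in> {T4..s}" for q
        unfolding d_def D_def
      proof (rule sample_error[OF T(2,1,3,4) _ i01 _ S(1)])
        show "norm (z p - x (p - r)) \<le> S * exp (- \<sigma> * p)" if "p \<in> {ts i0..q}" for p
          using S(2)[of p] that q s unfolding phi_iff e_def by (auto simp: T4_def)
      qed (use i0 q in \<open>auto simp: T4_def\<close>)
      have "exp (2 * \<sigma> * s) * Y (e s) \<le> max (exp (2 * \<sigma> * T4) * Y (e T4)) (B * D\<^sup>2 / (k - 2 * \<sigma>))"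
      proof (rule solves_scalar_exp[OF ys])
        show "AE q in lebesgue. q \<in> {T4..s} \<longrightarrow> 2 * (e q \<bullet> (Q *v E q)) \<le> - k * Y (e q) + B * D\<^sup>2 * exp (- (2 * \<sigma>) * q)"
          using delayed_inputs(3)[OF inputs_admissible order_refl]
        proof eventually_elim
          case (elim q)
          show ?case
          proof
            assume q: "q \<in> {T4..s}"
            have "(norm (d q))\<^sup>2 \<le> (D * exp (- \<sigma> * q))\<^sup>2" using dD[OF q] by (intro power_mono) auto
            also have "\<dots> = D\<^sup>2 * exp (- (2 * \<sigma>) * q)" by (simp add: power_mult_distrib exp_double[symmetric] mult.assoc)
            finally have "B * (norm (d q))\<^sup>2 \<le> B * (D\<^sup>2 * exp (- (2 * \<sigma>) * q))" using B0 by (intro mult_left_mono) auto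
            moreover have "2 * (e q \<bullet> (Q *v E q)) \<le> - (cw / nQ) * Y (e q) + B * (norm (d q))\<^sup>2"
              by (rule Ydot) (use elim q T4 in auto)
            ultimately show "2 * (e q \<bullet> (Q *v E q)) \<le> - k * Y (e q) + B * D\<^sup>2 * exp (- (2 * \<sigma>) * q)"
              by (simp add: k_def mult.assoc)
          qed
        qed
      qed (use s k sigma in auto)
      also have "B * D\<^sup>2 / (k - 2 * \<sigma>) \<le> B * D\<^sup>2 / (k / 2)"
        using k sigma B0 by (intro divide_left_mono) auto
      finally have *: "exp (2 * \<sigma> * s) * Y (e s) \<le> max (exp (2 * \<sigma> * T4) * Y (e T4)) (B * D\<^sup>2 / (k / 2))"
        by (auto simp: max_def split: if_splits)
      have "K2 * (\<phi> s)\<^sup>2 = exp (2 * \<sigma> * s) * (K2 * (norm (e s))\<^sup>2)"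
        by (simp add: \<phi>_def power_mult_distrib exp_double[symmetric] mult.assoc)
      also have "\<dots> \<le> exp (2 * \<sigma> * s) * Y (e s)" unfolding Y_def by (intro mult_left_mono Q_low) auto
      finally have **: "K2 * (\<phi> s)\<^sup>2 \<le> max (exp (2 * \<sigma> * T4) * Y (e T4)) (B * D\<^sup>2 / (k / 2))" using * by linarith
      show "\<phi> s \<le> max C (0 + \<gamma> * S)"
      proof (cases "K2 * (\<phi> s)\<^sup>2 \<le> exp (2 * \<sigma> * T4) * Y (e T4)")
        case True
        then have "(\<phi> s)\<^sup>2 \<le> \<bar>exp (2 * \<sigma> * T4) * Y (e T4)\<bar> / K2" using K2 by (simp add: field_simps)
        then have "\<phi> s \<le> C" unfolding C_def by (rule real_le_rsqrt)
        then show ?thesis by simp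
      next
        case False
        then have "K2 * (\<phi> s)\<^sup>2 \<le> B * D\<^sup>2 / (k / 2)" using ** by linarith
        then have "(\<phi> s)\<^sup>2 \<le> (2 * nQ / K2) * (G2 * nQ / cw)\<^sup>2 * D\<^sup>2"
          using K2 nQ cw by (simp add: B_def k_def field_simps power2_eq_square)
        also have "\<dots> = (sqrt (2 * nQ / K2))\<^sup>2 * (G2 * nQ / cw)\<^sup>2 * D\<^sup>2" using nQ K2 by simp
        also have "\<dots> = (\<gamma> * S)\<^sup>2" by (simp only: \<gamma>_def D_def power_mult_distrib[symmetric]) (simp add: mult_ac)
        finally have sq: "(\<phi> s)\<^sup>2 \<le> (\<gamma> * S)\<^sup>2" .
        have "\<phi> s \<le> \<gamma> * S" by (rule power2_le_imp_le[OF sq mult_nonneg_nonneg[OF g(1) S(1)]])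
        then show ?thesis by simp
      qed
    qed (use t g C0 in \<open>auto simp: \<phi>_def\<close>)
    then show ?thesis by simp
  qed
  have eb: "norm (e t) \<le> max C 0 * exp (- \<sigma> * t)" if "t \<ge> T4" for t using bound[OF that] unfolding phi_iff .
  then have 1: "decays \<sigma> e" unfolding decays_def by blast
  have "norm (d t) \<le> (Ts * G1 * exp (\<sigma> * Ts) * max C 0) * exp (- \<sigma> * t)" if "t \<ge> T4" for t
    unfolding d_def by (rule sample_error[OF T(2,1,3,4) _ i01]) (use i0 that eb in \<open>auto simp: T4_def e_def\<close>)
  then have 2: "decays \<sigma> d" unfolding decays_def by blast
  show ?thesis by (rule that[OF T(1,2,3,4)]) (use 1 2 in \<open>auto simp: e_def[abs_def] d_def[abs_def]\<close>)
qed

section \<open>Prediction errors\<close>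

abbreviation pred_input :: "nat \<Rightarrow> real \<Rightarrow> real \<Rightarrow> real^'m" where
  "pred_input j t s \<equiv> u (t + (real j - 1) * \<delta> - \<tau> - r + s)"

abbreviation sat :: "real^'n \<Rightarrow> real^'n \<Rightarrow> real^'n" where
  "sat p y \<equiv> q (norm y / \<psi> p) *\<^sub>R y"

lemma pred_Linf:
  assumes "t \<ge> 0" and j: "j \<in> {1..N}"
  shows "Linf_on {0..\<delta>} (\<lambda>s. f (sat (z t) (\<xi> j (t + s - \<delta>))) (pred_input j t s))"
proof -
  have "Linf_on {-\<delta>..t} (\<xi> j)" using Linf_loc_onD[OF open_loop_Linf_xi[OF response, rule_format, OF j]] by simp
  then have 1: "Linf_on {0..\<delta>} (\<lambda>s. \<xi> j (s + (t - \<delta>)))"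
    by (rule Linf_on_shift) (use assms in auto)
  have 2: "Linf_on {0..\<delta>} (\<lambda>s. u (s + (t + (real j - 1) * \<delta> - \<tau> - r)))"
    by (rule Linf_on_shift[OF u_Linf[of t]]) (use assms j_delta[OF j] in \<open>auto simp: algebra_simps\<close>)
  have "Linf_on {0..\<delta>} (\<lambda>s. window_field (z t, \<xi> j (s + (t - \<delta>)), u (s + (t + (real j - 1) * \<delta> - \<tau> - r))))"
    by (rule Linf_on_compose[where S=UNIV, OF Linf_on_Pair[OF Linf_on_continuous[OF continuous_on_const] Linf_on_Pair[OF 1 2]]])
      (use lip_compact_continuous_on[OF window_field_lip] in auto)
  then show ?thesis by (simp add: window_field_def algebra_simps)
qed

lemma pred_eq:
  assumes "t \<ge> 0" and j: "j \<in> {1..N}"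
  shows "\<xi> j t = sat (z t) (\<xi> (j - 1) t) + integral {0..\<delta>} (\<lambda>s. f (sat (z t) (\<xi> j (t + s - \<delta>))) (pred_input j t s))"
proof -
  have "\<xi> j t = sat (z t) (\<xi> (j - 1) t) + (LINT s:{0..\<delta>}|lebesgue. f (sat (z t) (\<xi> j (t + s - \<delta>))) (pred_input j t s))"
    using bspec[OF bspec[OF open_loop_xi_eq[OF response], of t] j] assms(1) by simp
  also have "(LINT s:{0..\<delta>}|lebesgue. f (sat (z t) (\<xi> j (t + s - \<delta>))) (pred_input j t s)) =
      integral {0..\<delta>} (\<lambda>s. f (sat (z t) (\<xi> j (t + s - \<delta>))) (pred_input j t s))"
    by (rule set_lebesgue_integral_eq_integral(2)[OF Linf_on_absolutely_integrable[OF pred_Linf[OF assms]]])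
  finally show ?thesis .
qed

lemma pred_input_U:
  assumes "t \<ge> 0" and j: "j \<in> {1..N}" shows "AE s in lebesgue. s \<in> {0..\<delta>} \<longrightarrow> pred_input j t s \<in> U"
  using AE_lebesgue_shift[OF u_U, of "t + (real j - 1) * \<delta> - \<tau> - r"]
proof eventually_elim
  case (elim s)
  have eq: "s + (t + (real j - 1) * \<delta> - \<tau> - r) = t + (real j - 1) * \<delta> - \<tau> - r + s" by simp
  show ?case using elim[unfolded eq] assms(1) j_delta(1)[OF j] by auto
qed

lemma rho_nonneg: "s \<ge> 0 \<Longrightarrow> \<rho> s \<ge> 0"
  using rho[OF U_0, of 0 s] norm_ge_zero[of "f 0 0"] by (simp del: norm_ge_zero)

text \<open>The saturation bounds both terms of the predictor equation whatever the history, so once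
  \<open>V (z t) \<le> b\<close> every \<open>\<xi> j t\<close> lies in the set on which
  \<open>M1q\<close> is a Lipschitz constant. For \<open>j = 0\<close> the bound is
  \<open>psi_z\<close>.\<close>

lemma xi_bound:
  assumes "t \<ge> 0" and j: "j \<le> N" shows "norm (\<xi> j t) \<le> K * \<psi> (z t) + \<delta> * \<rho> (K * \<psi> (z t))"
proof -
  have Kp: "K * \<psi> (z t) \<ge> \<psi> (z t)" "\<psi> (z t) \<ge> 0"
    using psi_1[of "z t"] K_1 mult_right_mono[of 1 K "\<psi> (z t)"] by auto
  then have rn: "\<rho> (K * \<psi> (z t)) \<ge> 0" by (intro rho_nonneg) linarith
  show ?thesis
  proof (cases "j = 0")
    case True
    then show ?thesis using open_loop_xi_0[OF response] assms psi_z[of "z t"] Kp rn delta_pos by (simp add: add_increasing2)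
  next
    case False
    then have j: "j \<in> {1..N}" using j by simp
    have "norm (integral {0..\<delta>} (\<lambda>s. f (sat (z t) (\<xi> j (t + s - \<delta>))) (pred_input j t s))) \<le> \<rho> (K * \<psi> (z t)) * \<delta>"
    proof (rule norm_integral_le_AE[OF Linf_on_integrable[OF pred_Linf[OF assms(1) j]]])
      show "((\<lambda>_. \<rho> (K * \<psi> (z t))) has_integral \<rho> (K * \<psi> (z t)) * \<delta>) {0..\<delta>}"
        using has_integral_const_real[of "\<rho> (K * \<psi> (z t))" 0 \<delta>] delta_pos by (simp add: mult.commute)
      show "AE s in lebesgue. s \<in> {0..\<delta>} \<longrightarrow> norm (f (sat (z t) (\<xi> j (t + s - \<delta>))) (pred_input j t s)) \<le> \<rho> (K * \<psi> (z t))"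
        using pred_input_U[OF assms(1) j] by eventually_elim (use rho sat_bound in auto)
    qed
    then show ?thesis
      unfolding pred_eq[OF assms(1) j] using sat_bound[of "\<xi> (j - 1) t" "z t"]
      by (intro norm_triangle_mono) (auto simp: mult.commute)
  qed
qed

text \<open>The plant state obeys the predictor equation without saturation: integrating over the
  interval of length \<open>\<delta>\<close> that ends at \<open>t - r + j * \<delta>\<close> meets
  the same control values, since the plant reads them \<open>\<tau>\<close> late.\<close>

lemma x_pred:
  assumes T: "solves_ae_on {T2..} (\<lambda>t. f (x t) (u (t - \<tau>))) x" and T2_nonneg: "T2 \<ge> 0"
    and t: "t - r - \<delta> \<ge> T2" and j: "j \<in> {1..N}"
  shows "((\<lambda>s. f (x ((t + s - \<delta>) - r + real j * \<delta>)) (pred_input j t s)) has_integral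
     (x (t - r + real j * \<delta>) - x (t - r + (real j - 1) * \<delta>))) {0..\<delta>}"
proof -
  define d where "d = t - r + real j * \<delta>"
  define H where "H s = f (x s) (u (s - \<tau>))" for s
  have d\<delta>: "d - \<delta> = t - r + (real j - 1) * \<delta>" by (simp add: d_def algebra_simps)
  have "(H has_integral (x d - x (d - \<delta>))) {d - \<delta>..d}"
    unfolding H_def by (rule solves_ae_on_has_integral[OF T])
      (use d\<delta> t delta_pos j_delta(1)[OF j] in auto)
  then have "H integrable_on {d - \<delta>..d}" and i: "integral {d - \<delta>..d} H = x d - x (d - \<delta>)"
    by (auto simp: integral_unique)
  then have "integral {0..\<delta>} (\<lambda>s. H (d + s - \<delta>)) = x d - x (d - \<delta>)" by (simp add: integral_window_shift)
  moreover have "(\<lambda>s. H (d + s - \<delta>)) integrable_on {0..\<delta>}"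
  proof -
    have L: "Linf_on {d - \<delta>..d} H"
    proof -
      have c: "continuous_on {d - \<delta>..d} x"
        by (rule solves_ae_on_continuous_on[OF T]) (use d\<delta> t j_delta(1)[OF j] delta_pos in auto)
      have "Linf_on {d - \<delta>..d} (\<lambda>s. u (s + - \<tau>))"
        by (rule Linf_on_shift[OF u_Linf[of d]]) (use d\<delta> t j_delta(1)[OF j] delta_pos tau r T2_nonneg in auto)
      from Linf_on_Pair[OF Linf_on_continuous[OF c] this]
      have "Linf_on {d - \<delta>..d} (\<lambda>s. (x s, u (s + - \<tau>)))" by simp
      then have "Linf_on {d - \<delta>..d} (\<lambda>s. (\<lambda>(x, u). f x u) (x s, u (s + - \<tau>)))"
        by (rule Linf_on_compose[where S=UNIV and F="\<lambda>(x, u). f x u"]) (use f_cont in auto)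
      then show ?thesis by (simp add: H_def[abs_def])
    qed
    have "Linf_on {0..\<delta>} (\<lambda>s. H (s + (d - \<delta>)))" by (rule Linf_on_shift[OF L]) auto
    from Linf_on_integrable[OF this] show ?thesis by (simp add: algebra_simps)
  qed
  ultimately have "((\<lambda>s. H (d + s - \<delta>)) has_integral (x d - x (d - \<delta>))) {0..\<delta>}"
    by (metis integrable_integral)
  moreover have "H (d + s - \<delta>) = f (x ((t + s - \<delta>) - r + real j * \<delta>)) (pred_input j t s)" for s
  proof -
    have e1: "d + s - \<delta> = (t + s - \<delta>) - r + real j * \<delta>" and e2: "d + s - \<delta> - \<tau> = t + (real j - 1) * \<delta> - \<tau> - r + s"
      by (simp_all add: d_def algebra_simps)
    show ?thesis unfolding H_def e2 unfolding e1 ..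
  qed
  ultimately show ?thesis unfolding d\<delta> by (simp add: d_def)
qed

text \<open>Absorbed states satisfy \<open>norm y \<le> \<psi> p\<close> for every \<open>p\<close>,
  so the saturation fixes them and may be inserted into the plant equation. Subtraction then brings
  in \<open>M1q\<close> for the previous stage, \<open>M1f\<close> and \<open>M1q\<close> for the
  integrand, and \<open>exp (\<sigma> * \<delta>)\<close> from the oldest point of the
  window.\<close>

lemma pred_step:
  assumes T: "solves_ae_on {T2..} (\<lambda>t. f (x t) (u (t - \<tau>))) x" "T2 \<ge> 0"
    "\<And>t. t \<ge> T2 \<Longrightarrow> V (x t) \<le> R" "\<And>t. t \<ge> T2 \<Longrightarrow> V (z t) \<le> b"
    and t: "t - r - \<delta> \<ge> T2" and j: "j \<in> {1..N}" and S: "S \<ge> 0"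
    and e: "\<And>s. s \<in> {t - \<delta>..t} \<Longrightarrow> norm (\<xi> j s - x (s - r + real j * \<delta>)) \<le> S * exp (- \<sigma> * s)"
  shows "norm (\<xi> j t - x (t - r + real j * \<delta>)) \<le>
     M1q * norm (\<xi> (j - 1) t - x (t - r + (real j - 1) * \<delta>)) + (\<delta> * M1q * M1f * exp (\<sigma> * \<delta>)) * S * exp (- \<sigma> * t)"
proof -
  have t0: "t \<ge> 0" and tr: "t - r \<ge> T2" "t \<ge> T2" using t T(2) delta_pos r by auto
  note jd = j_delta[OF j]
  have jpos: "real j * \<delta> \<ge> \<delta>" using j delta_pos mult_right_mono[of 1 "real j" \<delta>] by simp
  have sat_x: "sat p y = y" if "V y \<le> R" for p y
  proof -
    have "norm y / \<psi> p \<le> 1" using psi_bound[OF that, of p] psi_1[of p] by (simp add: divide_le_eq_1)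
    then show ?thesis by (simp add: q_1)
  qed
  define x1 where "x1 = x (t - r + (real j - 1) * \<delta>)"
  have Vx1: "V x1 \<le> R" unfolding x1_def by (rule T(3)) (use tr jd in auto)
  have 1: "norm (sat (z t) (\<xi> (j - 1) t) - x1) \<le> M1q * norm (\<xi> (j - 1) t - x1)"
  proof -
    have jN: "j - 1 \<le> N" using j by auto
    show ?thesis using M1q[OF Vx1 T(4)[OF tr(2)] T(4)[OF tr(2)] xi_bound[OF t0 jN]] sat_x[OF Vx1] by simp
  qed
  let ?A = "\<lambda>s. f (sat (z t) (\<xi> j (t + s - \<delta>))) (pred_input j t s)"
  let ?B = "\<lambda>s. f (x ((t + s - \<delta>) - r + real j * \<delta>)) (pred_input j t s)"
  have Ai: "?A integrable_on {0..\<delta>}" by (rule Linf_on_integrable[OF pred_Linf[OF t0 j]])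
  note xp = x_pred[OF T(1,2) t j]
  then have Bi: "?B integrable_on {0..\<delta>}" by (auto simp: integrable_on_def)
  have "norm (integral {0..\<delta>} (\<lambda>s. ?A s - ?B s)) \<le> (M1f * (M1q * (S * exp (- \<sigma> * (t - \<delta>))))) * \<delta>"
  proof (rule norm_integral_le_AE)
    show "(\<lambda>s. ?A s - ?B s) integrable_on {0..\<delta>}" by (rule integrable_diff[OF Ai Bi])
    show "((\<lambda>_. M1f * (M1q * (S * exp (- \<sigma> * (t - \<delta>))))) has_integral (M1f * (M1q * (S * exp (- \<sigma> * (t - \<delta>))))) * \<delta>) {0..\<delta>}"
      using has_integral_const_real[of "M1f * (M1q * (S * exp (- \<sigma> * (t - \<delta>))))" 0 \<delta>] delta_pos by (simp add: mult.commute)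
    show "AE s in lebesgue. s \<in> {0..\<delta>} \<longrightarrow> norm (?A s - ?B s) \<le> M1f * (M1q * (S * exp (- \<sigma> * (t - \<delta>))))"
      using pred_input_U[OF t0 j]
    proof eventually_elim
      case (elim s)
      show ?case
      proof
        assume s: "s \<in> {0..\<delta>}"
        define p where "p = t + s - \<delta>"
        define y where "y = x (p - r + real j * \<delta>)"
        have p: "p \<in> {t - \<delta>..t}" "p \<ge> T2" "p \<ge> 0" using s t T(2) r by (auto simp: p_def)
        have Vy: "V y \<le> R" unfolding y_def by (rule T(3)) (use p t jpos in auto)
        have "norm (?A s - ?B s) \<le> M1f * norm (sat (z t) (\<xi> j p) - y)"
          unfolding p_def[symmetric] y_def[symmetric]
          by (rule M1f[OF _ Vy T(4)[OF tr(2)] sat_bound]) (use elim s in auto)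
        also have "norm (sat (z t) (\<xi> j p) - y) = norm (sat (z t) (\<xi> j p) - sat (z t) y)"
          by (simp only: sat_x[OF Vy])
        also have "M1f * \<dots> \<le> M1f * (M1q * norm (\<xi> j p - y))"
          using M1_nonneg j by (intro mult_left_mono M1q[OF Vy T(4)[OF tr(2)] T(4)[OF p(2)] xi_bound[OF p(3)]]) auto
        also have "\<dots> \<le> M1f * (M1q * (S * exp (- \<sigma> * p)))"
          using M1_nonneg e[OF p(1)] by (intro mult_left_mono) (auto simp: y_def)
        also have "\<dots> \<le> M1f * (M1q * (S * exp (- \<sigma> * (t - \<delta>))))"
          using M1_nonneg S p sigma by (intro mult_left_mono) auto
        finally show "norm (?A s - ?B s) \<le> M1f * (M1q * (S * exp (- \<sigma> * (t - \<delta>))))" .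
      qed
    qed
  qed
  then have 2: "norm (integral {0..\<delta>} ?A - integral {0..\<delta>} ?B) \<le> (\<delta> * M1q * M1f * exp (\<sigma> * \<delta>)) * S * exp (- \<sigma> * t)"
    unfolding integral_diff[OF Ai Bi] by (simp add: algebra_simps exp_diff exp_minus field_simps)
  have "integral {0..\<delta>} ?B = x (t - r + real j * \<delta>) - x1"
    using xp by (simp add: x1_def integral_unique)
  then have "\<xi> j t - x (t - r + real j * \<delta>) = (sat (z t) (\<xi> (j - 1) t) - x1) + (integral {0..\<delta>} ?A - integral {0..\<delta>} ?B)"
    using pred_eq[OF t0 j] by simp
  then show ?thesis
    using norm_triangle_ineq[of "sat (z t) (\<xi> (j - 1) t) - x1" "integral {0..\<delta>} ?A - integral {0..\<delta>} ?B"] 1 2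
    unfolding x1_def[symmetric] by (simp only:)
qed

text \<open>Each stage is a small-gain loop with itself, driven by the decaying error of the
  previous stage; stage 0 is the observer error.\<close>

lemma predictor_decay:
  assumes T: "solves_ae_on {T2..} (\<lambda>t. f (x t) (u (t - \<tau>))) x" "T2 \<ge> 0"
    "\<And>t. t \<ge> T2 \<Longrightarrow> V (x t) \<le> R" "\<And>t. t \<ge> T2 \<Longrightarrow> V (z t) \<le> b"
    and obsd: "decays \<sigma> (\<lambda>t. z t - x (t - r))" and "j \<le> N"
  shows "decays \<sigma> (\<lambda>t. \<xi> j t - x (t - r + real j * \<delta>))"
  using \<open>j \<le> N\<close>
proof (induction j)
  case 0
  show ?case by (rule decays_cong[OF obsd, of 0]) (use open_loop_xi_0[OF response] in auto)
next
  case (Suc j)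
  then have j: "Suc j \<in> {1..N}" and "j \<le> N" by auto
  obtain C Tj where C0: "C > 0" and C: "\<And>t. t \<ge> Tj \<Longrightarrow> norm (\<xi> j t - x (t - r + real j * \<delta>)) \<le> C * exp (- \<sigma> * t)"
    using decaysE[OF Suc.IH[OF \<open>j \<le> N\<close>]] by blast
  define e where "e t = \<xi> (Suc j) t - x (t - r + real (Suc j) * \<delta>)" for t
  define T6 where "T6 = max (T2 + r) Tj"
  have T6: "T6 \<ge> T2 + r" "T6 \<ge> Tj" "T6 \<ge> 0" using T(2) r by (auto simp: T6_def)
  \<comment> \<open>A bound known in advance: \<open>xi_bound\<close> and \<open>S3_bound\<close>
    control the predictor, \<open>psi_bound\<close> controls absorbed plant states. It makes the
    weighted supremum finite.\<close>
  define Bd where "Bd = B3 + \<psi> 0"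
  have bd: "norm (e t) \<le> Bd" if t: "t \<ge> T6" for t
  proof -
    have t2: "t \<ge> T2" "t \<ge> 0" using t T6 r T(2) by auto
    have Vz: "V (z t) \<le> b" using T(4) t2 by blast
    have "norm (\<xi> (Suc j) t) \<le> B3" by (rule S3_bound[OF Vz xi_bound[OF t2(2) Suc.prems]])
    moreover have "norm (x (t - r + real (Suc j) * \<delta>)) \<le> \<psi> 0"
      by (rule psi_bound, rule T(3)) (use t T6 delta_pos in \<open>auto intro: add_increasing2\<close>)
    ultimately show ?thesis unfolding e_def Bd_def
      using norm_triangle_ineq4[of "\<xi> (Suc j) t" "x (t - r + real (Suc j) * \<delta>)"] by linarith
  qed
  have Bd0: "Bd \<ge> 0" using bd[of T6] norm_ge_zero[of "e T6"] by linarith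
  define \<gamma> where "\<gamma> = \<delta> * M1q * M1f * exp (\<sigma> * \<delta>)"
  have g: "0 \<le> \<gamma>" "\<gamma> < 1" using gain_pred M1_nonneg delta_pos by (auto simp: \<gamma>_def)
  \<comment> \<open>On \<open>{T6..T6 + \<delta>}\<close> the window reaches back beyond
    \<open>T6\<close>, where no weighted bound is available; the bound \<open>Bd\<close> covers this
    piece.\<close>
  define C' where "C' = exp (\<sigma> * (T6 + \<delta>)) * Bd"
  define \<phi> where "\<phi> t = exp (\<sigma> * t) * norm (e t)" for t
  have phi_iff: "\<phi> t \<le> S \<longleftrightarrow> norm (e t) \<le> S * exp (- \<sigma> * t)" for t S
    by (simp add: \<phi>_def exp_minus field_simps)
  have phi_bd: "\<phi> s \<le> exp (\<sigma> * t) * Bd" if "s \<in> {T6..t}" for s t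
    unfolding \<phi>_def using that bd[of s] sigma Bd0 by (intro mult_mono) auto
  have "\<phi> t \<le> max C' (M1q * C / (1 - \<gamma>))" if t: "t \<ge> T6" for t
  proof (rule small_gain[where I="{T6..t}" and B="exp (\<sigma> * t) * Bd" and \<phi>=\<phi> and t=t and A="M1q * C" and C=C' and \<gamma>=\<gamma>])
    fix S s assume S: "S \<ge> 0" "\<And>s. s \<in> {T6..t} \<Longrightarrow> \<phi> s \<le> S" and s: "s \<in> {T6..t}"
    show "\<phi> s \<le> max C' (M1q * C + \<gamma> * S)"
    proof (cases "s \<le> T6 + \<delta>")
      case True
      then show ?thesis using phi_bd[of s "T6 + \<delta>"] s by (simp add: C'_def)
    next
      case False
      have "norm (e s) \<le> M1q * norm (\<xi> (Suc j - 1) s - x (s - r + (real (Suc j) - 1) * \<delta>)) + \<gamma> * S * exp (- \<sigma> * s)"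
        unfolding e_def \<gamma>_def
      proof (rule pred_step[OF T(1,2,3,4) _ j S(1)])
        show "norm (\<xi> (Suc j) p - x (p - r + real (Suc j) * \<delta>)) \<le> S * exp (- \<sigma> * p)" if "p \<in> {s - \<delta>..s}" for p
          using S(2)[of p] that False s unfolding phi_iff e_def by auto
      qed (use False T6 in auto)
      also have "\<dots> \<le> M1q * (C * exp (- \<sigma> * s)) + \<gamma> * S * exp (- \<sigma> * s)"
        using C[of s] s T6 M1_nonneg by (intro add_right_mono mult_left_mono) auto
      also have "\<dots> = (M1q * C + \<gamma> * S) * exp (- \<sigma> * s)" by (simp add: algebra_simps)
      finally have "\<phi> s \<le> M1q * C + \<gamma> * S" unfolding phi_iff .
      then show ?thesis by simp
    qed
  qed (use t g Bd0 phi_bd in \<open>auto simp: \<phi>_def C'_def\<close>)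
  then have "norm (e t) \<le> max C' (M1q * C / (1 - \<gamma>)) * exp (- \<sigma> * t)" if "t \<ge> T6" for t
    using that unfolding phi_iff by blast
  then show ?case unfolding decays_def e_def[symmetric] by blast
qed

text \<open>As \<open>N * \<delta> = r + \<tau>\<close>, the control acting at time \<open>t\<close>
  is the feedback of \<open>\<xi> N (t - \<tau>)\<close>, a prediction of \<open>x t\<close>. The
  plant thus runs under \<open>kk (x t)\<close> up to an exponentially small perturbation.\<close>

lemma state_decay:
  assumes T: "solves_ae_on {T2..} (\<lambda>t. f (x t) (u (t - \<tau>))) x" "T2 \<ge> 0" "\<And>t. t \<ge> T2 \<Longrightarrow> V (x t) \<le> R"
    and pd: "decays \<sigma> (\<lambda>t. \<xi> N t - x (t - r + real N * \<delta>))"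
  shows "decays \<sigma> x"
proof -
  have Lk0: "Lk \<ge> 0" using lipschitz_on_nonneg[OF kk_lip] .
  have "decays \<sigma> (\<lambda>t. \<xi> N (t + - \<tau>) - x (t + - \<tau> - r + real N * \<delta>))" by (rule decays_shift[OF pd])
  then obtain C T5 where C0: "C > 0" and C: "\<And>t. t \<ge> T5 \<Longrightarrow> norm (\<xi> N (t - \<tau>) - x t) \<le> C * exp (- \<sigma> * t)"
    using decaysE[of \<sigma> "\<lambda>t. \<xi> N (t - \<tau>) - x t"] by (auto simp: N_delta)
  define c where "c = max T2 (max T5 \<tau>)"
  have c: "c \<ge> T2" "c \<ge> T5" "c \<ge> \<tau>" by (auto simp: c_def)
  have "compact (cball (0::real^'n) (\<psi> 0) \<times> U)" using U_compact by (intro compact_Times) auto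
  then obtain Lf where Lf: "Lf \<ge> 0" "\<And>p p'. p \<in> cball 0 (\<psi> 0) \<times> U \<Longrightarrow> p' \<in> cball 0 (\<psi> 0) \<times> U \<Longrightarrow>
      norm ((\<lambda>(x, u). f x u) p - (\<lambda>(x, u). f x u) p') \<le> Lf * norm (p - p')"
    using lip_compact_normE[OF f_lip] by (metis subset_UNIV)
  \<comment> \<open>Collects the gradient bound of \<open>P\<close>, the Lipschitz constant of
    \<open>f\<close> over absorbed states, that of \<open>kk\<close>, and the constant of the
    prediction error.\<close>
  define D where "D = Pt * (Lf * (Lk * C))"
  have s: "solves_ae_on {T2..} (\<lambda>t. grad P (x t) \<bullet> f (x t) (u (t - \<tau>))) (\<lambda>t. P (x t))"
    by (rule solves_ae_on_compose[OF T(1) P_lip P_der])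
  have Pdot: "grad P (x t) \<bullet> f (x t) (u (t - \<tau>)) \<le> - (3 * \<mu> / Pt) * P (x t) + (D\<^sup>2 / (2 * \<mu>)) * exp (- (2 * \<sigma>) * t)"
    if t: "t \<ge> c" for t
  proof -
    have V: "V (x t) \<le> R" using T(3) t c by simp
    have uk: "u (t - \<tau>) = kk (\<xi> N (t - \<tau>))" using open_loop_u_eq[OF response] t c by simp
    have xb: "norm (x t) \<le> \<psi> 0" by (rule psi_bound[OF V])
    have du: "norm (u (t - \<tau>) - kk (x t)) \<le> Lk * (C * exp (- \<sigma> * t))"
    proof -
      have "norm (u (t - \<tau>) - kk (x t)) \<le> Lk * norm (\<xi> N (t - \<tau>) - x t)"
        unfolding uk using lipschitz_onD[OF kk_lip, of "\<xi> N (t - \<tau>)" "x t"] by (simp add: dist_norm)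
      also have "\<dots> \<le> Lk * (C * exp (- \<sigma> * t))" using C[of t] t c Lk0 by (intro mult_left_mono) auto
      finally show ?thesis .
    qed
    have "norm (f (x t) (u (t - \<tau>)) - f (x t) (kk (x t))) \<le> Lf * norm ((x t, u (t - \<tau>)) - (x t, kk (x t)))"
      using Lf(2)[of "(x t, u (t - \<tau>))" "(x t, kk (x t))"] xb uk kk_U by simp
    also have "\<dots> = Lf * norm (u (t - \<tau>) - kk (x t))" by (simp add: norm_Pair)
    also have "\<dots> \<le> Lf * (Lk * (C * exp (- \<sigma> * t)))" using du Lf by (intro mult_left_mono) auto
    finally have df: "norm (f (x t) (u (t - \<tau>)) - f (x t) (kk (x t))) \<le> Lf * (Lk * (C * exp (- \<sigma> * t)))" .
    have "grad P (x t) \<bullet> f (x t) (u (t - \<tau>)) = grad P (x t) \<bullet> f (x t) (kk (x t)) + grad P (x t) \<bullet> (f (x t) (u (t - \<tau>)) - f (x t) (kk (x t)))"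
      by (simp add: inner_diff_right)
    also have "grad P (x t) \<bullet> f (x t) (kk (x t)) \<le> - 2 * \<mu> * (norm (x t))\<^sup>2" by (rule P_dec[OF V])
    also have "grad P (x t) \<bullet> (f (x t) (u (t - \<tau>)) - f (x t) (kk (x t))) \<le> norm (x t) * (D * exp (- \<sigma> * t))"
    proof -
      have "grad P (x t) \<bullet> (f (x t) (u (t - \<tau>)) - f (x t) (kk (x t))) \<le> norm (grad P (x t)) * norm (f (x t) (u (t - \<tau>)) - f (x t) (kk (x t)))"
        by (rule norm_cauchy_schwarz)
      also have "\<dots> \<le> (Pt * norm (x t)) * (Lf * (Lk * (C * exp (- \<sigma> * t))))"
        using Pt by (intro mult_mono P_grad[OF V] df) auto
      finally show ?thesis by (simp add: D_def mult_ac)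
    qed
    \<comment> \<open>Young's inequality spends \<open>\<mu> / 2\<close> of the dissipation
      \<open>2 * \<mu>\<close>; by \<open>P_up\<close> the remaining \<open>3 * \<mu> / 2\<close>
      becomes the rate \<open>3 * \<mu> / Pt\<close> for \<open>P\<close>.\<close>
    also have "norm (x t) * (D * exp (- \<sigma> * t)) \<le> \<mu> / 2 * (norm (x t))\<^sup>2 + (D\<^sup>2 / (2 * \<mu>)) * exp (- (2 * \<sigma>) * t)"
    proof -
      have "0 \<le> (\<mu> * norm (x t) - D * exp (- \<sigma> * t))\<^sup>2 / (2 * \<mu>)" using mu by simp
      also have "\<dots> = \<mu> / 2 * (norm (x t))\<^sup>2 + (D\<^sup>2 / (2 * \<mu>)) * (exp (- \<sigma> * t))\<^sup>2 - norm (x t) * (D * exp (- \<sigma> * t))"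
        using mu by (simp add: power2_eq_square field_simps)
      also have "(exp (- \<sigma> * t))\<^sup>2 = exp (- (2 * \<sigma>) * t)" by (simp add: exp_double[symmetric] mult.assoc)
      finally show ?thesis by linarith
    qed
    also have "- 2 * \<mu> * (norm (x t))\<^sup>2 + (\<mu> / 2 * (norm (x t))\<^sup>2 + (D\<^sup>2 / (2 * \<mu>)) * exp (- (2 * \<sigma>) * t)) =
       - (3 * \<mu> / Pt) * (Pt / 2 * (norm (x t))\<^sup>2) + (D\<^sup>2 / (2 * \<mu>)) * exp (- (2 * \<sigma>) * t)"
      using Pt by (simp add: field_simps)
    also have "- (3 * \<mu> / Pt) * (Pt / 2 * (norm (x t))\<^sup>2) \<le> - (3 * \<mu> / Pt) * P (x t)"
      using P_up[OF V] Pt mu by (intro mult_left_mono_neg) auto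
    finally show ?thesis by simp
  qed
  define M where "M = max (exp (2 * \<sigma> * c) * P (x c)) ((D\<^sup>2 / (2 * \<mu>)) / (3 * \<mu> / Pt - 2 * \<sigma>))"
  have "norm (x t) \<le> sqrt (\<bar>M\<bar> / K1) * exp (- \<sigma> * t)" if t: "t \<ge> c" for t
  proof -
    have "exp (2 * \<sigma> * t) * P (x t) \<le> M"
      unfolding M_def
    proof (rule solves_scalar_exp[OF s t])
      show "{c..t} \<subseteq> {T2..}" using c by auto
      \<comment> \<open>\<open>sigma_mu\<close> gives \<open>2 * \<mu>\<close> on the right; the
        margin to \<open>3 * \<mu>\<close> makes the rate strictly larger than
        \<open>2 * \<sigma>\<close>, as \<open>solves_scalar_exp\<close> demands.\<close>
      have "2 * \<sigma> * Pt < 3 * \<mu>" using sigma_mu mu by linarith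
      then show "2 * \<sigma> < 3 * \<mu> / Pt" using Pt by (simp add: pos_less_divide_eq)
      show "AE q in lebesgue. q \<in> {c..t} \<longrightarrow> grad P (x q) \<bullet> f (x q) (u (q - \<tau>)) \<le> - (3 * \<mu> / Pt) * P (x q) + D\<^sup>2 / (2 * \<mu>) * exp (- (2 * \<sigma>) * q)"
        using Pdot by (intro always_eventually) auto
    qed
    then have "exp (2 * \<sigma> * t) * (K1 * (norm (x t))\<^sup>2) \<le> M"
      using P_low[of "x t"] T(3)[of t] t c by (meson exp_ge_zero mult_left_mono order_trans)
    then have "K1 * (exp (\<sigma> * t) * norm (x t))\<^sup>2 \<le> \<bar>M\<bar>"
      by (simp add: power_mult_distrib exp_double[symmetric] mult_ac)
    then have "(exp (\<sigma> * t) * norm (x t))\<^sup>2 \<le> \<bar>M\<bar> / K1" using K1 by (simp add: field_simps)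
    then have "exp (\<sigma> * t) * norm (x t) \<le> sqrt (\<bar>M\<bar> / K1)" by (rule real_le_rsqrt)
    then show ?thesis by (simp add: exp_minus field_simps)
  qed
  then show ?thesis unfolding decays_def by blast
qed

theorem limsup_finite:
  "Limsup at_top (\<lambda>t. ereal (exp (\<sigma> * t)) * state_size \<tau> r \<delta> N x z w \<theta> \<xi> u t) < \<infinity>"
proof -
  obtain T2 where T: "T2 \<ge> 0" "solves_ae_on {T2..} (\<lambda>t. f (x t) (u (t - \<tau>))) x"
    "\<And>t. t \<ge> T2 \<Longrightarrow> V (x t) \<le> R" "\<And>t. t \<ge> T2 \<Longrightarrow> V (z t) \<le> b"
    "decays \<sigma> (\<lambda>t. z t - x (t - r))" "decays \<sigma> (\<lambda>t. w t - h (x (t - r)))"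
    using observer_decay by blast
  have pd: "decays \<sigma> (\<lambda>t. \<xi> j t - x (t - r + real j * \<delta>))" if "j \<le> N" for j
    by (rule predictor_decay[OF T(2,1) _ _ T(5) that]) (use T in auto)
  have dx: "decays \<sigma> x" by (rule state_decay[OF T(2,1) _ pd]) (use T in auto)
  have dxs: "decays \<sigma> (\<lambda>t. x (t + s))" for s by (rule decays_shift[OF dx])
  have dz: "decays \<sigma> z" using decays_add[OF T(5) dxs[of "-r"]] by simp
  have dw: "decays \<sigma> w" using decays_add[OF T(6) decays_lipschitz_image[OF dxs[of "-r"] h_lip h_0 sigma(1)]] by simp
  have dth: "decays \<sigma> \<theta>"
  proof -
    obtain t1 where "\<And>t. t \<ge> t1 \<Longrightarrow> \<theta> t = a1 (x (t + \<tau>))" using theta_exact by blast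
    then show ?thesis
      by (intro decays_cong[OF decays_lipschitz_image[OF dxs[of \<tau>] a1_lip a1_0 sigma(1)], of t1]) simp
  qed
  have dxi: "decays \<sigma> (\<xi> j)" if "j \<le> N" for j
    using decays_add[OF pd[OF that] dxs[of "- r + real j * \<delta>"]] by (simp add: algebra_simps)
  have kk_lc: "lip_compact UNIV kk" unfolding lip_compact_def using lipschitz_on_subset[OF kk_lip] by blast
  have du: "decays \<sigma> u"
    by (rule decays_cong[OF decays_lipschitz_image[where G=kk, OF dxi[OF order_refl] kk_lc kk_0 sigma(1)], of 0])
      (use open_loop_u_eq[OF response] in auto)
  obtain Cx Tx where x: "\<And>t. t \<ge> Tx \<Longrightarrow> (SUP s\<in>{-r..0}. ereal (norm (x (t + s)))) \<le> ereal (Cx * exp (- \<sigma> * t))"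
    using decays_SUP[OF dx order_refl sigma(1)] by blast
  obtain Cu Tu where u: "\<And>t. t \<ge> Tu \<Longrightarrow> (SUP s\<in>{-r-\<tau>..<0}. ereal (norm (u (t + s)))) \<le> ereal (Cu * exp (- \<sigma> * t))"
    by (rule decays_SUP[OF du _ sigma(1), of "{-r-\<tau>..<0}" "r + \<tau>"]) auto
  obtain Cz Tz where z: "\<And>t. t \<ge> Tz \<Longrightarrow> norm (z t) \<le> Cz * exp (- \<sigma> * t)" using dz unfolding decays_def by blast
  obtain Cw Tw where w: "\<And>t. t \<ge> Tw \<Longrightarrow> norm (w t) \<le> Cw * exp (- \<sigma> * t)" using dw unfolding decays_def by blast
  obtain Ct Tt where th: "\<And>t. t \<ge> Tt \<Longrightarrow> norm (\<theta> t) \<le> Ct * exp (- \<sigma> * t)" using dth unfolding decays_def by blast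
  have "\<exists>C T. \<forall>t\<ge>T. (SUP s\<in>{-\<delta>..<0}. ereal (norm (\<xi> j (t + s)))) \<le> ereal (C * exp (- \<sigma> * t))" if "j \<le> N" for j
    by (rule decays_SUP[OF dxi[OF that] _ sigma(1), of "{-\<delta>..<0}" \<delta>]) auto
  then obtain Cj Tj where xi: "\<And>j t. j \<le> N \<Longrightarrow> t \<ge> Tj j \<Longrightarrow> (SUP s\<in>{-\<delta>..<0}. ereal (norm (\<xi> j (t + s)))) \<le> ereal (Cj j * exp (- \<sigma> * t))"
    by metis
  define Tm where "Tm = Max ({Tx, Tu, Tz, Tw, Tt} \<union> Tj ` {1..N})"
  define Cm where "Cm = Cx + Cw + Cz + Ct + (\<Sum>j=1..N. Cj j) + Cu"
  have Tm: "Tx \<le> Tm" "Tu \<le> Tm" "Tz \<le> Tm" "Tw \<le> Tm" "Tt \<le> Tm" "\<And>j. j \<in> {1..N} \<Longrightarrow> Tj j \<le> Tm"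
    unfolding Tm_def by (intro Max_ge; simp)+
  have bound: "ereal (exp (\<sigma> * t)) * state_size \<tau> r \<delta> N x z w \<theta> \<xi> u t \<le> ereal Cm" if t: "t \<ge> Tm" for t
  proof -
    have "state_size \<tau> r \<delta> N x z w \<theta> \<xi> u t \<le> ereal (Cx * exp (- \<sigma> * t)) + ereal (Cw * exp (- \<sigma> * t)) + ereal (Cz * exp (- \<sigma> * t)) +
       ereal (Ct * exp (- \<sigma> * t)) + (\<Sum>j=1..N. ereal (Cj j * exp (- \<sigma> * t))) + ereal (Cu * exp (- \<sigma> * t))"
      unfolding state_size_def
      by (intro add_mono sum_mono x u xi) (use t Tm order_trans[OF Tm(6) t] z[of t] w[of t] th[of t] in auto)
    also have "\<dots> = ereal (Cm * exp (- \<sigma> * t))"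
      by (simp add: sum_ereal Cm_def distrib_right sum_distrib_right)
    finally have "ereal (exp (\<sigma> * t)) * state_size \<tau> r \<delta> N x z w \<theta> \<xi> u t \<le> ereal (exp (\<sigma> * t)) * ereal (Cm * exp (- \<sigma> * t))"
      by (rule ereal_mult_left_mono) simp
    also have "\<dots> = ereal Cm" by (simp add: exp_minus)
    finally show ?thesis .
  qed
  have "Limsup at_top (\<lambda>t. ereal (exp (\<sigma> * t)) * state_size \<tau> r \<delta> N x z w \<theta> \<xi> u t) \<le> ereal Cm"
    by (rule Limsup_bounded, rule eventually_mono[OF eventually_ge_at_top[of Tm]], rule bound)
  also have "\<dots> < \<infinity>" by simp
  finally show ?thesis .
qed

end

end

section \<open>The observer correction and bounds for the constants\<close>

lemma symmetric_inner_matrix: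
  fixes Q :: "real^'n::finite^'n"
  assumes "transpose Q = Q" shows "x \<bullet> (Q *v y) = y \<bullet> (Q *v x)"
  by (metis assms dot_lmul_matrix inner_commute transpose_matrix_vector)

lemma mat_norm_bound: "norm (A *v x) \<le> mat_norm A * norm x"
  for A :: "real^'n::finite^'m::finite"
  unfolding mat_norm_def by (rule onorm) simp

lemma mat_norm_nonneg: "0 \<le> mat_norm A"
  for A :: "real^'n::finite^'m::finite"
  unfolding mat_norm_def by (rule onorm_pos_le) simp

lemma lip_compact_matrix_vector:
  fixes A :: "real^'n::finite^'m::finite" and f :: "'a::real_normed_vector \<Rightarrow> real^'n"
  shows "lip_compact S f \<Longrightarrow> lip_compact S (\<lambda>x. A *v f x)"
  by (rule lip_compact_compose_UNIV[OF lip_compact_bounded_linear]) simp_all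

text \<open>A positive continuous function has a positive minimum on a compact set.\<close>

lemma lip_compact_inverse_pos:
  fixes g :: "'a::real_normed_vector \<Rightarrow> real"
  assumes g: "lip_compact S g" and pos: "\<And>x. x \<in> S \<Longrightarrow> g x > 0"
  shows "lip_compact S (\<lambda>x. inverse (g x))"
proof (rule lip_compactI)
  fix K assume K: "compact K" "K \<subseteq> S"
  obtain C where C: "C-lipschitz_on K g" using lip_compactD[OF g K] by blast
  obtain c where c: "c > 0" "\<And>x. x \<in> K \<Longrightarrow> c \<le> g x"
  proof (cases "K = {}")
    case True then show ?thesis using that[of 1] by auto
  next
    case False
    obtain x0 where "x0 \<in> K" "\<And>x. x \<in> K \<Longrightarrow> g x0 \<le> g x"
      using continuous_attains_inf[OF K(1) False lipschitz_on_continuous_on[OF C]] by auto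
    then show ?thesis using that[of "g x0"] pos K by blast
  qed
  have "lip_compact K (\<lambda>x. inverse (g x))"
    by (rule lip_compact_compose[OF lip_compact_subset[OF g K(2)] lip_compact_inverse[OF c(1)]]) (use c in auto)
  then show "\<exists>C. C-lipschitz_on K (\<lambda>x. inverse (g x))" using lip_compactD[OF _ K(1) order_refl] by blast
qed

lemma lip_compact_bound:
  fixes f :: "'a::real_normed_vector \<Rightarrow> 'b::real_normed_vector"
  assumes "lip_compact S f" "compact K" "K \<subseteq> S"
  shows "\<exists>C. \<forall>x\<in>K. \<forall>y\<in>K. norm (f x - f y) \<le> C * norm (x - y)"
  using lip_compactD[OF assms] by (metis lipschitz_onD dist_norm)

text \<open>A real supremum is meaningful only for bounded sets, so each constant of the theorem
  needs its own proof of boundedness before it can serve as a Lipschitz constant.\<close>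

lemma Sup_ratio_upper:
  fixes x y :: real
  assumes "M = Sup A" "bdd_above A" "x / y \<in> A" "y > 0" shows "x \<le> M * y"
  using cSup_upper[OF assms(3,2)] assms(1,4) by (simp add: divide_le_eq)

lemma Sup_nonneg:
  fixes x :: real
  assumes "M = Sup A" "bdd_above A" "x \<in> A" "x \<ge> 0" shows "M \<ge> 0"
  using cSup_upper[OF assms(3,2)] assms(1,4) by simp

section \<open>Gradient and Hessian bounds for P\<close>

lemma grad_zero_at_min:
  assumes P: "C_k (Suc k) P" and min: "\<And>x. P 0 \<le> P x" shows "grad P 0 = 0"
proof -
  have "(\<lambda>d. grad P 0 \<bullet> d) = (\<lambda>d. 0)"
    by (rule has_derivative_local_min[OF grad_has_derivative[OF P]]) (use min in auto)
  then have "grad P 0 \<bullet> grad P 0 = 0" by metis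
  then show ?thesis by simp
qed

text \<open>Writing the gradient as a sum of scalar fields identifies the entries of the Hessian
  with iterated directional derivatives, whose continuity is what \<open>C_k\<close>
  provides.\<close>

lemma hessian_entries:
  fixes P :: "real^'n::finite \<Rightarrow> real"
  assumes P: "C_k (Suc (Suc k)) P"
  shows "(grad P has_derivative (\<lambda>d. hessian P x *v d)) (at x)"
    and "hessian P x $ i $ j = frechet_derivative (\<lambda>x. frechet_derivative P (at x) (axis i 1)) (at x) (axis j 1)"
proof -
  let ?F = "\<lambda>i x. frechet_derivative P (at x) (axis i 1)"
  have d: "?F i differentiable (at x)" for i using P by simp
  have d1: "(\<lambda>x. ?F i x *\<^sub>R (axis i 1 :: real^'n)) differentiable (at x)" for i
  proof -
    obtain D where "(?F i has_derivative D) (at x)" using d[of i] unfolding differentiable_def by blast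
    from bounded_linear.has_derivative[OF bounded_linear_scaleR_left this, of "axis i 1"]
    show ?thesis unfolding differentiable_def by blast
  qed
  have eq: "grad P = (\<lambda>x. \<Sum>i\<in>UNIV. ?F i x *\<^sub>R axis i 1)"
  proof
    fix x
    show "grad P x = (\<Sum>i\<in>UNIV. ?F i x *\<^sub>R axis i 1)"
      using basis_expansion[of "grad P x"] by (simp add: grad_def scalar_mult_eq_scaleR)
  qed
  have "grad P differentiable (at x)"
    unfolding eq by (intro differentiable_sum ballI d1) auto
  then show D: "(grad P has_derivative (\<lambda>d. hessian P x *v d)) (at x)"
    unfolding hessian_def using jacobian_works by blast
  have "((\<lambda>x. grad P x $ i) has_derivative (\<lambda>d. (hessian P x *v d) $ i)) (at x)"
    by (rule bounded_linear.has_derivative[OF bounded_linear_vec_nth D])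
  moreover have "(\<lambda>x. grad P x $ i) = ?F i" by (simp add: grad_def)
  ultimately have "frechet_derivative (?F i) (at x) = (\<lambda>d. (hessian P x *v d) $ i)"
    using frechet_derivative_at by metis
  then show "hessian P x $ i $ j = frechet_derivative (?F i) (at x) (axis j 1)"
    by (simp add: matrix_vector_mult_basis column_def)
qed

text \<open>\<open>P\<close> has a minimum at 0, so its gradient vanishes there and the mean value
  inequality bounds it by \<open>B * norm x\<close>; following \<open>P\<close> along the segment
  from 0 gives the factor one half. Such segments may leave \<open>S\<close>, hence the convex hull.
  The supremum is finite because the entries of the Hessian are continuous on a compact set.\<close>

lemma hessian_bounds:
  fixes P :: "real^'n::finite \<Rightarrow> real"
  assumes P: "C_k (Suc (Suc 0)) P" and P0: "P 0 = 0" and min: "\<And>x. P 0 \<le> P x"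
    and S: "compact S" "0 \<in> S" and B: "B = Sup {mat_norm (hessian P x) |x. x \<in> convex hull S}" and x: "x \<in> S"
  shows "norm (grad P x) \<le> B * norm x" "P x \<le> B / 2 * (norm x)\<^sup>2" "B \<ge> 0"
proof -
  let ?C = "convex hull S"
  let ?H = "\<lambda>x. \<Sum>i\<in>UNIV. \<Sum>j\<in>UNIV. \<bar>frechet_derivative (\<lambda>x. frechet_derivative P (at x) (axis i 1)) (at x) (axis j 1)\<bar>"
  have C: "compact ?C" "0 \<in> ?C" "x \<in> ?C" using compact_convex_hull[OF S(1)] S(2) x by (auto intro: hull_inc)
  have "continuous_on UNIV (\<lambda>x. frechet_derivative (\<lambda>x. frechet_derivative P (at x) (axis i 1)) (at x) (axis j 1))" for i j
    using P by simp
  then have "continuous_on UNIV ?H" by (intro continuous_on_sum continuous_on_rabs)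
  then have "compact (?H ` ?C)" by (intro compact_continuous_image[OF continuous_on_subset] C) auto
  then have "bdd_above (?H ` ?C)" by (intro bounded_imp_bdd_above compact_imp_bounded)
  then obtain M where M: "\<And>x. x \<in> ?C \<Longrightarrow> ?H x \<le> M" unfolding bdd_above_def by blast
  have "mat_norm (hessian P x) \<le> M" if "x \<in> ?C" for x
  proof -
    have "mat_norm (hessian P x) \<le> ?H x"
      using onorm_le_matrix_component_sum[of "hessian P x"] unfolding mat_norm_def hessian_entries(2)[OF P] .
    then show ?thesis using M[OF that] by simp
  qed
  then have bdd: "bdd_above {mat_norm (hessian P x) |x. x \<in> ?C}" unfolding bdd_above_def by blast
  have up: "mat_norm (hessian P x) \<le> B" if "x \<in> ?C" for x
    unfolding B by (rule cSup_upper[OF _ bdd]) (use that in blast)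
  show "B \<ge> 0" using up[OF C(2)] mat_norm_nonneg[of "hessian P 0"] by simp
  have g0: "grad P 0 = 0" by (rule grad_zero_at_min[OF P min])
  have gb: "norm (grad P y) \<le> B * norm y" if "y \<in> ?C" for y
  proof -
    have "norm (grad P y - grad P 0) \<le> B * norm (y - 0)"
      by (rule differentiable_bound[OF convex_convex_hull has_derivative_at_withinI[OF hessian_entries(1)[OF P]] _ that C(2)])
        (use up in \<open>simp add: mat_norm_def\<close>)
    then show ?thesis using g0 by simp
  qed
  show "norm (grad P x) \<le> B * norm x" by (rule gb[OF C(3)])
  \<comment> \<open>Subtracting the expected quadratic turns the bound for \<open>P x\<close> into
    monotonicity on \<open>[0, 1]\<close>.\<close>
  define \<phi> where "\<phi> t = P (t *\<^sub>R x) - B / 2 * t\<^sup>2 * (norm x)\<^sup>2" for t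
  have "\<phi> 1 \<le> \<phi> 0"
  proof (rule DERIV_nonpos_imp_nonincreasing[where f=\<phi>])
    fix t :: real assume t: "0 \<le> t" "t \<le> 1"
    have tx: "t *\<^sub>R x \<in> ?C"
      using convexD_alt[OF convex_convex_hull C(2,3) t] by simp
    have "((\<lambda>t. P (t *\<^sub>R x)) has_derivative (\<lambda>d. grad P (t *\<^sub>R x) \<bullet> (d *\<^sub>R x))) (at t)"
      by (rule has_derivative_compose[OF _ grad_has_derivative[OF P]]) (auto intro!: derivative_eq_intros)
    then have "((\<lambda>t. P (t *\<^sub>R x)) has_real_derivative (grad P (t *\<^sub>R x) \<bullet> x)) (at t)"
      by (simp add: has_field_derivative_def inner_scaleR_right mult_commute_abs)
    then have "(\<phi> has_real_derivative (grad P (t *\<^sub>R x) \<bullet> x - B * t * (norm x)\<^sup>2)) (at t)"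
      unfolding \<phi>_def[abs_def] by (auto intro!: derivative_eq_intros)
    moreover have "grad P (t *\<^sub>R x) \<bullet> x \<le> (B * norm (t *\<^sub>R x)) * norm x"
      using norm_cauchy_schwarz[of "grad P (t *\<^sub>R x)" x] mult_right_mono[OF gb[OF tx] norm_ge_zero[of x]] by linarith
    then have "grad P (t *\<^sub>R x) \<bullet> x - B * t * (norm x)\<^sup>2 \<le> 0" using t by (simp add: power2_eq_square mult_ac)
    ultimately show "\<exists>y. (\<phi> has_real_derivative y) (at t) \<and> y \<le> 0" by blast
  qed simp
  then show "P x \<le> B / 2 * (norm x)\<^sup>2" by (simp add: \<phi>_def P0)
qed

section \<open>The corrected observer\<close>

locale observer_redesign =
  fixes f :: "real^'n::finite \<Rightarrow> real^'m::finite \<Rightarrow> real^'n" and h :: "real^'n \<Rightarrow> real^'k::finite"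
    and U :: "(real^'m) set" and V W :: "real^'n \<Rightarrow> real" and R a b c \<omega> :: real
    and Q :: "real^'n^'n" and L :: "real^'k^'n" and p :: "real \<Rightarrow> real"
    and khat :: "real^'n \<Rightarrow> real^'k \<Rightarrow> real^'m \<Rightarrow> real^'n"
  assumes U: "closed U" "0 \<in> U" and f_lip: "lip_compact UNIV (\<lambda>(x, u). f x u)" and h_lip: "lip_compact UNIV h"
    and V: "C_k (Suc (Suc 0)) V" "\<And>x. V x \<ge> 0" "V 0 < R"
    and W: "C_k (Suc 0) W" "\<And>x. x \<noteq> 0 \<Longrightarrow> W x > 0"
    and V_dec: "\<And>x u. u \<in> U \<Longrightarrow> R \<le> V x \<Longrightarrow> grad V x \<bullet> f x u \<le> - W x"
    and Q_sym: "transpose Q = Q"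
    and obs_low: "\<And>u z x. u \<in> U \<Longrightarrow> V z \<le> b \<Longrightarrow> V x \<le> R \<Longrightarrow>
      (z - x) \<bullet> (Q *v (f z u + L *v (h z - h x) - f x u)) \<le> - \<omega> * (norm (z - x))\<^sup>2"
    and obs_high: "\<And>u z x. u \<in> U \<Longrightarrow> a < V z \<Longrightarrow> V z \<le> b \<Longrightarrow> grad V z \<bullet> (Q *v (z - x)) < 0 \<Longrightarrow> V x \<le> R \<Longrightarrow>
      grad V z \<bullet> (f z u + L *v (h z - h x)) \<le> - W z + (1 - c) * (norm (grad V z))\<^sup>2 *
        (((z - x) \<bullet> (Q *v (f z u + L *v (h z - h x) - f x u))) / (grad V z \<bullet> (Q *v (z - x))))"
    and cst: "0 < c" "c < 1" "0 < \<omega>" "R \<le> a" "a < b"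
    and p: "\<And>s. s \<ge> 0 \<Longrightarrow> p s \<in> {0..1}" "locally_lipschitz_on {0..} p" "\<And>s. s \<ge> b \<Longrightarrow> p s = 1"
      "\<And>s. 0 \<le> s \<Longrightarrow> s \<le> a \<Longrightarrow> p s = 0"
    and khat_eq: "khat = (\<lambda>z y u. if V z \<le> R then L *v (h z - y)
      else L *v (h z - y) - (max 0 (grad V z \<bullet> f z u + W z + p (V z) * (grad V z \<bullet> (L *v (h z - y)))) / (norm (grad V z))\<^sup>2) *\<^sub>R grad V z)"
begin

abbreviation excess :: "real^'n \<Rightarrow> real^'k \<Rightarrow> real^'m \<Rightarrow> real" where
  "excess z y u \<equiv> max 0 (grad V z \<bullet> f z u + W z + p (V z) * (grad V z \<bullet> (L *v (h z - y))))"

text \<open>Such a \<open>z\<close> is not the origin, so \<open>W z > 0\<close>, and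
  \<open>V_dec\<close> with the control 0 makes a directional derivative of \<open>V\<close>
  negative. The quotient in \<open>khat\<close> is therefore a genuine one.\<close>

lemma grad_nonzero: assumes "R \<le> V z" shows "grad V z \<noteq> 0"
proof -
  have "z \<noteq> 0" using assms V(3) by auto
  then show ?thesis using V_dec[OF U(2) assms] W(2)[of z] by auto
qed

text \<open>Above \<open>R\<close> all factors are Lipschitz on compact sets and the denominator is
  positive. On \<open>V z = R\<close> the excess vanishes, because \<open>p\<close> is zero up to
  \<open>a \<ge> R\<close> and \<open>V_dec\<close> holds; so \<open>lip_compact_extend_zero\<close>
  joins the two cases of \<open>khat\<close>.\<close>

lemma khat_lip: "lip_compact (UNIV \<times> UNIV \<times> U) (\<lambda>(z, y, u). khat z y u)"
proof -
  let ?S = "{z. R \<le> V z} \<times> (UNIV :: (real^'k) set) \<times> U"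
  let ?m = "\<lambda>(z, y, u). (excess z y u * inverse ((norm (grad V z))\<^sup>2)) *\<^sub>R grad V z"
  have z: "lip_compact S (\<lambda>q. G (fst q))" if "lip_compact UNIV G" for G :: "real^'n \<Rightarrow> 'z::real_normed_vector" and S :: "((real^'n) \<times> (real^'k) \<times> (real^'m)) set"
    by (rule lip_compact_compose_UNIV[OF that lip_compact_fst])
  have y: "lip_compact S (\<lambda>q :: (real^'n) \<times> (real^'k) \<times> (real^'m). fst (snd q))"
    and u: "lip_compact S (\<lambda>q :: (real^'n) \<times> (real^'k) \<times> (real^'m). snd (snd q))" for S
    by (rule lip_compact_bounded_linear; intro bounded_linear_fst_comp bounded_linear_snd_comp bounded_linear_fst bounded_linear_snd)+
  have fzu: "lip_compact S (\<lambda>q :: (real^'n) \<times> (real^'k) \<times> (real^'m). f (fst q) (snd (snd q)))" for S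
    using lip_compact_compose_UNIV[OF f_lip lip_compact_Pair[OF z[OF lip_compact_ident] u]] by simp
  have Lh: "lip_compact S (\<lambda>q :: (real^'n) \<times> (real^'k) \<times> (real^'m). L *v (h (fst q) - fst (snd q)))" for S
    by (intro lip_compact_matrix_vector lip_compact_minus z h_lip y)
  have g: "lip_compact S (\<lambda>q :: (real^'n) \<times> (real^'k) \<times> (real^'m). grad V (fst q))" for S
    by (rule z[OF lip_compact_grad[OF V(1)]])
  have pV: "lip_compact UNIV (\<lambda>z. p (V z))"
    by (rule lip_compact_compose[OF C_k_1_lip_compact[OF V(1)] locally_lipschitz_on_imp_lip_compact[OF p(2)]]) (use V(2) in auto)
  have "lip_compact ?S (\<lambda>q. inverse ((norm (grad V (fst q)))\<^sup>2))"
  proof (rule lip_compact_inverse_pos)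
    show "lip_compact ?S (\<lambda>q. (norm (grad V (fst q)))\<^sup>2)"
      unfolding power2_norm_eq_inner by (intro lip_compact_inner g)
  qed (use grad_nonzero in auto)
  then have "lip_compact ?S (\<lambda>q. (excess (fst q) (fst (snd q)) (snd (snd q)) * inverse ((norm (grad V (fst q)))\<^sup>2)) *\<^sub>R grad V (fst q))"
    by (intro lip_compact_scaleR lip_compact_mult lip_compact_compose_UNIV[OF lip_compact_max0] lip_compact_add lip_compact_inner
      g fzu Lh z[OF pV] z[OF C_k_1_lip_compact[OF W(1)]])
  then have m: "lip_compact ?S ?m" by (rule lip_compact_cong) (simp add: split_beta)
  have "lip_compact (UNIV \<times> (UNIV \<times> U)) (\<lambda>(z, yu). if V z \<le> R then 0 else ?m (z, yu))"
  proof (rule lip_compact_extend_zero)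
    show "continuous_on UNIV V" by (rule lip_compact_continuous_on[OF C_k_1_lip_compact[OF V(1)]]) simp
    show "closed ((UNIV :: (real^'k) set) \<times> U)" using U by (intro closed_Times) auto
    show "lip_compact ({z. R \<le> V z} \<times> UNIV \<times> U) ?m" by (rule m)
    fix z :: "real^'n" and yu assume z: "V z = R" "yu \<in> (UNIV :: (real^'k) set) \<times> U"
    then obtain y u where yu: "yu = (y, u)" "u \<in> U" by auto
    have "p (V z) = 0" using z cst V(2)[of z] by (intro p(4)) auto
    then have "excess z y u = 0" using V_dec[OF yu(2), of z] z by simp
    then show "?m (z, yu) = 0" by (simp add: yu)
  qed
  from lip_compact_minus[OF Lh this] show ?thesis
    by (rule lip_compact_cong) (auto simp: khat_eq divide_inverse)
qed

text \<open>Division by the squared norm makes the correction take exactly \<open>excess\<close> off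
  the derivative of \<open>V\<close>.\<close>

lemma khat_high: "R < V z \<Longrightarrow> grad V z \<bullet> khat z y u = grad V z \<bullet> (L *v (h z - y)) - excess z y u"
  using grad_nonzero[of z] by (simp add: khat_eq inner_diff_right power2_norm_eq_inner)

text \<open>From \<open>b\<close> on the weight \<open>p\<close> equals 1, so \<open>excess\<close>
  is at least the amount by which the uncorrected derivative exceeds \<open>- W z\<close>, for any
  output \<open>y\<close> and any control.\<close>

lemma V_dec_observer:
  assumes "b \<le> V z" shows "grad V z \<bullet> (f z u + khat z y u) \<le> - W z"
  using p(3)[OF assms] assms cst khat_high[of z y u] by (simp add: inner_add_right)

text \<open>The correction changes the quadratic form by \<open>- excess / n2 * Y\<close>, which is
  harmful only when the excess is positive and \<open>Y < 0\<close>. In that case the fourth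
  condition bounds the excess so that at most the fraction \<open>1 - c\<close> of the dissipation
  \<open>- X\<close> is lost, and \<open>c * \<omega>\<close> remains.\<close>

lemma observer_estimate:
  assumes u: "u \<in> U" and z: "V z \<le> b" and x: "V x \<le> R"
  shows "(z - x) \<bullet> (Q *v (f z u + khat z (h x) u - f x u)) \<le> - (c * \<omega>) * (norm (z - x))\<^sup>2"
proof -
  define X where "X = (z - x) \<bullet> (Q *v (f z u + L *v (h z - h x) - f x u))"
  have X: "X \<le> - \<omega> * (norm (z - x))\<^sup>2" unfolding X_def by (rule obs_low[OF u z x])
  have "\<omega> * (norm (z - x))\<^sup>2 \<ge> 0" using cst by simp
  then have X0: "X \<le> 0" using X by linarith
  have XcX: "X \<le> c * X" using mult_right_mono_neg[of c 1 X] X0 cst by simp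
  have cX: "c * X \<le> - (c * \<omega>) * (norm (z - x))\<^sup>2" using mult_left_mono[OF X, of c] cst by (simp add: mult.assoc)
  show ?thesis
  proof (cases "V z \<le> R")
    case True
    then show ?thesis using cX XcX by (simp add: khat_eq X_def)
  next
    case False
    define n2 where "n2 = (norm (grad V z))\<^sup>2"
    define Y where "Y = grad V z \<bullet> (Q *v (z - x))"
    have n2: "n2 > 0" using grad_nonzero[of z] False by (simp add: n2_def)
    have "f z u + khat z (h x) u - f x u = (f z u + L *v (h z - h x) - f x u) - (excess z (h x) u / n2) *\<^sub>R grad V z"
      using False by (simp add: khat_eq n2_def algebra_simps)
    then have eq: "(z - x) \<bullet> (Q *v (f z u + khat z (h x) u - f x u)) = X - excess z (h x) u / n2 * Y"
      by (simp only: X_def Y_def matrix_vector_mult_diff_distrib inner_diff_right matrix_vector_mult_scaleR inner_scaleR_right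
        symmetric_inner_matrix[OF Q_sym, of "z - x" "grad V z"])
    show ?thesis
    proof (cases "excess z (h x) u = 0 \<or> Y \<ge> 0")
      case True
      then have "0 \<le> excess z (h x) u / n2 * Y" using n2 by auto
      then show ?thesis unfolding eq using cX XcX by linarith
    next
      case F: False
      then have Y: "Y < 0" and e: "excess z (h x) u = grad V z \<bullet> f z u + W z + p (V z) * (grad V z \<bullet> (L *v (h z - h x)))"
        and e0: "excess z (h x) u > 0" by (auto simp: max_def split: if_splits)
      have fW: "grad V z \<bullet> f z u + W z \<le> 0" using V_dec[OF u, of z] False by simp
      have az: "a < V z"
      proof (rule ccontr)
        assume "\<not> a < V z"
        then have "p (V z) = 0" by (intro p(4)) (use V(2) in auto)
        then show False using e e0 fW by simp
      qed
      have p01: "0 \<le> p (V z)" "p (V z) \<le> 1" using p(1)[of "V z"] V(2) by auto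
      \<comment> \<open>The excess is the convex combination, with weights \<open>1 - p (V z)\<close> and \<open>p (V z)\<close>, of the
        defects in the decrease conditions without and with output injection.\<close>
      define Z where "Z = (1 - c) * n2 * (X / Y)"
      have Z0: "Z \<ge> 0" unfolding Z_def using cst n2 X0 Y by (intro mult_nonneg_nonneg divide_nonpos_neg) auto
      have "grad V z \<bullet> (f z u + L *v (h z - h x)) \<le> - W z + Z"
        unfolding Z_def X_def Y_def n2_def by (rule obs_high[OF u az z _ x]) (use Y in \<open>simp add: Y_def\<close>)
      then have "p (V z) * (grad V z \<bullet> f z u + W z + grad V z \<bullet> (L *v (h z - h x))) \<le> p (V z) * Z"
        using p01 by (intro mult_left_mono) (auto simp: inner_add_right)
      moreover have "(1 - p (V z)) * (grad V z \<bullet> f z u + W z) \<le> 0" using p01 fW by (simp add: mult_nonneg_nonpos)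
      moreover have "p (V z) * Z \<le> Z" using p01 Z0 by (simp add: mult_left_le_one_le)
      ultimately have "excess z (h x) u \<le> Z" unfolding e by (simp add: algebra_simps)
      \<comment> \<open>As \<open>- Y > 0\<close>, the bound on the excess can be multiplied by it;
        in \<open>Z\<close> the factors \<open>n2\<close> and \<open>Y\<close> then cancel.\<close>
      then have "excess z (h x) u / n2 * (- Y) \<le> Z / n2 * (- Y)" using n2 Y by (intro mult_right_mono divide_right_mono) auto
      also have "\<dots> = - (1 - c) * X" using n2 Y by (simp add: Z_def field_simps)
      finally show ?thesis unfolding eq using cX by (simp add: algebra_simps)
    qed
  qed
qed

text \<open>Since \<open>p\<close> is at most 1, the excess varies with the output at most by
  \<open>norm (grad V z)\<close> times the effect of \<open>L\<close>; the scaled gradient in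
  \<open>khat\<close> cancels that factor. So the correction contributes no more than
  \<open>L\<close> itself, and the supremum \<open>G2\<close> is finite.\<close>

lemma khat_lipschitz_output:
  "norm (khat z y u - khat z y' u) \<le> (2 * mat_norm L) * norm (y - y')"
proof -
  have L: "norm (L *v (y - y')) \<le> mat_norm L * norm (y - y')" by (rule mat_norm_bound)
  have d: "L *v (h z - y) - L *v (h z - y') = - (L *v (y - y'))"
    by (simp add: matrix_vector_mult_diff_distrib[symmetric])
       (simp add: matrix_vector_mult_diff_distrib)
  show ?thesis
  proof (cases "V z \<le> R")
    case True
    then have "norm (khat z y u - khat z y' u) = norm (L *v (y - y'))" by (simp add: khat_eq d)
    then show ?thesis using L norm_ge_zero[of "L *v (y - y')"] by linarith
  next
    case False
    define n where "n = norm (grad V z)"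
    have n: "n > 0" using grad_nonzero[of z] False by (simp add: n_def)
    have p01: "0 \<le> p (V z)" "p (V z) \<le> 1" using p(1)[of "V z"] V(2) by auto
    have "\<bar>excess z y u - excess z y' u\<bar> \<le> \<bar>p (V z) * (grad V z \<bullet> (L *v (h z - y)) - grad V z \<bullet> (L *v (h z - y')))\<bar>"
      by (simp add: algebra_simps)
    also have "\<dots> = p (V z) * \<bar>grad V z \<bullet> (L *v (y - y'))\<bar>"
      using p01 by (simp add: inner_diff_right[symmetric] d abs_mult)
    also have "\<dots> \<le> 1 * (n * (mat_norm L * norm (y - y')))"
    proof (rule mult_mono)
      show "\<bar>grad V z \<bullet> (L *v (y - y'))\<bar> \<le> n * (mat_norm L * norm (y - y'))"
        using Cauchy_Schwarz_ineq2[of "grad V z" "L *v (y - y')"] mult_left_mono[OF L, of n] n unfolding n_def by linarith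
    qed (use p01 in auto)
    finally have e: "\<bar>excess z y u - excess z y' u\<bar> \<le> n * (mat_norm L * norm (y - y'))" by simp
    have "khat z y u - khat z y' u = - (L *v (y - y')) - ((excess z y u - excess z y' u) / n\<^sup>2) *\<^sub>R grad V z"
      using False d by (simp add: khat_eq n_def diff_divide_distrib scaleR_diff_left algebra_simps)
    then have "norm (khat z y u - khat z y' u) \<le> norm (L *v (y - y')) + norm (((excess z y u - excess z y' u) / n\<^sup>2) *\<^sub>R grad V z)"
      using norm_triangle_ineq4[of "- (L *v (y - y'))" "((excess z y u - excess z y' u) / n\<^sup>2) *\<^sub>R grad V z"]
      by (simp only: norm_minus_cancel)
    also have "norm (((excess z y u - excess z y' u) / n\<^sup>2) *\<^sub>R grad V z) = \<bar>excess z y u - excess z y' u\<bar> / n"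
      using n by (simp add: n_def power2_eq_square)
    also have "\<dots> \<le> mat_norm L * norm (y - y')" using e n by (simp add: divide_le_eq mult_ac)
    finally show ?thesis using L by linarith
  qed
qed

end

text \<open>Existence of the solution for all times is expressed by one solution on the half-line
  with which every solution on any \<open>[0, T)\<close> agrees, so no other solution can end
  early.\<close>

theorem theorem2p4:
  fixes \<tau> r :: real
    and ft :: "real^'n::finite \<Rightarrow> real^'m::finite \<Rightarrow> real^'n"
    and h :: "real^'n \<Rightarrow> real^'k::finite"
    and a1 :: "real^'n \<Rightarrow> real^'l::finite"
    and a2 :: "real^'l \<Rightarrow> real^'m"
    and U :: "(real^'m) set"
    and f :: "real^'n \<Rightarrow> real^'m \<Rightarrow> real^'n"
    and V W P :: "real^'n \<Rightarrow> real"
    and R \<mu> K1 \<omega> a b c :: real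
    and kk :: "real^'n \<Rightarrow> real^'m"
    and Q :: "real^'n^'n"
    and L :: "real^'k^'n"
    and g :: "real^'l \<Rightarrow> real^'m \<Rightarrow> real^'l"
    and \<Phi> :: "real^'k \<Rightarrow> (real \<Rightarrow> real^'m) \<Rightarrow> real^'l"
    and p q :: "real \<Rightarrow> real"
    and \<phi> :: "real^'n \<Rightarrow> real^'k \<Rightarrow> real^'m \<Rightarrow> real"
    and khat :: "real^'n \<Rightarrow> real^'k \<Rightarrow> real^'m \<Rightarrow> real^'n"
    and \<psi> :: "real^'n \<Rightarrow> real"
    and N :: nat
    and \<rho> :: "real \<Rightarrow> real"
    and S1 S2 S3 S4 :: "(real^'n) set"
    and K \<delta> M1q M1f G1 G2 Pt K2 Ts \<sigma> :: real
  assumes "\<tau> > 0" and "r \<ge> 0"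
    and "smooth (\<lambda>(x, v). ft x v)" and "ft 0 0 = 0"
    and "smooth h" and "h 0 = 0"
    and "forward_complete ft \<tau> UNIV"
    and "smooth a1" and "smooth a2" and "a1 0 = 0" and "a2 0 = 0"
    and "compact U" and "0 \<in> U"
    and f_eq: "f = (\<lambda>x u. ft x (a2 (a1 x) + u))"
    \<comment> \<open>first condition\<close>
    and "radially_unbounded V" and "C_k 2 V" and "\<forall>x. V x \<ge> 0"
    and "pos_def_fun W" and "C_k 1 W" and "R > 0"
    and "\<forall>x. \<forall>u\<in>U. V x \<ge> R \<longrightarrow> grad V x \<bullet> f x u \<le> - W x"
    and V_origin: "V 0 < R"
    \<comment> \<open>second condition\<close>
    and "pos_def_fun P" and "C_k 2 P" and "\<mu> > 0" and "K1 > 0"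
    and "\<forall>x. V x \<le> R \<longrightarrow> K1 * (norm x)\<^sup>2 \<le> P x"
    and "globally_lipschitz kk" and "\<forall>x. kk x \<in> U" and "kk 0 = 0"
    and "\<forall>x. V x \<le> R \<longrightarrow> grad P x \<bullet> f x (kk x) \<le> - 2 * \<mu> * (norm x)\<^sup>2"
    \<comment> \<open>third condition\<close>
    and "sym_pos_def Q" and "\<omega> > 0" and "b > R"
    and "\<forall>u\<in>U. \<forall>z x. V z \<le> b \<longrightarrow> V x \<le> R \<longrightarrow>
           (z - x) \<bullet> (Q *v (f z u + L *v (h z - h x) - f x u)) \<le> - \<omega> * (norm (z - x))\<^sup>2"
    \<comment> \<open>fourth condition\<close>
    and "0 < c" and "c < 1" and "R \<le> a" and "a < b"
    and "\<forall>u\<in>U. \<forall>z x. a < V z \<longrightarrow> V z \<le> b \<longrightarrow> grad V z \<bullet> (Q *v (z - x)) < 0 \<longrightarrow> V x \<le> R \<longrightarrow>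
           grad V z \<bullet> (f z u + L *v (h z - h x)) \<le>
             - W z + (1 - c) * (norm (grad V z))\<^sup>2 *
               (((z - x) \<bullet> (Q *v (f z u + L *v (h z - h x) - f x u))) /
                (grad V z \<bullet> (Q *v (z - x))))"
    \<comment> \<open>the inter-sample predictor\<close>
    and "locally_lipschitz_on UNIV (\<lambda>(\<theta>, v). g \<theta> v)" and "g 0 0 = 0"
    and "\<forall>x v. jacobian a1 (at x) *v ft x v = g (a1 x) v"
    and "forward_complete (\<lambda>\<theta> u. g \<theta> (a2 \<theta> + u)) 0 U"
    and "\<forall>y. mapping_on_Linf {-\<tau>-r..0} (\<Phi> y)"
    and "\<forall>x v. Linf_on {-\<tau>..} v \<longrightarrow> solves_ae_on {0..} (\<lambda>t. ft (x t) (v (t - \<tau>))) x \<longrightarrow>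
           (\<forall>t\<ge>r. a1 (x (t + \<tau>)) = \<Phi> (h (x (t - r))) (\<lambda>s. v (t + s)))"
    \<comment> \<open>definitions\<close>
    and "\<forall>s\<ge>0. p s \<in> {0..1}" and "locally_lipschitz_on {0..} p"
    and "\<forall>s\<ge>b. p s = 1" and "\<forall>s. 0 \<le> s \<longrightarrow> s \<le> a \<longrightarrow> p s = 0"
    and phi_eq: "\<phi> = (\<lambda>z y u. max 0 (grad V z \<bullet> f z u + W z +
                   p (V z) * (grad V z \<bullet> (L *v (h z - y)))))"
    and khat_eq: "khat = (\<lambda>z y u. if V z \<le> R then L *v (h z - y)
                   else L *v (h z - y) - (\<phi> z y u / (norm (grad V z))\<^sup>2) *\<^sub>R grad V z)"
    and "C_k 1 q" and "\<forall>s. q s \<ge> 0" and "\<forall>s\<le>1. q s = 1"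
    and "K \<ge> 1" and "\<forall>s\<ge>1. s * q s \<le> K"
    and "smooth \<psi>" and "\<forall>z. \<psi> z \<ge> 1"
    and "\<forall>x z. V x \<le> max (V z) b \<longrightarrow> norm x \<le> \<psi> z"
    and "N > 0" and delta_eq: "\<delta> = (r + \<tau>) / real N"
    and rho_eq: "\<rho> = (\<lambda>s. Sup {norm (f z u) |z u. u \<in> U \<and> norm z \<le> s})"
    and S1_eq: "S1 = {x. V x \<le> R}" and S2_eq: "S2 = {x. V x \<le> b}"
    and S3_eq: "S3 = {x. \<exists>z\<in>S2. norm x \<le> K * \<psi> z + \<delta> * \<rho> (K * \<psi> z)}"
    and S4_eq: "S4 = {x. \<exists>z\<in>S2. norm x \<le> K * \<psi> z}"
    and M1q_eq: "M1q = Sup {norm (q (norm \<xi> / \<psi> z) *\<^sub>R \<xi> - q (norm x / \<psi> z) *\<^sub>R x) / norm (x - \<xi>)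
                   |x \<xi> z. x \<in> S1 \<and> \<xi> \<in> S3 \<and> z \<in> S2 \<and> x \<noteq> \<xi>}"
    and M1f_eq: "M1f = Sup {norm (f x u - f \<xi> u) / norm (x - \<xi>)
                   |x \<xi> u. x \<in> S1 \<and> \<xi> \<in> S4 \<and> u \<in> U \<and> x \<noteq> \<xi>}"
    and G1_eq: "G1 = Sup {norm (jacobian h (at x) *v f x u - jacobian h (at z) *v f z u) / norm (x - z)
                   |x z u. x \<in> S1 \<and> z \<in> S2 \<and> u \<in> U \<and> x \<noteq> z}"
    and G2_eq: "G2 = Sup {norm (khat z y u - khat z w u) / norm (y - w)
                   |y w z u. z \<in> S2 \<and> u \<in> U \<and> y \<noteq> w}"
    and Pt_eq: "Pt = Sup {mat_norm (hessian P x) |x. x \<in> convex hull S1}"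
    and "0 < K2" and "K2 \<le> mat_norm Q" and "\<forall>x. K2 * (norm x)\<^sup>2 \<le> x \<bullet> (Q *v x)"
    and "Ts > 0" and "\<sigma> > 0"
    and "\<sigma> \<le> min (\<mu> / (sqrt (real CARD('n)) * Pt)) (c * \<omega> / (4 * mat_norm Q))"
    and "\<delta> * M1q * M1f * exp (\<sigma> * \<delta>) < 1"
    and "Ts * G1 * exp (\<sigma> * Ts) * sqrt (2 * mat_norm Q / K2) * (G2 * mat_norm Q / (c * \<omega>)) < 1"
  shows "\<forall>ts \<xi>0 z0 w0 \<theta>0 x0 u0 v0.
    sampling_partition ts \<longrightarrow> (\<forall>i. ts (Suc i) - ts i \<le> Ts) \<longrightarrow>
    (\<forall>j\<in>{1..N}. Linf_on {-\<delta>..<0} (\<xi>0 j)) \<longrightarrow>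
    continuous_on {-r..0} x0 \<longrightarrow>
    Linf_on {-r-\<tau>..<0} u0 \<longrightarrow> (AE s in lebesgue_on {-r-\<tau>..<0}. u0 s \<in> U) \<longrightarrow>
    Linf_on {-r-\<tau>..<0} v0 \<longrightarrow>
    (\<exists>x z w \<theta> \<xi> u v.
       closed_loop_solution ft h f khat q \<psi> kk a2 g \<Phi> \<tau> r \<delta> N ts \<xi>0 z0 w0 \<theta>0 x0 u0 v0
         \<infinity> x z w \<theta> \<xi> u v \<and>
       (\<forall>T x' z' w' \<theta>' \<xi>' u' v'. 0 < T \<longrightarrow>
          closed_loop_solution ft h f khat q \<psi> kk a2 g \<Phi> \<tau> r \<delta> N ts \<xi>0 z0 w0 \<theta>0 x0 u0 v0
            T x' z' w' \<theta>' \<xi>' u' v' \<longrightarrow>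
          (\<forall>t\<in>time_ivl 0 T. x' t = x t \<and> z' t = z t \<and> w' t = w t \<and> \<theta>' t = \<theta> t \<and>
             (\<forall>j\<in>{1..N}. \<xi>' j t = \<xi> j t) \<and> u' t = u t \<and> v' t = v t)) \<and>
       Limsup at_top (\<lambda>t. ereal (exp (\<sigma> * t)) * state_size \<tau> r \<delta> N x z w \<theta> \<xi> u t) < \<infinity>)"
proof -
  note A = assms
  have V2: "C_k (Suc (Suc 0)) V" and P2: "C_k (Suc (Suc 0)) P" and W1: "C_k (Suc 0) W" and q1: "C_k (Suc 0) q"
    using A(16,24,19,53) unfolding numeral_2_eq_2 One_nat_def by blast+
  have h2: "C_k (Suc (Suc 0)) h" and a12: "C_k (Suc (Suc 0)) a1" using A(5,8) unfolding smooth_def by blast+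
  have V0: "V x \<ge> 0" for x using A(17) by blast
  have V_lip: "lip_compact UNIV V" by (rule C_k_1_lip_compact[OF V2])
  have V_cont: "continuous_on UNIV V" by (rule lip_compact_continuous_on[OF V_lip]) simp
  have V_bdd: "bounded {x. V x \<le> M}" for M
  proof (cases "M \<ge> 0")
    case True
    then show ?thesis using A(15) unfolding radially_unbounded_def by auto
  next
    case False
    then have "{x. V x \<le> M} = {}" using less_le_trans[OF _ V0, of M] by (auto simp: not_le)
    then show ?thesis by simp
  qed
  have S_compact: "compact {x. V x \<le> M}" for M
    unfolding compact_eq_bounded_closed using V_bdd by (auto intro!: closed_Collect_le continuous_intros V_cont)
  have W_pos: "W x > 0" if "x \<noteq> 0" for x using A(18) that unfolding pos_def_fun_def by blast
  have ft_lip: "lip_compact UNIV (\<lambda>(x, v). ft x v)" by (rule smooth_lip_compact[OF A(3)])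
  have a1_lip: "lip_compact S a1" and a2_lip: "lip_compact UNIV a2" and h_lip: "lip_compact UNIV h"
    and psi_lip: "lip_compact UNIV \<psi>" for S using A(8,9,5,58) by (blast intro: smooth_lip_compact)+
  have f_lip: "lip_compact UNIV (\<lambda>(x, u). f x u)"
  proof -
    have "lip_compact UNIV (\<lambda>p :: (real^'n) \<times> (real^'m). a2 (a1 (fst p)) + snd p)"
      by (intro lip_compact_add lip_compact_snd lip_compact_compose_UNIV[OF a2_lip] lip_compact_compose_UNIV[OF a1_lip lip_compact_fst])
    from lip_compact_compose_UNIV[OF ft_lip lip_compact_Pair[OF lip_compact_fst this]]
    show ?thesis by (rule lip_compact_cong) (simp add: f_eq split_beta)
  qed
  have f_eq': "f x u = ft x (a2 (a1 x) + u)" for x u by (simp add: f_eq)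
  interpret ob: observer_redesign f h U V W R a b c \<omega> Q L p khat
  proof
    show "closed U" by (rule compact_imp_closed[OF A(12)])
    show "transpose Q = Q" using A(32) unfolding sym_pos_def_def by blast
    show "khat = (\<lambda>z y u. if V z \<le> R then L *v (h z - y)
      else L *v (h z - y) - (max 0 (grad V z \<bullet> f z u + W z + p (V z) * (grad V z \<bullet> (L *v (h z - y)))) / (norm (grad V z))\<^sup>2) *\<^sub>R grad V z)"
      unfolding khat_eq phi_eq ..
  qed (use A(13,21,22,33,35-40,47-50) V0 V2 W1 W_pos f_lip h_lip in blast)+
  have hf_lip: "lip_compact UNIV (\<lambda>(z, u). jacobian h (at z) *v f z u)"
  proof -
    have "lip_compact UNIV (\<lambda>p :: (real^'n) \<times> (real^'m). f (fst p) (snd p))"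
      using f_lip by (rule lip_compact_cong) (simp add: split_beta)
    from lip_compact_jacobian[OF h2 lip_compact_fst this] show ?thesis
      by (rule lip_compact_cong) (simp add: split_beta)
  qed
  have psi_1: "1 \<le> \<psi> z" for z using A(59) by blast
  have psi_pos: "0 < \<psi> z" for z using psi_1[of z] by simp
  have sat_lip: "lip_compact UNIV (\<lambda>(z, \<xi> :: real^'n). q (norm \<xi> / \<psi> z) *\<^sub>R \<xi>)"
    by (rule lip_compact_saturation[OF q1 psi_lip psi_1])
  have sat_bound: "norm (q (norm \<xi> / \<psi> z) *\<^sub>R \<xi>) \<le> K * \<psi> z" for z and \<xi> :: "real^'n"
  proof -
    define s where "s = norm \<xi> / \<psi> z"
    have n: "norm \<xi> = s * \<psi> z" using psi_pos[of z] by (simp add: s_def)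
    have "s * q s \<le> K"
    proof (cases "s \<le> 1")
      case True then show ?thesis using A(55,56) by auto
    next
      case False then show ?thesis using A(57) by auto
    qed
    then have "(s * q s) * \<psi> z \<le> K * \<psi> z" using psi_pos[of z] by (intro mult_right_mono) auto
    moreover have "norm (q s *\<^sub>R \<xi>) = (s * q s) * \<psi> z" using A(54) by (simp add: n abs_of_nonneg)
    ultimately show ?thesis unfolding s_def by simp
  qed
  have psi_cont: "continuous_on UNIV \<psi>" by (rule lip_compact_continuous_on[OF psi_lip]) simp
  obtain Lk where Lk: "Lk-lipschitz_on UNIV kk" using A(28) unfolding globally_lipschitz_def by blast
  have g_lip: "lip_compact UNIV (\<lambda>(\<theta>, v). g \<theta> v)" by (rule locally_lipschitz_on_imp_lip_compact[OF A(41)])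
  have delta_pos: "\<delta> > 0" unfolding delta_eq using A(1,2,61) by simp
  \<comment> \<open>The maximum in the hypothesis on \<open>\<psi>\<close> yields two bounds: one
    for all states with \<open>V x \<le> b\<close>, the other, with \<open>x = z\<close>, for
    \<open>z\<close> itself.\<close>
  have psi_b: "norm x \<le> \<psi> z" if "V x \<le> b" for x z using A(60) that by (meson le_max_iff_disj)
  have psi_z: "norm z \<le> \<psi> z" for z using A(60) by (meson le_max_iff_disj order_refl)

  obtain B\<psi> where Bpsi: "\<And>z. z \<in> S2 \<Longrightarrow> \<psi> z \<le> B\<psi>"
    using lip_compact_image_bounded[OF psi_lip S_compact[of b] subset_UNIV] unfolding S2_eq
    by (metis abs_le_D1 real_norm_def)
  have S2_0: "0 \<in> S2" and S1_0: "0 \<in> S1" and S12: "S1 \<subseteq> S2" using A(22,34) by (auto simp: S1_eq S2_eq)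
  have cS1: "compact S1" and cS2: "compact S2" unfolding S1_eq S2_eq by (rule S_compact)+
  have fbdd: "bdd_above {norm (f z u) |z u. u \<in> U \<and> norm z \<le> s}" for s
  proof -
    have "compact (cball (0 :: real^'n) s \<times> U)" using A(12) by (intro compact_Times) auto
    then obtain B where B: "\<And>q. q \<in> cball 0 s \<times> U \<Longrightarrow> norm ((\<lambda>(x, u). f x u) q) \<le> B"
      using lip_compact_image_bounded[OF f_lip _ subset_UNIV] by metis
    show ?thesis by (rule bdd_aboveI[of _ B]) (use B in force)
  qed
  have rho: "norm (f x u) \<le> \<rho> s" if "u \<in> U" "norm x \<le> s" for x u s
    unfolding rho_eq by (rule cSup_upper[OF _ fbdd]) (use that in blast)
  have rho_mono: "\<rho> s \<le> \<rho> s'" if "0 \<le> s" "s \<le> s'" for s s'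
    unfolding rho_eq
  proof (rule cSup_subset_mono[OF _ fbdd])
    show "{norm (f z u) |z u. u \<in> U \<and> norm z \<le> s} \<noteq> {}"
      using A(13) that by (auto intro!: exI[of _ "0 :: real^'n"] exI[of _ "0 :: real^'m"])
    show "{norm (f z u) |z u. u \<in> U \<and> norm z \<le> s} \<subseteq> {norm (f z u) |z u. u \<in> U \<and> norm z \<le> s'}"
      using that by force
  qed
  \<comment> \<open>\<open>\<psi>\<close> is bounded by \<open>B\<psi>\<close> on the compact set
    \<open>S2\<close> and \<open>\<rho>\<close> is monotone, so \<open>S3\<close> is bounded and the
    supremum \<open>M1q\<close> is finite.\<close>
  define B3 where "B3 = K * B\<psi> + \<delta> * \<rho> (K * B\<psi>)"
  have KB: "0 \<le> K * \<psi> z" "K * \<psi> z \<le> K * B\<psi>" if "z \<in> S2" for z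
    using Bpsi[OF that] A(56) psi_pos[of z] by (auto intro!: mult_left_mono)
  have S3_bound: "norm \<xi> \<le> B3" if "V z \<le> b" "norm \<xi> \<le> K * \<psi> z + \<delta> * \<rho> (K * \<psi> z)" for z and \<xi> :: "real^'n"
  proof -
    have z: "z \<in> S2" using that by (simp add: S2_eq)
    have "K * \<psi> z + \<delta> * \<rho> (K * \<psi> z) \<le> B3"
      unfolding B3_def using delta_pos by (intro add_mono[OF KB(2)[OF z] mult_left_mono[OF rho_mono[OF KB[OF z]]]]) simp
    then show ?thesis using that by linarith
  qed
  have S4_bound: "norm \<xi> \<le> K * B\<psi>" if "\<xi> \<in> S4" for \<xi> using that KB(2) unfolding S4_eq by force
  \<comment> \<open>\<open>Sup {}\<close> is unspecified, so the signs of the suprema below need explicit elements.\<close>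
  define e1 :: "real^'n" where "e1 = axis undefined 1"
  have e1: "norm e1 = 1" "e1 \<noteq> 0" by (simp_all add: e1_def axis_eq_0_iff)
  have K\<psi>: "1 \<le> K * \<psi> 0" using A(56) psi_1[of 0] mult_mono[of 1 K 1 "\<psi> 0"] by simp
  have e1S4: "e1 \<in> S4" unfolding S4_eq using S2_0 K\<psi> e1 by force
  have "0 \<le> \<rho> (K * \<psi> 0)" using order_trans[OF norm_ge_zero rho[OF A(13), of 0 "K * \<psi> 0"]] K\<psi> by simp
  then have "norm e1 \<le> K * \<psi> 0 + \<delta> * \<rho> (K * \<psi> 0)"
    using K\<psi> delta_pos mult_nonneg_nonneg[of \<delta> "\<rho> (K * \<psi> 0)"] unfolding e1(1) by linarith
  then have e1S3: "e1 \<in> S3" unfolding S3_eq using S2_0 by blast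

  have M1q_bdd: "bdd_above {norm (q (norm \<xi> / \<psi> z) *\<^sub>R \<xi> - q (norm x / \<psi> z) *\<^sub>R x) / norm (x - \<xi>)
                   |x \<xi> z. x \<in> S1 \<and> \<xi> \<in> S3 \<and> z \<in> S2 \<and> x \<noteq> \<xi>}"
  proof -
    define D where "D = S2 \<times> (S1 \<union> cball 0 B3)"
    have "compact D" unfolding D_def using cS1 cS2 by (intro compact_Times compact_Un) auto
    from lip_compact_bound[OF sat_lip this subset_UNIV] obtain C where C: "\<forall>p\<in>D. \<forall>p'\<in>D. norm ((\<lambda>(z, \<xi> :: real^'n). q (norm \<xi> / \<psi> z) *\<^sub>R \<xi>) p
       - (\<lambda>(z, \<xi> :: real^'n). q (norm \<xi> / \<psi> z) *\<^sub>R \<xi>) p') \<le> C * norm (p - p')"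
      ..
    show ?thesis
    proof (rule bdd_aboveI[of _ C], clarify)
      fix x \<xi> z assume a: "x \<in> S1" "\<xi> \<in> S3" "z \<in> S2" "x \<noteq> \<xi>"
      have "norm \<xi> \<le> B3" using a(2) S3_bound unfolding S3_eq S2_eq by blast
      then have "(z, \<xi>) \<in> D" "(z, x) \<in> D" using a by (auto simp: D_def)
      from C[rule_format, OF this] have "norm (q (norm \<xi> / \<psi> z) *\<^sub>R \<xi> - q (norm x / \<psi> z) *\<^sub>R x) \<le> C * norm (x - \<xi>)"
        by (simp add: norm_Pair norm_minus_commute)
      then show "norm (q (norm \<xi> / \<psi> z) *\<^sub>R \<xi> - q (norm x / \<psi> z) *\<^sub>R x) / norm (x - \<xi>) \<le> C"
        using a(4) by (simp add: divide_le_eq)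
    qed
  qed
  have M1q: "norm (q (norm \<xi> / \<psi> z) *\<^sub>R \<xi> - q (norm x / \<psi> z) *\<^sub>R x) \<le> M1q * norm (\<xi> - x)"
    if "V x \<le> R" "V z \<le> b" "V z' \<le> b" "norm \<xi> \<le> K * \<psi> z' + \<delta> * \<rho> (K * \<psi> z')" for x z z' \<xi>
  proof (cases "x = \<xi>")
    case False
    have "\<xi> \<in> S3" unfolding S3_eq S2_eq using that by blast
    moreover have "x \<in> S1" "z \<in> S2" using that by (auto simp: S1_eq S2_eq)
    ultimately have "norm (q (norm \<xi> / \<psi> z) *\<^sub>R \<xi> - q (norm x / \<psi> z) *\<^sub>R x) \<le> M1q * norm (x - \<xi>)"
      by (intro Sup_ratio_upper[OF M1q_eq M1q_bdd]) (use False in auto)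
    then show ?thesis by (simp add: norm_minus_commute)
  qed simp
  have M1q_0: "M1q \<ge> 0"
  proof (rule Sup_nonneg[OF M1q_eq M1q_bdd])
    show "norm (q (norm e1 / \<psi> 0) *\<^sub>R e1 - q (norm 0 / \<psi> 0) *\<^sub>R 0) / norm (0 - e1) \<in> {norm (q (norm \<xi> / \<psi> z) *\<^sub>R \<xi> - q (norm x / \<psi> z) *\<^sub>R x) / norm (x - \<xi>)
                   |x \<xi> z. x \<in> S1 \<and> \<xi> \<in> S3 \<and> z \<in> S2 \<and> x \<noteq> \<xi>}"
      by (rule CollectI, rule exI[of _ 0], rule exI[of _ e1], rule exI[of _ 0]) (use S1_0 S2_0 e1S3 e1(2) in simp)
  qed simp

  have M1f_bdd: "bdd_above {norm (f x u - f \<xi> u) / norm (x - \<xi>) |x \<xi> u. x \<in> S1 \<and> \<xi> \<in> S4 \<and> u \<in> U \<and> x \<noteq> \<xi>}"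
  proof -
    define D where "D = (S1 \<union> cball 0 (K * B\<psi>)) \<times> U"
    have "compact D" unfolding D_def using cS1 A(12) by (intro compact_Times compact_Un) auto
    from lip_compact_bound[OF f_lip this subset_UNIV] obtain C where C: "\<forall>p\<in>D. \<forall>p'\<in>D. norm ((\<lambda>(x, u). f x u) p - (\<lambda>(x, u). f x u) p') \<le> C * norm (p - p')"
      ..
    show ?thesis
    proof (rule bdd_aboveI[of _ C], clarify)
      fix x \<xi> u assume a: "x \<in> S1" "\<xi> \<in> S4" "u \<in> U" "x \<noteq> \<xi>"
      then have "(x, u) \<in> D" "(\<xi>, u) \<in> D" using S4_bound[OF a(2)] by (auto simp: D_def)
      from C[rule_format, OF this] show "norm (f x u - f \<xi> u) / norm (x - \<xi>) \<le> C" using a(4) by (simp add: norm_Pair divide_le_eq)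
    qed
  qed
  have M1f: "norm (f \<xi> u - f x u) \<le> M1f * norm (\<xi> - x)"
    if "u \<in> U" "V x \<le> R" "V z \<le> b" "norm \<xi> \<le> K * \<psi> z" for x z u \<xi>
  proof (cases "x = \<xi>")
    case False
    have "\<xi> \<in> S4" "x \<in> S1" unfolding S4_eq S2_eq S1_eq using that by blast+
    then have "norm (f x u - f \<xi> u) \<le> M1f * norm (x - \<xi>)"
      by (intro Sup_ratio_upper[OF M1f_eq M1f_bdd]) (use False that in auto)
    then show ?thesis by (simp add: norm_minus_commute)
  qed simp
  have M1f_0: "M1f \<ge> 0"
  proof (rule Sup_nonneg[OF M1f_eq M1f_bdd])
    show "norm (f 0 0 - f e1 0) / norm (0 - e1) \<in> {norm (f x u - f \<xi> u) / norm (x - \<xi>) |x \<xi> u. x \<in> S1 \<and> \<xi> \<in> S4 \<and> u \<in> U \<and> x \<noteq> \<xi>}"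
      by (rule CollectI, rule exI[of _ 0], rule exI[of _ e1], rule exI[of _ 0]) (use S1_0 A(13) e1S4 e1(2) in simp)
  qed simp

  have G1_bdd: "bdd_above {norm (jacobian h (at x) *v f x u - jacobian h (at z) *v f z u) / norm (x - z)
                   |x z u. x \<in> S1 \<and> z \<in> S2 \<and> u \<in> U \<and> x \<noteq> z}"
  proof -
    have "compact (S2 \<times> U)" using cS2 A(12) by (rule compact_Times)
    from lip_compact_bound[OF hf_lip this subset_UNIV] obtain C where C: "\<forall>p\<in>S2 \<times> U. \<forall>p'\<in>S2 \<times> U.
        norm ((\<lambda>(z, u). jacobian h (at z) *v f z u) p - (\<lambda>(z, u). jacobian h (at z) *v f z u) p') \<le> C * norm (p - p')"
      ..
    show ?thesis
    proof (rule bdd_aboveI[of _ C], clarify)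
      fix x z u assume a: "x \<in> S1" "z \<in> S2" "u \<in> U" "x \<noteq> z"
      then have "(x, u) \<in> S2 \<times> U" "(z, u) \<in> S2 \<times> U" using S12 by auto
      from C[rule_format, OF this] show "norm (jacobian h (at x) *v f x u - jacobian h (at z) *v f z u) / norm (x - z) \<le> C"
        using a(4) by (simp add: norm_Pair divide_le_eq)
    qed
  qed
  have G1: "norm (jacobian h (at x) *v f x u - jacobian h (at z) *v f z u) \<le> G1 * norm (x - z)"
    if "u \<in> U" "V x \<le> R" "V z \<le> b" for x z u
  proof (cases "x = z")
    case False
    have "z \<in> S2" "x \<in> S1" unfolding S2_eq S1_eq using that by blast+
    then show ?thesis by (intro Sup_ratio_upper[OF G1_eq G1_bdd]) (use False that in auto)
  qed simp
  \<comment> \<open>\<open>e1\<close> need not belong to \<open>S2\<close>, so it is scaled into a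
    neighbourhood of the origin on which \<open>V < R\<close>.\<close>
  have G1_0: "G1 \<ge> 0"
  proof -
    have "open {x. V x < R}" by (intro open_Collect_less continuous_intros V_cont)
    moreover have "0 \<in> {x. V x < R}" using A(22) by simp
    ultimately obtain e where e: "e > 0" "ball 0 e \<subseteq> {x. V x < R}" using open_contains_ball by blast
    define z where "z = (e / 2) *\<^sub>R e1"
    have "z \<in> ball 0 e" "z \<noteq> 0" using e e1 by (auto simp: z_def)
    then have z: "z \<in> S2" "0 \<noteq> z" using e A(34) by (auto simp: S2_eq)
    show ?thesis
    proof (rule Sup_nonneg[OF G1_eq G1_bdd])
      show "norm (jacobian h (at 0) *v f 0 0 - jacobian h (at z) *v f z 0) / norm (0 - z) \<in>
         {norm (jacobian h (at x) *v f x u - jacobian h (at z) *v f z u) / norm (x - z)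
                   |x z u. x \<in> S1 \<and> z \<in> S2 \<and> u \<in> U \<and> x \<noteq> z}"
        by (rule CollectI, rule exI[of _ 0], rule exI[of _ z], rule exI[of _ 0]) (use S1_0 A(13) z in simp)
    qed simp
  qed

  have G2_bdd: "bdd_above {norm (khat z y u - khat z w u) / norm (y - w) |y w z u. z \<in> S2 \<and> u \<in> U \<and> y \<noteq> w}"
    by (rule bdd_aboveI[of _ "2 * mat_norm L"]) (use ob.khat_lipschitz_output in \<open>auto simp: divide_le_eq\<close>)
  have G2: "norm (khat z y u - khat z y' u) \<le> G2 * norm (y - y')" if "u \<in> U" "V z \<le> b" for z y y' u
  proof (cases "y = y'")
    case False
    have "z \<in> S2" unfolding S2_eq using that by blast
    then show ?thesis by (intro Sup_ratio_upper[OF G2_eq G2_bdd]) (use False that in auto)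
  qed simp
  have G2_0: "G2 \<ge> 0"
  proof (rule Sup_nonneg[OF G2_eq G2_bdd])
    define e2 :: "real^'k" where "e2 = axis undefined 1"
    have e2: "e2 \<noteq> 0" by (simp add: e2_def axis_eq_0_iff)
    show "norm (khat 0 e2 0 - khat 0 0 0) / norm (e2 - 0) \<in>
        {norm (khat z y u - khat z w u) / norm (y - w) |y w z u. z \<in> S2 \<and> u \<in> U \<and> y \<noteq> w}"
      by (rule CollectI, rule exI[of _ e2], rule exI[of _ 0], rule exI[of _ 0], rule exI[of _ 0]) (use S2_0 A(13) e2 in simp)
  qed simp

  have P0: "P 0 = 0" "P 0 \<le> P x" for x
    using A(23) unfolding pos_def_fun_def by (auto simp: less_imp_le) (metis less_eq_real_def)
  note hb = hessian_bounds[OF P2 P0 cS1 S1_0 Pt_eq]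
  have snPt: "\<sigma> \<le> \<mu> / (sqrt (real CARD('n)) * Pt)" and s4: "\<sigma> \<le> c * \<omega> / (4 * mat_norm Q)" using A(78) by auto
  \<comment> \<open>If \<open>Pt\<close> were 0, the quotient in the bound on
    \<open>\<sigma>\<close> would be a division by zero with value 0, contradicting
    \<open>\<sigma> > 0\<close>.\<close>
  have Pt: "Pt > 0"
  proof (rule ccontr)
    assume "\<not> Pt > 0"
    then have "Pt = 0" using hb(3)[OF S1_0] by simp
    then show False using snPt A(77) by simp
  qed
  have sn: "sqrt (real CARD('n)) \<ge> 1" by (simp add: Suc_leI)
  \<comment> \<open>The dimension enters through \<open>sqrt n \<ge> 1\<close>, which turns the
    hypothesis into the form used by \<open>stable_loop\<close>.\<close>
  have sigma_mu: "\<sigma> * Pt \<le> \<mu>"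
  proof -
    have "\<sigma> * (sqrt (real CARD('n)) * Pt) \<le> \<mu>" using snPt Pt sn by (simp add: le_divide_eq)
    moreover have "\<sigma> * (1 * Pt) \<le> \<sigma> * (sqrt (real CARD('n)) * Pt)"
      using A(77) Pt sn by (intro mult_left_mono mult_right_mono) auto
    ultimately show ?thesis by simp
  qed
  have nQ: "mat_norm Q > 0" using A(73,74) by linarith
  have sigma_Q: "4 * \<sigma> * mat_norm Q \<le> c * \<omega>" using s4 nQ by (simp add: le_divide_eq mult_ac)
  have cw: "0 < c * \<omega>" using A(33,36) by simp
  have W_cont: "continuous_on UNIV W" by (rule lip_compact_continuous_on[OF C_k_1_lip_compact[OF W1]]) simp
  have a1_der: "(a1 has_derivative (\<lambda>d. jacobian a1 (at x) *v d)) (at x)" for x using jacobian_works a12 by auto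
  have h_der: "(h has_derivative (\<lambda>d. jacobian h (at x) *v d)) (at x)" for x using jacobian_works h2 by auto
  have V_dec: "grad V z \<bullet> (f z u + khat z y u) \<le> 0" if "u \<in> U" "b \<le> V z" for z y u
  proof -
    have "z \<noteq> 0" using that A(22,34) by auto
    then show ?thesis using ob.V_dec_observer[OF that(2), of u y] W_pos[of z] by linarith
  qed
  have V_dec_W: "grad V z \<bullet> (f z u + khat z y u) \<le> - W z" if "u \<in> U" "b \<le> V z" for z y u
    by (rule ob.V_dec_observer[OF that(2)])
  note V_der = grad_has_derivative[OF V2]
  note P_der = grad_has_derivative[OF P2]
  have P_lip: "lip_compact UNIV P" by (rule C_k_1_lip_compact[OF P2])

  show ?thesis
  proof (intro allI impI)
    fix ts :: "nat \<Rightarrow> real" and \<xi>0 :: "nat \<Rightarrow> real \<Rightarrow> real^'n" and z0 :: "real^'n" and w0 :: "real^'k" and \<theta>0 :: "real^'l"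
      and x0 :: "real \<Rightarrow> real^'n" and u0 v0 :: "real \<Rightarrow> real^'m"
    assume ts: "sampling_partition ts" and Ts: "\<forall>i. ts (Suc i) - ts i \<le> Ts" and \<xi>0: "\<forall>j\<in>{1..N}. Linf_on {-\<delta>..<0} (\<xi>0 j)"
      and u0: "Linf_on {-r-\<tau>..<0} u0" "AE s in lebesgue_on {-r-\<tau>..<0}. u0 s \<in> U" and v0: "Linf_on {-r-\<tau>..<0} v0"
    have u0': "AE s in lebesgue. s \<in> {-r-\<tau>..<0} \<longrightarrow> u0 s \<in> U" using u0(2) by (simp add: AE_lebesgue_on_iff)
    interpret loop ts \<tau> r \<delta> Lk b K N ft h f khat q \<psi> kk a2 g \<Phi> U V \<xi>0 z0 w0 \<theta>0 x0 u0 v0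
    proof
      show "\<delta> = (r + \<tau>) / real N" by (rule delta_eq)
      show "forward_complete ft \<tau> UNIV" by (rule A(7))
      show "lip_compact (UNIV \<times> UNIV \<times> U) (\<lambda>(z, y, u). khat z y u)" by (rule ob.khat_lip)
      show "forward_complete (\<lambda>\<theta> u. g \<theta> (a2 \<theta> + u)) 0 U" by (rule A(44))
    qed (fact ts A(1) A(2) A(61) ft_lip f_lip hf_lip sat_lip sat_bound psi_cont A(12) A(13) Lk A(29)[rule_format] a2_lip g_lip
      A(45)[rule_format] V_der V_lip V_bdd V_dec \<xi>0[rule_format] u0 u0' v0)+
    interpret stable_loop ts \<tau> r \<delta> Lk b K N ft h f khat q \<psi> kk a2 g \<Phi> U V \<xi>0 z0 w0 \<theta>0 x0 u0 v0
      a1 W P Q \<rho> R \<sigma> "mat_norm Q" K2 "c * \<omega>" G1 G2 Ts M1q M1f \<mu> K1 Pt B3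
    proof
      show "a1 (x (t + \<tau>)) = \<Phi> (h (x (t - r))) (\<lambda>s. v (t + s))"
        if "Linf_on {-\<tau>..} v" "solves_ae_on {0..} (\<lambda>t. ft (x t) (v (t - \<tau>))) x" "t \<ge> r" for x v t
        using A(46) that by blast
      show "norm x \<le> \<psi> z" if "V x \<le> R" for x z by (rule psi_b) (use that A(34) in simp)
      show "P x \<le> Pt / 2 * (norm x)\<^sup>2" "norm (grad P x) \<le> Pt * norm x" if "V x \<le> R" for x
        using hb(1,2)[of x] that by (auto simp: S1_eq)
    qed (fact a1_der a1_lip A(43)[rule_format] A(10) f_eq' W_cont W_pos V_origin A(34) A(21)[rule_format] V_dec_W
      ob.observer_estimate G2 ob.Q_sym mat_norm_bound A(75)[rule_format] A(73) nQ cw G1 G1_0 G2_0 A(77) sigma_Q A(80) Ts[rule_format]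
      h_der h_lip A(6) psi_1 A(55)[rule_format] A(56) psi_z rho M1q M1f M1q_0 M1f_0 A(79) S3_bound P_der P_lip A(27)[rule_format]
      A(31)[rule_format] A(26) A(25) Pt sigma_mu A(30))+
    obtain x z w \<theta> \<xi> u v where sol: "closed_loop \<infinity> x z w \<theta> \<xi> u v" using closed_loop_exists by blast
    have "\<forall>T x' z' w' \<theta>' \<xi>' u' v'. 0 < T \<longrightarrow> closed_loop T x' z' w' \<theta>' \<xi>' u' v' \<longrightarrow>
      (\<forall>t\<in>time_ivl 0 T. x' t = x t \<and> z' t = z t \<and> w' t = w t \<and> \<theta>' t = \<theta> t \<and>
         (\<forall>j\<in>{1..N}. \<xi>' j t = \<xi> j t) \<and> u' t = u t \<and> v' t = v t)"
      using closed_loop_unique[OF sol] by blast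
    with sol limsup_finite[OF sol]
    show "\<exists>x z w \<theta> \<xi> u v. closed_loop \<infinity> x z w \<theta> \<xi> u v \<and>
       (\<forall>T x' z' w' \<theta>' \<xi>' u' v'. 0 < T \<longrightarrow> closed_loop T x' z' w' \<theta>' \<xi>' u' v' \<longrightarrow>
          (\<forall>t\<in>time_ivl 0 T. x' t = x t \<and> z' t = z t \<and> w' t = w t \<and> \<theta>' t = \<theta> t \<and>
             (\<forall>j\<in>{1..N}. \<xi>' j t = \<xi> j t) \<and> u' t = u t \<and> v' t = v t)) \<and>
       Limsup at_top (\<lambda>t. ereal (exp (\<sigma> * t)) * state_size \<tau> r \<delta> N x z w \<theta> \<xi> u t) < \<infinity>"
      by blast
  qed
qed

end
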